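(* Let $n\ge1$ and $\mathcal R=\mathbb Z[t_1^{\pm1},\dots,t_n^{\pm1}]=\mathbb Z[\mathbb Z^n]$. Suppose $M_1$ and $M_2$ are two pseudo-isomorphic finitely generated $\mathcal R$-modules. Then $$\lim_{\langle\Gamma\rangle\to\infty}\left(\frac{\log|\mathrm{tor}_{\mathbb Z}(M_1\otimes_{\mathcal R}\mathbb Z[\mathbb Z^n/\Gamma])|}{|\mathbb Z^n/\Gamma|}-\frac{\log|\mathrm{tor}_{\mathbb Z}(M_2\otimes_{\mathcal R}\mathbb Z[\mathbb Z^n/\Gamma])|}{|\mathbb Z^n/\Gamma|}\right)=0,$$ where $\Gamma$ runs over the finite-index subgroups of $\mathbb Z^n$.
   Context: An $\mathcal R$-module $N$ is pseudo-zero if $N_{\mathcal P}=0$ for every prime ideal $\mathcal P\subset\mathcal R$ of height 1. An $\mathcal R$-morphism $M_1\to M_2$ is a pseudo-isomorphism if its kernel and cokernel are pseudo-zero; $M_1$ and $M_2$ are pseudo-isomorphic if there is a pseudo-isomorphism $M_1\to M_2$. $\mathbb Z[\mathbb Z^n/\Gamma]$ is an $\mathcal R$-module via the projection $\mathbb Z[\mathbb Z^n]\to\mathbb Z[\mathbb Z^n/\Gamma]$. $\mathrm{tor}_{\mathbb Z}(G)$ is the torsion subgroup of an abelian group $G$. $\langle\Gamma\rangle=\min\{|x|:x\in\Gamma\setminus\{0\}\}$ with $|\cdot|$ the Euclidean norm. *)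

theory Defs
  imports
    Complex_Main
    "HOL-Library.Poly_Mapping"
    "HOL-Library.Extended_Nat"
    "HOL-Library.Going_To_Filter"
    "HOL-Analysis.L2_Norm"
    "HOL-Algebra.Module"
    "HOL-Algebra.Ideal"
    "HOL-Algebra.Product_Groups"
    "HOL-Algebra.Free_Abelian_Groups"
begin

section \<open>Modules over a commutative ring\<close>

text \<open>
  Modules are the records of HOL-Algebra, with scalars in the carrier of a ring record.
  Such a record also has the ring fields \<open>mult\<close> and \<open>one\<close>; they play no role in a module and are
  left \<^const>\<open>undefined\<close> where a module is constructed that is not also a ring.
\<close>

definition finitely_generated ::
    "('r, 'q) ring_scheme \<Rightarrow> ('r, 'a, 'm) module_scheme \<Rightarrow> bool" where
  "finitely_generated R M \<longleftrightarrow>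
     (\<exists>A. finite A \<and> A \<subseteq> carrier M \<and> \<Inter>{H. submodule H R M \<and> A \<subseteq> H} = carrier M)"

definition module_homs ::
    "('r, 'q) ring_scheme \<Rightarrow> ('r, 'a, 'm) module_scheme \<Rightarrow> ('r, 'b, 'k) module_scheme
       \<Rightarrow> ('a \<Rightarrow> 'b) set" where
  "module_homs R M N =
     {h. h \<in> carrier M \<rightarrow> carrier N
       \<and> (\<forall>x\<in>carrier M. \<forall>y\<in>carrier M. h (x \<oplus>\<^bsub>M\<^esub> y) = h x \<oplus>\<^bsub>N\<^esub> h y)
       \<and> (\<forall>r\<in>carrier R. \<forall>x\<in>carrier M. h (r \<odot>\<^bsub>M\<^esub> x) = r \<odot>\<^bsub>N\<^esub> h x)}"

definition quotient_module ::
    "('r, 'a, 'm) module_scheme \<Rightarrow> 'a set \<Rightarrow> ('r, 'a set) module" where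
  "quotient_module M H =
     \<lparr>carrier = a_rcosets\<^bsub>M\<^esub> H, monoid.mult = undefined, one = undefined,
      ring.zero = H, ring.add = set_add M,
      smult = (\<lambda>r C. \<Union>x\<in>C. H +>\<^bsub>M\<^esub> (r \<odot>\<^bsub>M\<^esub> x))\<rparr>"

definition kernel_module ::
    "('r, 'a, 'm) module_scheme \<Rightarrow> ('r, 'b, 'k) module_scheme \<Rightarrow> ('a \<Rightarrow> 'b)
       \<Rightarrow> ('r, 'a, 'm) module_scheme" where
  "kernel_module M N h = M\<lparr>carrier := a_kernel M N h\<rparr>"

definition cokernel_module ::
    "('r, 'a, 'm) module_scheme \<Rightarrow> ('r, 'b, 'k) module_scheme \<Rightarrow> ('a \<Rightarrow> 'b)
       \<Rightarrow> ('r, 'b set) module" where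
  "cokernel_module M N h = quotient_module N (h ` carrier M)"

section \<open>Localization and pseudo-isomorphism\<close>

definition fraction_rel ::
    "('r, 'q) ring_scheme \<Rightarrow> 'r set \<Rightarrow> ('r, 'a, 'm) module_scheme
       \<Rightarrow> (('a \<times> 'r) \<times> ('a \<times> 'r)) set" where
  "fraction_rel R S M =
     {((x, s), (y, t)). x \<in> carrier M \<and> s \<in> S \<and> y \<in> carrier M \<and> t \<in> S
        \<and> (\<exists>u\<in>S. u \<odot>\<^bsub>M\<^esub> (t \<odot>\<^bsub>M\<^esub> x) = u \<odot>\<^bsub>M\<^esub> (s \<odot>\<^bsub>M\<^esub> y))}"

definition fraction ::
    "('r, 'q) ring_scheme \<Rightarrow> 'r set \<Rightarrow> ('r, 'a, 'm) module_scheme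
       \<Rightarrow> 'a \<Rightarrow> 'r \<Rightarrow> ('a \<times> 'r) set" where
  "fraction R S M x s = fraction_rel R S M `` {(x, s)}"

text \<open>
  The module of fractions of \<open>M\<close> with denominators in the multiplicative set \<open>S\<close>,
  with its structure of a module over \<open>R\<close> itself.
\<close>

definition localization ::
    "('r, 'q) ring_scheme \<Rightarrow> 'r set \<Rightarrow> ('r, 'a, 'm) module_scheme
       \<Rightarrow> ('r, ('a \<times> 'r) set) module" where
  "localization R S M =
     \<lparr>carrier = (carrier M \<times> S) // fraction_rel R S M, monoid.mult = undefined, one = undefined,
      ring.zero = fraction R S M \<zero>\<^bsub>M\<^esub> \<one>\<^bsub>R\<^esub>,
      ring.add = (\<lambda>A B. \<Union>(x, s)\<in>A. \<Union>(y, t)\<in>B.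
               fraction R S M ((t \<odot>\<^bsub>M\<^esub> x) \<oplus>\<^bsub>M\<^esub> (s \<odot>\<^bsub>M\<^esub> y)) (s \<otimes>\<^bsub>R\<^esub> t)),
      smult = (\<lambda>r A. \<Union>(x, s)\<in>A. fraction R S M (r \<odot>\<^bsub>M\<^esub> x) s)\<rparr>"

definition localization_at ::
    "('r, 'q) ring_scheme \<Rightarrow> 'r set \<Rightarrow> ('r, 'a, 'm) module_scheme
       \<Rightarrow> ('r, ('a \<times> 'r) set) module" where
  "localization_at R P M = localization R (carrier R - P) M"

definition prime_height :: "('r, 'q) ring_scheme \<Rightarrow> 'r set \<Rightarrow> enat" where
  "prime_height R P =
     Sup {enat k |k. \<exists>Q. (\<forall>i\<le>k. primeideal (Q i) R) \<and> (\<forall>i<k. Q i \<subset> Q (Suc i)) \<and> Q k = P}"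

definition pseudo_zero ::
    "('r, 'q) ring_scheme \<Rightarrow> ('r, 'a, 'm) module_scheme \<Rightarrow> bool" where
  "pseudo_zero R N \<longleftrightarrow>
     (\<forall>P. primeideal P R \<and> prime_height R P = 1 \<longrightarrow>
        carrier (localization_at R P N) = {\<zero>\<^bsub>localization_at R P N\<^esub>})"

definition pseudo_isomorphism ::
    "('r, 'q) ring_scheme \<Rightarrow> ('r, 'a, 'm) module_scheme \<Rightarrow> ('r, 'b, 'k) module_scheme
       \<Rightarrow> ('a \<Rightarrow> 'b) \<Rightarrow> bool" where
  "pseudo_isomorphism R M N h \<longleftrightarrow>
     h \<in> module_homs R M N
     \<and> pseudo_zero R (kernel_module M N h) \<and> pseudo_zero R (cokernel_module M N h)"

definition pseudo_isomorphic ::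
    "('r, 'q) ring_scheme \<Rightarrow> ('r, 'a, 'm) module_scheme \<Rightarrow> ('r, 'b, 'k) module_scheme
       \<Rightarrow> bool" where
  "pseudo_isomorphic R M N \<longleftrightarrow> (\<exists>h. pseudo_isomorphism R M N h)"

section \<open>Tensor products and torsion\<close>

text \<open>
  The abelian group underlying \<open>M \<otimes>\<^sub>R N\<close>, written multiplicatively like every group record:
  the free abelian group on pairs modulo the bilinearity relations.
\<close>

definition tensor_relations ::
    "('r, 'q) ring_scheme \<Rightarrow> ('r, 'a, 'm) module_scheme \<Rightarrow> ('r, 'b, 'k) module_scheme
       \<Rightarrow> (('a \<times> 'b) \<Rightarrow>\<^sub>0 int) set" where
  "tensor_relations R M N =
     {frag_of (x \<oplus>\<^bsub>M\<^esub> x', y) - frag_of (x, y) - frag_of (x', y) |x x' y.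
        x \<in> carrier M \<and> x' \<in> carrier M \<and> y \<in> carrier N}
     \<union> {frag_of (x, y \<oplus>\<^bsub>N\<^esub> y') - frag_of (x, y) - frag_of (x, y') |x y y'.
        x \<in> carrier M \<and> y \<in> carrier N \<and> y' \<in> carrier N}
     \<union> {frag_of (r \<odot>\<^bsub>M\<^esub> x, y) - frag_of (x, r \<odot>\<^bsub>N\<^esub> y) |r x y.
        r \<in> carrier R \<and> x \<in> carrier M \<and> y \<in> carrier N}"

definition tensor_product ::
    "('r, 'q) ring_scheme \<Rightarrow> ('r, 'a, 'm) module_scheme \<Rightarrow> ('r, 'b, 'k) module_scheme
       \<Rightarrow> (('a \<times> 'b) \<Rightarrow>\<^sub>0 int) set monoid" where
  "tensor_product R M N =
     (let F = free_Abelian_group (carrier M \<times> carrier N)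
      in F Mod generate F (tensor_relations R M N))"

definition torsion_subgroup :: "('a, 'm) monoid_scheme \<Rightarrow> 'a set" where
  "torsion_subgroup G = {x \<in> carrier G. \<exists>k::nat. k > 0 \<and> x [^]\<^bsub>G\<^esub> k = \<one>\<^bsub>G\<^esub>}"

section \<open>Integral group rings\<close>

definition group_ring :: "('a, 'm) monoid_scheme \<Rightarrow> ('a \<Rightarrow>\<^sub>0 int) ring" where
  "group_ring G =
     \<lparr>carrier = carrier (free_Abelian_group (carrier G)),
      monoid.mult = (\<lambda>a b. frag_extend (\<lambda>x. frag_extend (\<lambda>y. frag_of (x \<otimes>\<^bsub>G\<^esub> y)) b) a),
      one = frag_of \<one>\<^bsub>G\<^esub>, ring.zero = 0, ring.add = (+)\<rparr>"

definition group_ring_projection ::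
    "('a, 'm) monoid_scheme \<Rightarrow> 'a set \<Rightarrow> ('a \<Rightarrow>\<^sub>0 int) \<Rightarrow> ('a set \<Rightarrow>\<^sub>0 int)" where
  "group_ring_projection G H = frag_extend (\<lambda>x. frag_of (H #>\<^bsub>G\<^esub> x))"

text \<open>The ring \<open>\<int>[G/H]\<close> as a module over \<open>\<int>[G]\<close> via the projection.\<close>

definition quotient_group_ring_module ::
    "('a, 'm) monoid_scheme \<Rightarrow> 'a set \<Rightarrow> ('a \<Rightarrow>\<^sub>0 int, 'a set \<Rightarrow>\<^sub>0 int) module" where
  "quotient_group_ring_module G H =
     ring.extend (group_ring (G Mod H))
       (module.fields (\<lambda>r x. group_ring_projection G H r \<otimes>\<^bsub>group_ring (G Mod H)\<^esub> x))"

section \<open>The lattice \<open>\<int>\<^sup>n\<close>\<close>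

text \<open>Elements of \<open>\<int>\<^sup>n\<close> are functions on \<open>{..<n}\<close>, extended by \<^const>\<open>undefined\<close>.\<close>

definition int_lattice :: "nat \<Rightarrow> (nat \<Rightarrow> int) monoid" where
  "int_lattice n = product_group {..<n} (\<lambda>_. integer_group)"

definition laurent_ring :: "nat \<Rightarrow> ((nat \<Rightarrow> int) \<Rightarrow>\<^sub>0 int) ring" where
  "laurent_ring n = group_ring (int_lattice n)"

definition lattice_norm :: "nat \<Rightarrow> (nat \<Rightarrow> int) \<Rightarrow> real" where
  "lattice_norm n x = L2_set (\<lambda>i. real_of_int (x i)) {..<n}"

text \<open>
  The minimum is attained whenever \<open>\<Gamma>\<close> has a nonzero element, in particular when \<open>\<Gamma>\<close> has
  finite index and \<open>n \<ge> 1\<close>.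
\<close>

definition min_norm :: "nat \<Rightarrow> (nat \<Rightarrow> int) set \<Rightarrow> real" where
  "min_norm n \<Gamma> = (LEAST r. r \<in> lattice_norm n ` (\<Gamma> - {\<one>\<^bsub>int_lattice n\<^esub>}))"

definition finite_index_subgroups :: "nat \<Rightarrow> (nat \<Rightarrow> int) set set" where
  "finite_index_subgroups n =
     {\<Gamma>. subgroup \<Gamma> (int_lattice n) \<and> finite (carrier (int_lattice n Mod \<Gamma>))}"

definition torsion_growth ::
    "nat \<Rightarrow> ((nat \<Rightarrow> int) \<Rightarrow>\<^sub>0 int, 'a, 'm) module_scheme \<Rightarrow> (nat \<Rightarrow> int) set \<Rightarrow> real" where
  "torsion_growth n M \<Gamma> =
     ln (real (card (torsion_subgroup
           (tensor_product (laurent_ring n) M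
              (quotient_group_ring_module (int_lattice n) \<Gamma>)))))
     / real (order (int_lattice n Mod \<Gamma>))"

end

theory Submission
  imports Defs "HOL-Library.Function_Algebras" "HOL-Library.Z2"
    "HOL-Computational_Algebra.Polynomial"
begin

text \<open>
  Present \<open>M\<^sub>i\<close> as the quotient of a free module of rank \<open>q\<^sub>i\<close>, put \<open>X = \<int>\<^sup>n/\<Gamma>\<close> and \<open>N = card X\<close>. The torsion of
  \<open>M\<^sub>i \<otimes> \<int>[X]\<close> is \<open>S/\<Lambda>\<close>, where \<open>\<Lambda>\<close> is the image of the presentation matrix in the functions on \<open>q\<^sub>i\<close> copies of
  \<open>X\<close> and \<open>S\<close> is the saturation of \<open>\<Lambda>\<close>. The annihilator of the kernel and the cokernel of a
  pseudo-isomorphism lies in no prime of height one, so it contains \<open>f\<close> and \<open>g\<close> without a common prime of height one.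
  Multiplication by \<open>f\<^sup>2\<close> and by \<open>g\<^sup>2\<close> factors both ways through the pseudo-isomorphism, so that with
  \<open>J = (f\<^sup>2, g\<^sup>2)\<close> the two torsion orders differ at most by the factor \<open>[S : \<Lambda> + J S]\<close> of \<open>M\<^sub>2\<close>
  and the order of the \<open>J\<close>-torsion in \<open>S/\<Lambda>\<close> for \<open>M\<^sub>1\<close>. The latter is an index of the former kind for the
  transposed matrix and the inverse action. It remains to see that \<open>[S : \<Lambda> + J S]\<close> is \<open>exp (o(N))\<close>.

  Let \<open>c\<close> bound the number of classes modulo \<open>J\<close> of functions on \<open>X\<close> with small values. Since \<open>\<rat>[X]\<close> is von Neumann
  regular, a Koszul argument bounds \<open>[S : \<Lambda> + J S]\<close> by powers of \<open>c\<close> and of the index \<open>\<iota>\<close> of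
  \<open>J \<int>[X] + K\<close> in \<open>\<int>[X]\<close>, \<open>K\<close> being the common kernel of \<open>f\<^sup>2\<close> and \<open>g\<^sup>2\<close>. Choosing greedily a set \<open>E\<close> of points
  complementing the saturation of \<open>J \<int>[X]\<close> gives \<open>\<iota> e! \<le> c\<^sup>2 N\<^sup>e\<close> with \<open>e = card E\<close> and \<open>2\<^sup>e \<le> c\<close>, which is \<open>exp (o(N))\<close>
  as soon as \<open>c\<close> is. Finally \<open>c\<close> is \<open>exp (o(N))\<close>, because for large \<open>\<langle>\<Gamma>\<rangle>\<close> few translates of a large box cover
  \<open>X\<close>, and the Laurent polynomials of bounded height supported in a box of side \<open>L\<close> have only \<open>exp (o(L\<^sup>n))\<close> classes
  modulo \<open>J\<close>: by Noetherian induction this reduces to ideals that contain a nonzero prime \<open>P\<close> and some \<open>g\<close> outside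
  \<open>P\<close>, for which the sums of \<open>g\<^sup>i y\<^sub>i\<close> would otherwise fill a box with too many classes modulo \<open>P\<close>.
\<close>

text \<open>The torsion of one module involves products of values of Laurent polynomials at torsion
  points, and small values among them are hard to bound from below. No such product is estimated
  here. Only classes of integer vectors with bounded entries are counted, and saturation supplies
  the bounded entries: a vector with a multiple in a lattice is reduced by its generators through
  fractional parts of rational coefficients. The squares come from inverting a pseudo-isomorphism up
  to \<open>r\<close>: a matrix that lifts \<open>r\<close> through the cokernel sends relations
  only into the kernel, and a second factor \<open>r\<close> turns them into relations again. The
  factorial comes from covolumes. For a sublattice \<open>J\<close> of Z^X, the index of
  \<open>J + perp X J\<close> times the order of \<open>sat X J\<close> modulo \<open>J\<close> is
  the squared covolume of \<open>J\<close>; adjoining a unit vector multiplies it by the squared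
  length of the component orthogonal to \<open>J\<close>. These squared lengths add up to the rank
  of \<open>perp X J\<close>, so some unit vector contributes at least rank / N, and the rank drops
  by one at each step.\<close>

abbreviation "lookup \<equiv> Poly_Mapping.lookup"
abbreviation "keys \<equiv> Poly_Mapping.keys"

section \<open>Subgroups and indices\<close>

definition sgrp :: "'a::ab_group_add set \<Rightarrow> bool" where
 "sgrp H \<longleftrightarrow> 0 \<in> H \<and> (\<forall>x\<in>H. \<forall>y\<in>H. x - y \<in> H)"

definition setsum2 :: "'a::ab_group_add set \<Rightarrow> 'a set \<Rightarrow> 'a set" (infixl \<open>[+]\<close> 65) where
 "H [+] K = {h + k | h k. h \<in> H \<and> k \<in> K}"

text \<open>Neither set has to be a subgroup, and representatives may lie outside \<open>H\<close>.
  Boxes of functions are therefore counted like subgroups, and upper bounds compose freely.\<close>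

definition covers :: "nat \<Rightarrow> 'a::ab_group_add set \<Rightarrow> 'a set \<Rightarrow> bool" where
 "covers n H K \<longleftrightarrow> (\<exists>R. finite R \<and> card R \<le> n \<and> (\<forall>h\<in>H. \<exists>r\<in>R. h - r \<in> K))"

text \<open>For a subgroup \<open>K\<close> of a group \<open>H\<close> this is the index. For an
  arbitrary set \<open>H\<close>, such as a cube of polynomials, it is the number of classes modulo
  \<open>K\<close> that \<open>H\<close> meets.\<close>

definition has_idx :: "'a::ab_group_add set \<Rightarrow> 'a set \<Rightarrow> nat \<Rightarrow> bool" where
 "has_idx H K n \<longleftrightarrow> (\<exists>R\<subseteq>H. finite R \<and> card R = n \<and> (\<forall>h\<in>H. \<exists>r\<in>R. h - r \<in> K)
   \<and> (\<forall>r\<in>R. \<forall>r'\<in>R. r - r' \<in> K \<longrightarrow> r = r'))"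

lemma sgrpI: "0 \<in> H \<Longrightarrow> (\<And>x y. x \<in> H \<Longrightarrow> y \<in> H \<Longrightarrow> x - y \<in> H) \<Longrightarrow> sgrp H"
 by (auto simp: sgrp_def)

lemma sgrp_0: "sgrp H \<Longrightarrow> 0 \<in> H"
 and sgrp_diff: "sgrp H \<Longrightarrow> x \<in> H \<Longrightarrow> y \<in> H \<Longrightarrow> x - y \<in> H"
 by (auto simp: sgrp_def)

lemma sgrp_minus: "sgrp H \<Longrightarrow> x \<in> H \<Longrightarrow> - x \<in> H"
 using sgrp_diff[of H 0 x] sgrp_0[of H] by simp

lemma sgrp_minus_iff: "sgrp H \<Longrightarrow> - x \<in> H \<longleftrightarrow> x \<in> H"
 using sgrp_minus[of H x] sgrp_minus[of H "-x"] by auto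

lemma sgrp_add: "sgrp H \<Longrightarrow> x \<in> H \<Longrightarrow> y \<in> H \<Longrightarrow> x + y \<in> H"
 using sgrp_diff[of H x "-y"] sgrp_minus[of H y] by simp

lemma sgrp_diff_commute: "sgrp H \<Longrightarrow> x - y \<in> H \<Longrightarrow> y - x \<in> H"
 using sgrp_minus[of H "x-y"] by simp

lemma sgrp_sum: "sgrp H \<Longrightarrow> (\<And>i. i \<in> I \<Longrightarrow> f i \<in> H) \<Longrightarrow> sum f I \<in> H"
 by (induction I rule: infinite_finite_induct) (auto simp: sgrp_0 sgrp_add)

lemma setsum2_I: "h \<in> H \<Longrightarrow> k \<in> K \<Longrightarrow> h + k \<in> H [+] K"
 by (auto simp: setsum2_def)

lemma setsum2_E: "x \<in> H [+] K \<Longrightarrow> (\<And>h k. x = h + k \<Longrightarrow> h \<in> H \<Longrightarrow> k \<in> K \<Longrightarrow> P) \<Longrightarrow> P"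
 by (auto simp: setsum2_def)

lemma setsum2_left: "sgrp K \<Longrightarrow> H \<subseteq> H [+] K"
 using setsum2_I[of _ H 0 K] sgrp_0[of K] by fastforce

lemma setsum2_right: "sgrp H \<Longrightarrow> K \<subseteq> H [+] K"
 using setsum2_I[of 0 H _ K] sgrp_0[of H] by fastforce

lemma sgrp_setsum2: assumes "sgrp H" "sgrp K" shows "sgrp (H [+] K)"
proof (rule sgrpI)
 show "0 \<in> H [+] K" using setsum2_I[of 0 H 0 K] assms by (simp add: sgrp_0)
next
 fix x y assume "x \<in> H [+] K" "y \<in> H [+] K"
 then obtain h k h' k' where "x = h + k" "y = h' + k'" "h \<in> H" "k \<in> K" "h' \<in> H" "k' \<in> K"
  by (auto simp: setsum2_def)
 moreover have "(h + k) - (h' + k') = (h - h') + (k - k')" by simp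
 ultimately show "x - y \<in> H [+] K" using assms by (metis setsum2_I sgrp_diff)
qed

lemma setsum2_assoc: "(A [+] B) [+] C = A [+] (B [+] C)"
 by (auto simp: setsum2_def) (metis add.assoc)+

lemma setsum2_commute: "A [+] B = B [+] A"
 by (auto simp: setsum2_def) (metis add.commute)+

lemma setsum2_subset: "sgrp H \<Longrightarrow> A \<subseteq> H \<Longrightarrow> B \<subseteq> H \<Longrightarrow> A [+] B \<subseteq> H"
 by (auto simp: setsum2_def intro!: sgrp_add)

lemma setsum2_mono: "A \<subseteq> A' \<Longrightarrow> B \<subseteq> B' \<Longrightarrow> A [+] B \<subseteq> A' [+] B'"
 by (auto simp: setsum2_def)

lemma covers_mono: "covers m H K \<Longrightarrow> m \<le> n \<Longrightarrow> H' \<subseteq> H \<Longrightarrow> K \<subseteq> K' \<Longrightarrow> covers n H' K'"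
 unfolding covers_def by (meson order_trans subset_iff)

lemma covers_trans:
 assumes "covers m H K" "covers n K L"
 shows "covers (m * n) H L"
proof -
 obtain R where R: "finite R" "card R \<le> m" "\<forall>h\<in>H. \<exists>r\<in>R. h - r \<in> K"
  using assms(1) by (auto simp: covers_def)
 obtain R' where R': "finite R'" "card R' \<le> n" "\<forall>h\<in>K. \<exists>r\<in>R'. h - r \<in> L"
  using assms(2) by (auto simp: covers_def)
 let ?Q = "(\<lambda>(a,b). a + b) ` (R \<times> R')"
 have "card ?Q \<le> card (R \<times> R')" using R R' by (intro card_image_le) auto
 also have "\<dots> \<le> m * n" using R R' by (simp add: card_cartesian_product mult_le_mono)
 finally have "card ?Q \<le> m * n" .
 moreover have "\<exists>r\<in>?Q. h - r \<in> L" if hh: "h \<in> H" for h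
 proof -
  obtain r where r: "r \<in> R" "h - r \<in> K" using R hh by blast
  obtain r' where r': "r' \<in> R'" "h - r - r' \<in> L" using R' r by blast
  have "h - (r + r') \<in> L" using r' by (simp add: algebra_simps)
  then show ?thesis using r r' by force
 qed
 ultimately show ?thesis unfolding covers_def using R R' by (intro exI[of _ ?Q]) auto
qed

lemma covers_card_le:
 assumes "sgrp K" "covers n H K" "Y \<subseteq> H" "\<And>y y'. y \<in> Y \<Longrightarrow> y' \<in> Y \<Longrightarrow> y - y' \<in> K \<Longrightarrow> y = y'"
 shows "finite Y \<and> card Y \<le> n"
proof -
 obtain R where R: "finite R" "card R \<le> n" "\<forall>h\<in>H. \<exists>r\<in>R. h - r \<in> K"
  using assms(2) by (auto simp: covers_def)
 then obtain \<phi> where \<phi>: "\<And>y. y \<in> Y \<Longrightarrow> \<phi> y \<in> R \<and> y - \<phi> y \<in> K" using assms(3) by (metis subsetD)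
 have inj: "inj_on \<phi> Y"
 proof (rule inj_onI)
  fix y y' assume a: "y \<in> Y" "y' \<in> Y" "\<phi> y = \<phi> y'"
  have "y - y' \<in> K" using \<phi>[OF a(1)] \<phi>[OF a(2)] a(3) sgrp_diff[OF assms(1), of "y - \<phi> y" "y' - \<phi> y'"] by simp
  then show "y = y'" using assms(4) a by blast
 qed
 have "\<phi> ` Y \<subseteq> R" using \<phi> by auto
 then have "card Y \<le> card R" by (rule card_inj_on_le[OF inj _ R(1)])
 moreover have "finite Y" by (rule finite_imageD[OF finite_subset[OF \<open>\<phi> ` Y \<subseteq> R\<close> R(1)] inj])
 ultimately show ?thesis using R by auto
qed

lemma has_idx_covers: "has_idx H K n \<Longrightarrow> covers n H K"
 unfolding has_idx_def covers_def by auto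

lemma has_idx_le_covers:
 assumes "sgrp K" "has_idx H K n" "covers m H K" shows "n \<le> m"
proof -
 obtain R where "R \<subseteq> H" "card R = n" "\<forall>r\<in>R. \<forall>r'\<in>R. r - r' \<in> K \<longrightarrow> r = r'"
  using assms(2) by (auto simp: has_idx_def)
 then show ?thesis using covers_card_le[OF assms(1,3), of R] by auto
qed

lemma has_idx_unique: "sgrp K \<Longrightarrow> has_idx H K m \<Longrightarrow> has_idx H K n \<Longrightarrow> m = n"
 by (intro order_antisym; erule (1) has_idx_le_covers; erule has_idx_covers)

lemma has_idx_incong:
 assumes "sgrp K" "has_idx H K n" "Y \<subseteq> H" "\<And>y y'. y \<in> Y \<Longrightarrow> y' \<in> Y \<Longrightarrow> y - y' \<in> K \<Longrightarrow> y = y'"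
 shows "card Y \<le> n"
 using covers_card_le[OF assms(1) has_idx_covers[OF assms(2)] assms(3)] assms(4) by auto

text \<open>The cover bounds the size of pairwise incongruent families; a largest one is a complete
  set of representatives, since any class it missed could be added.\<close>

lemma covers_imp_has_idx:
 assumes "sgrp K" "covers n H K"
 shows "\<exists>m\<le>n. has_idx H K m"
proof -
 define P where "P = (\<lambda>m. \<exists>Y\<subseteq>H. finite Y \<and> card Y = m \<and> (\<forall>r\<in>Y. \<forall>r'\<in>Y. r - r' \<in> K \<longrightarrow> r = r'))"
 have P0: "P 0" unfolding P_def by (intro exI[of _ "{}"]) auto
 have bd: "m \<le> n" if "P m" for m
  using that covers_card_le[OF assms] unfolding P_def by blast
 obtain m where m: "P m" "\<And>m'. P m' \<Longrightarrow> m' \<le> m"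
  using GreatestI_nat[of P 0 n] Greatest_le_nat[of P _ n] P0 bd by blast
 then obtain Y where Y: "Y \<subseteq> H" "finite Y" "card Y = m" "\<forall>r\<in>Y. \<forall>r'\<in>Y. r - r' \<in> K \<longrightarrow> r = r'"
  unfolding P_def by blast
 have "\<exists>r\<in>Y. h - r \<in> K" if h: "h \<in> H" for h
 proof (rule ccontr)
  assume c: "\<not> ?thesis"
  then have "h \<notin> Y" using sgrp_0[OF assms(1)] by force
  moreover have "\<forall>r\<in>insert h Y. \<forall>r'\<in>insert h Y. r - r' \<in> K \<longrightarrow> r = r'"
   using Y(4) c sgrp_diff_commute[OF assms(1)] by auto
  ultimately have "P (Suc m)" unfolding P_def using Y h by (intro exI[of _ "insert h Y"]) auto
  then show False using m(2) by fastforce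
 qed
 then have "has_idx H K m" unfolding has_idx_def using Y by blast
 then show ?thesis using bd[OF m(1)] by blast
qed

lemma has_idx_mult:
 assumes H: "sgrp H" and K: "sgrp K" "K \<subseteq> H" and L: "sgrp L" "L \<subseteq> K"
  and a: "has_idx H K m" and b: "has_idx K L n"
 shows "has_idx H L (m * n)"
proof -
 obtain R where R: "R \<subseteq> H" "finite R" "card R = m" "\<And>h. h \<in> H \<Longrightarrow> \<exists>r\<in>R. h - r \<in> K"
   "\<And>r r'. r \<in> R \<Longrightarrow> r' \<in> R \<Longrightarrow> r - r' \<in> K \<Longrightarrow> r = r'" using a by (auto simp: has_idx_def)
 obtain R' where R': "R' \<subseteq> K" "finite R'" "card R' = n" "\<And>h. h \<in> K \<Longrightarrow> \<exists>r\<in>R'. h - r \<in> L"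
   "\<And>r r'. r \<in> R' \<Longrightarrow> r' \<in> R' \<Longrightarrow> r - r' \<in> L \<Longrightarrow> r = r'" using b by (auto simp: has_idx_def)
 let ?f = "\<lambda>(a,b). a + b"
 let ?Q = "?f ` (R \<times> R')"
 have key: "x = x' \<and> y = y'" if "x \<in> R" "x' \<in> R" "y \<in> R'" "y' \<in> R'" "(x + y) - (x' + y') \<in> L" for x x' y y'
 proof -
  have "((x + y) - (x' + y')) - (y - y') \<in> K" using that R' L K sgrp_diff by (meson subsetD)
  then have "x - x' \<in> K" by (simp add: algebra_simps)
  then have "x = x'" using R that by blast
  then show ?thesis using that R' by simp
 qed
 have "inj_on ?f (R \<times> R')"
  using key sgrp_0[OF L(1)] unfolding inj_on_def by auto
 then have "card ?Q = m * n" using R R' by (simp add: card_image card_cartesian_product)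
 moreover have "?Q \<subseteq> H" using R R' K H by (auto intro!: sgrp_add)
 moreover have "\<exists>r\<in>?Q. h - r \<in> L" if hh: "h \<in> H" for h
 proof -
  obtain r where r: "r \<in> R" "h - r \<in> K" using R hh by blast
  obtain r' where r': "r' \<in> R'" "h - r - r' \<in> L" using R' r by blast
  have "h - (r + r') \<in> L" using r' by (simp add: algebra_simps)
  then show ?thesis using r r' by force
 qed
 moreover have "\<forall>r\<in>?Q. \<forall>r'\<in>?Q. r - r' \<in> L \<longrightarrow> r = r'" by (auto dest: key)
 moreover have "finite ?Q" using R R' by blast
 ultimately show ?thesis unfolding has_idx_def by (intro exI[of _ ?Q]) simp
qed

lemma has_idx_split:
 assumes H: "sgrp H" and K: "sgrp K" "K \<subseteq> H" and L: "sgrp L" "L \<subseteq> K"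
  and a: "has_idx H L n"
 obtains p q where "has_idx H K p" "has_idx K L q" "n = p * q"
proof -
 have "covers n H K" by (rule covers_mono[OF has_idx_covers[OF a] _ _ L(2)]) auto
 then obtain p where p: "has_idx H K p" using covers_imp_has_idx[OF K(1)] by blast
 have "covers n K L" by (rule covers_mono[OF has_idx_covers[OF a] _ K(2)]) auto
 then obtain q where q: "has_idx K L q" using covers_imp_has_idx[OF L(1)] by blast
 show ?thesis by (rule that[OF p q has_idx_unique[OF L(1) a has_idx_mult[OF H K L p q]]])
qed

lemma covers_setsum2:
 assumes "covers n A B" shows "covers n (L [+] A) (L [+] B)"
proof -
 obtain R where R: "finite R" "card R \<le> n" "\<forall>h\<in>A. \<exists>r\<in>R. h - r \<in> B"
  using assms by (auto simp: covers_def)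
 have "\<exists>r\<in>R. h - r \<in> L [+] B" if hh: "h \<in> L [+] A" for h
 proof -
  obtain l a where la: "h = l + a" "l \<in> L" "a \<in> A" using hh unfolding setsum2_def by blast
  then obtain r where "r \<in> R" "a - r \<in> B" using R by blast
  then show ?thesis using la setsum2_I[of l L "a - r" B] by (intro bexI[of _ r]) (auto simp: algebra_simps)
 qed
 then show ?thesis unfolding covers_def using R by blast
qed

text \<open>An endomorphism of a finite group has kernel and cokernel of equal order, because the
  order of U/B is the order of the image times either of them. Here \<open>?C\<close> is the
  preimage of the kernel and \<open>?I\<close> that of the image.\<close>

lemma has_idx_ker_coker:
 assumes U: "sgrp U" and B: "sgrp B" "B \<subseteq> U" and g: "\<And>x y. x \<in> U \<Longrightarrow> y \<in> U \<Longrightarrow> g (x - y) = g x - g y"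
  and gU: "g ` U \<subseteq> U" and gB: "g ` B \<subseteq> B" and n: "has_idx U B n"
 obtains d where "has_idx {v\<in>U. g v \<in> B} B d" "has_idx U (g ` U [+] B) d"
proof -
 have g0: "g 0 = 0" using g[of 0 0] sgrp_0[OF U] by simp
 let ?C = "{v\<in>U. g v \<in> B}" and ?I = "g ` U [+] B"
 have CU: "?C \<subseteq> U" by auto
 have C: "sgrp ?C" by (rule sgrpI) (auto simp: g g0 sgrp_0 U B sgrp_diff)
 have "sgrp (g ` U)"
 proof (rule sgrpI)
  show "0 \<in> g ` U" using g0 sgrp_0[OF U] by (metis image_eqI)
  fix x y assume "x \<in> g ` U" "y \<in> g ` U"
  then obtain a b where "x = g a" "y = g b" "a \<in> U" "b \<in> U" by blast
  then show "x - y \<in> g ` U" using g[of a b] sgrp_diff[OF U, of a b] by (metis image_eqI)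
 qed
 then have I: "sgrp ?I" using B sgrp_setsum2 by blast
 have IU: "?I \<subseteq> U" using setsum2_subset[OF U gU B(2)] .
 have BI: "B \<subseteq> ?I" using setsum2_right[OF \<open>sgrp (g ` U)\<close>] .
 have BC: "B \<subseteq> ?C" using B gB by auto
 obtain a c where ac: "has_idx U ?C a" "has_idx ?C B c" "n = a * c"
  by (rule has_idx_split[OF U C CU B(1) BC n])
 obtain d e where de: "has_idx U ?I d" "has_idx ?I B e" "n = d * e"
  by (rule has_idx_split[OF U I IU B(1) BI n])
 obtain R where R: "R \<subseteq> U" "finite R" "card R = a" "\<And>h. h \<in> U \<Longrightarrow> \<exists>r\<in>R. h - r \<in> ?C"
   "\<And>r r'. r \<in> R \<Longrightarrow> r' \<in> R \<Longrightarrow> r - r' \<in> ?C \<Longrightarrow> r = r'" using ac(1) unfolding has_idx_def by blast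
 have key: "r = r'" if "r \<in> R" "r' \<in> R" "g r - g r' \<in> B" for r r'
 proof (rule R(5)[OF that(1,2)])
  have "r \<in> U" "r' \<in> U" using R(1) that by auto
  then show "r - r' \<in> ?C" using g[of r r'] sgrp_diff[OF U, of r r'] that(3) by auto
 qed
 have inj: "inj_on g R" by (rule inj_onI, rule key) (use sgrp_0[OF B(1)] in auto)
 have "has_idx ?I B a" unfolding has_idx_def
 proof (intro exI[of _ "g ` R"] conjI)
  show "g ` R \<subseteq> ?I" using R(1) setsum2_left[OF B(1), of "g ` U"] by blast
  show "\<forall>h\<in>?I. \<exists>r\<in>g ` R. h - r \<in> B"
  proof
   fix h assume "h \<in> ?I"
   then obtain u b where ub: "h = g u + b" "u \<in> U" "b \<in> B" by (auto elim: setsum2_E)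
   then obtain r where r: "r \<in> R" "u - r \<in> ?C" using R(4) by blast
   have "g u - g r \<in> B" using r g[of u r] ub R(1) by auto
   then have "h - g r \<in> B" using ub sgrp_add[OF B(1), of "g u - g r" b] by (simp add: algebra_simps)
   then show "\<exists>r\<in>g ` R. h - r \<in> B" using r by blast
  qed
  show "finite (g ` R)" "card (g ` R) = a" using R inj by (auto simp: card_image)
  show "\<forall>r\<in>g ` R. \<forall>r'\<in>g ` R. r - r' \<in> B \<longrightarrow> r = r'" using key by blast
 qed
 then have ea: "e = a" using de(2) has_idx_unique[OF B(1)] by blast
 have "n \<noteq> 0"
 proof
  assume "n = 0"
  then obtain R where "R = {}" "\<forall>h\<in>U. \<exists>r\<in>R. h - r \<in> B" using n unfolding has_idx_def by auto
  then show False using sgrp_0[OF U] by blast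
 qed
 then have "c = d" using ac(3) de(3) ea by auto
 then show ?thesis using that[OF _ de(1)] ac(2) by simp
qed

section \<open>Subgroups of a finite power of the integers\<close>

definition zmult :: "int \<Rightarrow> ('x \<Rightarrow> int) \<Rightarrow> 'x \<Rightarrow> int" (infixr \<open>\<star>\<close> 75) where
 "k \<star> u = (\<lambda>x. k * u x)"

text \<open>Functions on \<open>X\<close> extended by 0. They form a subgroup of the full function
  type, and for a subset \<open>E\<close> of \<open>X\<close> the group \<open>Zf E\<close> is
  literally contained in \<open>Zf X\<close>.\<close>

definition Zf :: "'x set \<Rightarrow> ('x \<Rightarrow> int) set" where
 "Zf X = {u. \<forall>x. x \<notin> X \<longrightarrow> u x = 0}"

definition ip :: "'x set \<Rightarrow> ('x \<Rightarrow> int) \<Rightarrow> ('x \<Rightarrow> int) \<Rightarrow> int" where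
 "ip X u v = (\<Sum>x\<in>X. u x * v x)"

definition perp :: "'x set \<Rightarrow> ('x \<Rightarrow> int) set \<Rightarrow> ('x \<Rightarrow> int) set" where
 "perp X J = {u\<in>Zf X. \<forall>j\<in>J. ip X u j = 0}"

definition sat :: "'x set \<Rightarrow> ('x \<Rightarrow> int) set \<Rightarrow> ('x \<Rightarrow> int) set" where
 "sat X J = {u\<in>Zf X. \<exists>k>0. k \<star> u \<in> J}"

definition unit_fun :: "'x \<Rightarrow> 'x \<Rightarrow> int" where
 "unit_fun a = (\<lambda>x. if x = a then 1 else 0)"

lemma zmult_apply [simp]: "(k \<star> u) x = k * u x"
 by (simp add: zmult_def)

lemma zmult_simps [simp]: "0 \<star> u = 0" "1 \<star> u = u" "k \<star> 0 = 0" "k \<star> l \<star> u = (k * l) \<star> u"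
 by (auto simp: fun_eq_iff)

lemma zmult_distrib: "k \<star> (u + v) = k \<star> u + k \<star> v" "k \<star> (u - v) = k \<star> u - k \<star> v"
  "(k + l) \<star> u = k \<star> u + l \<star> u" "(k - l) \<star> u = k \<star> u - l \<star> u" "(- k) \<star> u = - (k \<star> u)"
 by (auto simp: fun_eq_iff algebra_simps)

lemma sum_fun_apply: "(sum f A) x = (\<Sum>a\<in>A. f a x)"
 by (induction A rule: infinite_finite_induct) auto

lemma zmult_sum: "k \<star> (sum f A) = (\<Sum>a\<in>A. k \<star> f a)"
 by (simp add: fun_eq_iff sum_fun_apply sum_distrib_left)

lemma sgrp_zmult:
 assumes "sgrp H" "u \<in> H" shows "k \<star> u \<in> H"
proof -
 have nat: "int n \<star> u \<in> H" for n
 proof (induction n)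
  case (Suc n)
  have "int (Suc n) \<star> u = u + int n \<star> u" by (auto simp: fun_eq_iff algebra_simps)
  then show ?case using sgrp_add[OF assms Suc] by metis
 qed (metis of_nat_0 zmult_simps(1) sgrp_0[OF assms(1)])
 show ?thesis
 proof (cases "k \<ge> 0")
  case True then show ?thesis using nat[of "nat k"] by simp
 next
  case False then show ?thesis using sgrp_minus[OF assms(1) nat[of "nat (-k)"]] by (simp add: zmult_distrib)
 qed
qed

lemma sgrp_Zf: "sgrp (Zf X)"
 by (rule sgrpI) (auto simp: Zf_def)

lemma Zf_zmult: "u \<in> Zf X \<Longrightarrow> k \<star> u \<in> Zf X"
 by (auto simp: Zf_def)

lemma unit_fun_Zf: "a \<in> X \<Longrightarrow> unit_fun a \<in> Zf X"
 by (auto simp: Zf_def unit_fun_def)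

lemma ip_simps: "ip X (u + v) w = ip X u w + ip X v w" "ip X (u - v) w = ip X u w - ip X v w"
 "ip X (k \<star> u) w = k * ip X u w" "ip X w (u + v) = ip X w u + ip X w v" "ip X w (u - v) = ip X w u - ip X w v"
 "ip X w (k \<star> u) = k * ip X w u" "ip X 0 w = 0" "ip X w 0 = 0" "ip X (-u) w = - ip X u w" "ip X w (-u) = - ip X w u"
 by (auto simp: ip_def algebra_simps sum.distrib sum_subtractf sum_distrib_left sum_negf)

lemma ip_commute: "ip X u v = ip X v u"
 by (simp add: ip_def mult.commute)

lemma ip_sum: "ip X (sum f A) w = (\<Sum>a\<in>A. ip X (f a) w)" "ip X w (sum f A) = (\<Sum>a\<in>A. ip X w (f a))"
 by (induction A rule: infinite_finite_induct) (auto simp: ip_simps)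

lemma ip_nonneg: "ip X u u \<ge> 0"
 by (simp add: ip_def sum_nonneg)

lemma ip_self_eq_0: "finite X \<Longrightarrow> u \<in> Zf X \<Longrightarrow> ip X u u = 0 \<Longrightarrow> u = 0"
 unfolding ip_def by (subst (asm) sum_nonneg_eq_0_iff) (auto simp: Zf_def fun_eq_iff)

lemma ip_unit_fun: "finite X \<Longrightarrow> a \<in> X \<Longrightarrow> ip X u (unit_fun a) = u a" "finite X \<Longrightarrow> a \<in> X \<Longrightarrow> ip X (unit_fun a) u = u a"
 by (simp_all add: ip_def unit_fun_def if_distrib[of "\<lambda>z. _ * z"] if_distribR if_distrib[of "\<lambda>z. z * _"] cong: if_cong)

lemma sgrp_perp: "sgrp (perp X J)"
 by (rule sgrpI) (auto simp: perp_def ip_simps sgrp_0[OF sgrp_Zf] sgrp_diff[OF sgrp_Zf])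

lemma perp_Zf: "perp X J \<subseteq> Zf X"
 by (auto simp: perp_def)

lemma sat_Zf: "sat X J \<subseteq> Zf X"
 by (auto simp: sat_def)

lemma sgrp_sat: assumes "sgrp J" shows "sgrp (sat X J)"
proof (rule sgrpI)
 show "0 \<in> sat X J" using sgrp_0[OF assms] sgrp_0[OF sgrp_Zf, of X] by (auto simp: sat_def intro: exI[of _ 1])
next
 fix x y assume "x \<in> sat X J" "y \<in> sat X J"
 then obtain k l where kl: "k > 0" "l > 0" "k \<star> x \<in> J" "l \<star> y \<in> J" "x \<in> Zf X" "y \<in> Zf X" by (auto simp: sat_def)
 have "l \<star> k \<star> x - k \<star> l \<star> y \<in> J" using kl assms by (intro sgrp_diff[OF assms] sgrp_zmult[OF assms kl(3)] sgrp_zmult[OF assms kl(4)])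
 moreover have "l \<star> k \<star> x - k \<star> l \<star> y = (k * l) \<star> (x - y)" by (auto simp: fun_eq_iff algebra_simps)
 moreover have "k * l > 0" using kl by simp
 ultimately show "x - y \<in> sat X J" using kl sgrp_diff[OF sgrp_Zf, of x X y] unfolding sat_def by (intro CollectI conjI exI[of _ "k * l"]) auto
qed

lemma sat_superset: "J \<subseteq> Zf X \<Longrightarrow> J \<subseteq> sat X J"
 by (auto simp: sat_def intro!: exI[of _ 1])

lemma sat_saturated: "k > 0 \<Longrightarrow> u \<in> Zf X \<Longrightarrow> k \<star> u \<in> sat X J \<Longrightarrow> u \<in> sat X J"
 unfolding sat_def using mult_pos_pos by fastforce

lemma perp_sat: "perp X (sat X J) = perp X J" if "J \<subseteq> Zf X"
proof -
 have "ip X u j = 0" if h: "\<forall>j\<in>J. ip X u j = 0" "j \<in> sat X J" for u j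
 proof -
  obtain k where "k > 0" "k \<star> j \<in> J" using h by (auto simp: sat_def)
  then have "k * ip X u j = 0" using h by (metis ip_simps(6))
  then show ?thesis using \<open>k > 0\<close> by simp
 qed
 then show ?thesis using sat_superset[OF that] unfolding perp_def by blast
qed

subsection \<open>Orthogonal families\<close>

text \<open>Orthogonal families of integer vectors take the place of bases of rational subspaces:
  their sizes give the rank \<open>odim\<close>, and they yield projections with integer
  entries.\<close>

definition ofam :: "'x set \<Rightarrow> ('x \<Rightarrow> int) set \<Rightarrow> ('x \<Rightarrow> int) set \<Rightarrow> bool" where
 "ofam X D Y \<longleftrightarrow> Y \<subseteq> D \<and> finite Y \<and> (\<forall>y\<in>Y. ip X y y \<noteq> 0) \<and> (\<forall>y\<in>Y. \<forall>y'\<in>Y. y \<noteq> y' \<longrightarrow> ip X y y' = 0)"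

definition oscale :: "'x set \<Rightarrow> ('x \<Rightarrow> int) set \<Rightarrow> int" where
 "oscale X Y = (\<Prod>y\<in>Y. ip X y y)"

text \<open>The orthogonal projection onto the span of \<open>Y\<close>, multiplied by \<open>oscale X Y\<close> to stay integral.\<close>

definition oproj :: "'x set \<Rightarrow> ('x \<Rightarrow> int) set \<Rightarrow> ('x \<Rightarrow> int) \<Rightarrow> 'x \<Rightarrow> int" where
 "oproj X Y v = (\<Sum>y\<in>Y. ((\<Prod>z\<in>Y - {y}. ip X z z) * ip X v y) \<star> y)"

lemma oscale_pos: "ofam X D Y \<Longrightarrow> oscale X Y > 0"
 unfolding oscale_def ofam_def by (intro prod_pos) (metis ip_nonneg order_le_neq_trans)

lemma oscale_split: "ofam X D Y \<Longrightarrow> y \<in> Y \<Longrightarrow> (\<Prod>z\<in>Y - {y}. ip X z z) * ip X y y = oscale X Y"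
 unfolding oscale_def ofam_def by (simp add: prod.remove mult.commute)

lemma ip_oproj: assumes "ofam X D Y" "y \<in> Y" shows "ip X (oproj X Y v) y = oscale X Y * ip X v y"
proof -
 have "ip X (oproj X Y v) y = (\<Sum>z\<in>Y. if z = y then (\<Prod>z\<in>Y - {y}. ip X z z) * ip X v y * ip X y y else 0)"
  unfolding oproj_def ip_sum ip_simps by (rule sum.cong) (use assms in \<open>auto simp: ofam_def\<close>)
 also have "\<dots> = (\<Prod>z\<in>Y - {y}. ip X z z) * ip X y y * ip X v y"
  using assms by (simp add: ofam_def)
 finally show ?thesis using oscale_split[OF assms] by simp
qed

lemma ip_oproj_right:
 assumes "ofam X D Y" "\<And>y. y \<in> Y \<Longrightarrow> ip X u y = 0" shows "ip X u (oproj X Y v) = 0"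
 unfolding oproj_def ip_sum ip_simps using assms(2) by simp

lemma ip_oproj_diff: assumes "ofam X D Y" shows "ip X (oscale X Y \<star> v - oproj X Y v) (oproj X Y w) = 0"
 by (rule ip_oproj_right[OF assms]) (simp add: ip_simps ip_oproj[OF assms])

lemma bessel: assumes "ofam X D Y" shows "ip X v (oproj X Y v) \<le> oscale X Y * ip X v v"
proof -
 let ?K = "oscale X Y" and ?p = "oproj X Y v"
 have "0 \<le> ip X (?K \<star> v - ?p) (?K \<star> v - ?p)" by (rule ip_nonneg)
 also have "\<dots> = ?K * ip X (?K \<star> v - ?p) v" using ip_oproj_diff[OF assms, of v v] by (simp add: ip_simps)
 finally have "0 \<le> ip X (?K \<star> v - ?p) v" using oscale_pos[OF assms] by (simp add: zero_le_mult_iff)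
 then show ?thesis by (simp add: ip_simps ip_commute[of X ?p])
qed

text \<open>The trace of an orthogonal projection is its rank. This bounds the size of orthogonal
  families and, by averaging over \<open>X\<close>, later provides a coordinate vector with a long
  projection.\<close>

lemma oproj_trace:
 assumes "ofam X D Y" "finite X"
 shows "(\<Sum>a\<in>X. ip X (unit_fun a) (oproj X Y (unit_fun a))) = int (card Y) * oscale X Y"
proof -
 have "(\<Sum>a\<in>X. ip X (unit_fun a) (oproj X Y (unit_fun a))) = (\<Sum>a\<in>X. \<Sum>y\<in>Y. (\<Prod>z\<in>Y - {y}. ip X z z) * (y a * y a))"
  by (rule sum.cong) (auto simp: oproj_def ip_sum ip_simps ip_unit_fun assms(2) algebra_simps)
 also have "\<dots> = (\<Sum>y\<in>Y. (\<Prod>z\<in>Y - {y}. ip X z z) * ip X y y)"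
  unfolding ip_def[of X y y for y] sum_distrib_left by (rule sum.swap)
 also have "\<dots> = (\<Sum>y\<in>Y. oscale X Y)" by (rule sum.cong) (auto simp: oscale_split[OF assms(1)])
 finally show ?thesis by simp
qed

lemma ofam_card: assumes "ofam X D Y" "finite X" shows "card Y \<le> card X"
proof -
 have "int (card Y) * oscale X Y \<le> (\<Sum>a\<in>X. oscale X Y * 1)"
  unfolding oproj_trace[OF assms, symmetric]
 proof (rule sum_mono)
  fix a assume "a \<in> X"
  then have "ip X (unit_fun a) (unit_fun a) = 1" using ip_unit_fun(1)[OF assms(2)] by (simp add: unit_fun_def)
  then show "ip X (unit_fun a) (oproj X Y (unit_fun a)) \<le> oscale X Y * 1"
   using bessel[OF assms(1), of "unit_fun a"] by simp
 qed
 then have "int (card Y) * oscale X Y \<le> int (card X) * oscale X Y" by simp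
 then show ?thesis using oscale_pos[OF assms(1)] by simp
qed

definition odim :: "'x set \<Rightarrow> ('x \<Rightarrow> int) set \<Rightarrow> nat" where
 "odim X D = Max (card ` {Y. ofam X D Y})"

lemma ofam_finite_cards: "finite X \<Longrightarrow> finite (card ` {Y. ofam X D Y})"
 by (rule finite_subset[of _ "{..card X}"]) (auto simp: ofam_card)

lemma ofam_odim: assumes "finite X" "ofam X D Y" shows "card Y \<le> odim X D"
 unfolding odim_def by (rule Max_ge[OF ofam_finite_cards[OF assms(1)]]) (use assms in auto)

lemma maximal_ofam:
 assumes "finite X" "D \<subseteq> Zf X"
 obtains Y where "ofam X D Y" "card Y = odim X D" "\<And>d. d \<in> D \<Longrightarrow> (\<And>y. y \<in> Y \<Longrightarrow> ip X d y = 0) \<Longrightarrow> d = 0"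
proof -
 have "ofam X D {}" by (simp add: ofam_def)
 then have "odim X D \<in> card ` {Y. ofam X D Y}" unfolding odim_def
  by (intro Max_in ofam_finite_cards assms) auto
 then obtain Y where Y: "ofam X D Y" "card Y = odim X D" by auto
 show ?thesis
 proof (rule that[OF Y])
  fix d assume d: "d \<in> D" "\<And>y. y \<in> Y \<Longrightarrow> ip X d y = 0"
  show "d = 0"
  proof (rule ccontr)
   assume "d \<noteq> 0"
   then have nz: "ip X d d \<noteq> 0" using ip_self_eq_0 assms d by blast
   then have nin: "d \<notin> Y" using d by blast
   have "ofam X D (insert d Y)"
    unfolding ofam_def
   proof (intro conjI ballI impI)
    fix y y' assume a: "y \<in> insert d Y" "y' \<in> insert d Y" "y \<noteq> y'"
    show "ip X y y' = 0" using a Y(1) d(2) ip_commute[of X y y'] unfolding ofam_def by (metis insertE)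
   qed (use Y d nz in \<open>auto simp: ofam_def\<close>)
   then have "card (insert d Y) \<le> odim X D" using ofam_odim assms by blast
   then show False using nin Y unfolding ofam_def by simp
  qed
 qed
qed

text \<open>A maximal orthogonal family in \<open>D\<close> spans \<open>D\<close> rationally: for
  \<open>d\<close> in \<open>D\<close> the residual
  \<open>oscale X Y \<star> d - oproj X Y d\<close> lies in \<open>D\<close> and is orthogonal to
  \<open>Y\<close>, hence is 0. So projecting onto the span of \<open>Y\<close> is projecting onto
  \<open>D\<close>.\<close>

lemma orthogonal_projection:
 assumes "finite X" "sgrp D" "D \<subseteq> Zf X"
 obtains Y where "ofam X D Y" "card Y = odim X D"
  "\<And>v. oproj X Y v \<in> D" "\<And>v d. d \<in> D \<Longrightarrow> ip X (oscale X Y \<star> v - oproj X Y v) d = 0"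
proof -
 obtain Y where Y: "ofam X D Y" "card Y = odim X D"
  and mx: "\<And>d. d \<in> D \<Longrightarrow> (\<And>y. y \<in> Y \<Longrightarrow> ip X d y = 0) \<Longrightarrow> d = 0"
  by (rule maximal_ofam[OF assms(1,3)]) blast
 have pD: "oproj X Y v \<in> D" for v
  unfolding oproj_def by (rule sgrp_sum[OF assms(2)], rule sgrp_zmult[OF assms(2)]) (use Y in \<open>auto simp: ofam_def\<close>)
 have "ip X (oscale X Y \<star> v - oproj X Y v) d = 0" if d: "d \<in> D" for v d
 proof -
  have "oscale X Y \<star> d - oproj X Y d = 0"
   by (rule mx) (use assms d pD in \<open>auto simp: sgrp_diff sgrp_zmult ip_simps ip_oproj[OF Y(1)]\<close>)
  then have "oscale X Y \<star> d = oproj X Y d" by simp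
  then have "oscale X Y * ip X (oscale X Y \<star> v - oproj X Y v) d = 0"
   using ip_oproj_diff[OF Y(1), of v d] by (metis ip_simps(6))
  then show ?thesis using oscale_pos[OF Y(1)] by simp
 qed
 then show ?thesis using that[OF Y pD] by blast
qed

text \<open>The scale of the projection onto \<open>J\<close> is a uniform exponent: the residual of
  a vector of the double complement lies in \<open>perp X J\<close> and turns out to be orthogonal
  to itself.\<close>

lemma perp_perp:
 assumes "finite X" "sgrp J" "J \<subseteq> Zf X"
 obtains k where "k > 0" "\<And>x. x \<in> perp X (perp X J) \<Longrightarrow> k \<star> x \<in> J"
proof -
 obtain Y where Y: "ofam X J Y"
  "\<And>v. oproj X Y v \<in> J" "\<And>v d. d \<in> J \<Longrightarrow> ip X (oscale X Y \<star> v - oproj X Y v) d = 0"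
  by (rule orthogonal_projection[OF assms]) blast
 have "oscale X Y \<star> x \<in> J" if x: "x \<in> perp X (perp X J)" for x
 proof -
  let ?z = "oscale X Y \<star> x - oproj X Y x"
  have "x \<in> Zf X" using x perp_Zf by blast
  then have zZ: "?z \<in> Zf X" using Y(2) assms(3) by (intro sgrp_diff[OF sgrp_Zf] Zf_zmult) auto
  then have zp: "?z \<in> perp X J" using Y(3) by (simp add: perp_def)
  then have "ip X x ?z = 0" using x by (auto simp: perp_def)
  moreover have "ip X (oproj X Y x) ?z = 0" using zp Y(2)[of x] ip_commute[of X "oproj X Y x" ?z] by (auto simp: perp_def)
  ultimately have "oscale X Y * ip X x ?z - ip X (oproj X Y x) ?z = 0" by simp
  then have "ip X ?z ?z = 0" by (metis ip_simps(2,3))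
  then have "?z = 0" using ip_self_eq_0 zZ assms by blast
  then show ?thesis using Y(2)[of x] by simp
 qed
 then show ?thesis using that oscale_pos[OF Y(1)] by blast
qed

lemma perp_perp_sat:
 assumes "finite X" "sgrp J" "J \<subseteq> Zf X" shows "perp X (perp X J) = sat X J"
proof
 show "perp X (perp X J) \<subseteq> sat X J"
 proof
  fix x assume x: "x \<in> perp X (perp X J)"
  obtain k where "k > 0" "\<And>x. x \<in> perp X (perp X J) \<Longrightarrow> k \<star> x \<in> J" by (rule perp_perp[OF assms]) blast
  then show "x \<in> sat X J" using x perp_Zf unfolding sat_def by blast
 qed
 show "sat X J \<subseteq> perp X (perp X J)"
 proof
  fix u assume u: "u \<in> sat X J"
  then have "ip X u d = 0" if "d \<in> perp X J" for d
   using that u perp_sat[OF assms(3)] ip_commute[of X u d] unfolding perp_def by auto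
  then show "u \<in> perp X (perp X J)" using u sat_Zf unfolding perp_def by auto
 qed
qed

subsection \<open>Finiteness of indices\<close>

text \<open>There are finitely many residues modulo \<open>k\<close>. Two elements of
  \<open>S\<close> with equal residues differ by some \<open>k \<star> w\<close>; the last
  hypothesis puts \<open>w\<close> into \<open>S\<close>, and then \<open>k \<star> w\<close> into
  \<open>H\<close>.\<close>

lemma covers_Zf_exponent:
 assumes "finite X" "k > 0" "S \<subseteq> Zf X" "sgrp S" "\<And>u. u \<in> S \<Longrightarrow> k \<star> u \<in> H"
  "\<And>u. u \<in> Zf X \<Longrightarrow> k \<star> u \<in> S \<Longrightarrow> u \<in> S"
 shows "\<exists>n. covers n S H"
proof -
 define \<rho> where "\<rho> = (\<lambda>u::'a \<Rightarrow> int.  (\<lambda>x. if x \<in> X then u x mod k else 0))"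
 have "\<rho> ` S \<subseteq> {f. \<forall>x. (x \<in> X \<longrightarrow> f x \<in> {0..<k}) \<and> (x \<notin> X \<longrightarrow> f x = 0)}"
  using assms(2) by (auto simp: \<rho>_def)
 then have fin: "finite (\<rho> ` S)"
  by (rule finite_subset) (intro finite_set_of_finite_funs assms finite_atLeastLessThan_int)
 define R where "R = (\<lambda>c. SOME u. u \<in> S \<and> \<rho> u = c) ` (\<rho> ` S)"
 have "\<exists>r\<in>R. h - r \<in> H" if h: "h \<in> S" for h
 proof -
  define r where "r = (SOME u. u \<in> S \<and> \<rho> u = \<rho> h)"
  have r: "r \<in> S" "\<rho> r = \<rho> h" using someI[of "\<lambda>u. u \<in> S \<and> \<rho> u = \<rho> h" h] h by (auto simp: r_def)
  define w where "w = (\<lambda>x. (h x - r x) div k)"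
  have kw: "k \<star> w = h - r"
  proof
   fix x
   show "(k \<star> w) x = (h - r) x"
   proof (cases "x \<in> X")
    case True
    then have "r x mod k = h x mod k" using r(2) unfolding \<rho>_def fun_eq_iff by metis
    then have "k dvd (h x - r x)" by (metis mod_eq_dvd_iff)
    then show ?thesis by (simp add: w_def)
   next
    case False
    then have "h x = 0" "r x = 0" using h r(1) assms(3) by (auto simp: Zf_def)
    then show ?thesis by (simp add: w_def)
   qed
  qed
  have "h x = 0" "r x = 0" if "x \<notin> X" for x using that h r(1) assms(3) unfolding Zf_def by blast+
  then have "w \<in> Zf X" by (auto simp: Zf_def w_def)
  moreover have "k \<star> w \<in> S" using kw sgrp_diff[OF assms(4) h r(1)] by simp
  ultimately have "w \<in> S" using assms(6) by blast
  then have "h - r \<in> H" using assms(5) kw by metis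
  moreover have "r \<in> R" using h by (auto simp: R_def r_def)
  ultimately show ?thesis by blast
 qed
 moreover have "finite R" using fin by (simp add: R_def)
 ultimately show ?thesis unfolding covers_def by blast
qed

lemma sat_finite_index:
 assumes "finite X" "sgrp J" "J \<subseteq> Zf X" shows "\<exists>n. has_idx (sat X J) J n"
proof -
 obtain k where k: "k > 0" "\<And>x. x \<in> perp X (perp X J) \<Longrightarrow> k \<star> x \<in> J" by (rule perp_perp[OF assms]) blast
 have "\<exists>n. covers n (sat X J) J"
 proof (rule covers_Zf_exponent[OF assms(1) k(1) sat_Zf sgrp_sat[OF assms(2)]])
  show "k \<star> u \<in> J" if "u \<in> sat X J" for u using that k(2) perp_perp_sat[OF assms] by blast
  show "u \<in> sat X J" if "u \<in> Zf X" "k \<star> u \<in> sat X J" for u by (rule sat_saturated[OF k(1) that])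
 qed
 then show ?thesis using covers_imp_has_idx assms(2) by blast
qed

lemma sat_mono: "J \<subseteq> J' \<Longrightarrow> sat X J \<subseteq> sat X J'"
 by (auto simp: sat_def)

lemma finite_index_Zf:
 assumes "finite X" "k > 0" "sgrp H" "\<And>u. u \<in> Zf X \<Longrightarrow> k \<star> u \<in> H" shows "\<exists>n. has_idx (Zf X) H n"
proof -
 have "\<exists>n. covers n (Zf X) H"
  by (rule covers_Zf_exponent[OF assms(1,2)]) (use assms sgrp_Zf in auto)
 then show ?thesis using covers_imp_has_idx assms(3) by blast
qed

lemma perp_sum_finite_index:
 assumes "finite X" "sgrp J" "J \<subseteq> Zf X" shows "\<exists>n. has_idx (Zf X) (J [+] perp X J) n"
proof -
 obtain k where k: "k > 0" "\<And>x. x \<in> perp X (perp X J) \<Longrightarrow> k \<star> x \<in> J" by (rule perp_perp[OF assms]) blast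
 obtain Y where Y: "ofam X (perp X J) Y" "\<And>v. oproj X Y v \<in> perp X J"
  "\<And>v d. d \<in> perp X J \<Longrightarrow> ip X (oscale X Y \<star> v - oproj X Y v) d = 0"
  by (rule orthogonal_projection[OF assms(1) sgrp_perp perp_Zf]) blast
 show ?thesis
 proof (rule finite_index_Zf[OF assms(1)])
  show "k * oscale X Y > 0" using k oscale_pos[OF Y(1)] by simp
  show "sgrp (J [+] perp X J)" by (intro sgrp_setsum2 assms sgrp_perp)
  fix u assume u: "u \<in> Zf X"
  let ?z = "oscale X Y \<star> u - oproj X Y u"
  have "?z \<in> perp X (perp X J)" using Y(3) sgrp_diff[OF sgrp_Zf Zf_zmult[OF u]] Y(2)[of u] perp_Zf[of X J]
   unfolding perp_def[of X "perp X J"] by blast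
  then have "k \<star> ?z \<in> J" using k by blast
  moreover have "k \<star> oproj X Y u \<in> perp X J" by (rule sgrp_zmult[OF sgrp_perp Y(2)])
  ultimately have "k \<star> ?z + k \<star> oproj X Y u \<in> J [+] perp X J" by (rule setsum2_I)
  then show "(k * oscale X Y) \<star> u \<in> J [+] perp X J" by (simp add: zmult_distrib)
 qed
qed

subsection \<open>Saturated subgroups\<close>

lemma sum_exchange:
 fixes b :: "'i \<Rightarrow> 'x \<Rightarrow> int"
 assumes "finite I" "i \<in> I" "j \<in> I" "i \<noteq> j"
 shows "(\<Sum>k\<in>I. (d(j := d j - s * d i)) k \<star> (b(i := b i + s \<star> b j)) k) = (\<Sum>k\<in>I. d k \<star> b k)"
proof -
 have split: "sum f I = f i + (f j + sum f (I - {i} - {j}))" for f :: "'i \<Rightarrow> 'x \<Rightarrow> int"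
  using assms by (simp add: sum.remove)
 have "(\<Sum>k\<in>I - {i} - {j}. (d(j := d j - s * d i)) k \<star> (b(i := b i + s \<star> b j)) k) = (\<Sum>k\<in>I - {i} - {j}. d k \<star> b k)"
  by (rule sum.cong) auto
 then show ?thesis unfolding split using assms(4) by (simp add: fun_eq_iff algebra_simps)
qed

definition quotient_basis :: "'x set \<Rightarrow> ('x \<Rightarrow> int) set \<Rightarrow> 'i set \<Rightarrow> ('i \<Rightarrow> 'x \<Rightarrow> int) \<Rightarrow> bool" where
 "quotient_basis X S I b \<longleftrightarrow> finite I \<and> (\<forall>i\<in>I. b i \<in> Zf X)
  \<and> (\<forall>z\<in>Zf X. \<exists>c. z - (\<Sum>i\<in>I. c i \<star> b i) \<in> S)
  \<and> (\<forall>c. (\<Sum>i\<in>I. c i \<star> b i) \<in> S \<longrightarrow> (\<forall>i\<in>I. c i = 0))"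

text \<open>A finitely generated torsion-free abelian group is free. In a generating family of least
  size, a relation with two nonzero coefficients is shortened by a Euclidean step, so the induction
  runs on the sum \<open>ms\<close> of absolute values. A relation with a single nonzero coefficient
  puts a generator into \<open>S\<close> by saturation, and the family was not minimal.\<close>

lemma saturated_quotient_free:
 assumes fin: "finite (X :: 'x set)" and S: "sgrp S" "S \<subseteq> Zf X"
  and st: "\<forall>k>0. \<forall>u\<in>Zf X. k \<star> u \<in> S \<longrightarrow> u \<in> S"
 shows "\<exists>(I :: 'x set) b. quotient_basis X S I b"
proof -
 define gen where "gen = (\<lambda>(I::'x set) b. finite I \<and> (\<forall>i\<in>I. b i \<in> Zf X) \<and> (\<forall>z\<in>Zf X. \<exists>c. z - (\<Sum>i\<in>I. c i \<star> b i) \<in> S))"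
 have "z - (\<Sum>i\<in>X. z i \<star> unit_fun i) = 0" if "z \<in> Zf X" for z
  using that fin by (auto simp: fun_eq_iff sum_fun_apply unit_fun_def Zf_def if_distrib[of "\<lambda>z. _ * z"] cong: if_cong)
 then have gen0: "gen X unit_fun" unfolding gen_def using fin unit_fun_Zf sgrp_0[OF S(1)] by metis
 define Q where "Q = (\<lambda>r. \<exists>I b. gen I b \<and> card I = r)"
 define r where "r = (LEAST r. Q r)"
 have Qr: "Q r" unfolding r_def by (rule LeastI[of Q "card X"]) (use gen0 Q_def in blast)
 have rmin: "r \<le> card I" if "gen I b" for I b
  unfolding r_def by (rule Least_le) (use that Q_def in blast)
 define ms where "ms = (\<lambda>(I::'x set) (c::'x \<Rightarrow> int). nat (\<Sum>i\<in>I. \<bar>c i\<bar>))"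
 define T where "T = (\<lambda>m. \<exists>I b c. gen I b \<and> card I = r \<and> (\<Sum>i\<in>I. c i \<star> b i) \<in> S \<and> (\<exists>i\<in>I. c i \<noteq> 0) \<and> ms I c = m)"
 have noT: "\<not> T m" for m
 proof (induction m rule: less_induct)
  case (less m)
  show ?case
  proof
   assume "T m"
   then obtain I b c where g: "gen I b" "card I = r" and c: "(\<Sum>i\<in>I. c i \<star> b i) \<in> S" "\<exists>i\<in>I. c i \<noteq> 0" "ms I c = m"
    unfolding T_def by blast
   have fI: "finite I" using g by (simp add: gen_def)
   show False
   proof (cases "\<exists>i\<in>I. \<exists>j\<in>I. i \<noteq> j \<and> c i \<noteq> 0 \<and> c j \<noteq> 0")
    case True
    then obtain i j where ij: "i \<in> I" "j \<in> I" "i \<noteq> j" "c i \<noteq> 0" "c j \<noteq> 0" "\<bar>c i\<bar> \<le> \<bar>c j\<bar>"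
     by (metis linear)
    \<comment> \<open>With this sign, removing the smaller coefficient once from the larger one
      lowers its absolute value.\<close>
    define s where "s = sgn (c i) * sgn (c j)"
    have small: "\<bar>c j - s * c i\<bar> < \<bar>c j\<bar>" using ij by (auto simp: s_def sgn_if split: if_splits)
    define c' where "c' = c(j := c j - s * c i)"
    define b' where "b' = b(i := b i + s \<star> b j)"
    have "gen I b'" unfolding gen_def
    proof (intro conjI ballI)
     show "b' k \<in> Zf X" if "k \<in> I" for k
      using that g(1) ij sgrp_add[OF sgrp_Zf] Zf_zmult unfolding b'_def gen_def by (metis fun_upd_apply)
     fix z assume "z \<in> Zf X"
     then obtain d where "z - (\<Sum>i\<in>I. d i \<star> b i) \<in> S" using g unfolding gen_def by blast
     then show "\<exists>d. z - (\<Sum>i\<in>I. d i \<star> b' i) \<in> S" unfolding b'_def using sum_exchange[OF fI ij(1-3)] by metis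
    qed (rule fI)
    moreover have "(\<Sum>i\<in>I. c' i \<star> b' i) \<in> S" unfolding c'_def b'_def sum_exchange[OF fI ij(1-3)] by (rule c)
    moreover have "c' i \<noteq> 0" using ij by (simp add: c'_def)
    moreover have "ms I c' < m"
    proof -
     have "(\<Sum>i\<in>I. \<bar>c' i\<bar>) < (\<Sum>i\<in>I. \<bar>c i\<bar>)"
      by (rule sum_strict_mono_ex1[OF fI]) (use small ij in \<open>auto simp: c'_def\<close>)
     moreover have "(\<Sum>i\<in>I. \<bar>c' i\<bar>) \<ge> 0" by (simp add: sum_nonneg)
     ultimately show ?thesis using c(3) unfolding ms_def by linarith
    qed
    ultimately show False using less g(2) ij(1) unfolding T_def by blast
   next
    case False
    obtain i where i: "i \<in> I" "c i \<noteq> 0" using c by blast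
    then have others: "c k = 0" if "k \<in> I - {i}" for k using False that by blast
    have "(\<Sum>i\<in>I. c i \<star> b i) = c i \<star> b i"
     using others by (simp add: sum.remove[OF fI i(1)])
    then have "c i \<star> b i \<in> S" using c(1) by simp
    then have "\<bar>c i\<bar> \<star> b i \<in> S" using sgrp_minus[OF S(1)] by (cases "c i > 0") (auto simp: zmult_distrib)
    then have biS: "b i \<in> S" using st i g(1) unfolding gen_def by (metis zero_less_abs_iff)
    have "gen (I - {i}) b" unfolding gen_def
    proof (intro conjI ballI)
     fix z assume "z \<in> Zf X"
     then obtain d where d: "z - (\<Sum>k\<in>I. d k \<star> b k) \<in> S" using g unfolding gen_def by blast
     have "z - (\<Sum>k\<in>I - {i}. d k \<star> b k) = (z - (\<Sum>k\<in>I. d k \<star> b k)) + d i \<star> b i"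
      by (simp add: sum.remove[OF fI i(1)])
     then have "z - (\<Sum>k\<in>I - {i}. d k \<star> b k) \<in> S" using sgrp_add[OF S(1) d sgrp_zmult[OF S(1) biS]] by metis
     then show "\<exists>d. z - (\<Sum>k\<in>I - {i}. d k \<star> b k) \<in> S" by blast
    qed (use g fI in \<open>auto simp: gen_def\<close>)
    then have "r \<le> card (I - {i})" by (rule rmin)
    moreover have "card (I - {i}) < card I" by (rule card_Diff1_less[OF fI i(1)])
    ultimately show False using g(2) by simp
   qed
  qed
 qed
 obtain I b where Ib: "gen I b" "card I = r" using Qr unfolding Q_def by blast
 have "\<forall>c. (\<Sum>i\<in>I. c i \<star> b i) \<in> S \<longrightarrow> (\<forall>i\<in>I. c i = 0)"
  using noT Ib unfolding T_def by blast
 then have "quotient_basis X S I b" using Ib(1) unfolding quotient_basis_def gen_def by blast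
 then show ?thesis by blast
qed

text \<open>The coordinates with respect to a basis of the quotient by \<open>S\<close> are inner
  products with vectors \<open>y i\<close> orthogonal to \<open>S\<close>. The hypothesis thus makes
  every coordinate of \<open>z\<close> divisible by \<open>k\<close>, and \<open>w\<close> is the
  vector of quotients.\<close>

lemma saturated_dvd:
 assumes fin: "finite (X :: 'x set)" and S: "sgrp S" "S \<subseteq> Zf X"
  and st: "\<forall>k>0. \<forall>u\<in>Zf X. k \<star> u \<in> S \<longrightarrow> u \<in> S"
  and z: "z \<in> Zf X" "\<And>y. y \<in> perp X S \<Longrightarrow> k dvd ip X y z"
 obtains w where "w \<in> Zf X" "z - k \<star> w \<in> S"
proof -
 have ex: "\<exists>(I::'x set) b. quotient_basis X S I b" by (rule saturated_quotient_free[OF fin S st])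
 from ex obtain I :: "'x set" and b where "quotient_basis X S I b" by (elim exE) (rule that)
 note qb = this[unfolded quotient_basis_def]
 have I1: "finite I" by (rule qb[THEN conjunct1])
 have I2: "\<forall>i\<in>I. b i \<in> Zf X" by (rule qb[THEN conjunct2, THEN conjunct1])
 have I3: "\<forall>z\<in>Zf X. \<exists>c. z - (\<Sum>i\<in>I. c i \<star> b i) \<in> S" by (rule qb[THEN conjunct2, THEN conjunct2, THEN conjunct1])
 have I4: "\<forall>c. (\<Sum>i\<in>I. c i \<star> b i) \<in> S \<longrightarrow> (\<forall>i\<in>I. c i = 0)" by (rule qb[THEN conjunct2, THEN conjunct2, THEN conjunct2])
 define c where "c = (\<lambda>x. SOME c. unit_fun x - (\<Sum>i\<in>I. c i \<star> b i) \<in> S)"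
 have c: "unit_fun x - (\<Sum>i\<in>I. c x i \<star> b i) \<in> S" if "x \<in> X" for x
  unfolding c_def
  by (rule someI_ex[where P = "\<lambda>c. unit_fun x - (\<Sum>i\<in>I. c i \<star> b i) \<in> S"]) (rule bspec[OF I3 unit_fun_Zf[OF that]])
 define y where "y = (\<lambda>i x. if x \<in> X then c x i else 0)"
 have yZ: "y i \<in> Zf X" for i by (simp add: y_def Zf_def)
 have key: "u - (\<Sum>i\<in>I. ip X (y i) u \<star> b i) \<in> S" if u: "u \<in> Zf X" for u
 proof -
  have "(\<Sum>x\<in>X. u x \<star> (unit_fun x - (\<Sum>i\<in>I. c x i \<star> b i))) \<in> S"
   by (intro sgrp_sum[OF S(1)] sgrp_zmult[OF S(1)] c)
  moreover have "(\<Sum>x\<in>X. u x \<star> (unit_fun x - (\<Sum>i\<in>I. c x i \<star> b i))) = u - (\<Sum>i\<in>I. ip X (y i) u \<star> b i)"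
  proof
   fix a
   have 1: "(\<Sum>x\<in>X. u x * unit_fun x a) = u a"
    using u fin by (auto simp: unit_fun_def Zf_def if_distrib[of "\<lambda>z. _ * z"] cong: if_cong)
   have "(\<Sum>x\<in>X. u x * (\<Sum>i\<in>I. c x i * b i a)) = (\<Sum>x\<in>X. \<Sum>i\<in>I. c x i * u x * b i a)"
    by (simp add: sum_distrib_left algebra_simps)
   also have "\<dots> = (\<Sum>i\<in>I. \<Sum>x\<in>X. c x i * u x * b i a)" by (rule sum.swap)
   also have "\<dots> = (\<Sum>i\<in>I. ip X (y i) u * b i a)"
    by (rule sum.cong) (auto simp: ip_def y_def sum_distrib_right)
   finally show "(\<Sum>x\<in>X. u x \<star> (unit_fun x - (\<Sum>i\<in>I. c x i \<star> b i))) a = (u - (\<Sum>i\<in>I. ip X (y i) u \<star> b i)) a"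
    using 1 by (simp add: sum_fun_apply right_diff_distrib sum_subtractf)
  qed
  ultimately show ?thesis by simp
 qed
 have yp: "y i \<in> perp X S" if i: "i \<in> I" for i
 proof -
  have "ip X (y i) s = 0" if s: "s \<in> S" for s
  proof -
   have "(\<Sum>i\<in>I. ip X (y i) s \<star> b i) \<in> S" using sgrp_diff[OF S(1) s key[of s]] s S(2) by auto
   then show ?thesis using I4[THEN spec, of "\<lambda>i. ip X (y i) s"] i by simp
  qed
  then show ?thesis using yZ by (simp add: perp_def)
 qed
 define m where "m = (\<lambda>i. ip X (y i) z div k)"
 have m: "ip X (y i) z = k * m i" if "i \<in> I" for i using z(2)[OF yp[OF that]] by (simp add: m_def)
 show ?thesis
 proof (rule that[of "\<Sum>i\<in>I. m i \<star> b i"])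
  show "(\<Sum>i\<in>I. m i \<star> b i) \<in> Zf X" using I2 by (intro sgrp_sum[OF sgrp_Zf] Zf_zmult) auto
  have "k \<star> (\<Sum>i\<in>I. m i \<star> b i) = (\<Sum>i\<in>I. ip X (y i) z \<star> b i)"
   unfolding zmult_sum by (rule sum.cong) (auto simp: m)
  then show "z - k \<star> (\<Sum>i\<in>I. m i \<star> b i) \<in> S" using key[OF z(1)] by simp
 qed
qed

definition cyc :: "('x \<Rightarrow> int) \<Rightarrow> ('x \<Rightarrow> int) set" where
 "cyc j = range (\<lambda>k. k \<star> j)"

lemma sgrp_cyc: "sgrp (cyc j)"
proof (rule sgrpI)
 show "0 \<in> cyc j" unfolding cyc_def by (metis rangeI zmult_simps(1))
 fix x y assume "x \<in> cyc j" "y \<in> cyc j"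
 then show "x - y \<in> cyc j" unfolding cyc_def by (auto simp flip: zmult_distrib)
qed

lemma cyc_subset: "sgrp H \<Longrightarrow> j \<in> H \<Longrightarrow> cyc j \<subseteq> H"
 by (auto simp: cyc_def sgrp_zmult)

lemma cyc_self: "j \<in> cyc j"
 unfolding cyc_def by (metis rangeI zmult_simps(2))

lemma int_subgroup_principal:
 assumes "sgrp (A :: int set)" "a \<in> A" "a \<noteq> 0"
 obtains c where "c > 0" "c \<in> A" "\<And>x. x \<in> A \<Longrightarrow> c dvd x"
proof -
 have mul: "k * x \<in> A" if x: "x \<in> A" for k x :: int
 proof -
  have nat: "int n * x \<in> A" for n
  proof (induction n)
   case (Suc n)
   then show ?case using sgrp_add[OF assms(1) x Suc] by (simp add: algebra_simps)
  qed (use sgrp_0[OF assms(1)] in simp)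
  show ?thesis using nat[of "nat k"] sgrp_minus[OF assms(1) nat[of "nat (-k)"]] by (cases "k \<ge> 0") auto
 qed
 define n where "n = (LEAST n. n > 0 \<and> int n \<in> A)"
 have "nat \<bar>a\<bar> > 0 \<and> int (nat \<bar>a\<bar>) \<in> A" using assms mul[of a "-1"] by (auto simp: abs_if)
 then have n: "n > 0" "int n \<in> A" using LeastI[of "\<lambda>n. n > 0 \<and> int n \<in> A"] unfolding n_def by blast+
 have "int n dvd x" if x: "x \<in> A" for x
 proof -
  have "x - (x div int n) * int n \<in> A" by (intro sgrp_diff[OF assms(1)] x mul n)
  then have "x mod int n \<in> A" by (simp add: minus_div_mult_eq_mod)
  then have "nat (x mod int n) = 0"
   using not_less_Least[of "nat (x mod int n)" "\<lambda>n. n > 0 \<and> int n \<in> A"] n(1) unfolding n_def[symmetric]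
   by (auto simp: nat_less_iff)
  then show ?thesis using n(1) using pos_mod_sign[of "int n" x] unfolding dvd_eq_mod_eq_0 by linarith
 qed
 then show ?thesis using that[of "int n"] n by simp
qed

subsection \<open>The index of \<open>J + J\<^sup>\<bottom>\<close>\<close>

lemma has_idx_pos: "has_idx H K n \<Longrightarrow> h \<in> H \<Longrightarrow> n > 0"
 unfolding has_idx_def by (metis card_gt_0_iff empty_iff)

lemma has_idx_cyclic:
 assumes H: "sgrp H" and j: "m > 0" "int m \<star> j \<in> H" "\<And>k. k \<star> j \<in> H \<Longrightarrow> int m dvd k"
 shows "has_idx (H [+] cyc j) H m"
 unfolding has_idx_def
proof (intro exI[of _ "(\<lambda>i. int i \<star> j) ` {..<m}"] conjI ballI impI)
 let ?R = "(\<lambda>i. int i \<star> j) ` {..<m}"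
 show "?R \<subseteq> H [+] cyc j" using setsum2_right[OF H, of "cyc j"] by (auto simp: cyc_def)
 have key: "a = b" if "a < m" "b < m" "int a \<star> j - int b \<star> j \<in> H" for a b
 proof -
  have "int m dvd int a - int b" using that j(3)[of "int a - int b"] by (simp add: zmult_distrib)
  then have "int a mod int m = int b mod int m" by (simp add: mod_eq_dvd_iff)
  then show ?thesis using that by simp
 qed
 then have "inj_on (\<lambda>i. int i \<star> j) {..<m}" using sgrp_0[OF H] by (auto simp: inj_on_def)
 then show "finite ?R" "card ?R = m" by (auto simp: card_image)
 fix h assume "h \<in> H [+] cyc j"
 then obtain u k where u: "h = u + k \<star> j" "u \<in> H" by (auto simp: setsum2_def cyc_def)
 have "h - (k mod int m) \<star> j = u + (k div int m) \<star> int m \<star> j"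
 proof -
  have "k \<star> j = (k mod int m + (k div int m) * int m) \<star> j" by simp
  then show ?thesis unfolding u(1) by (simp only: zmult_distrib zmult_simps) simp
 qed
 also have "\<dots> \<in> H" by (intro sgrp_add[OF H] u sgrp_zmult[OF H] j)
 finally have "h - (k mod int m) \<star> j \<in> H" .
 moreover have "(k mod int m) \<star> j \<in> ?R"
  using j(1) by (intro image_eqI[of _ _ "nat (k mod int m)"]) (auto simp: nat_less_iff)
 ultimately show "\<exists>r\<in>?R. h - r \<in> H" by blast
next
 fix r r' assume "r \<in> (\<lambda>i. int i \<star> j) ` {..<m}" "r' \<in> (\<lambda>i. int i \<star> j) ` {..<m}" "r - r' \<in> H"
 then obtain a b where ab: "a < m" "b < m" "r = int a \<star> j" "r' = int b \<star> j" "int a \<star> j - int b \<star> j \<in> H" by auto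
 then have "int m dvd int a - int b" using j(3)[of "int a - int b"] by (simp add: zmult_distrib)
 then have "int a mod int m = int b mod int m" by (simp add: mod_eq_dvd_iff)
 then show "r = r'" using ab by simp
qed

lemma perp_add_cyc:
 assumes "sgrp J" shows "perp X (J [+] cyc j) = {d \<in> perp X J. ip X d j = 0}"
proof
 have "J \<subseteq> J [+] cyc j" "j \<in> J [+] cyc j"
  using setsum2_left[OF sgrp_cyc] setsum2_right[OF assms, of "cyc j"] cyc_self[of j] by auto
 then show "perp X (J [+] cyc j) \<subseteq> {d \<in> perp X J. ip X d j = 0}" unfolding perp_def by blast
 have "ip X d (l + k \<star> j) = 0" if "d \<in> perp X J" "ip X d j = 0" "l \<in> J" for d l k
  using that by (simp add: ip_simps perp_def)
 then have "ip X d h = 0" if "d \<in> perp X J" "ip X d j = 0" "h \<in> J [+] cyc j" for d h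
  using that unfolding setsum2_def cyc_def by blast
 then show "{d \<in> perp X J. ip X d j = 0} \<subseteq> perp X (J [+] cyc j)"
  unfolding perp_def[of X "J [+] cyc j"] using perp_Zf by blast
qed

text \<open>The vector \<open>w\<close> divided by \<open>K\<close> is the component of
  \<open>j\<close> orthogonal to \<open>J\<close>, and \<open>ip X w j\<close> divided by
  \<open>K\<close> is its squared length: base times height for squared covolumes. Let \<kappa> be
  the order of \<open>j\<close> modulo \<open>J [+] D\<close>, \<open>x\<close> the
  \<open>D\<close>-component of \<open>\<kappa> \<star> j\<close>, \<open>c\<close> the positive
  generator of the values of \<open>ip X d j\<close> on \<open>D\<close>, and
  \<open>ip X x j = c * m\<close>. With \<open>a\<close> the index of
  \<open>J [+] D [+] cyc j\<close>, one finds \<open>\<iota> = a * \<kappa>\<close>,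
  \<open>\<iota>' = a * m\<close> and \<open>c * t \<le> t'\<close>.\<close>

lemma index_add_vector:
 assumes fin: "finite X" and J: "sgrp J" "J \<subseteq> Zf X" and jX: "j \<in> Zf X"
  and w: "w \<in> perp X J" "\<And>d. d \<in> perp X J \<Longrightarrow> ip X (K \<star> j - w) d = 0" "ip X w j > 0" "K > 0"
  and i1: "has_idx (Zf X) (J [+] perp X J) \<iota>" and t1: "has_idx (sat X J) J t"
  and i2: "has_idx (Zf X) ((J [+] cyc j) [+] perp X (J [+] cyc j)) \<iota>'"
  and t2: "has_idx (sat X (J [+] cyc j)) (J [+] cyc j) t'"
 shows "int (\<iota> * t) * ip X w j \<le> int (\<iota>' * t') * K"
proof -
 define D where "D = perp X J"
 define D' where "D' = perp X (J [+] cyc j)"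
 have D: "sgrp D" "D \<subseteq> Zf X" unfolding D_def by (rule sgrp_perp perp_Zf)+
 have D': "sgrp D'" "D' = {d \<in> D. ip X d j = 0}" unfolding D'_def D_def
  by (rule sgrp_perp, rule perp_add_cyc[OF J(1)])
 have JD: "ip X l d = 0" "ip X d l = 0" if "l \<in> J" "d \<in> D" for l d
  using that ip_commute[of X l d] by (auto simp: D_def perp_def)
 have JD0: "l = 0" if "l \<in> J" "l \<in> D" for l
  using ip_self_eq_0[OF fin, of l] JD[OF that] that J by auto
 have sJD: "sgrp (J [+] D)" by (intro sgrp_setsum2 J D)
 define A where "A = {k. k \<star> j \<in> J [+] D}"
 have "has_idx (Zf X) (J [+] D) \<iota>" using i1 by (simp add: D_def)
 then have "covers \<iota> (cyc j) (J [+] D)"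
  using has_idx_covers covers_mono cyc_subset[OF sgrp_Zf jX] by blast
 have sA: "sgrp A"
  by (rule sgrpI) (use sJD in \<open>auto simp: A_def zmult_distrib sgrp_0 sgrp_diff\<close>)
 have exA: "\<exists>a\<in>A. a \<noteq> 0"
 proof (rule ccontr)
  assume c: "\<not> ?thesis"
  have key: "a = b" if "int a \<star> j - int b \<star> j \<in> J [+] D" for a b
   using that c unfolding A_def by (metis (mono_tags, lifting) zmult_distrib(4) mem_Collect_eq eq_iff_diff_eq_0 of_nat_eq_iff)
  have "inj (\<lambda>i. int i \<star> j)" by (rule injI, rule key) (use sgrp_0[OF sJD] in simp)
  moreover have "finite (range (\<lambda>i. int i \<star> j)) \<and> card (range (\<lambda>i. int i \<star> j)) \<le> \<iota>"
   by (rule covers_card_le[OF sJD \<open>covers \<iota> (cyc j) (J [+] D)\<close>]) (auto simp: cyc_def dest: key)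
  ultimately show False using finite_imageD infinite_UNIV_nat by blast
 qed
 then obtain \<kappa>i where \<kappa>i: "\<kappa>i > 0" "\<kappa>i \<in> A" "\<And>x. x \<in> A \<Longrightarrow> \<kappa>i dvd x" using int_subgroup_principal[OF sA] by metis
 define \<kappa> where "\<kappa> = nat \<kappa>i"
 have \<kappa>: "\<kappa> > 0" "int \<kappa> \<star> j \<in> J [+] D" "\<And>k. k \<star> j \<in> J [+] D \<Longrightarrow> int \<kappa> dvd k"
  using \<kappa>i by (auto simp: \<kappa>_def A_def)
 have idx\<kappa>: "has_idx ((J [+] D) [+] cyc j) (J [+] D) \<kappa>" by (rule has_idx_cyclic[OF sJD \<kappa>])
 have sM: "sgrp ((J [+] D) [+] cyc j)" by (intro sgrp_setsum2 sJD sgrp_cyc)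
 have MZ: "(J [+] D) [+] cyc j \<subseteq> Zf X"
  by (intro setsum2_subset[OF sgrp_Zf] J D cyc_subset[OF sgrp_Zf jX])
 obtain a where a: "has_idx (Zf X) ((J [+] D) [+] cyc j) a" "\<iota> = a * \<kappa>"
 proof (rule has_idx_split[OF sgrp_Zf sM MZ sJD setsum2_left[OF sgrp_cyc]])
  show "has_idx (Zf X) (J [+] D) \<iota>" by fact
  fix p q assume "has_idx (Zf X) (J [+] D [+] cyc j) p" "has_idx (J [+] D [+] cyc j) (J [+] D) q" "\<iota> = p * q"
  then show thesis using that has_idx_unique[OF sJD idx\<kappa>] by blast
 qed
 obtain j0 x where x: "int \<kappa> \<star> j = j0 + x" "j0 \<in> J" "x \<in> D" using \<kappa>(2) by (rule setsum2_E)
 have Kx: "K \<star> x = int \<kappa> \<star> w"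
 proof -
  have "K \<star> x - int \<kappa> \<star> w = int \<kappa> \<star> (K \<star> j - w) - K \<star> j0"
   using arg_cong[OF x(1), of "\<lambda>v. K \<star> v"] by (auto simp: fun_eq_iff algebra_simps)
  then have "ip X (K \<star> x - int \<kappa> \<star> w) d = 0" if "d \<in> D" for d
   using w(2)[of d] JD(1)[OF x(2) that] that unfolding D_def by (simp add: ip_simps)
  moreover have KD: "K \<star> x - int \<kappa> \<star> w \<in> D" using x w(1) D unfolding D_def by (intro sgrp_diff sgrp_zmult) auto
  ultimately have "K \<star> x - int \<kappa> \<star> w = 0" using ip_self_eq_0[OF fin] D(2) by blast
  then show ?thesis by simp
 qed
 have Kxj: "K * ip X x j = int \<kappa> * ip X w j" using arg_cong[OF Kx, of "\<lambda>v. ip X v j"] by (simp add: ip_simps)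
 have xj: "ip X x j > 0"
 proof -
  have "K * ip X x j > 0" unfolding Kxj using \<kappa>(1) w(3) by simp
  then show ?thesis using w(4) by (simp add: zero_less_mult_iff)
 qed
 have sB: "sgrp ((\<lambda>d. ip X d j) ` D)"
 proof (rule sgrpI)
  show "0 \<in> (\<lambda>d. ip X d j) ` D" using sgrp_0[OF D(1)] by (force simp: ip_simps)
  fix p q assume "p \<in> (\<lambda>d. ip X d j) ` D" "q \<in> (\<lambda>d. ip X d j) ` D"
  then obtain d e where "p = ip X d j" "q = ip X e j" "d \<in> D" "e \<in> D" by auto
  then show "p - q \<in> (\<lambda>d. ip X d j) ` D" using sgrp_diff[OF D(1), of d e] by (intro image_eqI[of _ _ "d - e"]) (auto simp: ip_simps)
 qed
 obtain c where c: "c > 0" "c \<in> (\<lambda>d. ip X d j) ` D" "\<And>p. p \<in> (\<lambda>d. ip X d j) ` D \<Longrightarrow> c dvd p"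
  by (rule int_subgroup_principal[OF sB, of "ip X x j"]) (use xj x in auto)
 obtain d0 where d0: "d0 \<in> D" "ip X d0 j = c" using c(2) by auto
 obtain m where m: "ip X x j = c * int m" "m > 0"
 proof -
  have "c dvd ip X x j" by (rule c(3)) (use x in auto)
  then obtain q where q: "ip X x j = c * q" by (auto simp: dvd_def)
  then have "q > 0" using xj c(1) by (simp add: zero_less_mult_iff)
  then show ?thesis using that[of "nat q"] q by simp
 qed
 let ?J' = "J [+] cyc j"
 let ?N = "?J' [+] D'"
 have sJ': "sgrp ?J'" by (intro sgrp_setsum2 J sgrp_cyc)
 have sN: "sgrp ?N" by (intro sgrp_setsum2 sJ' D')
 \<comment> \<open>The difference of \<open>m \<star> d0\<close> and \<open>x\<close> is orthogonal
   to \<open>j\<close>, which puts \<open>m \<star> d0\<close> into \<open>?N\<close>. Conversely,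
   if \<open>k \<star> d0\<close> lies in \<open>?N\<close>, the coefficient of \<open>j\<close> is
   a multiple \<open>s * \<kappa>\<close>, and pairing with \<open>j\<close> gives
   \<open>k = s * m\<close>.\<close>
 have idxm: "has_idx (?N [+] cyc d0) ?N m"
 proof (rule has_idx_cyclic[OF sN m(2)])
  have xJ': "x \<in> ?J'"
  proof -
   have "x = (- j0) + int \<kappa> \<star> j" using x(1) by simp
   then show ?thesis using setsum2_I[OF sgrp_minus[OF J(1) x(2)], of "int \<kappa> \<star> j" "cyc j"] by (simp add: cyc_def)
  qed
  have "int m \<star> d0 - x \<in> D'" unfolding D' using d0 x D m
   by (auto simp: ip_simps intro!: sgrp_diff sgrp_zmult)
  from setsum2_I[OF xJ' this] show "int m \<star> d0 \<in> ?N" by simp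
  fix k assume "k \<star> d0 \<in> ?N"
  then obtain l n d' where e: "k \<star> d0 = l + n \<star> j + d'" "l \<in> J" "d' \<in> D'" by (auto simp: setsum2_def cyc_def)
  have "n \<star> j = (- l) + (k \<star> d0 - d')" using e(1) by simp
  also have "\<dots> \<in> J [+] D" using e d0 D' by (intro setsum2_I sgrp_minus[OF J(1)] sgrp_diff[OF D(1)] sgrp_zmult[OF D(1)]) auto
  finally have "int \<kappa> dvd n" by (rule \<kappa>(3))
  then obtain s where s: "n = int \<kappa> * s" by (auto simp: dvd_def)
  have nj: "n \<star> j = s \<star> j0 + s \<star> x" unfolding s zmult_distrib(1)[symmetric] x(1)[symmetric] by (simp add: mult.commute)
  have "l + s \<star> j0 = k \<star> d0 - d' - s \<star> x" unfolding e(1) nj by simp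
  moreover have "d' \<in> D" using e(3) D'(2) by simp
  then have "k \<star> d0 - d' - s \<star> x \<in> D" by (intro sgrp_diff[OF D(1)] sgrp_zmult[OF D(1)] d0 x)
  moreover have "l + s \<star> j0 \<in> J" by (intro sgrp_add sgrp_zmult J e x)
  ultimately have "k \<star> d0 - d' - s \<star> x = 0" using JD0 by metis
  then have "ip X (k \<star> d0 - d' - s \<star> x) j = 0" by (simp add: ip_simps)
  moreover have "ip X d' j = 0" using e(3) D'(2) by simp
  ultimately have "k * c = s * (c * int m)" using d0(2) m(1) by (simp add: ip_simps)
  then have "k = s * int m" using c(1) by simp
  then show "int m dvd k" by simp
 qed
 have N_eq: "?N [+] cyc d0 = (J [+] D) [+] cyc j"
 proof
  show "?N [+] cyc d0 \<subseteq> (J [+] D) [+] cyc j"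
   by (intro setsum2_subset[OF sM])
     (use setsum2_left[OF sgrp_cyc, of "J [+] D" j] setsum2_right[OF sJD, of "cyc j"]
      setsum2_left[OF D(1), of J] setsum2_right[OF J(1), of D] D' cyc_subset[OF D(1) d0(1)] in blast)+
  show "(J [+] D) [+] cyc j \<subseteq> ?N [+] cyc d0"
  proof -
   have s: "sgrp (?N [+] cyc d0)" by (intro sgrp_setsum2 sN sgrp_cyc)
   have J'N: "?J' \<subseteq> ?N [+] cyc d0" "D' \<subseteq> ?N [+] cyc d0"
    using setsum2_left[OF sgrp_cyc, of ?N d0] setsum2_left[OF D'(1), of ?J'] setsum2_right[OF sJ', of D'] by blast+
   have "D \<subseteq> ?N [+] cyc d0"
   proof
    fix d assume d: "d \<in> D"
    have "c dvd ip X d j" by (rule c(3)) (use d in auto)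
    then obtain q where q: "ip X d j = c * q" by (auto simp: dvd_def)
    have "d - q \<star> d0 \<in> D'" unfolding D' using d d0 q D by (auto simp: ip_simps intro!: sgrp_diff sgrp_zmult)
    then have "d - q \<star> d0 \<in> ?N" using setsum2_right[OF sJ', of D'] by blast
    from setsum2_I[OF this, of "q \<star> d0" "cyc d0"] show "d \<in> ?N [+] cyc d0" by (simp add: cyc_def)
   qed
   then show ?thesis
    using J'N setsum2_left[OF sgrp_cyc, of J j] setsum2_right[OF J(1), of "cyc j"]
    by (intro setsum2_subset[OF s]) blast+
  qed
 qed
 have \<iota>': "\<iota>' = a * m"
 proof (rule has_idx_unique[OF sN])
  show "has_idx (Zf X) ?N \<iota>'" using i2 by (simp add: D'_def)
  show "has_idx (Zf X) ?N (a * m)"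
   using has_idx_mult[OF sgrp_Zf _ _ sN _ a(1)[folded N_eq] idxm] sM MZ setsum2_left[OF sgrp_cyc, of ?N d0] N_eq by metis
 qed
 \<comment> \<open>Modulo \<open>sat X J\<close> the vector \<open>u\<close> is \<open>j\<close>
   divided by \<open>c\<close>. It pairs to 1 with \<open>d0\<close>, while \<open>sat X J\<close>
   pairs to 0 and \<open>j\<close> to \<open>c\<close>. So the multiples of \<open>u\<close> below
   \<open>c\<close>, shifted by representatives of \<open>sat X J\<close> modulo \<open>J\<close>,
   are pairwise incongruent modulo \<open>J [+] cyc j\<close>.\<close>
 have ct: "nat c * t \<le> t'"
 proof -
  have sS: "sgrp (sat X J)" by (rule sgrp_sat[OF J(1)])
  obtain u where u: "u \<in> Zf X" "j - c \<star> u \<in> sat X J"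
  proof (rule saturated_dvd[OF fin sS sat_Zf _ jX])
   show "\<forall>k>0. \<forall>u\<in>Zf X. k \<star> u \<in> sat X J \<longrightarrow> u \<in> sat X J" by (blast intro: sat_saturated)
   show "c dvd ip X y j" if "y \<in> perp X (sat X J)" for y
    using that c(3) unfolding perp_sat[OF J(2)] D_def by blast
  qed blast
  have Sd: "ip X s d0 = 0" if "s \<in> sat X J" for s
   using that d0(1) ip_commute[of X s d0] unfolding D_def perp_sat[OF J(2), symmetric] by (auto simp: perp_def)
  have ud0: "ip X u d0 = 1"
  proof -
   have "c = c * ip X u d0" using Sd[OF u(2)] d0(2) ip_commute[of X j d0] by (simp add: ip_simps)
   then show ?thesis using c(1) by simp
  qed
  obtain R where R: "R \<subseteq> sat X J" "finite R" "card R = t" "\<And>r r'. r \<in> R \<Longrightarrow> r' \<in> R \<Longrightarrow> r - r' \<in> J \<Longrightarrow> r = r'"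
   using t1 unfolding has_idx_def by auto
  have uS: "u \<in> sat X ?J'"
  proof -
   have "j \<in> ?J'" using setsum2_right[OF J(1), of "cyc j"] cyc_self by blast
   then have "j \<in> sat X ?J'" using jX by (auto simp: sat_def intro: exI[of _ 1])
   moreover have "j - c \<star> u \<in> sat X ?J'" using u sat_mono[OF setsum2_left[OF sgrp_cyc, of J j]] by blast
   ultimately have "j - (j - c \<star> u) \<in> sat X ?J'" by (rule sgrp_diff[OF sgrp_sat[OF sJ']])
   then show ?thesis using sat_saturated[OF c(1) u(1)] by simp
  qed
  let ?f = "\<lambda>(i, r). int i \<star> u + r"
  let ?Y = "?f ` ({..<nat c} \<times> R)"
  have key: "i = i' \<and> r = r'" if h: "i < nat c" "i' < nat c" "r \<in> R" "r' \<in> R"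
   "(int i \<star> u + r) - (int i' \<star> u + r') \<in> ?J'" for i i' r r'
  proof -
   obtain l n where ln: "(int i \<star> u + r) - (int i' \<star> u + r') = l + n \<star> j" "l \<in> J"
    using h(5) by (auto simp: setsum2_def cyc_def)
   have "ip X l d0 = 0" "ip X r d0 = 0" "ip X r' d0 = 0" using Sd ln sat_superset[OF J(2)] R h by auto
   then have "int i - int i' = n * c"
    using arg_cong[OF ln(1), of "\<lambda>v. ip X v d0"] ud0 d0(2) ip_commute[of X j d0] by (simp add: ip_simps)
   then have "int i mod c = int i' mod c" by (metis dvd_triv_right mod_eq_dvd_iff)
   then have ii: "i = i'" using h(1,2) by simp
   then have "n = 0" using \<open>int i - int i' = n * c\<close> c(1) by simp
   then have "r - r' \<in> J" using ln ii by simp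
   then show ?thesis using R(4) h ii by blast
  qed
  have inj: "inj_on ?f ({..<nat c} \<times> R)"
   by (rule inj_onI) (use key sgrp_0[OF sJ'] in force)
  have "card ?Y \<le> t'"
  proof (rule has_idx_incong[OF sJ' t2])
   show "?Y \<subseteq> sat X ?J'"
    using uS R(1) sat_mono[OF setsum2_left[OF sgrp_cyc, of J j]]
    by (auto intro!: sgrp_add[OF sgrp_sat[OF sJ']] sgrp_zmult[OF sgrp_sat[OF sJ']])
  qed (auto dest: key)
  then show ?thesis using inj R by (simp add: card_image card_cartesian_product)
 qed
 have "int (\<iota> * t) * ip X w j = int (a * t) * (K * ip X x j)" unfolding a(2) Kxj by simp
 also have "\<dots> = int (a * m) * (c * int t) * K" unfolding m(1) by (simp add: algebra_simps)
 also have "\<dots> \<le> int (a * m) * int t' * K"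
 proof -
  have "c * int t \<le> int t'" using ct c(1) by (metis (no_types) int_nat_eq less_imp_le of_nat_le_iff of_nat_mult)
  then show ?thesis using w(4) by (intro mult_right_mono mult_left_mono) auto
 qed
 finally show ?thesis unfolding \<iota>' by simp
qed

lemma Zf_mono: "A \<subseteq> B \<Longrightarrow> Zf A \<subseteq> Zf B"
 by (auto simp: Zf_def)

lemma Zf_insert: "Zf (insert a E) = cyc (unit_fun a) [+] Zf E"
proof
 show "Zf (insert a E) \<subseteq> cyc (unit_fun a) [+] Zf E"
 proof
  fix v assume v: "v \<in> Zf (insert a E)"
  have "v - v a \<star> unit_fun a \<in> Zf E" using v by (auto simp: Zf_def unit_fun_def)
  moreover have "v a \<star> unit_fun a \<in> cyc (unit_fun a)" by (auto simp: cyc_def)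
  ultimately have "v a \<star> unit_fun a + (v - v a \<star> unit_fun a) \<in> cyc (unit_fun a) [+] Zf E" by (intro setsum2_I)
  then show "v \<in> cyc (unit_fun a) [+] Zf E" by simp
 qed
 show "cyc (unit_fun a) [+] Zf E \<subseteq> Zf (insert a E)"
  by (intro setsum2_subset[OF sgrp_Zf] cyc_subset[OF sgrp_Zf] unit_fun_Zf Zf_mono) auto
qed

lemma Zf_empty: "Zf {} = {0}"
 by (auto simp: Zf_def)

text \<open>Each step adjoins a coordinate vector whose component orthogonal to \<open>J\<close> has
  squared length at least \<tau> / \<open>card X\<close>, where \<tau> is the rank of
  \<open>perp X J\<close>; averaging \<open>oproj_trace\<close> provides it. By
  \<open>index_add_vector\<close> the product \<open>\<iota> * t\<close> grows by at least this
  factor. The rank decreases with every step, which produces the factorial; at rank 0 both indices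
  equal \<kappa>, hence the square.\<close>

theorem greedy_complement:
 assumes fin: "finite X" and "sgrp J" "J \<subseteq> Zf X"
 shows "\<exists>E\<subseteq>X. card E \<le> odim X (perp X J) \<and> (\<forall>v\<in>Zf E. v \<in> sat X J \<longrightarrow> v = 0)
  \<and> (\<exists>\<kappa> \<iota> t. has_idx (Zf X) (J [+] Zf E) \<kappa> \<and> has_idx (Zf X) (J [+] perp X J) \<iota> \<and> has_idx (sat X J) J t
    \<and> \<iota> * t * fact (card E) \<le> \<kappa>\<^sup>2 * card X ^ card E)"
 using assms(2,3)
proof (induction "odim X (perp X J)" arbitrary: J rule: less_induct)
 case less
 note J = less.prems
 obtain Y where Y: "ofam X (perp X J) Y" "card Y = odim X (perp X J)"
  and PD: "\<And>v. oproj X Y v \<in> perp X J" and Pip: "\<And>v d. d \<in> perp X J \<Longrightarrow> ip X (oscale X Y \<star> v - oproj X Y v) d = 0"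
  using orthogonal_projection[OF fin sgrp_perp perp_Zf, where J1 = J] by blast
 obtain \<iota> where \<iota>: "has_idx (Zf X) (J [+] perp X J) \<iota>" using perp_sum_finite_index[OF fin J] by blast
 obtain t where t: "has_idx (sat X J) J t" using sat_finite_index[OF fin J] by blast
 show ?case
 proof (cases "odim X (perp X J) = 0")
  case True
  then have "Y = {}" using Y unfolding ofam_def by simp
  then have "ip X d d = 0" if "d \<in> perp X J" for d using Pip[OF that, of d] by (simp add: oscale_def oproj_def)
  then have p0: "perp X J = {0}" using ip_self_eq_0[OF fin] perp_Zf[of X J] sgrp_0[OF sgrp_perp, of X J] by blast
  have "sat X J = perp X {0}" using perp_perp_sat[OF fin J] p0 by simp
  also have "\<dots> = Zf X" by (auto simp: perp_def ip_simps)
  finally have sZ: "sat X J = Zf X" .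
  have J0: "J [+] {0} = J" by (auto simp: setsum2_def)
  have "\<iota> = t" using \<iota> t unfolding p0 J0 sZ by (rule has_idx_unique[OF J(1)])
  then have "has_idx (Zf X) (J [+] Zf {}) t \<and> has_idx (Zf X) (J [+] perp X J) \<iota> \<and> has_idx (sat X J) J t
    \<and> \<iota> * t * fact (card ({} :: 'a set)) \<le> t\<^sup>2 * card X ^ card ({} :: 'a set)"
   using \<iota> t unfolding Zf_empty p0 J0 sZ by (simp add: power2_eq_square)
  then show ?thesis using Zf_empty by (intro exI[of _ "{}"]) auto
 next
  case False
  define \<tau> where "\<tau> = card Y"
  define K where "K = oscale X Y"
  have K: "K > 0" unfolding K_def by (rule oscale_pos[OF Y(1)])
  have tr: "(\<Sum>a\<in>X. ip X (unit_fun a) (oproj X Y (unit_fun a))) = int \<tau> * K"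
   unfolding \<tau>_def K_def by (rule oproj_trace[OF Y(1) fin])
  have "\<exists>a\<in>X. int \<tau> * K \<le> int (card X) * ip X (unit_fun a) (oproj X Y (unit_fun a))"
  proof (rule ccontr)
   assume "\<not> ?thesis"
   then have lt: "int (card X) * ip X (unit_fun a) (oproj X Y (unit_fun a)) < int \<tau> * K" if "a \<in> X" for a using that by force
   have "X \<noteq> {}" using tr False K Y(2) unfolding \<tau>_def by auto
   then have "(\<Sum>a\<in>X. int (card X) * ip X (unit_fun a) (oproj X Y (unit_fun a))) < (\<Sum>a\<in>X. int \<tau> * K)"
    using lt fin by (intro sum_strict_mono) auto
   then show False unfolding sum_distrib_left[symmetric] tr by simp
  qed
  then obtain a where a: "a \<in> X" "int \<tau> * K \<le> int (card X) * ip X (unit_fun a) (oproj X Y (unit_fun a))" by blast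
  define w where "w = oproj X Y (unit_fun a)"
  define e where "e = unit_fun a"
  have eX: "e \<in> Zf X" unfolding e_def by (rule unit_fun_Zf[OF a(1)])
  have wD: "w \<in> perp X J" unfolding w_def by (rule PD)
  have wip: "ip X (K \<star> e - w) d = 0" if "d \<in> perp X J" for d unfolding K_def e_def w_def by (rule Pip[OF that])
  have big: "int \<tau> * K \<le> int (card X) * ip X w e" using a(2) unfolding w_def e_def by (simp add: ip_commute)
  have "int \<tau> * K > 0" using False K Y(2) unfolding \<tau>_def by simp
  then have we: "ip X w e > 0" using big by (smt (verit) mult_nonneg_nonpos of_nat_0_le_iff)
  define J' where "J' = J [+] cyc e"
  have J': "sgrp J'" "J' \<subseteq> Zf X" unfolding J'_def
   by (intro sgrp_setsum2 J sgrp_cyc) (intro setsum2_subset[OF sgrp_Zf] J cyc_subset[OF sgrp_Zf eX])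
  have JJ': "J \<subseteq> J'" "e \<in> J'" unfolding J'_def
   using setsum2_left[OF sgrp_cyc] setsum2_right[OF J(1), of "cyc e"] cyc_self[of e] by auto
  have perp': "perp X J' = {d \<in> perp X J. ip X d e = 0}" unfolding J'_def by (rule perp_add_cyc[OF J(1)])
  \<comment> \<open>The vector \<open>w\<close> is orthogonal to \<open>perp X J'\<close>, so it
    enlarges every orthogonal family found there.\<close>
  have dim: "odim X (perp X J') + 1 \<le> \<tau>"
  proof -
   obtain Y' where Y': "ofam X (perp X J') Y'" "card Y' = odim X (perp X J')"
    by (rule maximal_ofam[OF fin perp_Zf, of J']) blast
   have wd: "ip X w d = 0" if "d \<in> perp X J'" for d
   proof -
    have "d \<in> perp X J" "ip X d e = 0" using that perp' by auto
    then show ?thesis using wip[of d] ip_commute[of X d e] by (simp add: ip_simps)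
   qed
   have ww: "ip X w w \<noteq> 0"
   proof -
    have "ip X w w = K * ip X w e" using wip[OF wD] ip_commute[of X e w] by (simp add: ip_simps)
    then show ?thesis using we K by simp
   qed
   have nin: "w \<notin> Y'" using wd ww Y' unfolding ofam_def by blast
   have "ofam X (perp X J) (insert w Y')" unfolding ofam_def
   proof (intro conjI ballI impI)
    show "insert w Y' \<subseteq> perp X J" using wD Y'(1) perp' unfolding ofam_def by auto
    show "finite (insert w Y')" using Y' by (simp add: ofam_def)
    show "ip X y y \<noteq> 0" if "y \<in> insert w Y'" for y using that ww Y' unfolding ofam_def by auto
    fix y y' assume h: "y \<in> insert w Y'" "y' \<in> insert w Y'" "y \<noteq> y'"
    have "ip X w z = 0" "ip X z w = 0" if "z \<in> Y'" for z
     using wd[of z] that Y' ip_commute[of X w z] unfolding ofam_def by auto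
    then show "ip X y y' = 0" using h Y' unfolding ofam_def by auto
   qed
   then have "card (insert w Y') \<le> odim X (perp X J)" by (rule ofam_odim[OF fin])
   then show ?thesis using nin Y' Y(2) unfolding ofam_def \<tau>_def by simp
  qed
  then have "odim X (perp X J') < odim X (perp X J)" using Y(2) unfolding \<tau>_def by simp
  from less.hyps[OF this J'] obtain E' \<kappa> \<iota>' t' where E': "E' \<subseteq> X" "card E' \<le> odim X (perp X J')"
   "\<forall>v\<in>Zf E'. v \<in> sat X J' \<longrightarrow> v = 0" "has_idx (Zf X) (J' [+] Zf E') \<kappa>"
   "has_idx (Zf X) (J' [+] perp X J') \<iota>'" "has_idx (sat X J') J' t'" "\<iota>' * t' * fact (card E') \<le> \<kappa>\<^sup>2 * card X ^ card E'"
   by blast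
  define E where "E = insert a E'"
  have finE': "finite E'" using E'(1) fin finite_subset by blast
  have aE': "a \<notin> E'"
  proof
   assume "a \<in> E'"
   then have "e \<in> Zf E'" unfolding e_def by (rule unit_fun_Zf)
   moreover have "e \<in> sat X J'" using JJ'(2) sat_superset[OF J'(2)] by blast
   ultimately have "e = 0" using E'(3) by blast
   then show False using we by (simp add: ip_simps)
  qed
  have JE: "J [+] Zf E = J' [+] Zf E'" unfolding E_def Zf_insert J'_def e_def setsum2_assoc ..
  have indep: "v = 0" if v: "v \<in> Zf E" "v \<in> sat X J" for v
  proof -
   obtain n u where nu: "v = n \<star> e + u" "u \<in> Zf E'" using v(1) unfolding E_def Zf_insert e_def[symmetric]
    by (auto simp: setsum2_def cyc_def)
   have "v \<in> sat X J'" using v(2) sat_mono[OF JJ'(1)] by blast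
   moreover have "n \<star> e \<in> sat X J'"
    using sgrp_zmult[OF J'(1) JJ'(2)] sat_superset[OF J'(2)] by blast
   ultimately have "v - n \<star> e \<in> sat X J'" by (rule sgrp_diff[OF sgrp_sat[OF J'(1)]])
   then have u0: "u = 0" using E'(3) nu by simp
   have "w \<in> perp X (sat X J)" using wD perp_sat[OF J(2)] by simp
   then have "ip X w v = 0" using v(2) by (simp add: perp_def)
   then have "n = 0" using nu u0 we by (simp add: ip_simps)
   then show ?thesis using nu u0 by simp
  qed
  have "int (\<iota> * t) * ip X w e \<le> int (\<iota>' * t') * K"
   by (rule index_add_vector[OF fin J eX wD wip we K \<iota> t]) (use E' in \<open>auto simp: J'_def\<close>)
  then have "int (card X) * (int (\<iota> * t) * ip X w e) \<le> int (card X) * (int (\<iota>' * t') * K)"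
   by (rule mult_left_mono) simp
  moreover have "int (\<iota> * t) * (int \<tau> * K) \<le> int (\<iota> * t) * (int (card X) * ip X w e)"
   by (rule mult_left_mono[OF big]) simp
  ultimately have "int (\<iota> * t * \<tau>) * K \<le> int (card X * (\<iota>' * t')) * K" by (simp add: algebra_simps)
  then have "int (\<iota> * t * \<tau>) \<le> int (card X * (\<iota>' * t'))" using K by (rule mult_right_le_imp_le)
  then have main: "\<iota> * t * \<tau> \<le> card X * (\<iota>' * t')" by (simp only: of_nat_le_iff)
  have cE: "card E = Suc (card E')" using aE' finE' by (simp add: E_def)
  have "\<iota> * t * fact (card E) = \<iota> * t * Suc (card E') * fact (card E')" unfolding cE by (simp add: algebra_simps)
  also have "\<dots> \<le> \<iota> * t * \<tau> * fact (card E')" using E'(2) dim by (intro mult_right_mono mult_left_mono) auto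
  also have "\<dots> \<le> card X * (\<iota>' * t') * fact (card E')" by (rule mult_right_mono[OF main]) simp
  also have "\<dots> = card X * (\<iota>' * t' * fact (card E'))" by simp
  also have "\<dots> \<le> card X * (\<kappa>\<^sup>2 * card X ^ card E')" by (rule mult_left_mono[OF E'(7)]) simp
  also have "\<dots> = \<kappa>\<^sup>2 * card X ^ card E" unfolding cE by simp
  finally have "\<iota> * t * fact (card E) \<le> \<kappa>\<^sup>2 * card X ^ card E" .
  moreover have "E \<subseteq> X" using E' a by (simp add: E_def)
  moreover have "card E \<le> odim X (perp X J)" using cE E'(2) dim Y(2) by (simp add: \<tau>_def)
  moreover have "has_idx (Zf X) (J [+] Zf E) \<kappa>" using E'(4) JE by simp
  ultimately show ?thesis using indep \<iota> t by blast
 qed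
qed

subsection \<open>Representatives of bounded size\<close>

definition cubeZ :: "'x set \<Rightarrow> int \<Rightarrow> ('x \<Rightarrow> int) set" where
 "cubeZ X m = {u\<in>Zf X. \<forall>x\<in>X. \<bar>u x\<bar> \<le> m}"

text \<open>Write \<open>z\<close> as a rational combination of the generators and take fractional parts of the coefficients.\<close>

lemma bounded_representative:
 assumes "finite C" "sgrp L" "\<And>c. c \<in> C \<Longrightarrow> ev c \<in> L" "L \<subseteq> Zf X"
  and col: "\<And>x. x \<in> X \<Longrightarrow> (\<Sum>c\<in>C. \<bar>ev c x\<bar>) \<le> m"
  and z: "z \<in> Zf X" "k > 0" "k \<star> z = (\<Sum>c\<in>C. n c \<star> ev c)"
 shows "\<exists>z'\<in>cubeZ X m. z - z' \<in> L"
proof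
 define z' where "z' = z - (\<Sum>c\<in>C. (n c div k) \<star> ev c)"
 have L: "(\<Sum>c\<in>C. (n c div k) \<star> ev c) \<in> L" by (intro sgrp_sum[OF assms(2)] sgrp_zmult[OF assms(2)] assms(3))
 then show "z - z' \<in> L" by (simp add: z'_def)
 have "z' \<in> Zf X" unfolding z'_def using L assms(4) by (intro sgrp_diff[OF sgrp_Zf] z) auto
 moreover have "\<bar>z' x\<bar> \<le> m" if x: "x \<in> X" for x
 proof -
  have "k * z' x = (\<Sum>c\<in>C. n c * ev c x) - (\<Sum>c\<in>C. k * (n c div k) * ev c x)"
   using fun_cong[OF z(3), of x] by (simp add: z'_def sum_fun_apply algebra_simps sum_distrib_left)
  also have "\<dots> = (\<Sum>c\<in>C. (n c mod k) * ev c x)"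
   unfolding sum_subtractf[symmetric] by (rule sum.cong) (auto simp: minus_mult_div_eq_mod simp flip: left_diff_distrib)
  finally have "k * \<bar>z' x\<bar> = \<bar>\<Sum>c\<in>C. (n c mod k) * ev c x\<bar>" using z(2) by (metis abs_mult abs_of_pos)
  also have "\<dots> \<le> (\<Sum>c\<in>C. \<bar>(n c mod k) * ev c x\<bar>)" by (rule sum_abs)
  also have "\<dots> \<le> (\<Sum>c\<in>C. k * \<bar>ev c x\<bar>)"
   unfolding abs_mult by (intro sum_mono mult_right_mono) (use z(2) in \<open>auto simp: abs_of_nonneg less_imp_le\<close>)
  also have "\<dots> = k * (\<Sum>c\<in>C. \<bar>ev c x\<bar>)" by (simp add: sum_distrib_left)
  also have "\<dots> \<le> k * m" using col[OF x] z(2) by simp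
  finally show ?thesis using z(2) by simp
 qed
 ultimately show "z' \<in> cubeZ X m" by (simp add: cubeZ_def)
qed

subsection \<open>Counting characters\<close>

text \<open>Translation by \<open>h\<close> permutes the classes modulo \<open>K\<close>, so it
  leaves the sum unchanged while multiplying it by \<open>\<psi> h\<close>.\<close>

lemma sum_character_eq_0:
 fixes \<psi> :: "'a::ab_group_add \<Rightarrow> complex"
 assumes H: "sgrp H" and K: "sgrp K" "K \<subseteq> H"
  and R: "R \<subseteq> H" "finite R" "\<forall>h\<in>H. \<exists>r\<in>R. h - r \<in> K" "\<forall>r\<in>R. \<forall>r'\<in>R. r - r' \<in> K \<longrightarrow> r = r'"
  and mult: "\<And>x y. x \<in> H \<Longrightarrow> y \<in> H \<Longrightarrow> \<psi> (x + y) = \<psi> x * \<psi> y" and triv: "\<And>k. k \<in> K \<Longrightarrow> \<psi> k = 1"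
  and h: "h \<in> H" "\<psi> h \<noteq> 1"
 shows "(\<Sum>r\<in>R. \<psi> r) = 0"
proof -
 have "\<forall>r\<in>R. \<exists>s. s \<in> R \<and> (r + h) - s \<in> K" using R(1,3) h(1) sgrp_add[OF H] by blast
 then obtain \<sigma> where \<sigma>: "\<And>r. r \<in> R \<Longrightarrow> \<sigma> r \<in> R \<and> (r + h) - \<sigma> r \<in> K" by metis
 have inj: "inj_on \<sigma> R"
 proof (rule inj_onI)
  fix r s assume rs: "r \<in> R" "s \<in> R" "\<sigma> r = \<sigma> s"
  have "((r + h) - \<sigma> r) - ((s + h) - \<sigma> s) \<in> K" by (rule sgrp_diff[OF K(1)]) (use \<sigma> rs in blast)+
  then have "r - s \<in> K" using rs by (simp add: algebra_simps)
  then show "r = s" using R(4) rs by blast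
 qed
 have im: "\<sigma> ` R = R" by (rule endo_inj_surj[OF R(2) _ inj]) (use \<sigma> in auto)
 have val: "\<psi> (\<sigma> r) = \<psi> r * \<psi> h" if "r \<in> R" for r
 proof -
  have "\<psi> (r + h) = \<psi> (((r + h) - \<sigma> r) + \<sigma> r)" by simp
  also have "\<dots> = \<psi> ((r + h) - \<sigma> r) * \<psi> (\<sigma> r)" using \<sigma>[OF that] K(2) R(1) by (intro mult) auto
  finally have "\<psi> (r + h) = \<psi> (\<sigma> r)" using triv \<sigma>[OF that] by simp
  then show ?thesis using mult[of r h] that R(1) h(1) by auto
 qed
 have "(\<Sum>r\<in>R. \<psi> r) = (\<Sum>r\<in>\<sigma> ` R. \<psi> r)" using im by simp
 also have "\<dots> = (\<Sum>r\<in>R. \<psi> (\<sigma> r))" using sum.reindex[OF inj, of \<psi>] by simp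
 also have "\<dots> = (\<Sum>r\<in>R. \<psi> r) * \<psi> h" by (simp add: val sum_distrib_right)
 finally show ?thesis using h(2) by simp
qed

lemma cis_2pi_eq_1_iff: "cis (2 * pi * x) = 1 \<longleftrightarrow> x \<in> \<int>"
proof
 assume "cis (2 * pi * x) = 1"
 then have "cos (2 * pi * x) = 1" by (metis Re_complex_of_real cis.simps(1) of_real_1)
 then obtain k where "2 * pi * x = of_int k * 2 * pi" using cos_one_2pi_int by (metis mult.commute mult.left_commute)
 then have "x = of_int k" by simp
 then show "x \<in> \<int>" by simp
next
 assume "x \<in> \<int>" then show "cis (2 * pi * x) = 1" by (rule cis_multiple_2pi)
qed

text \<open>Each \<open>\<chi> y\<close> is a character of H/K with values in the reals modulo 1.
  The bound is Bessel's inequality for the indicator function of the zero class, represented by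
  \<open>r0\<close>, against orthogonal characters of squared norm \<open>n\<close>: the vector
  \<open>v\<close> has squared norm \<open>n * n - n * card Y\<close>.\<close>

theorem card_characters_le:
 fixes \<chi> :: "'y \<Rightarrow> 'a::ab_group_add \<Rightarrow> real"
 assumes H: "sgrp H" and K: "sgrp K" "K \<subseteq> H" and n: "has_idx H K n" and Y: "finite Y"
  and add: "\<And>y u v. y \<in> Y \<Longrightarrow> u \<in> H \<Longrightarrow> v \<in> H \<Longrightarrow> \<chi> y (u + v) - \<chi> y u - \<chi> y v \<in> \<int>"
  and triv: "\<And>y u. y \<in> Y \<Longrightarrow> u \<in> K \<Longrightarrow> \<chi> y u \<in> \<int>"
  and dist: "\<And>y y'. y \<in> Y \<Longrightarrow> y' \<in> Y \<Longrightarrow> (\<And>u. u \<in> H \<Longrightarrow> \<chi> y u - \<chi> y' u \<in> \<int>) \<Longrightarrow> y = y'"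
 shows "card Y \<le> n"
proof -
 obtain R where R: "R \<subseteq> H" "finite R" "card R = n" "\<forall>h\<in>H. \<exists>r\<in>R. h - r \<in> K" "\<forall>r\<in>R. \<forall>r'\<in>R. r - r' \<in> K \<longrightarrow> r = r'"
  using n unfolding has_idx_def by blast
 obtain r0 where r0: "r0 \<in> R" "0 - r0 \<in> K" using R(4) sgrp_0[OF H] by blast
 define e where "e = (\<lambda>y u. cis (2 * pi * \<chi> y u))"
 have e_add: "e y (u + v) = e y u * e y v" if "y \<in> Y" "u \<in> H" "v \<in> H" for y u v
 proof -
  have "cis (2 * pi * (\<chi> y (u + v) - \<chi> y u - \<chi> y v)) = 1" unfolding cis_2pi_eq_1_iff by (rule add[OF that])
  moreover have "cis (2 * pi * \<chi> y (u + v)) = cis (2 * pi * (\<chi> y (u + v) - \<chi> y u - \<chi> y v)) * (cis (2 * pi * \<chi> y u) * cis (2 * pi * \<chi> y v))"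
   by (simp add: cis_mult algebra_simps)
  ultimately show ?thesis by (simp add: e_def)
 qed
 have e_triv: "e y u = 1" if "y \<in> Y" "u \<in> K" for y u using triv[OF that] by (simp add: e_def cis_2pi_eq_1_iff)
 have e_cnj: "e y u * cnj (e y' u) = cis (2 * pi * (\<chi> y u - \<chi> y' u))" for y y' u
  by (simp add: e_def cis_cnj cis_mult algebra_simps)
 have orth: "(\<Sum>r\<in>R. e y r * cnj (e y' r)) = (if y = y' then of_nat n else 0)" if yy: "y \<in> Y" "y' \<in> Y" for y y'
 proof (cases "y = y'")
  case True then show ?thesis using R(3) by (simp add: e_cnj)
 next
  case False
  then obtain h where h: "h \<in> H" "\<chi> y h - \<chi> y' h \<notin> \<int>" using dist[OF yy] by blast
  have "(\<Sum>r\<in>R. e y r * cnj (e y' r)) = 0"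
   by (rule sum_character_eq_0[OF H K R(1,2,4,5) _ _ h(1)])
     (use e_add e_triv yy h in \<open>auto simp: e_cnj[of y h y'] cis_2pi_eq_1_iff\<close>)
  then show ?thesis using False by simp
 qed
 have er0: "e y r0 = 1" if "y \<in> Y" for y
  using e_triv[OF that, of r0] sgrp_minus[OF K(1) r0(2)] by simp
 define v where "v = (\<lambda>r. (if r = r0 then of_nat n else 0) - (\<Sum>y\<in>Y. e y r))"
 have "(\<Sum>r\<in>R. v r * cnj (v r)) = of_nat n * of_nat n - of_nat n * of_nat (card Y)"
 proof -
  have 1: "(\<Sum>r\<in>R. (if r = r0 then of_nat n else 0) * cnj (v r)) = of_nat n * (of_nat n - of_nat (card Y))"
  proof -
   have "(\<Sum>r\<in>R. (if r = r0 then of_nat n else 0) * cnj (v r)) = (\<Sum>r\<in>R. if r = r0 then of_nat n * cnj (v r0) else 0)"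
    by (rule sum.cong) auto
   also have "\<dots> = of_nat n * cnj (v r0)" using r0 R by simp
   finally show ?thesis by (simp add: v_def er0)
  qed
  have "(\<Sum>r\<in>R. (\<Sum>y\<in>Y. e y r) * cnj (v r)) = (\<Sum>y\<in>Y. \<Sum>r\<in>R. e y r * cnj (v r))"
   unfolding sum_distrib_right by (rule sum.swap)
  also have "\<dots> = (\<Sum>y\<in>Y. 0)"
  proof (rule sum.cong[OF refl])
   fix y assume y: "y \<in> Y"
   have "(\<Sum>r\<in>R. e y r * cnj (v r)) = (\<Sum>r\<in>R. e y r * (if r = r0 then of_nat n else 0)) - (\<Sum>r\<in>R. \<Sum>y'\<in>Y. e y r * cnj (e y' r))"
    unfolding sum_subtractf[symmetric] by (rule sum.cong) (auto simp: v_def algebra_simps sum_distrib_left)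
   also have "(\<Sum>r\<in>R. e y r * (if r = r0 then of_nat n else 0)) = (\<Sum>r\<in>R. if r = r0 then of_nat n else 0)"
    by (rule sum.cong) (auto simp: er0[OF y])
   also have "\<dots> = of_nat n" using r0 R by simp
   also have "(\<Sum>r\<in>R. \<Sum>y'\<in>Y. e y r * cnj (e y' r)) = (\<Sum>y'\<in>Y. \<Sum>r\<in>R. e y r * cnj (e y' r))" by (rule sum.swap)
   also have "\<dots> = (\<Sum>y'\<in>Y. if y = y' then of_nat n else 0)" by (rule sum.cong) (auto simp: orth y)
   also have "\<dots> = of_nat n" using y Y by simp
   finally show "(\<Sum>r\<in>R. e y r * cnj (v r)) = 0" by simp
  qed
  finally have 2: "(\<Sum>r\<in>R. (\<Sum>y\<in>Y. e y r) * cnj (v r)) = 0" by simp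
  have "(\<Sum>r\<in>R. v r * cnj (v r)) = (\<Sum>r\<in>R. (if r = r0 then of_nat n else 0) * cnj (v r)) - (\<Sum>r\<in>R. (\<Sum>y\<in>Y. e y r) * cnj (v r))"
   unfolding sum_subtractf[symmetric] by (rule sum.cong) (auto simp: v_def algebra_simps)
  then show ?thesis unfolding 1 2 by (simp add: algebra_simps)
 qed
 moreover have "(\<Sum>r\<in>R. v r * cnj (v r)) = of_real (\<Sum>r\<in>R. (cmod (v r))\<^sup>2)"
  by (simp only: of_real_sum complex_norm_square)
 ultimately have "of_real (\<Sum>r\<in>R. (cmod (v r))\<^sup>2) = (of_real (real n * real n - real n * real (card Y)) :: complex)" by simp
 then have "(\<Sum>r\<in>R. (cmod (v r))\<^sup>2) = real n * real n - real n * real (card Y)" by (simp only: of_real_eq_iff)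
 moreover have "(\<Sum>r\<in>R. (cmod (v r))\<^sup>2) \<ge> 0" by (simp add: sum_nonneg)
 ultimately have "real n * real (card Y) \<le> real n * real n" by simp
 moreover have "n > 0" using r0 R by (metis card_gt_0_iff empty_iff)
 ultimately show ?thesis by simp
qed

section \<open>Laurent polynomials acting on functions on a finite set\<close>

declare plus_fun_apply [simp del] zero_fun_apply [simp del] minus_apply [simp del] uminus_apply [simp del] zmult_apply [simp del]

lemmas fun_apply = plus_fun_apply zero_fun_apply minus_apply uminus_apply zmult_apply

text \<open>Exponent vectors in infinitely many variables. One type then serves every
  \<open>n\<close>, which permits inductions on \<open>n\<close>; the ring for a given
  \<open>n\<close> is the subset \<open>Rn n\<close>.\<close>

type_synonym mon = "nat \<Rightarrow>\<^sub>0 int"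
type_synonym lp = "mon \<Rightarrow>\<^sub>0 int"

text \<open>The group ring acting by translation: the monomial \<open>y\<close> moves the unit
  function at \<open>c\<close> to the one at \<open>act y c\<close>, hence the sign in the
  argument.\<close>

definition act_op :: "'x set \<Rightarrow> (mon \<Rightarrow> 'x \<Rightarrow> 'x) \<Rightarrow> lp \<Rightarrow> ('x \<Rightarrow> int) \<Rightarrow> 'x \<Rightarrow> int" where
 "act_op X act r u x = (if x \<in> X then \<Sum>y\<in>keys r. lookup r y * u (act (- y) x) else 0)"

definition l1norm :: "lp \<Rightarrow> int" where
 "l1norm r = (\<Sum>y\<in>keys r. \<bar>lookup r y\<bar>)"

lemma l1norm_nonneg: "l1norm r \<ge> 0"
 by (simp add: l1norm_def sum_nonneg)

lemma lp_induct [case_names zero one diff]: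
 fixes r :: "'b \<Rightarrow>\<^sub>0 int"
 assumes "P 0" "\<And>y. P (frag_of y)" "\<And>a b. P a \<Longrightarrow> P b \<Longrightarrow> P (a - b)"
 shows "P r"
 by (rule frag_induction[of r UNIV P]) (use assms in auto)

definition lp_star :: "lp \<Rightarrow> lp" where
 "lp_star = frag_extend (\<lambda>y. frag_of (- y))"

locale finite_action =
 fixes X :: "'x set" and act :: "mon \<Rightarrow> 'x \<Rightarrow> 'x"
 assumes fin: "finite X" and act_closed: "c \<in> X \<Longrightarrow> act y c \<in> X"
  and act_0: "c \<in> X \<Longrightarrow> act 0 c = c"
  and act_add: "c \<in> X \<Longrightarrow> act (y + z) c = act y (act z c)"
begin

abbreviation "opr \<equiv> act_op X act"

lemma opr_superset:
 assumes "finite A" "keys r \<subseteq> A" "x \<in> X"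
 shows "opr r u x = (\<Sum>y\<in>A. lookup r y * u (act (- y) x))"
 using assms by (simp add: act_op_def) (intro sum.mono_neutral_left; auto simp: in_keys_iff)

lemma opr_0 [simp]: "opr 0 u = 0"
 by (auto simp: act_op_def fun_apply)

lemma opr_frag_of: "opr (frag_of y) u x = (if x \<in> X then u (act (- y) x) else 0)"
 by (simp add: act_op_def)

lemma opr_diff: "opr (r - s) u = opr r u - opr s u"
proof
 fix x
 show "opr (r - s) u x = (opr r u - opr s u) x"
 proof (cases "x \<in> X")
  case True
  let ?A = "keys r \<union> keys s"
  have "keys (r - s) \<subseteq> ?A" by (rule keys_diff)
  then show ?thesis
   by (simp add: opr_superset[of ?A _ x] True lookup_minus left_diff_distrib sum_subtractf fun_apply)
 qed (simp add: act_op_def fun_apply)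
qed

lemma opr_add: "opr (r + s) u = opr r u + opr s u"
 using opr_diff[of "r + s" s u] by simp

lemma opr_linear: "opr r (u - v) = opr r u - opr r v" "opr r (u + v) = opr r u + opr r v"
 "opr r (k \<star> u) = k \<star> opr r u" "opr r 0 = 0"
 by (auto simp: act_op_def fun_eq_iff algebra_simps sum_subtractf sum.distrib sum_distrib_left fun_apply)

lemma opr_sum: "opr r (sum f A) = (\<Sum>a\<in>A. opr r (f a))"
 by (induction A rule: infinite_finite_induct) (auto simp: opr_linear)

lemma opr_Zf: "opr r u \<in> Zf X"
 by (auto simp: Zf_def act_op_def)

lemma opr_mult: "opr (r * s) u = opr r (opr s u)"
proof (induction r rule: lp_induct)
 case (one y)
 show ?case
 proof (induction s rule: lp_induct)
  case (one z)
  have "frag_of y * frag_of z = frag_of (y + z)" by (simp add: mult_single)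
  moreover have "act (- (y + z)) x = act (- z) (act (- y) x)" if "x \<in> X" for x
   using act_add[OF that, of "- z" "- y"] by (simp add: add.commute)
  ultimately show ?case by (auto simp: fun_eq_iff opr_frag_of act_closed)
 qed (auto simp: opr_linear opr_diff right_diff_distrib)
qed (auto simp: opr_diff left_diff_distrib)

lemma opr_commute: "opr r (opr s u) = opr s (opr r u)"
 by (metis mult.commute opr_mult)

lemma opr_1: "u \<in> Zf X \<Longrightarrow> opr 1 u = u"
 using opr_frag_of[of 0 u] act_0 by (auto simp: fun_eq_iff Zf_def)

lemma opr_of_int: "u \<in> Zf X \<Longrightarrow> opr (of_int k) u = k \<star> u"
proof -
 assume u: "u \<in> Zf X"
 have nat: "opr (of_nat m) u = int m \<star> u" for m
  by (induction m) (auto simp: opr_add opr_1[OF u] fun_eq_iff algebra_simps fun_apply)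
 show ?thesis
 proof (cases "k \<ge> 0")
  case True
  then show ?thesis using nat[of "nat k"] by simp
 next
  case False
  then have "of_int k = (0::lp) - of_nat (nat (- k))" by simp
  then have "opr (of_int k) u = 0 - opr (of_nat (nat (- k))) u" using opr_diff[of 0 "of_nat (nat (-k))" u] by simp
  then show ?thesis using nat[of "nat (- k)"] False by (auto simp: fun_eq_iff fun_apply)
 qed
qed

lemma act_inverse: "c \<in> X \<Longrightarrow> act (- y) (act y c) = c" "c \<in> X \<Longrightarrow> act y (act (- y) c) = c"
 using act_add[of c "- y" y] act_add[of c y "- y"] act_0[of c] by auto

lemma act_bij: "bij_betw (act y) X X"
 unfolding bij_betw_def inj_on_def using act_closed act_inverse by (auto simp: image_iff) metis+

lemma opr_star: "ip X (opr r u) v = ip X u (opr (lp_star r) v)"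
proof (induction r rule: lp_induct)
 case (one y)
 have "ip X (opr (frag_of y) u) v = (\<Sum>x\<in>X. u (act (- y) x) * v x)"
  unfolding ip_def by (rule sum.cong) (auto simp: opr_frag_of)
 also have "\<dots> = (\<Sum>x\<in>X. u (act (- y) (act y x)) * v (act y x))"
  by (rule sum.reindex_bij_betw[OF act_bij, symmetric])
 also have "\<dots> = ip X u (opr (lp_star (frag_of y)) v)"
  unfolding ip_def by (rule sum.cong) (auto simp: opr_frag_of lp_star_def act_inverse)
 finally show ?case .
qed (auto simp: ip_simps opr_diff lp_star_def frag_extend_diff)

text \<open>Supplies the column sums in \<open>bounded_representative\<close>. The bound depends on
  \<open>r\<close> alone, so the cubes needed later have a size independent of
  \<open>X\<close>.\<close>

lemma opr_unit_fun_column: "(\<Sum>c\<in>X. \<bar>opr r (unit_fun c) x\<bar>) \<le> l1norm r"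
proof (cases "x \<in> X")
 case True
 have "(\<Sum>c\<in>X. \<bar>opr r (unit_fun c) x\<bar>) \<le> (\<Sum>c\<in>X. \<Sum>y\<in>keys r. \<bar>lookup r y\<bar> * unit_fun c (act (- y) x))"
 proof (rule sum_mono)
  fix c
  show "\<bar>opr r (unit_fun c) x\<bar> \<le> (\<Sum>y\<in>keys r. \<bar>lookup r y\<bar> * unit_fun c (act (- y) x))"
   using True unfolding act_op_def by (auto intro!: order_trans[OF sum_abs] sum_mono simp: abs_mult unit_fun_def)
 qed
 also have "\<dots> = (\<Sum>y\<in>keys r. \<bar>lookup r y\<bar> * (\<Sum>c\<in>X. unit_fun c (act (- y) x)))"
  unfolding sum_distrib_left by (rule sum.swap)
 also have "\<dots> = l1norm r"
  unfolding l1norm_def by (rule sum.cong) (use act_closed[OF True] fin in \<open>auto simp: unit_fun_def\<close>)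
 finally show ?thesis .
qed (simp add: act_op_def l1norm_nonneg)

lemma Zf_expand: "u \<in> Zf X \<Longrightarrow> u = (\<Sum>c\<in>X. u c \<star> unit_fun c)"
 using fin by (auto simp: fun_apply fun_eq_iff sum_fun_apply unit_fun_def Zf_def if_distrib[of "\<lambda>z. _ * z"] cong: if_cong)

text \<open>The operator commutes with its adjoint \<open>opr (lp_star z)\<close>, and a normal
  operator has no nilpotent part.\<close>

lemma opr_square_eq_0:
 assumes "u \<in> Zf X" "opr z (opr z u) = 0" shows "opr z u = 0"
proof -
 let ?B = "opr (lp_star z)"
 have "ip X (opr z (?B (opr z u))) (opr z u) = ip X (?B (opr z u)) (?B (opr z u))" by (rule opr_star)
 moreover have "opr z (?B (opr z u)) = 0" using assms(2) opr_commute[of z "lp_star z" "opr z u"] by (simp add: opr_linear)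
 ultimately have "?B (opr z u) = 0" using ip_self_eq_0[OF fin opr_Zf] by (metis ip_simps(7))
 then have "ip X (opr z u) (opr z u) = 0" unfolding opr_star by (simp add: ip_simps)
 then show ?thesis using ip_self_eq_0[OF fin opr_Zf] by blast
qed

lemma opr_star_eq_0: assumes "u \<in> Zf X" "opr (lp_star z) u = 0" shows "opr z u = 0"
proof -
 have "ip X (opr z u) (opr z u) = ip X u (opr (lp_star z) (opr z u))" by (rule opr_star)
 also have "\<dots> = ip X u (opr z (opr (lp_star z) u))" by (simp add: opr_commute[of z "lp_star z"])
 also have "\<dots> = 0" using assms(2) by (simp add: opr_linear ip_simps)
 finally show ?thesis using ip_self_eq_0[OF fin opr_Zf] by blast
qed

definition annih :: "lp set" where
 "annih = {r. \<forall>u\<in>Zf X. opr r u = 0}"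

lemma annih_mult: "r \<in> annih \<Longrightarrow> r * s \<in> annih"
 unfolding annih_def using opr_mult[of s r] by (auto simp: mult.commute opr_linear)

lemma annih_eq: "r - s \<in> annih \<Longrightarrow> u \<in> Zf X \<Longrightarrow> opr r u = opr s u"
 unfolding annih_def using opr_diff[of r s u] by simp

end

lemma finite_action_product:
 assumes "finite_action X act" shows "finite_action ({..<q::nat} \<times> X) (\<lambda>y (i, c). (i, act y c))"
proof -
 interpret finite_action X act by fact
 show ?thesis by standard (auto simp: fin act_closed act_0 act_add)
qed

lemma act_op_product:
 "act_op ({..<q::nat} \<times> X) (\<lambda>y (i, c). (i, act y c)) r u (i, c) = (if i < q then act_op X act r (\<lambda>c. u (i, c)) c else 0)"
 by (simp add: act_op_def)

lemma Zf_slice: "u \<in> Zf ({..<q::nat} \<times> X) \<Longrightarrow> (\<lambda>c. u (i, c)) \<in> Zf X"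
 by (auto simp: Zf_def)

locale transitive_action = finite_action X act for X :: "'x set" and act +
 fixes pt :: 'x
 assumes pt: "pt \<in> X" and trans: "c \<in> X \<Longrightarrow> \<exists>y. act y pt = c"
begin

lemma unit_fun_act: assumes "c \<in> X" shows "unit_fun (act y c) = opr (frag_of y) (unit_fun c)"
proof
 fix x
 have "act (- y) x = c \<longleftrightarrow> x = act y c" if "x \<in> X" using that assms act_inverse by metis
 then show "unit_fun (act y c) x = opr (frag_of y) (unit_fun c) x"
  using act_closed[OF assms, of y] by (auto simp: opr_frag_of unit_fun_def)
qed

lemma Zf_cyclic: assumes "u \<in> Zf X" obtains r where "u = opr r (unit_fun pt)"
proof -
 obtain y where y: "\<And>c. c \<in> X \<Longrightarrow> act (y c) pt = c" using trans by metis
 have op_sum: "opr (sum f A) v = (\<Sum>a\<in>A. opr (f a) v)" for f :: "'x \<Rightarrow> lp" and A v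
  by (induction A rule: infinite_finite_induct) (auto simp: opr_add)
 have "u = (\<Sum>c\<in>X. u c \<star> unit_fun c)" by (rule Zf_expand[OF assms])
 also have "\<dots> = (\<Sum>c\<in>X. opr (of_int (u c) * frag_of (y c)) (unit_fun pt))"
 proof (rule sum.cong[OF refl])
  fix c assume c: "c \<in> X"
  have "unit_fun c = opr (frag_of (y c)) (unit_fun pt)" using unit_fun_act[OF pt, of "y c"] y[OF c] by simp
  then show "u c \<star> unit_fun c = opr (of_int (u c) * frag_of (y c)) (unit_fun pt)"
   by (simp add: opr_mult opr_of_int opr_Zf)
 qed
 also have "\<dots> = opr (\<Sum>c\<in>X. of_int (u c) * frag_of (y c)) (unit_fun pt)" by (simp add: op_sum)
 finally show ?thesis by (rule that)
qed

lemma annihI: assumes "opr r (unit_fun pt) = 0" shows "r \<in> annih"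
proof -
 have "opr r u = 0" if "u \<in> Zf X" for u
 proof -
  obtain s where "u = opr s (unit_fun pt)" using Zf_cyclic[OF \<open>u \<in> Zf X\<close>] by blast
  then show ?thesis using assms opr_commute[of r s] by (simp add: opr_linear)
 qed
 then show ?thesis by (simp add: annih_def)
qed

text \<open>The rational group algebra of a finite abelian group is von Neumann regular.\<close>

lemma regular: obtains d c where "d > 0" "of_int d * h - c * h * h \<in> annih"
proof -
 let ?J = "(\<lambda>w. opr h (opr h w)) ` Zf X"
 have J: "sgrp ?J"
 proof (rule sgrpI)
  show "0 \<in> ?J" by (rule image_eqI[of _ _ 0]) (auto simp: opr_linear sgrp_0[OF sgrp_Zf])
  fix x y assume "x \<in> ?J" "y \<in> ?J"
  then obtain a b where ab: "x = opr h (opr h a)" "y = opr h (opr h b)" "a \<in> Zf X" "b \<in> Zf X" by blast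
  then show "x - y \<in> ?J" by (intro image_eqI[of _ _ "a - b"]) (auto simp: opr_linear sgrp_diff[OF sgrp_Zf])
 qed
 have JZ: "?J \<subseteq> Zf X" using opr_Zf by blast
 obtain d where d: "d > 0" "\<And>x. x \<in> perp X (perp X ?J) \<Longrightarrow> d \<star> x \<in> ?J" by (rule perp_perp[OF fin J JZ]) blast
 \<comment> \<open>A vector orthogonal to the image of the square of \<open>opr h\<close> is killed
   by the square of the adjoint, by normality already by the adjoint, and so is orthogonal to the
   image of \<open>opr h\<close>.\<close>
 have "ip X (opr h (unit_fun pt)) v = 0" if v: "v \<in> perp X ?J" for v
 proof -
  have vZ: "v \<in> Zf X" using v perp_Zf by blast
  let ?s = "lp_star h"
  have "opr ?s (opr ?s v) \<in> Zf X" by (rule opr_Zf)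
  moreover have "ip X (opr ?s (opr ?s v)) w = 0" if "w \<in> Zf X" for w
  proof -
   have "ip X w (opr ?s (opr ?s v)) = ip X (opr h (opr h w)) v" by (simp add: opr_star)
   also have "\<dots> = 0" using v that ip_commute[of X v] unfolding perp_def by auto
   finally show ?thesis by (simp add: ip_commute)
  qed
  ultimately have "opr ?s (opr ?s v) = 0" using ip_self_eq_0[OF fin] by blast
  then have "opr ?s v = 0" by (rule opr_square_eq_0[OF vZ])
  then show ?thesis by (simp add: opr_star ip_simps)
 qed
 then have "opr h (unit_fun pt) \<in> perp X (perp X ?J)" using opr_Zf unfolding perp_def[of X "perp X ?J"] by blast
 then obtain w where w: "d \<star> opr h (unit_fun pt) = opr h (opr h w)" "w \<in> Zf X" using d(2) by blast
 obtain c where c: "w = opr c (unit_fun pt)" by (rule Zf_cyclic[OF w(2)])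
 have "opr (of_int d * h - c * h * h) (unit_fun pt) = 0"
  using w(1) unfolding c opr_diff opr_mult opr_of_int[OF opr_Zf]
  by (simp add: opr_commute[of h c])
 then show ?thesis using that[OF d(1)] annihI by blast
qed

text \<open>Modulo \<open>annih\<close>, \<open>c * f / r\<close> is an idempotent e that generates
  the rational ideal of \<open>f\<close>, and \<open>\<rho> = r * (1 - e)\<close>. Thus e h = f and
  (1 - e) h = r (1 - e) g, so \<open>g\<close> is a rational multiple of \<open>h\<close>.
  Integrally, replacing \<open>f\<close> by \<open>f + \<rho> * g\<close> does not change the ideal
  generated together with \<open>g\<close>.\<close>

lemma koszul_elements:
 obtains h \<rho> d1 c1 d2 c2 where "h = f + \<rho> * g" "d1 > 0" "d2 > 0"
  "of_int d1 * h - c1 * h * h \<in> annih" "of_int d2 * g - c2 * h \<in> annih"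
proof -
 obtain r c where r: "r > 0" "of_int r * f - c * f * f \<in> annih" by (rule regular[of f])
 define \<rho> :: lp where "\<rho> = of_int r - c * f"
 define h where "h = f + \<rho> * g"
 obtain d1 c1 where d1: "d1 > 0" "of_int d1 * h - c1 * h * h \<in> annih" by (rule regular[of h])
 have "of_int (r * r) * g - (\<rho> + c * c * f * g) * h = (of_int r * f - c * f * f) * (2 * c * g - 1 - c * c * g * g)"
  unfolding h_def \<rho>_def by (simp add: algebra_simps)
 then have "of_int (r * r) * g - (\<rho> + c * c * f * g) * h \<in> annih" using annih_mult[OF r(2)] by metis
 then show ?thesis using that[OF h_def d1(1) _ d1(2)] r(1) by (metis mult_pos_pos)
qed

end

subsection \<open>Counting the first Koszul homology\<close>

text \<open>\<open>P\<close> may relate \<open>y\<close> to several \<open>v\<close>; it only has to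
  reflect congruence. Each class of \<open>C\<close> that is hit receives one chosen
  preimage.\<close>

lemma covers_via:
 assumes "covers n C B" "sgrp B"
  and ex: "\<And>y. y \<in> H \<Longrightarrow> \<exists>v\<in>C. P y v"
  and imp: "\<And>y y' v v'. y \<in> H \<Longrightarrow> y' \<in> H \<Longrightarrow> P y v \<Longrightarrow> P y' v' \<Longrightarrow> v - v' \<in> B \<Longrightarrow> y - y' \<in> M"
 shows "covers n H M"
proof -
 obtain R where R: "finite R" "card R \<le> n" "\<forall>h\<in>C. \<exists>r\<in>R. h - r \<in> B" using assms(1) by (auto simp: covers_def)
 define F where "F = (\<lambda>r. SOME y. y \<in> H \<and> (\<exists>v. P y v \<and> v - r \<in> B))"
 have "\<exists>r\<in>F ` R. y - r \<in> M" if y: "y \<in> H" for y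
 proof -
  obtain v where v: "v \<in> C" "P y v" using ex[OF y] by blast
  obtain r where r: "r \<in> R" "v - r \<in> B" using R v by blast
  have "F r \<in> H \<and> (\<exists>v. P (F r) v \<and> v - r \<in> B)" unfolding F_def by (rule someI_ex) (use y v r in blast)
  then obtain v' where v': "F r \<in> H" "P (F r) v'" "v' - r \<in> B" by blast
  have "v - v' \<in> B" using sgrp_diff[OF assms(2) r(2) v'(3)] by simp
  then have "y - F r \<in> M" by (rule imp[OF y v'(1) v(2) v'(2)])
  then show ?thesis using r by blast
 qed
 moreover have "finite (F ` R)" "card (F ` R) \<le> n" using R card_image_le[OF R(1), of F] by auto
 ultimately show ?thesis unfolding covers_def by blast
qed

lemma covers_representatives:
 assumes "covers c C J" "sgrp J" "sgrp L" "J \<subseteq> L" "\<And>z. z \<in> H \<Longrightarrow> \<exists>z'\<in>C. z - z' \<in> L"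
 shows "covers c H L"
proof (rule covers_via[OF assms(1,2), where P = "\<lambda>y v. y - v \<in> L"])
 fix y y' v v' assume a: "y - v \<in> L" "y' - v' \<in> L" "v - v' \<in> J"
 have "(y - v) - (y' - v') + (v - v') \<in> L"
  by (rule sgrp_add[OF assms(3) sgrp_diff[OF assms(3) a(1,2)]]) (use a(3) assms(4) in blast)
 then show "y - y' \<in> L" by (simp add: algebra_simps)
qed (use assms(5) in blast)

context finite_action
begin

lemma sgrp_opr_image: assumes "sgrp A" shows "sgrp (opr r ` A)"
proof (rule sgrpI)
 show "0 \<in> opr r ` A" using sgrp_0[OF assms] by (intro image_eqI[of _ _ 0]) (auto simp: opr_linear)
 fix x y assume "x \<in> opr r ` A" "y \<in> opr r ` A"
 then obtain a b where "x = opr r a" "y = opr r b" "a \<in> A" "b \<in> A" by blast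
 then show "x - y \<in> opr r ` A" using sgrp_diff[OF assms, of a b] by (intro image_eqI[of _ _ "a - b"]) (auto simp: opr_linear)
qed

definition Jset :: "lp \<Rightarrow> lp \<Rightarrow> ('x \<Rightarrow> int) set \<Rightarrow> ('x \<Rightarrow> int) set" where
 "Jset f g A = opr f ` A [+] opr g ` A"

definition Kset :: "lp \<Rightarrow> lp \<Rightarrow> ('x \<Rightarrow> int) set" where
 "Kset f g = {u\<in>Zf X. opr f u = 0 \<and> opr g u = 0}"

lemma sgrp_Jset: "sgrp A \<Longrightarrow> sgrp (Jset f g A)"
 unfolding Jset_def by (intro sgrp_setsum2 sgrp_opr_image)

lemma sgrp_Kset: "sgrp (Kset f g)"
 by (rule sgrpI) (auto simp: Kset_def opr_linear sgrp_0[OF sgrp_Zf] sgrp_diff[OF sgrp_Zf])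

lemma Jset_Zf: "Jset f g A \<subseteq> Zf X"
 unfolding Jset_def by (intro setsum2_subset[OF sgrp_Zf]) (use opr_Zf in blast)+

lemma JsetI: "a \<in> A \<Longrightarrow> b \<in> A \<Longrightarrow> opr f a + opr g b \<in> Jset f g A"
 unfolding Jset_def by (intro setsum2_I) auto

lemma JsetE: "x \<in> Jset f g A \<Longrightarrow> (\<And>a b. x = opr f a + opr g b \<Longrightarrow> a \<in> A \<Longrightarrow> b \<in> A \<Longrightarrow> P) \<Longrightarrow> P"
 unfolding Jset_def setsum2_def by blast

lemma Jset_change:
 assumes A: "sgrp A" "\<And>r a. a \<in> A \<Longrightarrow> opr r a \<in> A"
 shows "Jset (f + \<rho> * g) g A = Jset f g A"
proof
 show "Jset (f + \<rho> * g) g A \<subseteq> Jset f g A"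
 proof
  fix x assume "x \<in> Jset (f + \<rho> * g) g A"
  then obtain a b where ab: "x = opr (f + \<rho> * g) a + opr g b" "a \<in> A" "b \<in> A" by (rule JsetE)
  have "x = opr f a + opr g (opr \<rho> a + b)" unfolding ab(1)
   by (simp add: opr_add opr_linear opr_mult opr_commute[of \<rho> g] add.assoc)
  then show "x \<in> Jset f g A" using JsetI[OF ab(2), of "opr \<rho> a + b"] ab A sgrp_add by blast
 qed
 show "Jset f g A \<subseteq> Jset (f + \<rho> * g) g A"
 proof
  fix x assume "x \<in> Jset f g A"
  then obtain a b where ab: "x = opr f a + opr g b" "a \<in> A" "b \<in> A" by (rule JsetE)
  have "x = opr (f + \<rho> * g) a + opr g (b - opr \<rho> a)" unfolding ab(1)
   by (simp add: opr_add opr_linear opr_mult opr_commute[of \<rho> g] algebra_simps)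
  moreover have "b - opr \<rho> a \<in> A" using ab A sgrp_diff by blast
  ultimately show "x \<in> Jset (f + \<rho> * g) g A" using JsetI[OF ab(2)] by metis
 qed
qed

text \<open>Write U for \<open>Zf X\<close>, J and K for the two sets with \<open>h\<close> in place
  of \<open>f\<close>, Y for the preimage of \<open>S\<close> under \<open>h\<close>, and B for h U
  + Y. An element h u + g v of \<open>S\<close> is determined modulo h Y + g Y by the class of v in
  the kernel of g on U/B. This kernel has the order of the cokernel of g, and since g U + B contains
  J + K that order is at most \<iota>. Next, Y modulo S + K embeds into U modulo J + K. As h and g
  kill K, replacing Y by \<open>S\<close> costs a factor \<iota> in each of the two
  arguments.\<close>

lemma koszul_count:
 assumes S: "sgrp S" "S \<subseteq> Zf X" and st: "\<And>r s. s \<in> S \<Longrightarrow> opr r s \<in> S"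
  and sd: "\<And>k u. k > 0 \<Longrightarrow> u \<in> Zf X \<Longrightarrow> k \<star> u \<in> S \<Longrightarrow> u \<in> S"
  and h: "h = f + \<rho> * g" and d: "d1 > 0" "d2 > 0"
  and ann: "of_int d1 * h - c1 * h * h \<in> annih" "of_int d2 * g - c2 * h \<in> annih"
  and cov: "covers \<iota> (Zf X) (Jset f g (Zf X) [+] Kset f g)"
 shows "covers (\<iota> * (\<iota> * \<iota>)) (S \<inter> Jset f g (Zf X)) (Jset f g S)"
proof -
 have JU: "Jset f g (Zf X) = Jset h g (Zf X)" unfolding h by (rule Jset_change[symmetric, OF sgrp_Zf]) (rule opr_Zf)
 have JS: "Jset f g S = Jset h g S" unfolding h by (rule Jset_change[symmetric, OF S(1) st])
 have KK: "Kset f g = Kset h g" by (auto simp: Kset_def h opr_add opr_mult opr_linear)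
 let ?J = "Jset h g (Zf X)" and ?K = "Kset h g"
 have sJ: "sgrp ?J" by (rule sgrp_Jset[OF sgrp_Zf])
 have sJK: "sgrp (?J [+] ?K)" by (intro sgrp_setsum2 sJ sgrp_Kset)
 have cov': "covers \<iota> (Zf X) (?J [+] ?K)" using cov JU KK by simp
 have hh: "d1 \<star> opr h u = opr h (opr h (opr c1 u))" if "u \<in> Zf X" for u
 proof -
  have "opr (of_int d1 * h) u = opr (c1 * h * h) u" by (rule annih_eq[OF ann(1) that])
  then show ?thesis by (simp add: opr_mult opr_of_int opr_Zf opr_commute[of c1 h])
 qed
 have gh: "d2 \<star> opr g u = opr c2 (opr h u)" if "u \<in> Zf X" for u
 proof -
  have "opr (of_int d2 * g) u = opr (c2 * h) u" by (rule annih_eq[OF ann(2) that])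
  then show ?thesis by (simp add: opr_mult opr_of_int opr_Zf)
 qed
 define Y where "Y = {u\<in>Zf X. opr h u \<in> S}"
 have sY: "sgrp Y" by (rule sgrpI) (auto simp: Y_def opr_linear sgrp_0[OF sgrp_Zf] sgrp_diff[OF sgrp_Zf] sgrp_0[OF S(1)] sgrp_diff[OF S(1)])
 have YZ: "Y \<subseteq> Zf X" by (auto simp: Y_def)
 have SY: "S \<subseteq> Y" using S st by (auto simp: Y_def)
 have KY: "?K \<subseteq> Y" using sgrp_0[OF S(1)] by (auto simp: Y_def Kset_def)
 have gY: "opr g u \<in> S" if "u \<in> Y" for u
 proof (rule sd[OF d(2) opr_Zf])
  show "d2 \<star> opr g u \<in> S" using that gh[of u] st unfolding Y_def by auto
 qed
 have Y_stable: "opr r u \<in> Y" if "u \<in> Y" for r u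
  using that st[of "opr h u" r] opr_commute[of h r u] opr_Zf by (auto simp: Y_def)
 define B where "B = opr h ` Zf X [+] Y"
 have sB: "sgrp B" unfolding B_def by (intro sgrp_setsum2 sgrp_opr_image sgrp_Zf sY)
 have BZ: "B \<subseteq> Zf X" unfolding B_def by (intro setsum2_subset[OF sgrp_Zf] YZ) (use opr_Zf in blast)
 obtain nB where nB: "has_idx (Zf X) B nB"
 proof -
  have "d1 \<star> u \<in> B" if u: "u \<in> Zf X" for u
  proof -
   let ?y = "d1 \<star> u - opr h (opr c1 u)"
   have "opr h ?y = 0" using hh[OF u] by (simp add: opr_linear)
   then have "?y \<in> Y" using sgrp_diff[OF sgrp_Zf Zf_zmult[OF u] opr_Zf] sgrp_0[OF S(1)] by (simp add: Y_def)
   moreover have "opr h (opr c1 u) \<in> opr h ` Zf X" using opr_Zf by blast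
   ultimately have "opr h (opr c1 u) + ?y \<in> B" unfolding B_def by (intro setsum2_I)
   then show ?thesis by simp
  qed
  then show ?thesis using finite_index_Zf[OF fin d(1) sB] that by blast
 qed
 have gB: "opr g ` B \<subseteq> B"
 proof
  fix x assume "x \<in> opr g ` B"
  then obtain u y where "x = opr g (opr h u + y)" "u \<in> Zf X" "y \<in> Y" unfolding B_def setsum2_def by blast
  then have "x = opr h (opr g u) + opr g y" "opr g y \<in> Y" using Y_stable by (auto simp: opr_linear opr_commute[of g h])
  then show "x \<in> B" unfolding B_def using opr_Zf by (auto intro: setsum2_I)
 qed
 obtain dd where dd: "has_idx {v\<in>Zf X. opr g v \<in> B} B dd" "has_idx (Zf X) (opr g ` Zf X [+] B) dd"
  by (rule has_idx_ker_coker[OF sgrp_Zf sB BZ _ _ gB nB]) (use opr_Zf in \<open>auto simp: opr_linear\<close>)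
 have dd\<iota>: "dd \<le> \<iota>"
 proof (rule has_idx_le_covers[OF _ dd(2)])
  show "sgrp (opr g ` Zf X [+] B)" by (intro sgrp_setsum2 sgrp_opr_image sgrp_Zf sB)
  have "?J [+] ?K = opr g ` Zf X [+] (opr h ` Zf X [+] ?K)"
   unfolding Jset_def by (metis setsum2_assoc setsum2_commute)
  also have "\<dots> \<subseteq> opr g ` Zf X [+] B" unfolding B_def by (intro setsum2_mono KY) auto
  finally show "covers \<iota> (Zf X) (opr g ` Zf X [+] B)" using cov' covers_mono by blast
 qed
 have c1: "covers dd (S \<inter> ?J) (Jset h g Y)"
 proof (rule covers_via[OF has_idx_covers[OF dd(1)] sB, where P = "\<lambda>y v. \<exists>u\<in>Zf X. v \<in> Zf X \<and> y = opr h u + opr g v"])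
  fix y assume y: "y \<in> S \<inter> ?J"
  then obtain u v where uv: "y = opr h u + opr g v" "u \<in> Zf X" "v \<in> Zf X" by (blast elim: JsetE)
  have "opr g v = opr h (- u) + y" using uv(1) opr_linear(1)[of h 0 u] by (simp add: opr_linear)
  moreover have "- u \<in> Zf X" by (rule sgrp_minus[OF sgrp_Zf uv(2)])
  ultimately have "opr h (- u) + y \<in> B" unfolding B_def using y SY by (intro setsum2_I) auto
  then have "opr g v \<in> B" using \<open>opr g v = opr h (- u) + y\<close> by simp
  then show "\<exists>v\<in>{v\<in>Zf X. opr g v \<in> B}. \<exists>u\<in>Zf X. v \<in> Zf X \<and> y = opr h u + opr g v" using uv by blast
 next
  fix y y' v v' assume y: "y \<in> S \<inter> ?J" "y' \<in> S \<inter> ?J"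
   and "\<exists>u\<in>Zf X. v \<in> Zf X \<and> y = opr h u + opr g v" "\<exists>u\<in>Zf X. v' \<in> Zf X \<and> y' = opr h u + opr g v'" and vB: "v - v' \<in> B"
  then obtain u u' where u: "u \<in> Zf X" "y = opr h u + opr g v" "u' \<in> Zf X" "y' = opr h u' + opr g v'" by blast
  obtain w z where wz: "v - v' = opr h w + z" "w \<in> Zf X" "z \<in> Y" using vB unfolding B_def setsum2_def by blast
  let ?a = "u - u' + opr g w"
  have "y - y' = opr h (u - u') + opr g (v - v')" unfolding u by (simp add: opr_linear)
  also have "\<dots> = opr h ?a + opr g z" unfolding wz(1) by (simp add: opr_linear opr_commute[of g h])
  finally have e: "y - y' = opr h ?a + opr g z" .
  have "opr h ?a = (y - y') - opr g z" using e by simp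
  also have "\<dots> \<in> S" using y gY[OF wz(3)] by (intro sgrp_diff[OF S(1)]) auto
  finally have "?a \<in> Y" unfolding Y_def using u opr_Zf by (auto intro!: sgrp_add[OF sgrp_Zf] sgrp_diff[OF sgrp_Zf])
  then show "y - y' \<in> Jset h g Y" unfolding e using wz(3) by (rule JsetI)
 qed
 \<comment> \<open>An element z of Y that lies in J belongs to \<open>S\<close>: the multiple
   \<open>d2 \<star> z\<close> equals h t for some t, hence h h t lies in \<open>S\<close>, and the
   relation between \<open>d1 * h\<close> and \<open>c1 * h * h\<close> strips off one h because
   \<open>S\<close> is saturated.\<close>
 have c2: "covers \<iota> Y (S [+] ?K)"
 proof (rule covers_via[OF cov' sJK, where P = "\<lambda>y v. y = v"])
  fix y y' v v' assume "y \<in> Y" "y' \<in> Y" "y = v" "y' = v'" "v - v' \<in> ?J [+] ?K"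
  then have y: "y - y' \<in> Y" "y - y' \<in> ?J [+] ?K" using sgrp_diff[OF sY] by auto
  then obtain z k where zk: "y - y' = z + k" "z \<in> ?J" "k \<in> ?K" by (blast elim: setsum2_E)
  have "z = (y - y') - k" using zk(1) by simp
  then have zY: "z \<in> Y" using sgrp_diff[OF sY y(1)] zk(3) KY by blast
  obtain u v where uv: "z = opr h u + opr g v" "u \<in> Zf X" "v \<in> Zf X" using zk(2) by (rule JsetE)
  define t where "t = d2 \<star> u + opr c2 v"
  have tZ: "t \<in> Zf X" unfolding t_def by (intro sgrp_add[OF sgrp_Zf] Zf_zmult uv opr_Zf)
  have ht: "d2 \<star> z = opr h t" unfolding uv(1) t_def zmult_distrib gh[OF uv(3)]
   by (simp add: opr_linear opr_commute[of c2 h])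
  have "opr h (d2 \<star> z) \<in> S" unfolding opr_linear(3) by (rule sgrp_zmult[OF S(1)]) (use zY in \<open>auto simp: Y_def\<close>)
  then have "opr c1 (opr h (opr h t)) \<in> S" unfolding ht by (rule st)
  then have "d1 \<star> opr h t \<in> S" unfolding hh[OF tZ] by (simp add: opr_commute[of c1 h])
  then have "opr h t \<in> S" by (rule sd[OF d(1) opr_Zf])
  then have "d2 \<star> z \<in> S" using ht by simp
  then have "z \<in> S" using sd[OF d(2)] zY YZ by blast
  then show "y - y' \<in> S [+] ?K" unfolding zk(1) using zk(3) by (rule setsum2_I)
 qed (use YZ in blast)
 have c3: "covers (\<iota> * \<iota>) (Jset h g Y) (Jset h g S)"
 proof -
  obtain R where R: "finite R" "card R \<le> \<iota>" "\<forall>y\<in>Y. \<exists>r\<in>R. y - r \<in> S [+] ?K" using c2 by (auto simp: covers_def)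
  have "\<exists>r\<in>R. \<exists>s\<in>S. opr h y - opr h r = opr h s \<and> (\<exists>s\<in>S. opr g y - opr g r = opr g s)" if yY: "y \<in> Y" for y
  proof -
   obtain r where r0: "r \<in> R" "y - r \<in> S [+] ?K" using R(3) yY by blast
   obtain s k where r: "y - r = s + k" "s \<in> S" "k \<in> ?K" using r0(2) by (rule setsum2_E)
   have "opr h y - opr h r = opr h s" "opr g y - opr g r = opr g s"
    using r(3) opr_linear(1)[of h y r] opr_linear(1)[of g y r] unfolding r(1) by (simp_all add: opr_linear Kset_def)
   then show ?thesis using r0 r by blast
  qed
  note key = this
  let ?Q = "(\<lambda>(a,b). opr h a + opr g b) ` (R \<times> R)"
  have "card ?Q \<le> card (R \<times> R)" using R by (intro card_image_le) auto
  also have "\<dots> \<le> \<iota> * \<iota>" using R by (simp add: card_cartesian_product mult_le_mono)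
  finally have "card ?Q \<le> \<iota> * \<iota>" .
  moreover have "\<exists>r\<in>?Q. x - r \<in> Jset h g S" if x: "x \<in> Jset h g Y" for x
  proof -
   obtain a b where ab: "x = opr h a + opr g b" "a \<in> Y" "b \<in> Y" using x by (rule JsetE)
   obtain r s where r: "r \<in> R" "s \<in> S" "opr h a - opr h r = opr h s" using key[OF ab(2)] by blast
   obtain r' s' where r': "r' \<in> R" "s' \<in> S" "opr g b - opr g r' = opr g s'" using key[OF ab(3)] by blast
   have "x - (opr h r + opr g r') = (opr h a - opr h r) + (opr g b - opr g r')" unfolding ab by simp
   also have "\<dots> = opr h s + opr g s'" unfolding r r' ..
   also have "\<dots> \<in> Jset h g S" using r r' by (intro JsetI)
   finally have "x - (opr h r + opr g r') \<in> Jset h g S" .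
   moreover have "opr h r + opr g r' \<in> ?Q" using r r' by (intro image_eqI[of _ _ "(r, r')"]) auto
   ultimately show ?thesis by (rule bexI)
  qed
  moreover have "finite ?Q" using R(1) by blast
  ultimately show ?thesis unfolding covers_def by blast
 qed
 have "covers (dd * (\<iota> * \<iota>)) (S \<inter> ?J) (Jset h g S)" by (rule covers_trans[OF c1 c3])
 then show ?thesis unfolding JU JS by (rule covers_mono) (use dd\<iota> in auto)
qed

end

subsection \<open>Bounding the index of \<open>J + K\<close>\<close>

lemma has_idx_torsion:
 assumes "sgrp L" "has_idx (Zf X) L \<kappa>" "z \<in> Zf X" shows "\<exists>k>0. k \<star> z \<in> L"
proof (rule ccontr)
 assume c: "\<not> ?thesis"
 have key: "a = b" if "int a \<star> z - int b \<star> z \<in> L" for a b :: nat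
 proof (rule ccontr)
  assume "a \<noteq> b"
  then consider "int a - int b > 0" | "int b - int a > 0" by linarith
  then show False
  proof cases
   case 1 then show False using c that by (auto simp flip: zmult_distrib)
  next
   case 2 then show False using c sgrp_diff_commute[OF assms(1) that] by (auto simp flip: zmult_distrib)
  qed
 qed
 have "inj (\<lambda>a. int a \<star> z)" by (rule injI, rule key) (use sgrp_0[OF assms(1)] in simp)
 moreover have "finite (range (\<lambda>a. int a \<star> z)) \<and> card (range (\<lambda>a. int a \<star> z)) \<le> \<kappa>"
  by (rule covers_card_le[OF assms(1) has_idx_covers[OF assms(2)]]) (use assms(3) Zf_zmult key in \<open>auto dest: key\<close>)
 ultimately show False using finite_imageD infinite_UNIV_nat by blast
qed

context transitive_action
begin

text \<open>Both bounds on the set \<open>E\<close> of \<open>greedy_complement\<close> come from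
  \<open>c\<close>. The lattice \<open>?J [+] Zf E\<close> is spanned by vectors with column sums at
  most \<open>l1norm f + l1norm g + 1\<close>, so each class modulo it meets the cube and \<kappa>
  is at most \<open>c\<close>. The 0-1 vectors on \<open>E\<close> are incongruent modulo
  \<open>?J\<close>. Finally \<open>perp X ?J\<close> lies in \<open>Kset f g\<close>, since an
  operator and its adjoint have the same kernel.\<close>

lemma index_bound:
 assumes cov: "covers c (cubeZ X m) (Jset f g (Zf X))" and m: "l1norm f + l1norm g + 1 \<le> m"
 obtains \<iota> e where "covers \<iota> (Zf X) (Jset f g (Zf X) [+] Kset f g)" "\<iota> * fact e \<le> c\<^sup>2 * card X ^ e" "2 ^ e \<le> c"
proof -
 let ?J = "Jset f g (Zf X)"
 have J: "sgrp ?J" "?J \<subseteq> Zf X" by (rule sgrp_Jset[OF sgrp_Zf], rule Jset_Zf)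
 obtain E \<kappa> \<iota> t where E: "E \<subseteq> X" "\<forall>v\<in>Zf E. v \<in> sat X ?J \<longrightarrow> v = 0"
  and \<kappa>: "has_idx (Zf X) (?J [+] Zf E) \<kappa>" and \<iota>: "has_idx (Zf X) (?J [+] perp X ?J) \<iota>"
  and t: "has_idx (sat X ?J) ?J t" and bd: "\<iota> * t * fact (card E) \<le> \<kappa>\<^sup>2 * card X ^ card E"
  using greedy_complement[OF fin J] by blast
 let ?L = "?J [+] Zf E"
 have ZE: "Zf E \<subseteq> Zf X" by (rule Zf_mono[OF E(1)])
 have L: "sgrp ?L" "?L \<subseteq> Zf X" by (intro sgrp_setsum2 J sgrp_Zf, intro setsum2_subset[OF sgrp_Zf] J ZE)
 have finE: "finite E" using E(1) fin finite_subset by blast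
 have 1: "covers c (Zf X) ?L"
 proof -
  \<comment> \<open>Labels 0, 1, 2 stand for translates of \<open>f\<close>, translates of
    \<open>g\<close> and unit vectors of \<open>E\<close>. The padding by 0 outside \<open>E\<close>
    makes the index set a product.\<close>
  define ev where "ev = (\<lambda>(k::nat, c). if k = 0 then opr f (unit_fun c) else if k = 1 then opr g (unit_fun c)
    else if c \<in> E then unit_fun c else 0)"
  let ?C = "{0,1,2::nat} \<times> X"
  have sumC: "(\<Sum>p\<in>?C. F p) = (\<Sum>c\<in>X. F (0, c)) + ((\<Sum>c\<in>X. F (1, c)) + (\<Sum>c\<in>X. F (2, c)))" for F :: "nat \<times> 'x \<Rightarrow> 'z::comm_monoid_add"
   using fin unfolding sum.cartesian_product' by simp
  have evL: "ev p \<in> ?L" if pC: "p \<in> ?C" for p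
  proof -
   obtain k c where p: "p = (k, c)" "c \<in> X" using pC by auto
   have "opr f (unit_fun c) \<in> ?J" using JsetI[OF unit_fun_Zf[OF p(2)] sgrp_0[OF sgrp_Zf], of f g] by (simp add: opr_linear)
   moreover have "opr g (unit_fun c) \<in> ?J" using JsetI[OF sgrp_0[OF sgrp_Zf] unit_fun_Zf[OF p(2)], of f g] by (simp add: opr_linear)
   moreover have "unit_fun c \<in> Zf E" if "c \<in> E" using that by (rule unit_fun_Zf)
   ultimately show ?thesis using setsum2_left[OF sgrp_Zf, of ?J E] setsum2_right[OF J(1), of "Zf E"] sgrp_0[OF L(1)]
    by (auto simp: p ev_def)
  qed
  have ecol: "(\<Sum>p\<in>?C. \<bar>ev p x\<bar>) \<le> m" if x: "x \<in> X" for x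
  proof -
   have "(\<Sum>c\<in>X. \<bar>ev (2, c) x\<bar>) \<le> (\<Sum>c\<in>X. if c = x then 1 else 0)"
    by (rule sum_mono) (auto simp: ev_def unit_fun_def fun_apply)
   also have "\<dots> \<le> 1" using fin by simp
   finally have "(\<Sum>c\<in>X. \<bar>ev (2, c) x\<bar>) \<le> 1" .
   then show ?thesis unfolding sumC using m opr_unit_fun_column[of f x] opr_unit_fun_column[of g x] by (simp add: ev_def)
  qed
  have "\<exists>z'\<in>cubeZ X m. z - z' \<in> ?L" if z: "z \<in> Zf X" for z
  proof -
   obtain k where k: "k > 0" "k \<star> z \<in> ?L" using has_idx_torsion[OF L(1) \<kappa> z] by blast
   obtain a b v where abv: "k \<star> z = (opr f a + opr g b) + v" "a \<in> Zf X" "b \<in> Zf X" "v \<in> Zf E"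
    using k(2) by (blast elim: setsum2_E JsetE)
   define nn where "nn = (\<lambda>(k::nat, c). if k = 0 then a c else if k = 1 then b c else v c)"
   have exp: "opr r a = (\<Sum>c\<in>X. a c \<star> opr r (unit_fun c))" if "a \<in> Zf X" for r a
    using arg_cong[OF Zf_expand[OF that], of "opr r"] by (simp add: opr_sum opr_linear)
   have "v = (\<Sum>c\<in>X. v c \<star> unit_fun c)" by (rule Zf_expand) (use abv ZE in blast)
   also have "\<dots> = (\<Sum>c\<in>X. v c \<star> ev (2, c))"
    by (rule sum.cong) (use abv(4) in \<open>auto simp: ev_def Zf_def\<close>)
   finally have "k \<star> z = (\<Sum>p\<in>?C. nn p \<star> ev p)"
    unfolding sumC using abv(1) exp[OF abv(2), of f] exp[OF abv(3), of g] by (simp add: nn_def ev_def add.assoc)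
   then show ?thesis using bounded_representative[of ?C ?L ev X m z k nn] fin L evL ecol z k by blast
  qed
  then show ?thesis by (rule covers_representatives[OF cov J(1) L(1) setsum2_left[OF sgrp_Zf]])
 qed
 then have \<kappa>c: "\<kappa> \<le> c" by (rule has_idx_le_covers[OF L(1) \<kappa>])
 have 2: "2 ^ card E \<le> c"
 proof -
  let ?Y = "(\<lambda>B x. if x \<in> B then 1 else (0::int)) ` Pow E"
  have "inj_on (\<lambda>B x. if x \<in> B then 1 else (0::int)) (Pow E)"
   by (rule inj_onI) (auto simp: fun_eq_iff split: if_splits)
  then have "card ?Y = 2 ^ card E" using finE by (simp add: card_image card_Pow)
  moreover have "card ?Y \<le> c"
  proof -
   have "finite ?Y \<and> card ?Y \<le> c"
   proof (rule covers_card_le[OF J(1) cov])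
    show "?Y \<subseteq> cubeZ X m" using E(1) m l1norm_nonneg[of f] l1norm_nonneg[of g] by (auto simp: cubeZ_def Zf_def)
    fix y y' assume yy: "y \<in> ?Y" "y' \<in> ?Y" "y - y' \<in> ?J"
    have "y \<in> Zf E" "y' \<in> Zf E" using yy by (auto simp: Zf_def)
    then have "y - y' \<in> Zf E" by (rule sgrp_diff[OF sgrp_Zf])
    then show "y = y'" using E(2) yy(3) sat_superset[OF J(2)] by auto
   qed
   then show ?thesis by blast
  qed
  ultimately show ?thesis by simp
 qed
 have pK: "perp X ?J \<subseteq> Kset f g"
 proof
  fix u assume u: "u \<in> perp X ?J"
  then have uZ: "u \<in> Zf X" using perp_Zf by blast
  have "opr r u = 0" if r: "r = f \<or> r = g" for r
  proof (rule opr_star_eq_0[OF uZ])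
   have "ip X (opr r v) u = 0" if "v \<in> Zf X" for v
   proof -
    have "opr r v \<in> ?J" using r JsetI[OF that sgrp_0[OF sgrp_Zf], of f g] JsetI[OF sgrp_0[OF sgrp_Zf] that, of f g]
     by (auto simp: opr_linear)
    then show ?thesis using u ip_commute[of X u] by (auto simp: perp_def)
   qed
   then have "ip X (opr (lp_star r) u) (opr (lp_star r) u) = 0"
    using opr_star[of r "opr (lp_star r) u" u] opr_Zf ip_commute by metis
   then show "opr (lp_star r) u = 0" using ip_self_eq_0[OF fin opr_Zf] by blast
  qed
  then show "u \<in> Kset f g" using uZ by (simp add: Kset_def)
 qed
 have "covers \<iota> (Zf X) (?J [+] Kset f g)"
  by (rule covers_mono[OF has_idx_covers[OF \<iota>] _ _ setsum2_mono[OF _ pK]]) auto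
 moreover have "\<iota> * fact (card E) \<le> c\<^sup>2 * card X ^ card E"
 proof -
  have "0 \<in> sat X ?J" by (rule sgrp_0[OF sgrp_sat[OF J(1)]])
  then have "t > 0" using has_idx_pos[OF t] by blast
  then have "\<iota> * fact (card E) * 1 \<le> \<iota> * fact (card E) * t" by (intro mult_left_mono) auto
  also have "\<dots> \<le> \<kappa>\<^sup>2 * card X ^ card E" using bd by (simp add: algebra_simps)
  also have "\<dots> \<le> c\<^sup>2 * card X ^ card E" using \<kappa>c by (intro mult_right_mono power_mono) auto
  finally show ?thesis by simp
 qed
 ultimately show ?thesis using 2 by (rule that)
qed

end

subsection \<open>Matrices of Laurent polynomials\<close>

definition pact :: "(mon \<Rightarrow> 'x \<Rightarrow> 'x) \<Rightarrow> mon \<Rightarrow> nat \<times> 'x \<Rightarrow> nat \<times> 'x" where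
 "pact act = (\<lambda>y (i, c). (i, act y c))"

text \<open>Translations are orthogonal, so the adjoint of \<open>act_op X act r\<close> is the
  operator of the same \<open>r\<close> for this action. The adjoint of a matrix is then its plain
  transpose.\<close>

definition inv_act :: "(mon \<Rightarrow> 'x \<Rightarrow> 'x) \<Rightarrow> mon \<Rightarrow> 'x \<Rightarrow> 'x" where
 "inv_act act = (\<lambda>y. act (- y))"

definition mat_op :: "'x set \<Rightarrow> (mon \<Rightarrow> 'x \<Rightarrow> 'x) \<Rightarrow> nat \<Rightarrow> nat \<Rightarrow> (nat \<Rightarrow> nat \<Rightarrow> lp) \<Rightarrow> (nat \<times> 'x \<Rightarrow> int) \<Rightarrow> nat \<times> 'x \<Rightarrow> int" where
 "mat_op X act q p b z = (\<lambda>(i, c). if i < q then \<Sum>j<p. act_op X act (b i j) (\<lambda>c. z (j, c)) c else 0)"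

definition mat_image :: "'x set \<Rightarrow> (mon \<Rightarrow> 'x \<Rightarrow> 'x) \<Rightarrow> nat \<Rightarrow> nat \<Rightarrow> (nat \<Rightarrow> nat \<Rightarrow> lp) \<Rightarrow> (nat \<times> 'x \<Rightarrow> int) set" where
 "mat_image X act q p b = mat_op X act q p b ` Zf ({..<p} \<times> X)"

lemma finite_action_pact: "finite_action X act \<Longrightarrow> finite_action ({..<q} \<times> X) (pact act)"
 using finite_action_product unfolding pact_def by blast

lemma finite_action_inv_act: "finite_action X act \<Longrightarrow> finite_action X (inv_act act)"
proof -
 assume "finite_action X act"
 then interpret finite_action X act .
 have "act (- (y + z)) c = act (- y) (act (- z) c)" if "c \<in> X" for y z c
  using act_add[OF that, of "- y" "- z"] by simp
 note act_minus_add = this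
 show ?thesis by standard (use act_minus_add in \<open>simp_all add: fin act_closed act_0 inv_act_def\<close>)
qed

lemma transitive_action_inv_act:
 assumes "transitive_action X act pt" shows "transitive_action X (inv_act act) pt"
proof -
 interpret transitive_action X act pt by fact
 interpret I: finite_action X "inv_act act" by (rule finite_action_inv_act) unfold_locales
 show ?thesis
 proof
  show "\<exists>y. inv_act act y pt = c" if "c \<in> X" for c
   using trans[OF that] unfolding inv_act_def by (metis add.inverse_inverse)
 qed (rule pt)
qed

lemma act_op_pact:
 "act_op ({..<q::nat} \<times> X) (pact act) r u (i, c) = (if i < q then act_op X act r (\<lambda>c. u (i, c)) c else 0)"
 unfolding pact_def by (rule act_op_product)

lemma act_op_inv_act:
 assumes "finite_action X act"
 shows "ip X (act_op X act r u) v = ip X u (act_op X (inv_act act) r v)"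
proof -
 interpret finite_action X act by fact
 interpret I: finite_action X "inv_act act" by (rule finite_action_inv_act[OF assms])
 show ?thesis
 proof (induction r rule: lp_induct)
  case (one y)
  have "ip X (opr (frag_of y) u) v = ip X u (opr (lp_star (frag_of y)) v)" by (rule opr_star)
  also have "opr (lp_star (frag_of y)) v = I.opr (frag_of y) v"
   by (rule ext) (simp add: lp_star_def opr_frag_of I.opr_frag_of, simp add: inv_act_def)
  finally show ?case .
 qed (auto simp: ip_simps opr_diff I.opr_diff)
qed

lemma ip_product: "finite X \<Longrightarrow> ip ({..<q::nat} \<times> X) u v = (\<Sum>i<q. ip X (\<lambda>c. u (i, c)) (\<lambda>c. v (i, c)))"
 unfolding ip_def sum.cartesian_product' by simp

context finite_action
begin

lemma mat_op_slice: "i < q \<Longrightarrow> (\<lambda>c. mat_op X act q p b z (i, c)) = (\<Sum>j<p. opr (b i j) (\<lambda>c. z (j, c)))"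
 by (simp add: mat_op_def fun_eq_iff sum_fun_apply)

lemma mat_op_Zf: "mat_op X act q p b z \<in> Zf ({..<q} \<times> X)"
 unfolding Zf_def mat_op_def using opr_Zf by (auto simp: Zf_def intro!: sum.neutral)

lemma mat_op_linear: "mat_op X act q p b (z - w) = mat_op X act q p b z - mat_op X act q p b w"
 "mat_op X act q p b (k \<star> z) = k \<star> mat_op X act q p b z" "mat_op X act q p b 0 = 0"
 "mat_op X act q p b (z + w) = mat_op X act q p b z + mat_op X act q p b w"
proof -
 have s: "(\<lambda>c. (z - w) (j, c)) = (\<lambda>c. z (j, c)) - (\<lambda>c. w (j, c))" "(\<lambda>c. (k \<star> z) (j, c)) = k \<star> (\<lambda>c. z (j, c))"
  "(\<lambda>c. (0 :: nat \<times> 'x \<Rightarrow> int) (j, c)) = 0"  "(\<lambda>c. (z + w) (j, c)) = (\<lambda>c. z (j, c)) + (\<lambda>c. w (j, c))" for j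
  by (auto simp: fun_eq_iff fun_apply)
 show "mat_op X act q p b (z - w) = mat_op X act q p b z - mat_op X act q p b w"
  "mat_op X act q p b (k \<star> z) = k \<star> mat_op X act q p b z" "mat_op X act q p b 0 = 0"
  "mat_op X act q p b (z + w) = mat_op X act q p b z + mat_op X act q p b w"
  unfolding mat_op_def s opr_linear
  by (auto simp: fun_eq_iff fun_apply sum_subtractf sum_distrib_left sum.distrib)
qed

lemma mat_op_sum: "mat_op X act q p b (sum f A) = (\<Sum>a\<in>A. mat_op X act q p b (f a))"
 by (induction A rule: infinite_finite_induct) (auto simp: mat_op_linear)

lemma mat_op_opr: "act_op ({..<q} \<times> X) (pact act) r (mat_op X act q p b z) = mat_op X act q p b (act_op ({..<p} \<times> X) (pact act) r z)"
proof
 fix ic :: "nat \<times> 'x"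
 obtain i c where ic: "ic = (i, c)" by fastforce
 show "act_op ({..<q} \<times> X) (pact act) r (mat_op X act q p b z) ic = mat_op X act q p b (act_op ({..<p} \<times> X) (pact act) r z) ic"
 proof (cases "i < q")
  case True
  have e: "(\<lambda>c. act_op ({..<p} \<times> X) (pact act) r z (j, c)) = opr r (\<lambda>c. z (j, c))" if "j < p" for j
   using that by (auto simp: fun_eq_iff act_op_pact)
  have "act_op ({..<q} \<times> X) (pact act) r (mat_op X act q p b z) ic = opr r (\<Sum>j<p. opr (b i j) (\<lambda>c. z (j, c))) c"
   using True by (simp add: ic act_op_pact mat_op_slice)
  also have "\<dots> = (\<Sum>j<p. opr (b i j) (opr r (\<lambda>c. z (j, c)))) c"
   by (simp add: opr_sum opr_commute[of r])
  also have "\<dots> = mat_op X act q p b (act_op ({..<p} \<times> X) (pact act) r z) ic"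
   using True e by (simp add: ic mat_op_def sum_fun_apply)
  finally show ?thesis .
 qed (simp add: ic act_op_pact mat_op_def)
qed

lemma mat_op_adjoint:
 "ip ({..<q} \<times> X) (mat_op X act q p b z) w = ip ({..<p} \<times> X) z (mat_op X (inv_act act) p q (\<lambda>j i. b i j) w)"
proof -
 interpret I: finite_action X "inv_act act" by (rule finite_action_inv_act) unfold_locales
 have "ip ({..<q} \<times> X) (mat_op X act q p b z) w = (\<Sum>i<q. \<Sum>j<p. ip X (opr (b i j) (\<lambda>c. z (j, c))) (\<lambda>c. w (i, c)))"
  unfolding ip_product[OF fin] by (rule sum.cong) (simp_all add: mat_op_slice ip_sum)
 also have "\<dots> = (\<Sum>i<q. \<Sum>j<p. ip X (\<lambda>c. z (j, c)) (I.opr (b i j) (\<lambda>c. w (i, c))))"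
  by (intro sum.cong refl act_op_inv_act) unfold_locales
 also have "\<dots> = (\<Sum>j<p. \<Sum>i<q. ip X (\<lambda>c. z (j, c)) (I.opr (b i j) (\<lambda>c. w (i, c))))" by (rule sum.swap)
 also have "\<dots> = ip ({..<p} \<times> X) z (mat_op X (inv_act act) p q (\<lambda>j i. b i j) w)"
  unfolding ip_product[OF fin] by (rule sum.cong) (simp_all add: I.mat_op_slice ip_sum)
 finally show ?thesis .
qed

lemma sgrp_mat_image: "sgrp (mat_image X act q p b)"
 unfolding mat_image_def
proof (rule sgrpI)
 show "0 \<in> mat_op X act q p b ` Zf ({..<p} \<times> X)"
  by (rule image_eqI[of _ _ 0]) (auto simp: mat_op_linear sgrp_0[OF sgrp_Zf])
 fix x y assume "x \<in> mat_op X act q p b ` Zf ({..<p} \<times> X)" "y \<in> mat_op X act q p b ` Zf ({..<p} \<times> X)"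
 then obtain a c where "x = mat_op X act q p b a" "y = mat_op X act q p b c" "a \<in> Zf ({..<p} \<times> X)" "c \<in> Zf ({..<p} \<times> X)" by blast
 then show "x - y \<in> mat_op X act q p b ` Zf ({..<p} \<times> X)"
  by (intro image_eqI[of _ _ "a - c"]) (auto simp: mat_op_linear sgrp_diff[OF sgrp_Zf])
qed

lemma mat_image_Zf: "mat_image X act q p b \<subseteq> Zf ({..<q} \<times> X)"
 unfolding mat_image_def using mat_op_Zf by blast

lemma mat_image_stable:
 assumes "x \<in> mat_image X act q p b" shows "act_op ({..<q} \<times> X) (pact act) r x \<in> mat_image X act q p b"
proof -
 interpret P: finite_action "{..<p} \<times> X" "pact act" by (rule finite_action_pact) unfold_locales
 show ?thesis using assms unfolding mat_image_def by (auto simp: mat_op_opr P.opr_Zf)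
qed

lemma sat_mat_image_stable:
 assumes "x \<in> sat ({..<q} \<times> X) (mat_image X act q p b)"
 shows "act_op ({..<q} \<times> X) (pact act) r x \<in> sat ({..<q} \<times> X) (mat_image X act q p b)"
proof -
 interpret P: finite_action "{..<q} \<times> X" "pact act" by (rule finite_action_pact) unfold_locales
 obtain k where "k > 0" "k \<star> x \<in> mat_image X act q p b" using assms by (auto simp: sat_def)
 then have "k > 0 \<and> k \<star> P.opr r x \<in> mat_image X act q p b"
  using mat_image_stable[of "k \<star> x" q p b r] by (simp add: P.opr_linear)
 then show ?thesis using P.opr_Zf unfolding sat_def by blast
qed

end

lemma covers_power:
 assumes "covers n A B" "A \<subseteq> Zf X" "B \<subseteq> Zf X"
 shows "covers (n ^ q) {u\<in>Zf ({..<q::nat} \<times> X). \<forall>i<q. (\<lambda>c. u (i, c)) \<in> A} {u\<in>Zf ({..<q} \<times> X). \<forall>i<q. (\<lambda>c. u (i, c)) \<in> B}"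
proof -
 obtain R where R: "finite R" "card R \<le> n" "\<forall>h\<in>A. \<exists>r\<in>R. h - r \<in> B" using assms(1) by (auto simp: covers_def)
 define mk where "mk = (\<lambda>F (i::nat, c). if i < q \<and> c \<in> X then F i c else (0::int))"
 let ?Q = "mk ` ({..<q} \<rightarrow>\<^sub>E R)"
 have fQ: "finite ({..<q} \<rightarrow>\<^sub>E R)" using R(1) by (intro finite_PiE) auto
 have "card ?Q \<le> card ({..<q} \<rightarrow>\<^sub>E R)" by (rule card_image_le[OF fQ])
 also have "\<dots> = card R ^ q" by (simp add: card_PiE)
 also have "\<dots> \<le> n ^ q" using R(2) by (rule power_mono) simp
 finally have "card ?Q \<le> n ^ q" .
 moreover have "\<exists>r\<in>?Q. h - r \<in> {u\<in>Zf ({..<q} \<times> X). \<forall>i<q. (\<lambda>c. u (i, c)) \<in> B}"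
  if h: "h \<in> {u\<in>Zf ({..<q} \<times> X). \<forall>i<q. (\<lambda>c. u (i, c)) \<in> A}" for h
 proof -
  have "\<forall>i<q. \<exists>r\<in>R. (\<lambda>c. h (i, c)) - r \<in> B" using h R(3) by blast
  then obtain F where F: "\<And>i. i < q \<Longrightarrow> F i \<in> R \<and> (\<lambda>c. h (i, c)) - F i \<in> B" by metis
  let ?F = "restrict F {..<q}"
  have FZ: "F i \<in> Zf X" if i: "i < q" for i
  proof -
   have "(\<lambda>c. h (i, c)) \<in> Zf X" "(\<lambda>c. h (i, c)) - F i \<in> Zf X" using h F[OF i] i assms(2,3) by auto
   from sgrp_diff[OF sgrp_Zf this] show ?thesis by simp
  qed
  have "(\<lambda>c. (h - mk ?F) (i, c)) = (\<lambda>c. h (i, c)) - F i" if i: "i < q" for i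
   using i FZ[OF i] by (auto simp: fun_eq_iff mk_def fun_apply Zf_def)
  then have "\<forall>i<q. (\<lambda>c. (h - mk ?F) (i, c)) \<in> B" using F by simp
  moreover have "h - mk ?F \<in> Zf ({..<q} \<times> X)"
   using h by (intro sgrp_diff[OF sgrp_Zf]) (auto simp: mk_def Zf_def)
  moreover have "?F \<in> {..<q} \<rightarrow>\<^sub>E R" using F by auto
  ultimately show ?thesis by blast
 qed
 ultimately show ?thesis unfolding covers_def using fQ by (intro exI[of _ ?Q]) simp
qed

text \<open>Some multiple of each element of \<open>S\<close> is a combination of the columns of
  \<open>b\<close>, so modulo \<Lambda> the element may be taken from the cube: \<open>S\<close> has
  at most \<open>c ^ q\<close> classes modulo the sum of \<Lambda> and
  \<open>P.Jset f g (Zf U)\<close>. By the modular law the part of this sum inside \<open>S\<close>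
  is \<open>\<Lambda> [+] (S \<inter> P.Jset f g (Zf U))\<close>, and \<open>koszul_count\<close>
  descends from there to \<open>P.Jset f g S\<close>.\<close>

lemma torsion_mod_J_bound:
 assumes act: "transitive_action X act pt"
  and cov: "covers c (cubeZ X m) (finite_action.Jset X act f g (Zf X))"
  and m: "l1norm f + l1norm g + 1 \<le> m" "(\<Sum>i<q. \<Sum>j<p. l1norm (b i j)) \<le> m"
 defines "U \<equiv> {..<q} \<times> X"
 defines "\<Lambda> \<equiv> mat_image X act q p b"
 defines "S \<equiv> sat U \<Lambda>"
 obtains \<iota> e where "covers (c ^ q * (\<iota> ^ q * (\<iota> ^ q * \<iota> ^ q))) S (\<Lambda> [+] finite_action.Jset U (pact act) f g S)"
  "\<iota> * fact e \<le> c\<^sup>2 * card X ^ e" "2 ^ e \<le> c"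
proof -
 interpret transitive_action X act pt by fact
 have fa: "finite_action X act" by unfold_locales
 interpret P: finite_action U "pact act" unfolding U_def by (rule finite_action_pact[OF fa])
 obtain \<iota> e where \<iota>: "covers \<iota> (Zf X) (Jset f g (Zf X) [+] Kset f g)" "\<iota> * fact e \<le> c\<^sup>2 * card X ^ e" "2 ^ e \<le> c"
  by (rule index_bound[OF cov m(1)]) blast
 have popr: "P.opr r u (i, c) = (if i < q then opr r (\<lambda>c. u (i, c)) c else 0)" for r u i c
  unfolding U_def by (rule act_op_pact)
 have pslice: "(\<lambda>c. P.opr r u (i, c)) = opr r (\<lambda>c. u (i, c))" if "i < q" for r u i
  using that by (auto simp: popr)
 have eqU: "u = v" if "u \<in> Zf U" "v \<in> Zf U" "\<And>i. i < q \<Longrightarrow> (\<lambda>c. u (i, c)) = (\<lambda>c. v (i, c))" for u v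
 proof
  fix ic :: "nat \<times> 'a"
  obtain i c where ic: "ic = (i, c)" by fastforce
  show "u ic = v ic"
  proof (cases "i < q")
   case True then show ?thesis using fun_cong[OF that(3)[OF True], of c] ic by simp
  next
   case False then show ?thesis using that(1,2) ic by (auto simp: U_def Zf_def)
  qed
 qed
 define glue where "glue = (\<lambda>a (i::nat, c::'a). if i < q then a i c else (0::int))"
 have glue: "glue a \<in> Zf U" "\<And>i. i < q \<Longrightarrow> (\<lambda>c. glue a (i, c)) = a i" if "\<And>i. i < q \<Longrightarrow> a i \<in> Zf X" for a
  using that by (auto simp: glue_def U_def Zf_def)
 have annP: "r \<in> P.annih" if r: "r \<in> annih" for r
 proof -
  have "P.opr r u = 0" if "u \<in> Zf U" for u
  proof (rule eqU[OF P.opr_Zf sgrp_0[OF sgrp_Zf]])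
   fix i assume "i < q"
   then show "(\<lambda>c. P.opr r u (i, c)) = (\<lambda>c. (0 :: nat \<times> 'a \<Rightarrow> int) (i, c))"
    using r Zf_slice[of u q X i, folded U_def, OF \<open>u \<in> Zf U\<close>] unfolding annih_def by (simp add: pslice fun_apply zero_fun_def)
  qed
  then show ?thesis by (simp add: P.annih_def)
 qed
 have JP: "{u\<in>Zf U. \<forall>i<q. (\<lambda>c. u (i, c)) \<in> Jset f g (Zf X) [+] Kset f g} \<subseteq> P.Jset f g (Zf U) [+] P.Kset f g"
 proof
  fix u assume u: "u \<in> {u\<in>Zf U. \<forall>i<q. (\<lambda>c. u (i, c)) \<in> Jset f g (Zf X) [+] Kset f g}"
  then have "\<forall>i. \<exists>a b k. i < q \<longrightarrow> (\<lambda>c. u (i, c)) = opr f a + opr g b + k \<and> a \<in> Zf X \<and> b \<in> Zf X \<and> k \<in> Kset f g"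
   by (blast elim: setsum2_E JsetE)
  then obtain a b k where abk: "\<And>i. i < q \<Longrightarrow> (\<lambda>c. u (i, c)) = opr f (a i) + opr g (b i) + k i \<and> a i \<in> Zf X \<and> b i \<in> Zf X \<and> k i \<in> Kset f g"
   by metis
  have Z: "\<And>i. i < q \<Longrightarrow> a i \<in> Zf X" "\<And>i. i < q \<Longrightarrow> b i \<in> Zf X" "\<And>i. i < q \<Longrightarrow> k i \<in> Zf X"
   using abk by (auto simp: Kset_def)
  have Kk: "opr f (k i) = 0" "opr g (k i) = 0" if "i < q" for i using abk[OF that] by (auto simp: Kset_def)
  have "u = (P.opr f (glue a) + P.opr g (glue b)) + glue k"
  proof (rule eqU)
   show "P.opr f (glue a) + P.opr g (glue b) + glue k \<in> Zf U"
    by (intro sgrp_add[OF sgrp_Zf] P.opr_Zf glue Z)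
   fix i assume i: "i < q"
   have "(\<lambda>c. (P.opr f (glue a) + P.opr g (glue b) + glue k) (i, c)) = (\<lambda>c. P.opr f (glue a) (i, c)) + (\<lambda>c. P.opr g (glue b) (i, c)) + (\<lambda>c. glue k (i, c))"
    by (simp add: fun_eq_iff fun_apply)
   then show "(\<lambda>c. u (i, c)) = (\<lambda>c. (P.opr f (glue a) + P.opr g (glue b) + glue k) (i, c))"
    using abk[OF i] i glue(2)[OF Z(1) i] glue(2)[OF Z(2) i] glue(2)[OF Z(3) i] by (simp add: pslice)
  qed (use u in blast)
  moreover have "P.opr f (glue a) + P.opr g (glue b) \<in> P.Jset f g (Zf U)" by (intro P.JsetI glue Z)
  moreover have "glue k \<in> P.Kset f g"
  proof -
   have "P.opr r (glue k) = 0" if "\<And>i. i < q \<Longrightarrow> opr r (k i) = 0" for r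
   proof (rule eqU[OF P.opr_Zf sgrp_0[OF sgrp_Zf]])
    fix i assume i: "i < q"
    show "(\<lambda>c. P.opr r (glue k) (i, c)) = (\<lambda>c. (0 :: nat \<times> 'a \<Rightarrow> int) (i, c))"
     using that[OF i] i glue(2)[OF Z(3) i] by (simp add: pslice fun_apply zero_fun_def)
   qed
   then show ?thesis using Kk glue(1)[OF Z(3)] by (simp add: P.Kset_def)
  qed
  ultimately show "u \<in> P.Jset f g (Zf U) [+] P.Kset f g" using setsum2_I by metis
 qed
 have cov\<iota>: "covers (\<iota> ^ q) (Zf U) (P.Jset f g (Zf U) [+] P.Kset f g)"
 proof -
  have "Jset f g (Zf X) [+] Kset f g \<subseteq> Zf X"
   by (intro setsum2_subset[OF sgrp_Zf] Jset_Zf) (auto simp: Kset_def)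
  from covers_power[OF \<iota>(1) order_refl this, of q] show ?thesis
   by (rule covers_mono) (use JP Zf_slice[of _ q X] in \<open>auto simp: U_def\<close>)
 qed
 have J0: "Jset f g (Zf X) \<subseteq> Jset f g (Zf X) [+] Kset f g" by (rule setsum2_left[OF sgrp_Kset])
 have covc: "covers (c ^ q) (cubeZ U m) (P.Jset f g (Zf U))"
 proof -
  have "{u\<in>Zf U. \<forall>i<q. (\<lambda>c. u (i, c)) \<in> Jset f g (Zf X)} \<subseteq> P.Jset f g (Zf U)"
  proof
   fix u assume u: "u \<in> {u\<in>Zf U. \<forall>i<q. (\<lambda>c. u (i, c)) \<in> Jset f g (Zf X)}"
   then have "\<forall>i. \<exists>a b. i < q \<longrightarrow> (\<lambda>c. u (i, c)) = opr f a + opr g b \<and> a \<in> Zf X \<and> b \<in> Zf X"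
    by (blast elim: JsetE)
   then obtain a b where ab: "\<And>i. i < q \<Longrightarrow> (\<lambda>c. u (i, c)) = opr f (a i) + opr g (b i) \<and> a i \<in> Zf X \<and> b i \<in> Zf X"
    by metis
   have Z: "\<And>i. i < q \<Longrightarrow> a i \<in> Zf X" "\<And>i. i < q \<Longrightarrow> b i \<in> Zf X" using ab by auto
   have "u = P.opr f (glue a) + P.opr g (glue b)"
   proof (rule eqU)
    show "P.opr f (glue a) + P.opr g (glue b) \<in> Zf U" by (intro sgrp_add[OF sgrp_Zf] P.opr_Zf)
    fix i assume i: "i < q"
    have "(\<lambda>c. (P.opr f (glue a) + P.opr g (glue b)) (i, c)) = (\<lambda>c. P.opr f (glue a) (i, c)) + (\<lambda>c. P.opr g (glue b) (i, c))"
     by (simp add: fun_eq_iff fun_apply)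
    then show "(\<lambda>c. u (i, c)) = (\<lambda>c. (P.opr f (glue a) + P.opr g (glue b)) (i, c))"
     using ab[OF i] i glue(2)[OF Z(1) i] glue(2)[OF Z(2) i] by (simp add: pslice)
   qed (use u in blast)
   then show "u \<in> P.Jset f g (Zf U)" by (simp only:) (intro P.JsetI glue(1) Z)
  qed
  moreover have "cubeZ U m \<subseteq> {u\<in>Zf U. \<forall>i<q. (\<lambda>c. u (i, c)) \<in> cubeZ X m}"
   using Zf_slice[of _ q X] by (auto simp: cubeZ_def U_def)
  moreover have "cubeZ X m \<subseteq> Zf X" by (auto simp: cubeZ_def)
  ultimately show ?thesis using covers_power[OF cov _ Jset_Zf, of q] covers_mono[of "c ^ q"] unfolding U_def[symmetric] by blast
 qed
 have \<Lambda>: "sgrp \<Lambda>" "\<Lambda> \<subseteq> Zf U" unfolding \<Lambda>_def U_def by (rule sgrp_mat_image mat_image_Zf)+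
 have S: "sgrp S" "S \<subseteq> Zf U" "\<Lambda> \<subseteq> S" unfolding S_def by (rule sgrp_sat[OF \<Lambda>(1)] sat_Zf sat_superset[OF \<Lambda>(2)])+
 have S_stable: "P.opr r s \<in> S" if "s \<in> S" for r s
  using sat_mat_image_stable that unfolding S_def \<Lambda>_def U_def by blast
 have S_sat: "u \<in> S" if "k > 0" "u \<in> Zf U" "k \<star> u \<in> S" for k u
  using that unfolding S_def by (rule sat_saturated)
 let ?JU = "P.Jset f g (Zf U)"
 have sJU: "sgrp ?JU" by (rule P.sgrp_Jset[OF sgrp_Zf])
 have sL: "sgrp (\<Lambda> [+] ?JU)" by (intro sgrp_setsum2 \<Lambda> sJU)
 have step1: "covers (c ^ q) S (\<Lambda> [+] ?JU)"
 proof (rule covers_representatives[OF covc sJU sL setsum2_right[OF \<Lambda>(1)]])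
  fix z assume z: "z \<in> S"
  let ?C = "{..<p} \<times> X"
  let ?ev = "\<lambda>a. mat_op X act q p b (unit_fun a)"
  obtain k w where kw: "k > 0" "k \<star> z = mat_op X act q p b w" "w \<in> Zf ?C" "z \<in> Zf U"
   using z unfolding S_def sat_def \<Lambda>_def mat_image_def by blast
  interpret Q: finite_action ?C "pact act" by (rule finite_action_pact[OF fa])
  have "k \<star> z = (\<Sum>a\<in>?C. w a \<star> ?ev a)"
   unfolding kw(2) using arg_cong[OF Q.Zf_expand[OF kw(3)], of "mat_op X act q p b"] by (simp add: mat_op_sum mat_op_linear)
  moreover have "(\<Sum>a\<in>?C. \<bar>?ev a x\<bar>) \<le> m" if x: "x \<in> U" for x
  proof -
   obtain i c where ic: "x = (i, c)" "i < q" "c \<in> X" using x by (auto simp: U_def)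
   have sl: "(\<lambda>d. unit_fun (j, e) (j', d)) = (if j' = j then unit_fun e else 0)" for j j' :: nat and e :: 'a
    by (auto simp: fun_eq_iff unit_fun_def fun_apply)
   have "?ev (j, e) x = opr (b i j) (unit_fun e) c" if "j < p" for j e
   proof -
    have "?ev (j, e) x = (\<Sum>j'<p. if j' = j then opr (b i j) (unit_fun e) c else 0)"
    proof -
     have "opr (b i j') (if j' = j then unit_fun e else 0) c = (if j' = j then opr (b i j) (unit_fun e) c else 0)" for j'
      by (simp add: opr_linear fun_apply)
     then show ?thesis unfolding mat_op_def ic using ic(2) by (simp add: sl)
    qed
    then show ?thesis using that by simp
   qed
   then have "(\<Sum>a\<in>?C. \<bar>?ev a x\<bar>) = (\<Sum>j<p. \<Sum>e\<in>X. \<bar>opr (b i j) (unit_fun e) c\<bar>)"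
    unfolding sum.cartesian_product' by simp
   also have "\<dots> \<le> (\<Sum>j<p. l1norm (b i j))" by (intro sum_mono opr_unit_fun_column)
   also have "\<dots> \<le> (\<Sum>i<q. \<Sum>j<p. l1norm (b i j))"
    by (rule member_le_sum[of i "{..<q}" "\<lambda>i. \<Sum>j<p. l1norm (b i j)"]) (use ic in \<open>auto intro!: sum_nonneg l1norm_nonneg\<close>)
   finally show ?thesis using m(2) by simp
  qed
  moreover have "?ev a \<in> \<Lambda>" if "a \<in> ?C" for a
   unfolding \<Lambda>_def mat_image_def using unit_fun_Zf[OF that] by blast
  ultimately have "\<exists>z'\<in>cubeZ U m. z - z' \<in> \<Lambda>"
   using bounded_representative[of ?C \<Lambda> ?ev U m z k w] fin \<Lambda> kw by blast
  then show "\<exists>z'\<in>cubeZ U m. z - z' \<in> \<Lambda> [+] ?JU" using setsum2_left[OF sJU] by blast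
 qed
 obtain h \<rho> d1 c1 d2 c2 where h: "h = f + \<rho> * g" "d1 > 0" "d2 > 0"
  "of_int d1 * h - c1 * h * h \<in> annih" "of_int d2 * g - c2 * h \<in> annih"
  by (rule koszul_elements) blast
 have step2: "covers (\<iota> ^ q * (\<iota> ^ q * \<iota> ^ q)) (S \<inter> ?JU) (P.Jset f g S)"
  by (rule P.koszul_count[OF S(1,2) S_stable S_sat h(1-3) annP[OF h(4)] annP[OF h(5)] cov\<iota>])
 have step2': "covers (\<iota> ^ q * (\<iota> ^ q * \<iota> ^ q)) (\<Lambda> [+] (S \<inter> ?JU)) (\<Lambda> [+] P.Jset f g S)"
  by (rule covers_setsum2[OF step2])
 have step1': "covers (c ^ q) S (\<Lambda> [+] (S \<inter> ?JU))"
 proof (rule covers_via[OF step1 sL, where P = "\<lambda>y v. y = v"])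
  fix y y' v v' assume a: "y \<in> S" "y' \<in> S" "y = v" "y' = v'" "v - v' \<in> \<Lambda> [+] ?JU"
  then have "y - y' \<in> S" "y - y' \<in> \<Lambda> [+] ?JU" using sgrp_diff[OF S(1)] by auto
  then obtain l j where lj: "y - y' = l + j" "l \<in> \<Lambda>" "j \<in> ?JU" by (blast elim: setsum2_E)
  have "j = (y - y') - l" using lj(1) by simp
  then have "j \<in> S" using sgrp_diff[OF S(1) \<open>y - y' \<in> S\<close>] lj(2) S(3) by blast
  then show "y - y' \<in> \<Lambda> [+] (S \<inter> ?JU)" unfolding lj(1) using lj by (intro setsum2_I) auto
 qed blast
 show ?thesis by (rule that[OF covers_trans[OF step1' step2'] \<iota>(2,3)])
qed

subsection \<open>Duality of torsion\<close>

text \<open>This is the linking form. If \<open>k \<star> x\<close> is the image of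
  \<open>z\<close>, then \<chi> sends \<open>y\<close> in S' to \<open>ip z y / k\<close> modulo 1.
  Vectors killed by the matrix are orthogonal to S', so the choice of \<open>z\<close> is
  immaterial. Elements whose multiples by \<open>f\<close> and \<open>g\<close> lie in \<Lambda>
  pair integrally with \<Lambda>' and with \<open>Jset f g S'\<close>, and incongruent elements give
  different characters, so \<open>card_characters_le\<close> applies.\<close>

theorem torsion_duality:
 fixes b :: "nat \<Rightarrow> nat \<Rightarrow> lp" and p q :: nat
 assumes fa: "finite_action X act"
 defines "\<Lambda> \<equiv> mat_image X act q p b" and "\<Lambda>' \<equiv> mat_image X (inv_act act) p q (\<lambda>j i. b i j)"
 defines "S \<equiv> sat ({..<q} \<times> X) \<Lambda>" and "S' \<equiv> sat ({..<p} \<times> X) \<Lambda>'"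
 assumes cov: "covers n S' (\<Lambda>' [+] finite_action.Jset ({..<p} \<times> X) (pact (inv_act act)) f g S')"
 shows "covers n {x\<in>S. act_op ({..<q} \<times> X) (pact act) f x \<in> \<Lambda> \<and> act_op ({..<q} \<times> X) (pact act) g x \<in> \<Lambda>} \<Lambda>"
proof -
 interpret finite_action X act by fact
 have fa': "finite_action X (inv_act act)" by (rule finite_action_inv_act[OF fa])
 interpret I: finite_action X "inv_act act" by fact
 let ?U = "{..<q} \<times> X" and ?V = "{..<p} \<times> X"
 let ?m = "mat_op X act q p b" and ?mt = "mat_op X (inv_act act) p q (\<lambda>j i. b i j)"
 interpret PU: finite_action ?U "pact act" by (rule finite_action_pact[OF fa])
 interpret PV: finite_action ?V "pact act" by (rule finite_action_pact[OF fa])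
 interpret PV': finite_action ?V "pact (inv_act act)" by (rule finite_action_pact[OF fa'])
 have inv_pact: "inv_act (pact act) = pact (inv_act act)" by (auto simp: inv_act_def pact_def)
 have adjV: "ip ?V (PV.opr r u) v = ip ?V u (PV'.opr r v)" for r u v
  using act_op_inv_act[OF PV.finite_action_axioms, of r u v] unfolding inv_pact .
 have \<Lambda>: "sgrp \<Lambda>" "\<Lambda> \<subseteq> Zf ?U" unfolding \<Lambda>_def by (rule sgrp_mat_image mat_image_Zf)+
 have \<Lambda>': "sgrp \<Lambda>'" "\<Lambda>' \<subseteq> Zf ?V" unfolding \<Lambda>'_def by (rule I.sgrp_mat_image I.mat_image_Zf)+
 have S: "sgrp S" "S \<subseteq> Zf ?U" "\<Lambda> \<subseteq> S" unfolding S_def by (rule sgrp_sat[OF \<Lambda>(1)] sat_Zf sat_superset[OF \<Lambda>(2)])+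
 have S': "sgrp S'" "S' \<subseteq> Zf ?V" "\<Lambda>' \<subseteq> S'" unfolding S'_def by (rule sgrp_sat[OF \<Lambda>'(1)] sat_Zf sat_superset[OF \<Lambda>'(2)])+
 let ?K = "\<Lambda>' [+] PV'.Jset f g S'"
 have sK: "sgrp ?K" by (intro sgrp_setsum2 \<Lambda>' PV'.sgrp_Jset S')
 have S'_stable: "PV'.opr r s \<in> S'" if "s \<in> S'" for r s
  using I.sat_mat_image_stable that unfolding S'_def \<Lambda>'_def by blast
 have KS': "?K \<subseteq> S'"
  unfolding PV'.Jset_def by (intro setsum2_subset[OF S'(1)] S') (use S'_stable in blast)+
 obtain n' where n': "n' \<le> n" "has_idx S' ?K n'" using covers_imp_has_idx[OF sK cov] by blast
 define H where "H = {x\<in>S. PU.opr f x \<in> \<Lambda> \<and> PU.opr g x \<in> \<Lambda>}"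
 have sH: "sgrp H" by (rule sgrpI) (auto simp: H_def PU.opr_linear sgrp_0 sgrp_diff S \<Lambda>)
 have \<Lambda>H: "\<Lambda> \<subseteq> H" unfolding H_def using S(3) mat_image_stable unfolding \<Lambda>_def by blast
 have HS: "H \<subseteq> S" by (auto simp: H_def)
 obtain N where "has_idx S \<Lambda> N" using sat_finite_index[OF _ \<Lambda>] fin unfolding S_def by auto
 then obtain N' where N': "has_idx H \<Lambda> N'"
  using covers_imp_has_idx[OF \<Lambda>(1) covers_mono[OF has_idx_covers order_refl HS order_refl]] by blast
 then obtain R where R: "R \<subseteq> H" "finite R" "card R = N'" "\<forall>h\<in>H. \<exists>r\<in>R. h - r \<in> \<Lambda>" "\<forall>r\<in>R. \<forall>r'\<in>R. r - r' \<in> \<Lambda> \<longrightarrow> r = r'"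
  unfolding has_idx_def by blast
 have "\<forall>x\<in>R. \<exists>k z. k > 0 \<and> k \<star> x = ?m z \<and> z \<in> Zf ?V"
  using R(1) HS unfolding S_def sat_def \<Lambda>_def mat_image_def by blast
 then obtain k z where kz: "\<And>x. x \<in> R \<Longrightarrow> k x > 0 \<and> k x \<star> x = ?m (z x) \<and> z x \<in> Zf ?V" by metis
 define \<chi> where "\<chi> = (\<lambda>x y. real_of_int (ip ?V (z x) y) / real_of_int (k x))"
 have ker: "ip ?V v s = 0" if v: "?m v = 0" "s \<in> S'" for v s
 proof -
  obtain l w where lw: "l > 0" "l \<star> s = ?mt w" using v(2) unfolding S'_def sat_def \<Lambda>'_def mat_image_def by blast
  have "l * ip ?V v s = ip ?V v (?mt w)" unfolding lw(2)[symmetric] by (simp add: ip_simps)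
  also have "\<dots> = ip ?U (?m v) w" by (rule mat_op_adjoint[symmetric])
  finally show ?thesis using lw(1) v(1) by (simp add: ip_simps)
 qed
 have int_div: "real_of_int a / real_of_int d \<in> \<int>" if "a = d * e" "d > 0" for a d e
  using that by simp
 have "card R \<le> n'"
 proof (rule card_characters_le[OF S'(1) sK KS' n'(2) R(2), of \<chi>])
  fix x u v assume x: "x \<in> R"
  show "\<chi> x (u + v) - \<chi> x u - \<chi> x v \<in> \<int>" by (simp add: \<chi>_def ip_simps add_divide_distrib)
 next
  fix x y assume x: "x \<in> R" "y \<in> ?K"
  then obtain w s s' where y: "y = ?mt w + (PV'.opr f s + PV'.opr g s')" "s \<in> S'" "s' \<in> S'"
   unfolding \<Lambda>'_def mat_image_def by (blast elim: setsum2_E PV'.JsetE)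
  have 1: "ip ?V (z x) (?mt w) = k x * ip ?U x w"
   using kz[OF x(1)] mat_op_adjoint[of q p b "z x" w] by (metis ip_simps(3))
  have 2: "\<exists>e. ip ?V (z x) (PV'.opr r s) = k x * e" if r: "r = f \<or> r = g" and s: "s \<in> S'" for r s
  proof -
   have "PU.opr r x \<in> \<Lambda>" using r x(1) R(1) by (auto simp: H_def)
   then obtain z' where z': "PU.opr r x = ?m z'" unfolding \<Lambda>_def mat_image_def by blast
   have "?m (PV.opr r (z x)) = PU.opr r (?m (z x))" by (rule mat_op_opr[symmetric])
   also have "\<dots> = PU.opr r (k x \<star> x)" using kz[OF x(1)] by simp
   also have "\<dots> = k x \<star> ?m z'" using z' by (simp add: PU.opr_linear)
   finally have "?m (PV.opr r (z x) - k x \<star> z') = 0" by (simp add: mat_op_linear)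
   then have "ip ?V (PV.opr r (z x) - k x \<star> z') s = 0" using s by (rule ker)
   then have "ip ?V (z x) (PV'.opr r s) = k x * ip ?V z' s" unfolding adjV[symmetric] by (simp add: ip_simps)
   then show ?thesis by blast
  qed
  obtain e1 e2 where "ip ?V (z x) (PV'.opr f s) = k x * e1" "ip ?V (z x) (PV'.opr g s') = k x * e2"
   using 2[of f s, OF disjI1[OF refl] y(2)] 2[of g s', OF disjI2[OF refl] y(3)] by blast
  then have "ip ?V (z x) y = k x * (ip ?U x w + (e1 + e2))" using 1 unfolding y(1) by (simp add: ip_simps algebra_simps)
  then show "\<chi> x y \<in> \<int>" unfolding \<chi>_def using kz[OF x(1)] by (intro int_div) auto
 next
  fix x x' assume x: "x \<in> R" "x' \<in> R" and d: "\<And>u. u \<in> S' \<Longrightarrow> \<chi> x u - \<chi> x' u \<in> \<int>"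
  define Z where "Z = k x' \<star> z x - k x \<star> z x'"
  define \<kappa> where "\<kappa> = k x * k x'"
  have k0: "k x > 0" "k x' > 0" "\<kappa> > 0" using kz x by (auto simp: \<kappa>_def)
  have ZZ: "Z \<in> Zf ?V" unfolding Z_def using kz x by (intro sgrp_diff[OF sgrp_Zf] Zf_zmult) auto
  have mZ: "?m Z = \<kappa> \<star> (x - x')"
  proof -
   have "?m Z = k x' \<star> (k x \<star> x) - k x \<star> (k x' \<star> x')" unfolding Z_def using kz[OF x(1)] kz[OF x(2)] by (simp add: mat_op_linear)
   then show ?thesis by (simp add: \<kappa>_def zmult_distrib mult.commute)
  qed
  define S0 where "S0 = {v\<in>Zf ?V. ?m v = 0}"
  have "S0 = perp ?V \<Lambda>'"
  proof
   show "S0 \<subseteq> perp ?V \<Lambda>'" using ker S'(3) unfolding S0_def perp_def by blast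
   show "perp ?V \<Lambda>' \<subseteq> S0"
   proof
    fix v assume v: "v \<in> perp ?V \<Lambda>'"
    have "ip ?U (?m v) (?m v) = ip ?V v (?mt (?m v))" by (rule mat_op_adjoint)
    also have "\<dots> = 0" using v mat_op_Zf unfolding perp_def \<Lambda>'_def mat_image_def by blast
    finally have "?m v = 0" using ip_self_eq_0[OF PU.fin mat_op_Zf] by blast
    then show "v \<in> S0" using v perp_Zf unfolding S0_def by blast
   qed
  qed
  then have pS0: "perp ?V S0 = S'" unfolding S'_def using perp_perp_sat[OF PV.fin \<Lambda>'] by simp
  \<comment> \<open>The kernel \<open>S0\<close> of the matrix is saturated with complement S'.
    Integrality of all pairings says that \<open>Z\<close> pairs into multiples of \<kappa> with S',
    so \<open>Z\<close> is divisible by \<kappa> modulo \<open>S0\<close>.\<close>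
  obtain w where w: "w \<in> Zf ?V" "Z - \<kappa> \<star> w \<in> S0"
  proof (rule saturated_dvd[OF PV.fin _ _ _ ZZ])
   show "sgrp S0" unfolding \<open>S0 = perp ?V \<Lambda>'\<close> by (rule sgrp_perp)
   show "S0 \<subseteq> Zf ?V" by (auto simp: S0_def)
   have "?m u = 0" if "l > 0" "l \<star> ?m u = 0" for l u
    using that by (auto simp: fun_eq_iff fun_apply)
   then show "\<forall>l>0. \<forall>u\<in>Zf ?V. l \<star> u \<in> S0 \<longrightarrow> u \<in> S0" by (simp add: S0_def mat_op_linear)
   fix y assume "y \<in> perp ?V S0"
   then have y: "y \<in> S'" using pS0 by simp
   have "\<chi> x y - \<chi> x' y = real_of_int (ip ?V Z y) / real_of_int \<kappa>"
    using k0 unfolding \<chi>_def Z_def \<kappa>_def by (simp add: ip_simps field_simps)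
   then obtain e where "real_of_int (ip ?V Z y) / real_of_int \<kappa> = of_int e" using d[OF y] by (metis Ints_cases)
   then have "real_of_int (ip ?V Z y) = real_of_int (\<kappa> * e)" using k0 by (simp add: field_simps)
   then have "ip ?V Z y = \<kappa> * e" by (simp only: of_int_eq_iff)
   then show "\<kappa> dvd ip ?V y Z" by (simp add: ip_commute)
  qed blast
  have "?m Z = \<kappa> \<star> ?m w" using w(2) by (simp add: S0_def mat_op_linear)
  then have "\<kappa> \<star> ((x - x') - ?m w) = 0" using mZ by (simp add: zmult_distrib)
  then have "(x - x') - ?m w = 0" using k0(3) by (auto simp: fun_eq_iff fun_apply)
  then have "x - x' \<in> \<Lambda>" using w(1) unfolding \<Lambda>_def mat_image_def by auto
  then show "x = x'" using R(5) x by blast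
 qed
 then have "N' \<le> n" using R(3) n'(1) by simp
 then show ?thesis using covers_mono[OF has_idx_covers[OF N'], of n H \<Lambda>] by (simp add: H_def)
qed

section \<open>Ideals of zero entropy\<close>

definition mkmon :: "nat \<Rightarrow> (nat \<Rightarrow> int) \<Rightarrow> mon" where
 "mkmon n f = Abs_poly_mapping (\<lambda>i. if i < n then f i else 0)"

definition Rn :: "nat \<Rightarrow> lp set" where
 "Rn n = {r. \<forall>k\<in>keys r. keys k \<subseteq> {..<n}}"

text \<open>Half-open in every variable, so that translates by multiples of the side length tile
  larger boxes.\<close>

definition ibox :: "nat \<Rightarrow> int \<Rightarrow> int \<Rightarrow> mon set" where
 "ibox n a b = {k. keys k \<subseteq> {..<n} \<and> (\<forall>i\<in>{..<n}. lookup k i \<in> {a..<b})}"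

definition coef_box :: "mon set \<Rightarrow> int set \<Rightarrow> lp set" where
 "coef_box B A = {r. keys r \<subseteq> B \<and> (\<forall>k\<in>B. lookup r k \<in> A)}"

abbreviation cube :: "nat \<Rightarrow> int \<Rightarrow> int \<Rightarrow> int \<Rightarrow> lp set" where
 "cube n a b m \<equiv> coef_box (ibox n a b) {-m..m}"

definition rid :: "'r::comm_ring_1 set \<Rightarrow> 'r set \<Rightarrow> bool" where
 "rid S I \<longleftrightarrow> sgrp I \<and> I \<subseteq> S \<and> (\<forall>s\<in>S. \<forall>x\<in>I. s * x \<in> I)"

text \<open>A single side length suffices for each rate, since larger boxes are tiled by translates
  as in \<open>covers_ibox\<close>. It may depend on \<open>m\<close>: multiplication by fixed
  polynomials enlarges coefficients.\<close>

definition zent :: "nat \<Rightarrow> lp set \<Rightarrow> bool" where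
 "zent n I \<longleftrightarrow> (\<forall>m\<ge>0. \<forall>\<epsilon>>0. \<exists>L>0. \<exists>c. covers c (cube n 0 (int L) m) I \<and> real c \<le> exp (\<epsilon> * real L ^ n))"

section \<open>Boxes of exponents and cubes of Laurent polynomials\<close>

lemma lookup_mkmon: "lookup (mkmon n f) i = (if i < n then f i else 0)"
 unfolding mkmon_def by (subst lookup_Abs_poly_mapping) auto

lemma keys_mkmon: "keys (mkmon n f) \<subseteq> {..<n}"
 by (auto simp: in_keys_iff lookup_mkmon split: if_splits)

lemma card_poly_mapping_box:
 fixes A :: "int set"
 assumes "finite B" "finite A"
 shows "finite {r :: 'b \<Rightarrow>\<^sub>0 int. keys r \<subseteq> B \<and> (\<forall>k\<in>B. lookup r k \<in> A)}"
  "card {r :: 'b \<Rightarrow>\<^sub>0 int. keys r \<subseteq> B \<and> (\<forall>k\<in>B. lookup r k \<in> A)} = card A ^ card B"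
proof -
 let ?M = "{r :: 'b \<Rightarrow>\<^sub>0 int. keys r \<subseteq> B \<and> (\<forall>k\<in>B. lookup r k \<in> A)}"
 let ?f = "\<lambda>r :: 'b \<Rightarrow>\<^sub>0 int. restrict (lookup r) B"
 have inj: "inj_on ?f ?M"
 proof (rule inj_onI)
  fix r s assume rs: "r \<in> ?M" "s \<in> ?M" "?f r = ?f s"
  show "r = s"
  proof (rule poly_mapping_eqI)
   fix k
   show "lookup r k = lookup s k"
   proof (cases "k \<in> B")
    case True then show ?thesis using fun_cong[OF rs(3), of k] by simp
   next
    case False
    then have "k \<notin> keys r" "k \<notin> keys s" using rs by auto
    then show ?thesis by (simp add: in_keys_iff)
   qed
  qed
 qed
 have im: "?f ` ?M = B \<rightarrow>\<^sub>E A"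
 proof
  show "?f ` ?M \<subseteq> B \<rightarrow>\<^sub>E A" by auto
  show "B \<rightarrow>\<^sub>E A \<subseteq> ?f ` ?M"
  proof
   fix g assume g: "g \<in> B \<rightarrow>\<^sub>E A"
   let ?r = "Abs_poly_mapping (\<lambda>k. if k \<in> B then g k else 0)"
   have "finite {k. (if k \<in> B then g k else 0) \<noteq> 0}" by (rule finite_subset[OF _ assms(1)]) auto
   then have l: "lookup ?r = (\<lambda>k. if k \<in> B then g k else 0)" by simp
   have "?f ?r = g" unfolding l using g by (auto simp: fun_eq_iff PiE_def extensional_def)
   moreover have "?r \<in> ?M" using g by (auto simp: l in_keys_iff split: if_splits)
   ultimately show "g \<in> ?f ` ?M" by (metis (no_types, lifting) image_eqI)
  qed
 qed
 have "finite (B \<rightarrow>\<^sub>E A)" using assms by (intro finite_PiE) auto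
 then show "finite ?M" using finite_imageD[OF _ inj] im by simp
 show "card ?M = card A ^ card B" using card_image[OF inj] im card_PiE[OF assms(1), of "\<lambda>_. A"] by simp
qed

lemma ibox_card: "finite (ibox n a b)" "card (ibox n a b) = nat (b - a) ^ n"
 using card_poly_mapping_box[of "{..<n}" "{a..<b}"] by (auto simp: ibox_def)

lemma coef_box_card: assumes "finite A" "finite B" shows "finite (coef_box B A)" "card (coef_box B A) = card A ^ card B"
 using card_poly_mapping_box[OF assms(2,1)] by (auto simp: coef_box_def)

lemma cube_iff: "0 \<le> m \<Longrightarrow> r \<in> cube n a b m \<longleftrightarrow> keys r \<subseteq> ibox n a b \<and> (\<forall>k. \<bar>lookup r k\<bar> \<le> m)"
proof
 assume m: "0 \<le> m" and r: "r \<in> cube n a b m"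
 have "\<bar>lookup r k\<bar> \<le> m" for k
 proof (cases "k \<in> ibox n a b")
  case True
  then have "lookup r k \<in> {-m..m}" using r by (simp add: coef_box_def)
  then show ?thesis by (simp add: abs_le_iff)
 next
  case False
  then have "k \<notin> keys r" using r by (auto simp: coef_box_def)
  then show ?thesis using m by (simp add: in_keys_iff)
 qed
 then show "keys r \<subseteq> ibox n a b \<and> (\<forall>k. \<bar>lookup r k\<bar> \<le> m)" using r by (simp add: coef_box_def)
next
 assume "keys r \<subseteq> ibox n a b \<and> (\<forall>k. \<bar>lookup r k\<bar> \<le> m)"
 then show "r \<in> cube n a b m" by (auto simp: coef_box_def abs_le_iff minus_le_iff)
qed

lemma ibox_mono: "a' \<le> a \<Longrightarrow> b \<le> b' \<Longrightarrow> ibox n a b \<subseteq> ibox n a' b'"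
 by (force simp: ibox_def)

lemma cube_mono: "0 \<le> m \<Longrightarrow> a' \<le> a \<Longrightarrow> b \<le> b' \<Longrightarrow> m \<le> m' \<Longrightarrow> cube n a b m \<subseteq> cube n a' b' m'"
 using ibox_mono[of a' a b b' n] by (simp add: cube_iff subset_iff) (meson order_trans)

lemma cube_Rn: "cube n a b m \<subseteq> Rn n"
 by (auto simp: coef_box_def Rn_def ibox_def)

lemma cube_0: "0 \<le> m \<Longrightarrow> 0 \<in> cube n a b m"
 by (simp add: cube_iff)

lemma sgrp_Rn: "sgrp (Rn n)"
 by (rule sgrpI) (use keys_diff in \<open>fastforce simp: Rn_def\<close>)+

lemma Rn_mult: assumes "r \<in> Rn n" "s \<in> Rn n" shows "r * s \<in> Rn n"
proof -
 have "keys k \<subseteq> {..<n}" if k: "k \<in> keys (r * s)" for k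
 proof -
  obtain a b where "k = a + b" "a \<in> keys r" "b \<in> keys s" using k keys_mult[of r s] by blast
  then show ?thesis using assms keys_add[of a b] unfolding Rn_def by blast
 qed
 then show ?thesis by (simp add: Rn_def)
qed

lemma Rn_frag_of: "frag_of k \<in> Rn n \<longleftrightarrow> keys k \<subseteq> {..<n}"
 by (simp add: Rn_def)

lemma Rn_1: "1 \<in> Rn n"
 using Rn_frag_of[of 0 n] by simp

lemma Rn_power: "r \<in> Rn n \<Longrightarrow> r ^ i \<in> Rn n"
 by (induction i) (auto simp: Rn_1 Rn_mult)

lemma rid_mult: "rid S I \<Longrightarrow> s \<in> S \<Longrightarrow> x \<in> I \<Longrightarrow> s * x \<in> I"
 and rid_sgrp: "rid S I \<Longrightarrow> sgrp I" and rid_subset: "rid S I \<Longrightarrow> I \<subseteq> S"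
 by (auto simp: rid_def)

lemma lookup_single_mult: "lookup (Poly_Mapping.single y c * x) k = c * lookup x (k - y)" for x :: lp
proof (induction x rule: lp_induct)
 case (one z)
 have "Poly_Mapping.single y c * frag_of z = Poly_Mapping.single (y + z) c" by (simp add: mult_single)
 then show ?case by (auto simp: lookup_single when_def)
qed (auto simp: lookup_minus right_diff_distrib)

lemma lookup_frag_mult: "lookup (frag_of y * x) k = lookup x (k - y)" for x :: lp
 using lookup_single_mult[of y 1 x k] by simp

lemma lookup_mult_eq: "lookup (g * x) k = (\<Sum>y\<in>keys g. lookup g y * lookup x (k - y))" for x :: lp
proof -
 have e: "frag_cmul c (frag_of y) = Poly_Mapping.single y c" for c and y :: mon
  by (rule poly_mapping_eqI) (auto simp: lookup_single when_def)
 have "g = (\<Sum>y\<in>keys g. Poly_Mapping.single y (lookup g y))"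
  using frag_expansion[of g] unfolding frag_extend_def e .
 from arg_cong[OF this, of "\<lambda>p. p * x"]
 have "g * x = (\<Sum>y\<in>keys g. Poly_Mapping.single y (lookup g y) * x)"
  unfolding sum_distrib_right .
 then show ?thesis by (simp add: lookup_sum lookup_single_mult)
qed

lemma cube_mult:
 assumes x: "x \<in> cube n a b m" "0 \<le> m" and g: "keys g \<subseteq> ibox n (- s) (s + 1)"
 shows "g * x \<in> cube n (a - s) (b + s) (l1norm g * m)"
proof -
 have "keys (g * x) \<subseteq> ibox n (a - s) (b + s)"
 proof
  fix k assume "k \<in> keys (g * x)"
  then obtain c d where k: "k = c + d" "c \<in> keys g" "d \<in> keys x" using keys_mult[of g x] by blast
  then have cd: "c \<in> ibox n (-s) (s+1)" "d \<in> ibox n a b" using g x by (auto simp: cube_iff)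
  then have "keys k \<subseteq> {..<n}" using keys_add[of c d] unfolding k(1) ibox_def by blast
  moreover have "lookup k i \<in> {a - s..<b + s}" if "i \<in> {..<n}" for i
  proof -
   have "lookup c i \<in> {-s..<s+1}" "lookup d i \<in> {a..<b}" using cd that by (auto simp: ibox_def)
   then show ?thesis by (simp add: k(1) lookup_add)
  qed
  ultimately show "k \<in> ibox n (a - s) (b + s)" by (simp add: ibox_def)
 qed
 moreover have "\<bar>lookup (g * x) k\<bar> \<le> l1norm g * m" for k
 proof -
  have "\<bar>lookup (g * x) k\<bar> \<le> (\<Sum>y\<in>keys g. \<bar>lookup g y\<bar> * \<bar>lookup x (k - y)\<bar>)"
   unfolding lookup_mult_eq by (rule order_trans[OF sum_abs]) (simp add: abs_mult)
  also have "\<dots> \<le> (\<Sum>y\<in>keys g. \<bar>lookup g y\<bar> * m)"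
   by (intro sum_mono mult_left_mono) (use x in \<open>auto simp: cube_iff\<close>)
  finally show ?thesis by (simp add: l1norm_def sum_distrib_right)
 qed
 ultimately show ?thesis using x(2) l1norm_nonneg[of g] by (simp add: cube_iff)
qed

lemma cube_sum:
 assumes "finite J" "\<And>i. i \<in> J \<Longrightarrow> x i \<in> cube n a b (m i)" "\<And>i. i \<in> J \<Longrightarrow> 0 \<le> m i"
 shows "sum x J \<in> cube n a b (sum m J)"
proof -
 have "keys (sum x J) \<subseteq> (\<Union>i\<in>J. keys (x i))" by (rule keys_sum)
 also have "\<dots> \<subseteq> ibox n a b" using assms(2,3) by (auto simp: cube_iff)
 finally have "keys (sum x J) \<subseteq> ibox n a b" .
 moreover have "\<bar>lookup (sum x J) k\<bar> \<le> sum m J" for k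
  unfolding lookup_sum by (rule order_trans[OF sum_abs sum_mono]) (use assms in \<open>auto simp: cube_iff\<close>)
 moreover have "0 \<le> sum m J" using assms(3) by (rule sum_nonneg)
 ultimately show ?thesis by (simp add: cube_iff)
qed

lemma finite_keys_in_ibox:
 assumes "finite W" "W \<subseteq> {k. keys k \<subseteq> {..<n}}"
 obtains s :: int where "s > 0" "W \<subseteq> ibox n (- s) s"
proof -
 let ?s = "1 + (\<Sum>k\<in>W. \<Sum>i<n. \<bar>lookup k i\<bar>)"
 have "W \<subseteq> ibox n (- ?s) ?s"
 proof
  fix k assume k: "k \<in> W"
  have "\<bar>lookup k i\<bar> < ?s" if "i < n" for i
  proof -
   have "\<bar>lookup k i\<bar> \<le> (\<Sum>i<n. \<bar>lookup k i\<bar>)"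
    by (rule member_le_sum) (use that in auto)
   also have "\<dots> \<le> (\<Sum>k\<in>W. \<Sum>i<n. \<bar>lookup k i\<bar>)"
    by (rule member_le_sum[OF k]) (use assms in \<open>auto intro: sum_nonneg\<close>)
   finally show ?thesis by simp
  qed
  then show "k \<in> ibox n (- ?s) ?s" using k assms(2) by (force simp: ibox_def abs_less_iff)
 qed
 moreover have "0 \<le> (\<Sum>k\<in>W. \<Sum>i<n. \<bar>lookup k i\<bar>)" by (intro sum_nonneg) auto
 then have "?s > 0" by simp
 ultimately show ?thesis by (rule that[rotated])
qed

lemma finite_in_cube:
 assumes "finite W" "W \<subseteq> Rn n"
 obtains s m :: int where "s > 0" "m \<ge> 0" "W \<subseteq> cube n (- s) s m"
proof -
 have "finite (\<Union>r\<in>W. keys r)" "(\<Union>r\<in>W. keys r) \<subseteq> {k. keys k \<subseteq> {..<n}}"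
  using assms by (auto simp: Rn_def)
 then obtain s where s: "s > 0" "(\<Union>r\<in>W. keys r) \<subseteq> ibox n (- s) s" by (rule finite_keys_in_ibox)
 let ?m = "\<Sum>r\<in>W. l1norm r"
 have m0: "?m \<ge> 0" by (simp add: sum_nonneg l1norm_nonneg)
 have "r \<in> cube n (- s) s ?m" if r: "r \<in> W" for r
 proof -
  have "\<bar>lookup r k\<bar> \<le> ?m" for k
  proof (cases "k \<in> keys r")
   case True
   have "\<bar>lookup r k\<bar> \<le> l1norm r" unfolding l1norm_def by (rule member_le_sum[OF True]) auto
   also have "\<dots> \<le> ?m" by (rule member_le_sum[OF r]) (use assms in \<open>auto simp: l1norm_nonneg\<close>)
   finally show ?thesis .
  next
   case False then show ?thesis using m0 by (simp add: in_keys_iff)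
  qed
  then show ?thesis using s(2) r m0 by (auto simp: cube_iff)
 qed
 then show ?thesis using that[OF s(1) m0] by blast
qed

section \<open>Covering a box through its tiles\<close>

lemma covers_tile:
 fixes \<psi> :: "'w \<Rightarrow> 'a::ab_group_add \<Rightarrow> 'b::ab_group_add"
 assumes W: "finite W" and add: "\<And>w x y. w \<in> W \<Longrightarrow> \<psi> w (x - y) = \<psi> w x - \<psi> w y"
  and cov: "covers c C I"
  and dec: "\<And>u. u \<in> C' \<Longrightarrow> \<exists>x. (\<forall>w\<in>W. x w \<in> C) \<and> u = (\<Sum>w\<in>W. \<psi> w (x w))"
  and K: "\<And>z. (\<And>w. w \<in> W \<Longrightarrow> z w \<in> I) \<Longrightarrow> (\<Sum>w\<in>W. \<psi> w (z w)) \<in> K"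
 shows "covers (c ^ card W) C' K"
proof -
 obtain R where R: "finite R" "card R \<le> c" "\<forall>h\<in>C. \<exists>r\<in>R. h - r \<in> I" using cov by (auto simp: covers_def)
 let ?Q = "(\<lambda>F. \<Sum>w\<in>W. \<psi> w (F w)) ` (W \<rightarrow>\<^sub>E R)"
 have fQ: "finite (W \<rightarrow>\<^sub>E R)" using R W by (intro finite_PiE) auto
 have "card ?Q \<le> card (W \<rightarrow>\<^sub>E R)" by (rule card_image_le[OF fQ])
 also have "\<dots> = card R ^ card W" using W by (simp add: card_PiE)
 also have "\<dots> \<le> c ^ card W" using R(2) by (rule power_mono) simp
 finally have "card ?Q \<le> c ^ card W" .
 moreover have "\<exists>r\<in>?Q. u - r \<in> K" if u: "u \<in> C'" for u
 proof -
  obtain x where x: "\<forall>w\<in>W. x w \<in> C" "u = (\<Sum>w\<in>W. \<psi> w (x w))" using dec[OF u] by blast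
  have "\<forall>w\<in>W. \<exists>r\<in>R. x w - r \<in> I" using x(1) R(3) by blast
  then obtain F where F: "\<And>w. w \<in> W \<Longrightarrow> F w \<in> R \<and> x w - F w \<in> I" by metis
  let ?F = "restrict F W"
  have "u - (\<Sum>w\<in>W. \<psi> w (?F w)) = (\<Sum>w\<in>W. \<psi> w (x w - F w))"
   unfolding x(2) sum_subtractf[symmetric] by (rule sum.cong) (auto simp: add)
  also have "\<dots> \<in> K" using F by (intro K) auto
  finally have "u - (\<Sum>w\<in>W. \<psi> w (?F w)) \<in> K" .
  moreover have "?F \<in> W \<rightarrow>\<^sub>E R" using F by auto
  ultimately show ?thesis by blast
 qed
 ultimately show ?thesis unfolding covers_def using fQ by (intro exI[of _ ?Q]) simp
qed

text \<open>Every exponent is assigned to a single tile \<open>ow k\<close> even where tiles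
  overlap, so no coefficient grows.\<close>

lemma tile_decomposition:
 assumes W: "finite W" and m: "0 \<le> m" and x: "\<And>k. \<bar>lookup x k\<bar> \<le> m"
  and own: "\<And>k. k \<in> keys x \<Longrightarrow> \<exists>w\<in>W. k - w \<in> ibox n 0 L"
 shows "\<exists>y. (\<forall>w\<in>W. y w \<in> cube n 0 L m) \<and> x = (\<Sum>w\<in>W. frag_of w * y w)"
proof -
 obtain ow where ow: "\<And>k. k \<in> keys x \<Longrightarrow> ow k \<in> W \<and> k - ow k \<in> ibox n 0 L" using own by metis
 define P where "P = (\<lambda>w. Abs_poly_mapping (\<lambda>j. if j + w \<in> keys x \<and> ow (j + w) = w then lookup x (j + w) else 0))"
 have lP: "lookup (P w) j = (if j + w \<in> keys x \<and> ow (j + w) = w then lookup x (j + w) else 0)" for w j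
 proof -
  have "finite {j. (if j + w \<in> keys x \<and> ow (j + w) = w then lookup x (j + w) else 0) \<noteq> 0}"
   by (rule finite_subset[of _ "(\<lambda>k. k - w) ` keys x"]) (auto simp: image_iff intro!: bexI[of _ "_ + w"] split: if_splits)
  then show ?thesis unfolding P_def by simp
 qed
 have "P w \<in> cube n 0 L m" if "w \<in> W" for w
 proof -
  have "keys (P w) \<subseteq> ibox n 0 L"
  proof
   fix j assume "j \<in> keys (P w)"
   then have "j + w \<in> keys x" "ow (j + w) = w" by (auto simp: in_keys_iff lP split: if_splits)
   then show "j \<in> ibox n 0 L" using ow[of "j + w"] by simp
  qed
  then show ?thesis using m x by (simp add: cube_iff lP)
 qed
 moreover have "x = (\<Sum>w\<in>W. frag_of w * P w)"
 proof (rule poly_mapping_eqI)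
  fix k
  have "(\<Sum>w\<in>W. lookup (frag_of w * P w) k) = (\<Sum>w\<in>W. if w = ow k \<and> k \<in> keys x then lookup x k else 0)"
   by (rule sum.cong) (auto simp: lookup_frag_mult lP)
  also have "\<dots> = lookup x k"
  proof (cases "k \<in> keys x")
   case True then show ?thesis using ow[OF True] W by simp
  next
   case False then show ?thesis by (simp add: in_keys_iff)
  qed
  finally show "lookup x k = lookup (\<Sum>w\<in>W. frag_of w * P w) k" by (simp add: lookup_sum)
 qed
 ultimately show ?thesis by blast
qed

definition grid :: "nat \<Rightarrow> int \<Rightarrow> nat \<Rightarrow> nat \<Rightarrow> mon set" where
 "grid n a L k = (\<lambda>v. mkmon n (\<lambda>i. a + int L * lookup v i)) ` ibox n 0 (int k)"

lemma grid_finite: "finite (grid n a L k)"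
 by (simp add: grid_def ibox_card)

lemma grid_keys: "w \<in> grid n a L k \<Longrightarrow> keys w \<subseteq> {..<n}"
 using keys_mkmon by (auto simp: grid_def)

lemma grid_card: assumes "L > 0" shows "card (grid n a L k) = k ^ n"
proof -
 have "inj_on (\<lambda>v. mkmon n (\<lambda>i. a + int L * lookup v i)) (ibox n 0 (int k))"
 proof (rule inj_onI)
  fix u v assume uv: "u \<in> ibox n 0 (int k)" "v \<in> ibox n 0 (int k)"
   "mkmon n (\<lambda>i. a + int L * lookup u i) = mkmon n (\<lambda>i. a + int L * lookup v i)"
  show "u = v"
  proof (rule poly_mapping_eqI)
   fix i
   show "lookup u i = lookup v i"
   proof (cases "i < n")
    case True then show ?thesis using arg_cong[OF uv(3), of "\<lambda>p. lookup p i"] assms by (simp add: lookup_mkmon)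
   next
    case False
    then have "i \<notin> keys u" "i \<notin> keys v" using uv by (auto simp: ibox_def)
    then show ?thesis by (simp add: in_keys_iff)
   qed
  qed
 qed
 then show ?thesis unfolding grid_def by (simp add: card_image ibox_card)
qed

lemma grid_covers: assumes "L > 0" "b - a \<le> int k * int L" "x \<in> ibox n a b" shows "\<exists>w\<in>grid n a L k. x - w \<in> ibox n 0 (int L)"
proof -
 let ?v = "mkmon n (\<lambda>i. (lookup x i - a) div int L)"
 let ?w = "mkmon n (\<lambda>i. a + int L * lookup ?v i)"
 have xi: "lookup x i \<in> {a..<b}" if "i < n" for i using assms(3) that by (auto simp: ibox_def)
 have "?v \<in> ibox n 0 (int k)" unfolding ibox_def
 proof (intro CollectI conjI ballI keys_mkmon)
  fix i assume i: "i \<in> {..<n}"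
  have "(lookup x i - a) div int L \<ge> 0" using xi[of i] i assms(1) by (simp add: pos_imp_zdiv_nonneg_iff)
  moreover have "(lookup x i - a) div int L < int k"
  proof -
   have "(lookup x i - a) div int L * int L \<le> lookup x i - a"
    using div_mult_mod_eq[of "lookup x i - a" "int L"] pos_mod_sign[of "int L" "lookup x i - a"] assms(1) by linarith
   also have "\<dots> < int k * int L" using xi[of i] i assms(2) by auto
   finally show ?thesis using assms(1) by simp
  qed
  ultimately show "lookup ?v i \<in> {0..<int k}" using i by (simp add: lookup_mkmon)
 qed
 then have "?w \<in> grid n a L k" by (simp add: grid_def)
 moreover have "x - ?w \<in> ibox n 0 (int L)" unfolding ibox_def
 proof (intro CollectI conjI ballI)
  show "keys (x - ?w) \<subseteq> {..<n}" using keys_diff[of x ?w] keys_mkmon assms(3) unfolding ibox_def by blast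
  fix i assume i: "i \<in> {..<n}"
  have "lookup (x - ?w) i = (lookup x i - a) mod int L"
   using i by (simp add: lookup_minus lookup_mkmon minus_mult_div_eq_mod[symmetric])
  then show "lookup (x - ?w) i \<in> {0..<int L}" using assms(1) by simp
 qed
 ultimately show ?thesis by blast
qed

lemma covers_ibox:
 assumes "covers c (cube n 0 (int L) m) I" "rid (Rn n) I" "L > 0" "b - a \<le> int k * int L" "0 \<le> m"
 shows "covers (c ^ (k ^ n)) (cube n a b m) I"
proof -
 have "covers (c ^ card (grid n a L k)) (cube n a b m) I"
 proof (rule covers_tile[OF grid_finite _ assms(1), where \<psi> = "\<lambda>w x. frag_of w * x"])
  fix u assume u: "u \<in> cube n a b m"
  show "\<exists>x. (\<forall>w\<in>grid n a L k. x w \<in> cube n 0 (int L) m) \<and> u = (\<Sum>w\<in>grid n a L k. frag_of w * x w)"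
   by (rule tile_decomposition[OF grid_finite assms(5)])
     (use u assms grid_covers[OF assms(3,4)] in \<open>auto simp: cube_iff\<close>)
 next
  fix z assume "\<And>w. w \<in> grid n a L k \<Longrightarrow> z w \<in> I"
  then show "(\<Sum>w\<in>grid n a L k. frag_of w * z w) \<in> I"
   using grid_keys by (intro sgrp_sum[OF rid_sgrp[OF assms(2)]] rid_mult[OF assms(2)]) (auto simp: Rn_frag_of)
 qed (simp add: right_diff_distrib)
 then show ?thesis using grid_card[OF assms(3)] by simp
qed

lemma covers_pos: "covers c C I \<Longrightarrow> x \<in> C \<Longrightarrow> c > 0"
 by (auto simp: covers_def card_gt_0_iff) (metis card_gt_0_iff empty_iff gr0I le_zero_eq)

lemma zent_Rn: "zent n (Rn n)"
proof -
 have "covers 1 (cube n 0 (int 1) m) (Rn n)" for m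
  unfolding covers_def by (intro exI[of _ "{0}"]) (use cube_Rn[of n 0 1 m] in auto)
 moreover have "real 1 \<le> exp (\<epsilon> * real 1 ^ n)" if "\<epsilon> > 0" for \<epsilon> :: real using that by simp
 ultimately show ?thesis unfolding zent_def by blast
qed

lemma covers_cube_finite: "sgrp I \<Longrightarrow> \<exists>y. has_idx (cube n a b m) I y"
proof -
 assume I: "sgrp I"
 have "finite (cube n a b m)" by (intro coef_box_card ibox_card) auto
 then have "covers (card (cube n a b m)) (cube n a b m) I"
  unfolding covers_def using sgrp_0[OF I] by (intro exI[of _ "cube n a b m"]) (auto intro: bexI[rotated])
 then show ?thesis using covers_imp_has_idx[OF I] by blast
qed

text \<open>The sums \<open>y\<^sub>0 + g y\<^sub>1 + \<dots> + g\<^sup>k\<^sup>-\<^sup>1 y\<^sub>k\<^sub>-\<^sub>1\<close> with \<open>y\<^sub>i\<close> in a set of representatives modulo \<open>I\<close> are pairwise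
 incongruent modulo \<open>P\<close>; adding the multiples \<open>f q\<close> of an element of \<open>P\<close> packs them into a cube.\<close>

lemma packing_bound:
 assumes P: "rid (Rn n) P" and f: "f \<in> P" "f \<noteq> 0" and g: "g \<in> Rn n" "\<And>x. x \<in> Rn n \<Longrightarrow> g * x \<in> P \<Longrightarrow> x \<in> P"
  and I: "rid (Rn n) I" "P \<subseteq> I" "g \<in> I"
  and s: "0 \<le> s" "keys f \<subseteq> ibox n (- s) (s + 1)" "keys g \<subseteq> ibox n (- s) (s + 1)"
  and m: "0 \<le> m" and m': "m' = (\<Sum>i<k. l1norm g ^ i * m)" and L: "0 \<le> L"
  and y: "has_idx (cube n 0 L m) I y"
 shows "y ^ k * nat (m' + 1) ^ (nat (L + 2 * int k * s) ^ n) \<le> nat (2 * ((1 + l1norm f) * m') + 1) ^ (nat (L + 2 * (int k + 1) * s) ^ n)"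
proof -
 obtain Y where Y: "Y \<subseteq> cube n 0 L m" "finite Y" "card Y = y" "\<forall>r\<in>Y. \<forall>r'\<in>Y. r - r' \<in> I \<longrightarrow> r = r'"
  using y unfolding has_idx_def by blast
 have YR: "Y \<subseteq> Rn n" using Y(1) cube_Rn by blast
 have m0: "0 \<le> m'" unfolding m' by (intro sum_nonneg mult_nonneg_nonneg zero_le_power l1norm_nonneg m)
 define k' where "k' = int k * s"
 have k'0: "0 \<le> k'" using s by (simp add: k'_def)
 \<comment> \<open>Multiples \<open>f * q\<close> lie in \<open>P\<close> and do not disturb the
   digits \<open>F i\<close>. With \<open>m' + 1\<close> values per coefficient they occupy the
   target cube up to a factor \<open>2 * (1 + l1norm f)\<close> per exponent and boundary terms, and
   this is all the room left for the \<open>y ^ k\<close> digit strings.\<close>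
 define Q where "Q = coef_box (ibox n (- k') (L + k')) {0..m'}"
 define \<Phi> where "\<Phi> = (\<lambda>(F, q). (\<Sum>i<k. g ^ i * F i) + f * q)"
 have pw: "g ^ i * x \<in> cube n (- (int i * s)) (L + int i * s) (l1norm g ^ i * m)" if x: "x \<in> cube n 0 L m" for i x
 proof (induction i)
  case (Suc i)
  have "g * (g ^ i * x) \<in> cube n (- (int i * s) - s) (L + int i * s + s) (l1norm g * (l1norm g ^ i * m))"
   by (rule cube_mult[OF Suc _ s(3)]) (intro mult_nonneg_nonneg zero_le_power l1norm_nonneg m)
  moreover have "- (int i * s) - s = - (int (Suc i) * s)" "L + int i * s + s = L + int (Suc i) * s" by (simp_all add: algebra_simps)
  ultimately show ?case by (simp add: mult.assoc)
 qed (use x in simp)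
 have sumcube: "(\<Sum>i<k. g ^ i * F i) \<in> cube n (- k') (L + k') m'" if F: "F \<in> {..<k} \<rightarrow>\<^sub>E Y" for F
  unfolding m'
 proof (rule cube_sum)
  fix i assume i: "i \<in> {..<k}"
  then have "F i \<in> cube n 0 L m" using F Y(1) by (auto simp: PiE_def)
  from pw[OF this, of i] show "g ^ i * F i \<in> cube n (- k') (L + k') (l1norm g ^ i * m)"
  proof (rule subsetD[OF cube_mono, rotated -1])
   show "0 \<le> l1norm g ^ i * m" by (intro mult_nonneg_nonneg zero_le_power l1norm_nonneg m)
   have "int i * s \<le> k'" unfolding k'_def using i s(1) by (intro mult_right_mono) auto
   then show "- k' \<le> - (int i * s)" "L + int i * s \<le> L + k'" by simp_all
  qed simp
 qed (auto intro!: mult_nonneg_nonneg zero_le_power l1norm_nonneg m)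
 have Qc: "Q \<subseteq> cube n (- k') (L + k') m'" using m0 by (auto simp: Q_def coef_box_def)
 have im: "\<Phi> ` (({..<k} \<rightarrow>\<^sub>E Y) \<times> Q) \<subseteq> cube n (- k' - s) (L + k' + s) ((1 + l1norm f) * m')"
 proof
  fix z assume "z \<in> \<Phi> ` (({..<k} \<rightarrow>\<^sub>E Y) \<times> Q)"
  then obtain F q where z: "z = (\<Sum>i<k. g ^ i * F i) + f * q" "F \<in> {..<k} \<rightarrow>\<^sub>E Y" "q \<in> Q" by (auto simp: \<Phi>_def)
  have 1: "(\<Sum>i<k. g ^ i * F i) \<in> cube n (- k' - s) (L + k' + s) m'"
   by (rule subsetD[OF cube_mono sumcube[OF z(2)]]) (use m0 s in auto)
  have 2: "f * q \<in> cube n (- k' - s) (L + k' + s) (l1norm f * m')"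
   by (rule cube_mult[OF subsetD[OF Qc z(3)] m0 s(2)])
  have 3: "0 \<le> l1norm f * m'" "0 \<le> (1 + l1norm f) * m'" using l1norm_nonneg[of f] m0 by auto
  show "z \<in> cube n (- k' - s) (L + k' + s) ((1 + l1norm f) * m')"
   unfolding z(1) cube_iff[OF 3(2)]
  proof (intro conjI allI)
   show "keys ((\<Sum>i<k. g ^ i * F i) + f * q) \<subseteq> ibox n (- k' - s) (L + k' + s)"
    using keys_add[of "\<Sum>i<k. g ^ i * F i" "f * q"] 1 2 unfolding cube_iff[OF m0] cube_iff[OF 3(1)] by blast
   fix j
   have "\<bar>lookup (\<Sum>i<k. g ^ i * F i) j\<bar> \<le> m'" "\<bar>lookup (f * q) j\<bar> \<le> l1norm f * m'"
    using 1 2 unfolding cube_iff[OF m0] cube_iff[OF 3(1)] by blast+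
   then show "\<bar>lookup ((\<Sum>i<k. g ^ i * F i) + f * q) j\<bar> \<le> (1 + l1norm f) * m'"
    by (simp add: lookup_add distrib_right)
  qed
 qed
 \<comment> \<open>Expansions in base \<open>g\<close>: modulo \<open>I\<close>, which contains
   \<open>g\<close> and \<open>P\<close>, only the first digit survives, so first digits agree. Then
   \<open>g\<close> is cancelled modulo \<open>P\<close> and the next digit follows.\<close>
 have horner: "\<forall>i<k. F i = F' i" if "(\<Sum>i<k. g ^ i * (F i - F' i)) \<in> P" "\<forall>i<k. F i \<in> Y" "\<forall>i<k. F' i \<in> Y" for F F' k
  using that
 proof (induction k arbitrary: F F')
  case (Suc k)
  have e: "(\<Sum>i<Suc k. g ^ i * (F i - F' i)) = (F 0 - F' 0) + g * (\<Sum>i<k. g ^ i * (F (Suc i) - F' (Suc i)))"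
   by (simp only: sum.lessThan_Suc_shift sum_distrib_left power_Suc mult.assoc) simp
  have R: "(\<Sum>i<k. g ^ i * (F (Suc i) - F' (Suc i))) \<in> Rn n"
   using Suc.prems YR by (intro sgrp_sum[OF sgrp_Rn] Rn_mult Rn_power g sgrp_diff[OF sgrp_Rn]) auto
  have "g * (\<Sum>i<k. g ^ i * (F (Suc i) - F' (Suc i))) \<in> I" using rid_mult[OF I(1) R I(3)] by (simp add: mult.commute)
  then have "(F 0 - F' 0) \<in> I" using sgrp_diff[OF rid_sgrp[OF I(1)], of "(\<Sum>i<Suc k. g ^ i * (F i - F' i))"] Suc.prems(1) I(2) unfolding e by fastforce
  then have 0: "F 0 = F' 0" using Y(4) Suc.prems by blast
  then have "g * (\<Sum>i<k. g ^ i * (F (Suc i) - F' (Suc i))) \<in> P" using Suc.prems(1) unfolding e by simp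
  then have "(\<Sum>i<k. g ^ i * (F (Suc i) - F' (Suc i))) \<in> P" by (rule g(2)[OF R])
  then have "\<forall>i<k. F (Suc i) = F' (Suc i)" using Suc.prems by (intro Suc.IH) auto
  then show ?case using 0 less_Suc_eq_0_disj by auto
 qed simp
 have inj: "inj_on \<Phi> (({..<k} \<rightarrow>\<^sub>E Y) \<times> Q)"
 proof (rule inj_onI, clarify)
  fix F q F' q' assume a: "F \<in> {..<k} \<rightarrow>\<^sub>E Y" "q \<in> Q" "F' \<in> {..<k} \<rightarrow>\<^sub>E Y" "q' \<in> Q" "\<Phi> (F, q) = \<Phi> (F', q')"
  have qR: "q' - q \<in> Rn n" using a Qc cube_Rn by (intro sgrp_diff[OF sgrp_Rn]) blast+
  have e: "(\<Sum>i<k. g ^ i * (F i - F' i)) = f * (q' - q)"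
   using a(5) by (simp add: \<Phi>_def right_diff_distrib sum_subtractf algebra_simps)
  also have "\<dots> \<in> P" using rid_mult[OF P qR f(1)] by (simp add: mult.commute)
  finally have "\<forall>i<k. F i = F' i" by (rule horner) (use a in auto)
  then have FF: "F = F'" using a(1,3) by (intro PiE_ext) auto
  then have "f * (q' - q) = 0" using e by simp
  then show "F = F' \<and> q = q'" using f(2) FF by simp
 qed
 have fc: "finite (cube n (- k' - s) (L + k' + s) ((1 + l1norm f) * m'))" by (intro coef_box_card ibox_card) auto
 have "card (({..<k} \<rightarrow>\<^sub>E Y) \<times> Q) \<le> card (cube n (- k' - s) (L + k' + s) ((1 + l1norm f) * m'))"
  by (rule card_inj_on_le[OF inj im fc])
 moreover have "card (({..<k} \<rightarrow>\<^sub>E Y) \<times> Q) = y ^ k * nat (m' + 1) ^ (nat (L + 2 * int k * s) ^ n)"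
 proof -
  have "card Q = nat (m' + 1) ^ (nat (L + 2 * int k * s) ^ n)"
   unfolding Q_def by (simp add: coef_box_card ibox_card k'_def algebra_simps)
  then show ?thesis by (simp add: card_cartesian_product card_PiE Y)
 qed
 moreover have "card (cube n (- k' - s) (L + k' + s) ((1 + l1norm f) * m')) = nat (2 * ((1 + l1norm f) * m') + 1) ^ (nat (L + 2 * (int k + 1) * s) ^ n)"
  by (simp add: coef_box_card ibox_card k'_def algebra_simps)
 ultimately show ?thesis by simp
qed

lemma tendsto_shift_power:
 "((\<lambda>L. (real L + a) ^ n / real L ^ n) \<longlongrightarrow> 1) sequentially"
proof -
 have "((\<lambda>L. (1 + a / real L) ^ n) \<longlongrightarrow> (1 + 0) ^ n) sequentially"
  by (intro tendsto_intros lim_const_over_n)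
 then have "((\<lambda>L. (1 + a / real L) ^ n) \<longlongrightarrow> 1) sequentially" by simp
 then show ?thesis
 proof (rule Lim_transform_eventually)
  show "\<forall>\<^sub>F L in sequentially. (1 + a / real L) ^ n = (real L + a) ^ n / real L ^ n"
   using eventually_gt_at_top[of 0]
  proof eventually_elim
   case (elim L)
   then have "1 + a / real L = (real L + a) / real L" by (simp add: add_divide_distrib)
   then show ?case by (simp only: power_divide)
  qed
 qed
qed

text \<open>By \<open>packing_bound\<close> the quantity \<open>k * ln y\<close> is at most
  \<open>A * L ^ n\<close> up to lower order, where \<open>A\<close> depends on \<open>f\<close>
  only; a large \<open>k\<close> beats it. The bound \<open>m'\<close> grows with \<open>k\<close>,
  so \<open>k\<close> is fixed before \<open>L\<close>. Its logarithm \<open>B\<close> then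
  multiplies a difference of box volumes that is negligible against \<open>L ^ n\<close>.\<close>

theorem zent_regular_quotient:
 assumes P: "rid (Rn n) P" and f: "f \<in> P" "f \<noteq> 0" and g: "g \<in> Rn n" "\<And>x. x \<in> Rn n \<Longrightarrow> g * x \<in> P \<Longrightarrow> x \<in> P"
  and I: "rid (Rn n) I" "P \<subseteq> I" "g \<in> I"
 shows "zent n I"
 unfolding zent_def
proof (intro allI impI)
 fix m :: int and \<epsilon> :: real assume m: "0 \<le> m" and \<epsilon>: "\<epsilon> > 0"
 have fR: "f \<in> Rn n" using f(1) P by (auto simp: rid_def)
 obtain s0 M0 :: int where s0: "s0 > 0" "{f, g} \<subseteq> cube n (- s0) s0 M0" "M0 \<ge> 0"
  using finite_in_cube[of "{f, g}" n] fR g(1) by blast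
 define s where "s = s0"
 have s: "0 \<le> s" "keys f \<subseteq> ibox n (- s) (s + 1)" "keys g \<subseteq> ibox n (- s) (s + 1)"
  using s0 ibox_mono[of "-s" "-s0" s0 "s + 1" n] by (auto simp: s_def cube_iff)
 define A where "A = ln (2 * (1 + real_of_int (l1norm f)))"
 have F1: "2 * (1 + real_of_int (l1norm f)) \<ge> 1" using l1norm_nonneg[of f] by simp
 have A0: "A \<ge> 0" unfolding A_def using F1 by simp
 obtain k :: nat where k: "k > 0" "4 * A / \<epsilon> \<le> real k"
 proof -
  obtain k :: nat where "4 * A / \<epsilon> \<le> real k" using real_arch_simple by blast
  then show ?thesis using that[of "Suc k"] by simp
 qed
 define m' where "m' = (\<Sum>i<k. l1norm g ^ i * m)"
 have m'0: "0 \<le> m'" unfolding m'_def by (intro sum_nonneg mult_nonneg_nonneg zero_le_power l1norm_nonneg m)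
 define B where "B = ln (real_of_int m' + 1)"
 have B0: "B \<ge> 0" unfolding B_def using m'0 by simp
 define a where "a = real_of_int (2 * (int k + 1) * s)"
 define b where "b = real_of_int (2 * int k * s)"
 have ab: "0 \<le> b" "b \<le> a" unfolding a_def b_def using s(1) by (auto intro!: mult_right_mono)
 have t: "((\<lambda>L. A * ((real L + a) ^ n / real L ^ n) + B * ((real L + a) ^ n / real L ^ n - (real L + b) ^ n / real L ^ n)) \<longlongrightarrow> A * 1 + B * (1 - 1)) sequentially"
  by (intro tendsto_intros tendsto_shift_power)
 have "A * 1 + B * (1 - 1) < \<epsilon> * real k"
 proof -
  have "A < 4 * A + \<epsilon>" using A0 \<epsilon> by simp
  have "4 * A \<le> \<epsilon> * real k" using k(2) \<epsilon> by (simp add: field_simps)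
  then show ?thesis using A0 \<epsilon> k(1) by (cases "A = 0") auto
 qed
 from order_tendstoD(2)[OF t this]
 obtain L0 where L0: "\<And>L. L \<ge> L0 \<Longrightarrow> A * ((real L + a) ^ n / real L ^ n) + B * ((real L + a) ^ n / real L ^ n - (real L + b) ^ n / real L ^ n) < \<epsilon> * real k"
  unfolding eventually_sequentially by blast
 define L where "L = max L0 1"
 have L: "L > 0" "L \<ge> L0" by (auto simp: L_def)
 obtain y where y: "has_idx (cube n 0 (int L) m) I y" using covers_cube_finite[OF rid_sgrp[OF I(1)]] by blast
 have "y > 0" using has_idx_pos[OF y cube_0[OF m]] .
 have pb: "y ^ k * nat (m' + 1) ^ (nat (int L + 2 * int k * s) ^ n) \<le> nat (2 * ((1 + l1norm f) * m') + 1) ^ (nat (int L + 2 * (int k + 1) * s) ^ n)"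
  by (rule packing_bound[OF P f g I s m m'_def of_nat_0_le_iff y])
 define Na where "Na = nat (int L + 2 * (int k + 1) * s) ^ n"
 define Nb where "Nb = nat (int L + 2 * int k * s) ^ n"
 have Na: "real Na = (real L + a) ^ n" and Nb: "real Nb = (real L + b) ^ n"
  using s(1) unfolding Na_def Nb_def a_def b_def by (auto simp: of_nat_nat)
 have "real (y ^ k * nat (m' + 1) ^ Nb) \<le> real (nat (2 * ((1 + l1norm f) * m') + 1) ^ Na)"
  using pb unfolding Na_def Nb_def by (simp only: of_nat_le_iff)
 then have "real y ^ k * (real_of_int m' + 1) ^ Nb \<le> (2 * ((1 + real_of_int (l1norm f)) * real_of_int m') + 1) ^ Na"
  using m'0 l1norm_nonneg[of f] by (simp add: of_nat_nat)
 also have "\<dots> \<le> ((2 * (1 + real_of_int (l1norm f))) * (real_of_int m' + 1)) ^ Na"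
  using m'0 l1norm_nonneg[of f] by (intro power_mono) (auto simp: algebra_simps)
 finally have le: "real y ^ k * (real_of_int m' + 1) ^ Nb \<le> ((2 * (1 + real_of_int (l1norm f))) * (real_of_int m' + 1)) ^ Na" .
 have "real k * ln (real y) + real Nb * B = ln (real y ^ k * (real_of_int m' + 1) ^ Nb)"
  unfolding B_def using m'0 \<open>y > 0\<close> by (simp add: ln_mult ln_realpow)
 also have "\<dots> \<le> ln (((2 * (1 + real_of_int (l1norm f))) * (real_of_int m' + 1)) ^ Na)"
  using le m'0 \<open>y > 0\<close> l1norm_nonneg[of f] by (subst ln_le_cancel_iff) auto
 also have "\<dots> = real Na * (A + B)"
  unfolding A_def B_def using m'0 F1 by (simp add: ln_mult ln_realpow)
 finally have "real k * ln (real y) \<le> A * real Na + B * (real Na - real Nb)" by (simp add: algebra_simps)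
 also have "\<dots> = (A * ((real L + a) ^ n / real L ^ n) + B * ((real L + a) ^ n / real L ^ n - (real L + b) ^ n / real L ^ n)) * real L ^ n"
  unfolding Na Nb using L(1) by (simp add: field_simps)
 also have "\<dots> \<le> (\<epsilon> * real k) * real L ^ n" using L0[OF L(2)] by (intro mult_right_mono) auto
 finally have "real k * ln (real y) \<le> real k * (\<epsilon> * real L ^ n)" by (simp add: algebra_simps)
 then have "ln (real y) \<le> \<epsilon> * real L ^ n" using k(1) by simp
 then have "real y \<le> exp (\<epsilon> * real L ^ n)" using \<open>y > 0\<close> by (metis exp_le_cancel_iff exp_ln of_nat_0_less_iff)
 then show "\<exists>L>0. \<exists>c. covers c (cube n 0 (int L) m) I \<and> real c \<le> exp (\<epsilon> * real L ^ n)"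
  using L(1) has_idx_covers[OF y] by blast
qed

section \<open>Zero entropy of an ideal containing a product\<close>

lemma ibox_shift_count:
 assumes V: "finite V" and f: "\<And>v. v \<in> V \<Longrightarrow> \<bar>F v\<bar> \<le> (m::int)" "\<And>v. v \<in> V \<Longrightarrow> k - v \<notin> ibox n a b \<Longrightarrow> F v = 0" and m: "0 \<le> m"
 shows "\<bar>\<Sum>v\<in>V. F v\<bar> \<le> m * int (nat (b - a) ^ n)"
proof -
 let ?V = "{v\<in>V. k - v \<in> ibox n a b}"
 have "inj_on (\<lambda>v. k - v) ?V" by (auto simp: inj_on_def)
 then have "card ?V \<le> card (ibox n a b)" by (rule card_inj_on_le) (auto simp: ibox_card)
 then have c: "card ?V \<le> nat (b - a) ^ n" by (simp add: ibox_card)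
 have "(\<Sum>v\<in>V. F v) = (\<Sum>v\<in>?V. F v)" by (rule sum.mono_neutral_right[OF V]) (use f(2) in auto)
 then have "\<bar>\<Sum>v\<in>V. F v\<bar> \<le> (\<Sum>v\<in>?V. \<bar>F v\<bar>)" by (simp add: sum_abs)
 also have "\<dots> \<le> (\<Sum>v\<in>?V. m)" by (rule sum_mono) (use f(1) in auto)
 also have "\<dots> = m * int (card ?V)" by simp
 also have "\<dots> \<le> m * int (nat (b - a) ^ n)" by (rule mult_left_mono[OF _ m]) (use c in linarith)
 finally show ?thesis .
qed

text \<open>A cube of side \<open>L0\<close> is finite, so modulo the representatives its elements
  are combinations of \<open>A\<close> with cofactors in one cube given by \<open>s\<close> and
  \<open>m0\<close>. In a large box these combinations are translated and added; at most
  \<open>(2 * s) ^ n\<close> translates overlap at an exponent, so the cofactors stay below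
  \<open>m1\<close> however many tiles there are. Covering the cofactors modulo \<open>P\<close>
  covers the combinations modulo \<open>K\<close>.\<close>

theorem zent_product:
 assumes A: "finite A" "A \<subseteq> Rn n" and I: "\<And>x. x \<in> I \<Longrightarrow> \<exists>w. (\<forall>a\<in>A. w a \<in> Rn n) \<and> x = (\<Sum>a\<in>A. a * w a)"
  and zI: "zent n I" and P: "rid (Rn n) P" and zP: "zent n P"
  and K: "rid (Rn n) K" "\<And>a p. a \<in> A \<Longrightarrow> p \<in> P \<Longrightarrow> a * p \<in> K"
 shows "zent n K"
 unfolding zent_def
proof (intro allI impI)
 fix m :: int and \<epsilon> :: real assume m: "0 \<le> m" and \<epsilon>: "\<epsilon> > 0"
 obtain L0 c0 where L0: "L0 > 0" "covers c0 (cube n 0 (int L0) m) I" "real c0 \<le> exp ((\<epsilon> / 2) * real L0 ^ n)"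
  using zI m \<epsilon> unfolding zent_def by (metis half_gt_zero)
 obtain R0 where R0: "finite R0" "card R0 \<le> c0" "\<forall>h\<in>cube n 0 (int L0) m. \<exists>r\<in>R0. h - r \<in> I"
  using L0(2) by (auto simp: covers_def)
 define C0 where "C0 = cube n 0 (int L0) m"
 have fC0: "finite C0" unfolding C0_def by (intro coef_box_card ibox_card) auto
 have "\<forall>x\<in>C0. \<exists>r w. r \<in> R0 \<and> (\<forall>a\<in>A. w a \<in> Rn n) \<and> x - r = (\<Sum>a\<in>A. a * w a)"
  using R0(3) I unfolding C0_def by meson
 then obtain r w where rw: "\<And>x. x \<in> C0 \<Longrightarrow> r x \<in> R0" "\<And>x a. x \<in> C0 \<Longrightarrow> a \<in> A \<Longrightarrow> w x a \<in> Rn n"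
  "\<And>x. x \<in> C0 \<Longrightarrow> x - r x = (\<Sum>a\<in>A. a * w x a)" by metis
 have "finite ((\<lambda>(x, a). w x a) ` (C0 \<times> A))" "(\<lambda>(x, a). w x a) ` (C0 \<times> A) \<subseteq> Rn n" using fC0 A rw(2) by auto
 then obtain s m0 where s: "s > 0" "m0 \<ge> 0" "(\<lambda>(x, a). w x a) ` (C0 \<times> A) \<subseteq> cube n (- s) s m0" by (rule finite_in_cube)
 define D0 where "D0 = {z. \<exists>w. (\<forall>a\<in>A. w a \<in> cube n (- s) s m0) \<and> z = (\<Sum>a\<in>A. a * w a)}"
 have cov0: "covers c0 C0 D0"
  unfolding covers_def
 proof (intro exI[of _ R0] conjI ballI R0)
  fix x assume x: "x \<in> C0"
  have "w x a \<in> cube n (- s) s m0" if "a \<in> A" for a using s(3) x that by force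
  then have "x - r x \<in> D0" unfolding D0_def using rw(3)[OF x] by blast
  then show "\<exists>r\<in>R0. x - r \<in> D0" using rw(1)[OF x] by blast
 qed
 define m1 where "m1 = m0 * int (nat (s - (- s)) ^ n)"
 have m1: "0 \<le> m1" using s(2) by (simp add: m1_def)
 \<comment> \<open>There are \<open>card A\<close> cofactors, each covered by tiles of total side at
   most \<open>2 * L\<close>, which accounts for \<open>card A\<close> and \<open>2 ^ n\<close>.
   Adding 1 keeps the denominator positive for empty \<open>A\<close>.\<close>
 define \<epsilon>1 where "\<epsilon>1 = \<epsilon> / (2 * (real (card A) + 1) * 2 ^ n)"
 have \<epsilon>1: "\<epsilon>1 > 0" using \<epsilon> by (simp add: \<epsilon>1_def)
 obtain L1 c1 where L1: "L1 > 0" "covers c1 (cube n 0 (int L1) m1) P" "real c1 \<le> exp (\<epsilon>1 * real L1 ^ n)"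
  using zP m1 \<epsilon>1 unfolding zent_def by metis
 have c0p: "c0 > 0" by (rule covers_pos[OF L0(2) cube_0[OF m]])
 have c1p: "c1 > 0" by (rule covers_pos[OF L1(2) cube_0[OF m1]])
 \<comment> \<open>Makes \<open>L\<close> at least \<open>2 * s + L1\<close>. A box of side
   \<open>L + 2 * s\<close> rounded up to multiples of \<open>L1\<close> then has side at most
   \<open>2 * L\<close>.\<close>
 define k where "k = 2 * nat s + L1 + 1"
 define L where "L = k * L0"
 have Lk: "k \<le> L" using L0(1) by (simp add: L_def)
 have L: "L > 0" using L0(1) by (simp add: L_def k_def)
 define k1 where "k1 = (L + 2 * nat s) div L1 + 1"
 have k1: "int L + s - (- s) \<le> int k1 * int L1"
 proof -
  have "L + 2 * nat s \<le> k1 * L1" unfolding k1_def using L1(1)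
   by (simp add: dividend_less_div_times less_imp_le)
  then have "int (L + 2 * nat s) \<le> int (k1 * L1)" by (simp only: of_nat_le_iff)
  then show ?thesis using s(1) by simp
 qed
 let ?V = "grid n 0 L0 k"
 let ?D = "{z. \<exists>W. (\<forall>a\<in>A. W a \<in> cube n (- s) (int L + s) m1) \<and> z = (\<Sum>a\<in>A. a * W a)}"
 have step1: "covers (c0 ^ card ?V) (cube n 0 (int L) m) ?D"
 proof (rule covers_tile[OF grid_finite _ cov0, where \<psi> = "\<lambda>v x. frag_of v * x"])
  fix u assume u: "u \<in> cube n 0 (int L) m"
  show "\<exists>x. (\<forall>v\<in>?V. x v \<in> C0) \<and> u = (\<Sum>v\<in>?V. frag_of v * x v)"
   unfolding C0_def
  proof (rule tile_decomposition[OF grid_finite m])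
   show "\<exists>v\<in>?V. j - v \<in> ibox n 0 (int L0)" if "j \<in> keys u" for j
    using grid_covers[OF L0(1), of "int L" 0 k j n] that u m by (auto simp: L_def cube_iff)
  qed (use u m in \<open>auto simp: cube_iff\<close>)
 next
  fix z assume "\<And>v. v \<in> ?V \<Longrightarrow> z v \<in> D0"
  then obtain W where W: "\<And>v a. v \<in> ?V \<Longrightarrow> a \<in> A \<Longrightarrow> W v a \<in> cube n (- s) s m0" "\<And>v. v \<in> ?V \<Longrightarrow> z v = (\<Sum>a\<in>A. a * W v a)"
   unfolding D0_def mem_Collect_eq by metis
  have "(\<Sum>v\<in>?V. frag_of v * z v) = (\<Sum>v\<in>?V. \<Sum>a\<in>A. a * (frag_of v * W v a))"
   by (rule sum.cong) (auto simp: W(2) sum_distrib_left algebra_simps)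
  also have "\<dots> = (\<Sum>a\<in>A. \<Sum>v\<in>?V. a * (frag_of v * W v a))" by (rule sum.swap)
  also have "\<dots> = (\<Sum>a\<in>A. a * (\<Sum>v\<in>?V. frag_of v * W v a))" by (simp add: sum_distrib_left)
  finally have e: "(\<Sum>v\<in>?V. frag_of v * z v) = (\<Sum>a\<in>A. a * (\<Sum>v\<in>?V. frag_of v * W v a))" .
  have "(\<Sum>v\<in>?V. frag_of v * W v a) \<in> cube n (- s) (int L + s) m1" if a: "a \<in> A" for a
   unfolding cube_iff[OF m1]
  proof (intro conjI allI)
   have "keys (\<Sum>v\<in>?V. frag_of v * W v a) \<subseteq> (\<Union>v\<in>?V. keys (frag_of v * W v a))" by (rule keys_sum)
   also have "\<dots> \<subseteq> ibox n (- s) (int L + s)"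
   proof (rule UN_least)
    fix v assume v: "v \<in> ?V"
    show "keys (frag_of v * W v a) \<subseteq> ibox n (- s) (int L + s)"
    proof
     fix j assume "j \<in> keys (frag_of v * W v a)"
     then have "j - v \<in> keys (W v a)" by (simp add: in_keys_iff lookup_frag_mult)
     then have jv: "j - v \<in> ibox n (- s) s" using W(1)[OF v a] by (auto simp: cube_iff[OF s(2)])
     obtain p where p: "v = mkmon n (\<lambda>i. 0 + int L0 * lookup p i)" "p \<in> ibox n 0 (int k)"
      using v by (auto simp: grid_def)
     have "keys j \<subseteq> keys (j - v) \<union> keys v" using keys_add[of "j - v" v] by simp
     then have "keys j \<subseteq> {..<n}" using jv grid_keys[OF v] by (auto simp: ibox_def)
     moreover have "lookup j i \<in> {- s..<int L + s}" if i: "i \<in> {..<n}" for i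
     proof -
      have pi: "0 \<le> lookup p i" "lookup p i \<le> int k" using p(2) i by (auto simp: ibox_def less_imp_le)
      have "lookup v i = int L0 * lookup p i" using i by (simp add: p(1) lookup_mkmon)
      moreover have "int L0 * lookup p i \<le> int L0 * int k" using pi by (intro mult_left_mono) auto
      moreover have "0 \<le> int L0 * lookup p i" using pi by simp
      moreover have "lookup (j - v) i \<in> {- s..<s}" using jv i by (auto simp: ibox_def)
      ultimately show ?thesis by (auto simp: lookup_minus L_def mult.commute)
     qed
     ultimately show "j \<in> ibox n (- s) (int L + s)" by (simp add: ibox_def)
    qed
   qed
   finally show "keys (\<Sum>v\<in>?V. frag_of v * W v a) \<subseteq> ibox n (- s) (int L + s)" .
   fix j
   show "\<bar>lookup (\<Sum>v\<in>?V. frag_of v * W v a) j\<bar> \<le> m1"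
    unfolding lookup_sum lookup_frag_mult m1_def
   proof (rule ibox_shift_count[OF grid_finite _ _ s(2)])
    fix v assume v: "v \<in> ?V"
    show "\<bar>lookup (W v a) (j - v)\<bar> \<le> m0" using W(1)[OF v a] by (simp add: cube_iff[OF s(2)])
    show "lookup (W v a) (j - v) = 0" if "j - v \<notin> ibox n (- s) s"
     using W(1)[OF v a] that by (auto simp: cube_iff[OF s(2)] in_keys_iff)
   qed
  qed
  then show "(\<Sum>v\<in>?V. frag_of v * z v) \<in> ?D" unfolding e
   by (intro CollectI exI[of _ "\<lambda>a. \<Sum>v\<in>?V. frag_of v * W v a"]) simp
 qed (simp add: right_diff_distrib)
 have step2: "covers ((c1 ^ (k1 ^ n)) ^ card A) ?D K"
 proof (rule covers_tile[OF A(1) _ covers_ibox[OF L1(2) P L1(1) k1 m1], where \<psi> = "\<lambda>a x. a * x"])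
  show "(\<Sum>a\<in>A. a * z a) \<in> K" if "\<And>a. a \<in> A \<Longrightarrow> z a \<in> P" for z
   by (rule sgrp_sum[OF rid_sgrp[OF K(1)]]) (use that K(2) in blast)
  show "\<exists>x. (\<forall>a\<in>A. x a \<in> cube n (- s) (int L + s) m1) \<and> u = (\<Sum>a\<in>A. a * x a)" if "u \<in> ?D" for u
   using that by (rule CollectD)
 qed (rule right_diff_distrib)
 have "covers (c0 ^ (k ^ n) * (c1 ^ (k1 ^ n)) ^ card A) (cube n 0 (int L) m) K"
  using covers_trans[OF step1 step2] by (simp add: grid_card[OF L0(1)])
 moreover have "real (c0 ^ (k ^ n) * (c1 ^ (k1 ^ n)) ^ card A) \<le> exp (\<epsilon> * real L ^ n)"
 proof -
  have "real c0 ^ (k ^ n) \<le> exp ((\<epsilon> / 2) * real L0 ^ n) ^ (k ^ n)" by (rule power_mono[OF L0(3)]) simp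
  also have "\<dots> = exp (real (k ^ n) * ((\<epsilon> / 2) * real L0 ^ n))" by (rule exp_of_nat_mult[symmetric])
  also have "real (k ^ n) * ((\<epsilon> / 2) * real L0 ^ n) = (\<epsilon> / 2) * real L ^ n" by (simp add: L_def power_mult_distrib)
  finally have 1: "real c0 ^ (k ^ n) \<le> exp ((\<epsilon> / 2) * real L ^ n)" .
  have "real c1 ^ (k1 ^ n * card A) \<le> exp (\<epsilon>1 * real L1 ^ n) ^ (k1 ^ n * card A)" by (rule power_mono[OF L1(3)]) simp
  also have "\<dots> = exp (real (k1 ^ n * card A) * (\<epsilon>1 * real L1 ^ n))" by (rule exp_of_nat_mult[symmetric])
  also have "\<dots> \<le> exp ((\<epsilon> / 2) * real L ^ n)"
  proof -
   have "k1 * L1 \<le> 2 * L"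
   proof -
    have "(L + 2 * nat s) div L1 * L1 \<le> L + 2 * nat s" using div_times_less_eq_dividend by blast
    then have "k1 * L1 \<le> L + 2 * nat s + L1" by (simp add: k1_def)
    then show ?thesis using Lk by (simp add: k_def)
   qed
   then have "real (k1 * L1) \<le> real (2 * L)" by (simp only: of_nat_le_iff)
   then have "real (k1 * L1) ^ n \<le> real (2 * L) ^ n" by (rule power_mono) simp
   then have p: "real k1 ^ n * real L1 ^ n \<le> 2 ^ n * real L ^ n" by (simp add: power_mult_distrib)
   have "real (k1 ^ n * card A) * (\<epsilon>1 * real L1 ^ n) = real (card A) * \<epsilon>1 * (real k1 ^ n * real L1 ^ n)" by simp
   also have "\<dots> \<le> real (card A) * \<epsilon>1 * (2 ^ n * real L ^ n)" using p \<epsilon>1 by (intro mult_left_mono) auto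
   also have "\<dots> = (real (card A) / (real (card A) + 1)) * ((\<epsilon> / 2) * real L ^ n)" by (simp add: \<epsilon>1_def)
   also have "\<dots> \<le> 1 * ((\<epsilon> / 2) * real L ^ n)" using \<epsilon> by (intro mult_right_mono) auto
   finally show ?thesis by simp
  qed
  finally have 2: "real c1 ^ (k1 ^ n * card A) \<le> exp ((\<epsilon> / 2) * real L ^ n)" .
  have "real (c0 ^ (k ^ n) * (c1 ^ (k1 ^ n)) ^ card A) = real c0 ^ (k ^ n) * real c1 ^ (k1 ^ n * card A)"
   by (simp add: power_mult)
  also have "\<dots> \<le> exp ((\<epsilon> / 2) * real L ^ n) * exp ((\<epsilon> / 2) * real L ^ n)"
   using 1 2 by (intro mult_mono) auto
  also have "\<dots> = exp (\<epsilon> * real L ^ n)" by (simp flip: exp_add)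
  finally show ?thesis .
 qed
 ultimately show "\<exists>L>0. \<exists>c. covers c (cube n 0 (int L) m) K \<and> real c \<le> exp (\<epsilon> * real L ^ n)" using L by blast
qed

section \<open>Noetherian rings\<close>

text \<open>Rings are subsets of one type because \<open>Rn (Suc n)\<close> is obtained from
  \<open>Rn n\<close> by adjoining and inverting an element inside \<open>lp\<close>.\<close>

definition subr :: "'r::comm_ring_1 set \<Rightarrow> bool" where
 "subr S \<longleftrightarrow> sgrp S \<and> 1 \<in> S \<and> (\<forall>x\<in>S. \<forall>y\<in>S. x * y \<in> S)"

definition lin_span :: "'r::comm_ring_1 set \<Rightarrow> 'r set \<Rightarrow> 'r set" where
 "lin_span S B = {x. \<exists>c. (\<forall>b\<in>B. c b \<in> S) \<and> x = (\<Sum>b\<in>B. c b * b)}"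

definition noeth :: "'r::comm_ring_1 set \<Rightarrow> bool" where
 "noeth S \<longleftrightarrow> (\<forall>I. rid S I \<longrightarrow> (\<exists>B. finite B \<and> B \<subseteq> I \<and> I \<subseteq> lin_span S B))"

definition rprime :: "'r::comm_ring_1 set \<Rightarrow> 'r set \<Rightarrow> bool" where
 "rprime S P \<longleftrightarrow> rid S P \<and> P \<noteq> S \<and> (\<forall>a\<in>S. \<forall>b\<in>S. a * b \<in> P \<longrightarrow> a \<in> P \<or> b \<in> P)"

lemma subr_sgrp: "subr S \<Longrightarrow> sgrp S" and subr_1: "subr S \<Longrightarrow> 1 \<in> S"
 and subr_mult: "subr S \<Longrightarrow> x \<in> S \<Longrightarrow> y \<in> S \<Longrightarrow> x * y \<in> S"
 by (auto simp: subr_def)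

lemma subr_power: "subr S \<Longrightarrow> x \<in> S \<Longrightarrow> x ^ k \<in> S"
 by (induction k) (auto simp: subr_1 subr_mult)

lemma subr_Rn: "subr (Rn n)"
 by (auto simp: subr_def sgrp_Rn Rn_1 Rn_mult)

lemma lin_span_sgrp: assumes "subr S" shows "sgrp (lin_span S B)"
proof (rule sgrpI)
 show "0 \<in> lin_span S B" unfolding lin_span_def using sgrp_0[OF subr_sgrp[OF assms]]
  by (intro CollectI exI[of _ "\<lambda>_. 0"]) simp
 fix x y assume "x \<in> lin_span S B" "y \<in> lin_span S B"
 then obtain c d where "\<forall>b\<in>B. c b \<in> S" "x = (\<Sum>b\<in>B. c b * b)" "\<forall>b\<in>B. d b \<in> S" "y = (\<Sum>b\<in>B. d b * b)"
  unfolding lin_span_def by blast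
 then show "x - y \<in> lin_span S B" unfolding lin_span_def using sgrp_diff[OF subr_sgrp[OF assms]]
  by (intro CollectI exI[of _ "\<lambda>b. c b - d b"]) (simp add: left_diff_distrib sum_subtractf)
qed

lemma lin_span_mult: assumes "subr S" "s \<in> S" "x \<in> lin_span S B" shows "s * x \<in> lin_span S B"
proof -
 obtain c where "\<forall>b\<in>B. c b \<in> S" "x = (\<Sum>b\<in>B. c b * b)" using assms(3) unfolding lin_span_def by blast
 then show ?thesis unfolding lin_span_def using subr_mult[OF assms(1,2)]
  by (intro CollectI exI[of _ "\<lambda>b. s * c b"]) (simp add: sum_distrib_left mult.assoc)
qed

lemma lin_span_base: assumes "subr S" "finite B" "b \<in> B" shows "b \<in> lin_span S B"
 unfolding lin_span_def
proof (intro CollectI exI conjI ballI)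
 show "(if x = b then 1 else 0) \<in> S" for x using subr_1[OF assms(1)] sgrp_0[OF subr_sgrp[OF assms(1)]] by simp
 have "(\<Sum>x\<in>B. (if x = b then 1 else 0) * x) = (\<Sum>x\<in>B. if x = b then b else 0)" by (rule sum.cong) auto
 then show "b = (\<Sum>x\<in>B. (if x = b then 1 else 0) * x)" using assms by simp
qed

section \<open>Hilbert's basis theorem and Laurent extensions\<close>

definition adjoin :: "'r::comm_ring_1 set \<Rightarrow> 'r \<Rightarrow> 'r set" where
 "adjoin S t = (\<lambda>p. poly p t) ` {p. \<forall>i. coeff p i \<in> S}"

lemma poly_coeffs_closed:
 assumes S: "subr S" and p: "\<forall>i. coeff p i \<in> S" and q: "\<forall>i. coeff q i \<in> S"
 shows "\<forall>i. coeff (p - q) i \<in> S" "\<forall>i. coeff (p * q) i \<in> S"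
 using p q by (auto simp: coeff_mult intro!: sgrp_diff[OF subr_sgrp[OF S]] sgrp_sum[OF subr_sgrp[OF S]] subr_mult[OF S])

lemma poly_coeffs_monom: "subr S \<Longrightarrow> s \<in> S \<Longrightarrow> \<forall>i. coeff (monom s k) i \<in> S"
 using sgrp_0[OF subr_sgrp] by (auto simp: coeff_monom)

lemma subr_adjoin: assumes S: "subr S" shows "subr (adjoin S t)"
 unfolding subr_def
proof (intro conjI ballI sgrpI)
 have "poly (monom 1 0) t \<in> adjoin S t" unfolding adjoin_def using poly_coeffs_monom[OF S subr_1[OF S], of 0] by blast
 then show 1: "1 \<in> adjoin S t" by (simp add: poly_monom)
 have "poly 0 t \<in> adjoin S t" unfolding adjoin_def using sgrp_0[OF subr_sgrp[OF S]] by (intro imageI) simp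
 then show "0 \<in> adjoin S t" by simp
 fix x y assume "x \<in> adjoin S t" "y \<in> adjoin S t"
 then obtain p q where pq: "x = poly p t" "y = poly q t" "\<forall>i. coeff p i \<in> S" "\<forall>i. coeff q i \<in> S" unfolding adjoin_def by blast
 have "poly (p - q) t \<in> adjoin S t" "poly (p * q) t \<in> adjoin S t"
  unfolding adjoin_def using poly_coeffs_closed[OF S pq(3,4)] by blast+
 then show "x - y \<in> adjoin S t" "x * y \<in> adjoin S t" using pq by simp_all
qed

lemma adjoin_monom: "subr S \<Longrightarrow> s \<in> S \<Longrightarrow> s * t ^ k \<in> adjoin S t"
 using poly_coeffs_monom[of S s k] unfolding adjoin_def by (intro image_eqI[of _ _ "monom s k"]) (auto simp: poly_monom)

text \<open>The element \<open>t\<close> may satisfy equations over \<open>S\<close>, so leading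
  coefficients are taken in the set \<open>J\<close> of polynomials that evaluate into
  \<open>I\<close>. The ideals \<open>lead d\<close> increase, and the generators \<open>BU\<close>
  of their union already lie in \<open>lead D\<close>. Polynomials with generators of
  \<open>lead d\<close> for \<open>d\<close> up to \<open>D\<close> as leading coefficients
  therefore suffice, higher degrees being reached by powers of the variable.\<close>

theorem hilbert_basis:
 assumes S: "subr S" "noeth S" shows "noeth (adjoin S t)"
 unfolding noeth_def
proof (intro allI impI)
 fix I assume I: "rid (adjoin S t) I"
 let ?T = "adjoin S t"
 have T: "subr ?T" by (rule subr_adjoin[OF S(1)])
 define J where "J = {p. (\<forall>i. coeff p i \<in> S) \<and> poly p t \<in> I}"
 have J_diff: "p - q \<in> J" if "p \<in> J" "q \<in> J" for p q
  using that poly_coeffs_closed(1)[OF S(1), of p q] sgrp_diff[OF rid_sgrp[OF I]] by (simp add: J_def)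
 have J_0: "0 \<in> J" using sgrp_0[OF subr_sgrp[OF S(1)]] sgrp_0[OF rid_sgrp[OF I]] by (simp add: J_def)
 have J_mult: "p * q \<in> J" if p: "\<forall>i. coeff p i \<in> S" and q: "q \<in> J" for p q
 proof -
  have "poly p t \<in> ?T" using p unfolding adjoin_def by blast
  then have "poly p t * poly q t \<in> I" using q by (intro rid_mult[OF I]) (auto simp: J_def)
  then show ?thesis using poly_coeffs_closed(2)[OF S(1) p, of q] q by (simp add: J_def)
 qed
 have sJ: "sgrp J" by (rule sgrpI) (auto intro: J_0 J_diff)
 define lead where "lead = (\<lambda>d. {coeff p d | p. p \<in> J \<and> (\<forall>i>d. coeff p i = 0)})"
 have lead_rid: "rid S (lead d)" for d
  unfolding rid_def
 proof (intro conjI ballI sgrpI)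
  show "0 \<in> lead d" unfolding lead_def using J_0 by (intro CollectI exI[of _ 0]) simp
  show "lead d \<subseteq> S" by (auto simp: lead_def J_def)
  fix x y assume "x \<in> lead d" "y \<in> lead d"
  then obtain p q where "x = coeff p d" "y = coeff q d" "p \<in> J" "q \<in> J" "\<forall>i>d. coeff p i = 0" "\<forall>i>d. coeff q i = 0"
   unfolding lead_def by blast
  then show "x - y \<in> lead d" unfolding lead_def using J_diff by (intro CollectI exI[of _ "p - q"]) simp
 next
  fix s x assume s: "s \<in> S" and "x \<in> lead d"
  then obtain p where p: "x = coeff p d" "p \<in> J" "\<forall>i>d. coeff p i = 0" unfolding lead_def by blast
  have "monom s 0 * p \<in> J" by (rule J_mult[OF poly_coeffs_monom[OF S(1) s] p(2)])
  then show "s * x \<in> lead d" unfolding lead_def using p by (intro CollectI exI[of _ "monom s 0 * p"]) (simp add: coeff_monom_mult)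
 qed
 have lead_Suc: "lead d \<subseteq> lead (Suc d)" for d
 proof
  fix x assume "x \<in> lead d"
  then obtain p where p: "x = coeff p d" "p \<in> J" "\<forall>i>d. coeff p i = 0" unfolding lead_def by blast
  have "monom 1 1 * p \<in> J" by (rule J_mult[OF poly_coeffs_monom[OF S(1) subr_1[OF S(1)]] p(2)])
  then show "x \<in> lead (Suc d)" unfolding lead_def using p by (intro CollectI exI[of _ "monom 1 1 * p"]) (simp add: coeff_monom_mult)
 qed
 have lead_mono: "lead d \<subseteq> lead e" if "d \<le> e" for d e
  using lift_Suc_mono_le[of lead, OF lead_Suc that] .
 define U where "U = (\<Union>d. lead d)"
 have "rid S U"
  unfolding rid_def
 proof (intro conjI ballI sgrpI)
  show "0 \<in> U" using sgrp_0[OF rid_sgrp[OF lead_rid]] by (auto simp: U_def)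
  show "U \<subseteq> S" using rid_subset[OF lead_rid] by (auto simp: U_def)
  fix x y assume "x \<in> U" "y \<in> U"
  then obtain d e where "x \<in> lead d" "y \<in> lead e" by (auto simp: U_def)
  then have "x \<in> lead (max d e)" "y \<in> lead (max d e)" using lead_mono[of d "max d e"] lead_mono[of e "max d e"] by auto
  then show "x - y \<in> U" using sgrp_diff[OF rid_sgrp[OF lead_rid]] by (auto simp: U_def)
 next
  fix s x assume "s \<in> S" "x \<in> U"
  then show "s * x \<in> U" using rid_mult[OF lead_rid] by (auto simp: U_def)
 qed
 then obtain BU where BU: "finite BU" "BU \<subseteq> U" "U \<subseteq> lin_span S BU" using S(2) unfolding noeth_def by blast
 obtain dd where dd: "\<And>b. b \<in> BU \<Longrightarrow> b \<in> lead (dd b)" using BU(2) unfolding U_def by (metis UN_E subsetD)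
 define D where "D = Max (insert 0 (dd ` BU))"
 have BUD: "BU \<subseteq> lead D"
 proof
  fix b assume b: "b \<in> BU"
  have "dd b \<le> D" unfolding D_def using BU(1) b by (intro Max_ge) auto
  then show "b \<in> lead D" using dd[OF b] lead_mono by blast
 qed
 have "\<exists>B. finite B \<and> B \<subseteq> lead d \<and> lead d \<subseteq> lin_span S B" for d
  using S(2) lead_rid unfolding noeth_def by blast
 then obtain B0 where B0: "\<And>d. finite (B0 d) \<and> B0 d \<subseteq> lead d \<and> lead d \<subseteq> lin_span S (B0 d)" by metis
 define B where "B = (\<lambda>d. if d < D then B0 d else BU)"
 have B: "finite (B d)" "B (min d D) \<subseteq> lead (min d D)" "lead d \<subseteq> lin_span S (B (min d D))" for d
 proof -
  show "finite (B d)" "B (min d D) \<subseteq> lead (min d D)" using B0 BU BUD by (auto simp: B_def)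
  show "lead d \<subseteq> lin_span S (B (min d D))"
  proof (cases "d < D")
   case True then show ?thesis using B0 by (simp add: B_def)
  next
   case False
   have "lead d \<subseteq> U" by (auto simp: U_def)
   then show ?thesis using BU(3) False by (auto simp: B_def)
  qed
 qed
 have "\<forall>d b. \<exists>p. b \<in> lead d \<longrightarrow> p \<in> J \<and> coeff p d = b \<and> (\<forall>i>d. coeff p i = 0)" unfolding lead_def by blast
 then obtain Q where Q: "\<And>d b. b \<in> lead d \<Longrightarrow> Q d b \<in> J \<and> coeff (Q d b) d = b \<and> (\<forall>i>d. coeff (Q d b) i = 0)" by metis
 define G where "G = (\<Union>d\<in>{..D}. (\<lambda>b. poly (Q d b) t) ` (B d \<inter> lead d))"
 have fG: "finite G" unfolding G_def using B(1) by (intro finite_UN_I) auto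
 have GI: "G \<subseteq> I" unfolding G_def using Q by (auto simp: J_def)
 have main: "poly p t \<in> lin_span ?T G" if "p \<in> J" "\<forall>i\<ge>d. coeff p i = 0" for p d
  using that
 proof (induction d arbitrary: p)
  case 0
  then have "p = 0" by (simp add: poly_eq_iff)
  then show ?case using sgrp_0[OF lin_span_sgrp[OF T]] by simp
 next
  case (Suc d)
  define e where "e = min d D"
  have "coeff p d \<in> lead d" unfolding lead_def using Suc.prems by (intro CollectI exI[of _ p]) auto
  then obtain c where c: "\<forall>b\<in>B e. c b \<in> S" "coeff p d = (\<Sum>b\<in>B e. c b * b)"
   using B(3)[of d] unfolding e_def lin_span_def by blast
  define r where "r = (\<Sum>b\<in>B e. monom (c b) (d - e) * Q e b)"
  have bl: "b \<in> lead e" if "b \<in> B e" for b using B(2)[of d] that unfolding e_def by blast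
  have rJ: "r \<in> J" unfolding r_def
   by (intro sgrp_sum[OF sJ] J_mult poly_coeffs_monom[OF S(1)]) (use c(1) Q bl in auto)
  have rc: "coeff r i = (\<Sum>b\<in>B e. if i < d - e then 0 else c b * coeff (Q e b) (i - (d - e)))" for i
   unfolding r_def by (simp add: coeff_sum coeff_monom_mult)
  have "coeff r i = 0" if "i > d" for i
   unfolding rc by (rule sum.neutral) (use that Q bl in \<open>auto simp: e_def\<close>)
  moreover have "coeff r d = coeff p d"
  proof -
   have "d - (d - e) = e" by (simp add: e_def)
   then show ?thesis unfolding rc c(2) using Q bl by (intro sum.cong) auto
  qed
  ultimately have "\<forall>i\<ge>d. coeff (p - r) i = 0" using Suc.prems(2)
   by (metis Suc_leI coeff_diff diff_self le_neq_implies_less)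
  then have 1: "poly (p - r) t \<in> lin_span ?T G" by (rule Suc.IH[OF J_diff[OF Suc.prems(1) rJ]])
  have 2: "poly r t \<in> lin_span ?T G"
   unfolding r_def poly_sum poly_mult
  proof (rule sgrp_sum[OF lin_span_sgrp[OF T]], rule lin_span_mult[OF T])
   fix b assume b: "b \<in> B e"
   show "poly (monom (c b) (d - e)) t \<in> ?T" unfolding poly_monom using adjoin_monom[OF S(1)] c(1) b by blast
   have "poly (Q e b) t \<in> G" unfolding G_def using b bl by (intro UN_I[of e]) (auto simp: e_def)
   then show "poly (Q e b) t \<in> lin_span ?T G" by (rule lin_span_base[OF T fG])
  qed
  from sgrp_add[OF lin_span_sgrp[OF T] 1 2] show ?case by simp
 qed
 have "I \<subseteq> lin_span ?T G"
 proof
  fix x assume x: "x \<in> I"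
  then obtain p where p: "x = poly p t" "\<forall>i. coeff p i \<in> S" using rid_subset[OF I] unfolding adjoin_def by blast
  have "poly p t \<in> lin_span ?T G"
   by (rule main[of p "Suc (degree p)"]) (use p x in \<open>auto simp: J_def coeff_eq_0\<close>)
  then show "x \<in> lin_span ?T G" using p by simp
 qed
 then show "\<exists>B. finite B \<and> B \<subseteq> I \<and> I \<subseteq> lin_span ?T B" using fG GI by blast
qed

text \<open>Powers of \<open>t\<close> move any element of \<open>I\<close> into
  \<open>I \<inter> T\<close>, and powers of \<open>u\<close> move it back; generators of the
  intersection over \<open>T\<close> thus generate \<open>I\<close> over \<open>S\<close>.\<close>

lemma noeth_invert:
 assumes T: "subr T" "noeth T" "T \<subseteq> S" and S: "subr S" and t: "t \<in> T" "u \<in> S" "t * u = 1"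
  and loc: "\<And>x. x \<in> S \<Longrightarrow> \<exists>k. t ^ k * x \<in> T"
 shows "noeth S"
 unfolding noeth_def
proof (intro allI impI)
 fix I assume I: "rid S I"
 have "rid T (I \<inter> T)"
  unfolding rid_def
 proof (intro conjI ballI sgrpI Int_lower2)
  show "0 \<in> I \<inter> T" using sgrp_0[OF rid_sgrp[OF I]] sgrp_0[OF subr_sgrp[OF T(1)]] by simp
  fix x y assume "x \<in> I \<inter> T" "y \<in> I \<inter> T"
  then show "x - y \<in> I \<inter> T" using sgrp_diff[OF rid_sgrp[OF I]] sgrp_diff[OF subr_sgrp[OF T(1)]] by simp
 next
  fix s x assume "s \<in> T" "x \<in> I \<inter> T"
  then show "s * x \<in> I \<inter> T" using rid_mult[OF I] T(3) subr_mult[OF T(1)] by auto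
 qed
 from T(2)[unfolded noeth_def, rule_format, OF this]
 obtain B where B: "finite B" "B \<subseteq> I \<inter> T" "I \<inter> T \<subseteq> lin_span T B" by (elim exE conjE)
 have "I \<subseteq> lin_span S B"
 proof
  fix x assume x: "x \<in> I"
  then obtain k where k: "t ^ k * x \<in> T" using loc rid_subset[OF I] by blast
  have "t ^ k * x \<in> I" using rid_mult[OF I _ x] subr_power[OF S] t(1) T(3) by blast
  then have "t ^ k * x \<in> lin_span T B" using B(3) k by blast
  then have "t ^ k * x \<in> lin_span S B" using T(3) unfolding lin_span_def by blast
  then have "u ^ k * (t ^ k * x) \<in> lin_span S B" by (rule lin_span_mult[OF S subr_power[OF S t(2)]])
  moreover have "u ^ k * (t ^ k * x) = x" using t(3) by (metis mult.assoc mult.commute mult_1 power_mult_distrib power_one)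
  ultimately show "x \<in> lin_span S B" by simp
 qed
 then show "\<exists>B. finite B \<and> B \<subseteq> I \<and> I \<subseteq> lin_span S B" using B by blast
qed

lemma noeth_Rn_0: "noeth (Rn 0)"
 unfolding noeth_def
proof (intro allI impI)
 fix I assume I: "rid (Rn 0) I"
 have single: "r = Poly_Mapping.single 0 (lookup r 0)" if "r \<in> Rn 0" for r
 proof (rule poly_mapping_eqI)
  fix k
  have "k = 0" if "k \<in> keys r" using \<open>r \<in> Rn 0\<close> that by (auto simp: Rn_def)
  then show "lookup r k = lookup (Poly_Mapping.single 0 (lookup r 0)) k"
   by (auto simp: lookup_single when_def in_keys_iff)
 qed
 have single_Rn: "Poly_Mapping.single 0 c \<in> Rn 0" for c by (simp add: Rn_def)
 let ?A = "{c. Poly_Mapping.single 0 c \<in> I}"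
 have sA: "sgrp ?A" using rid_sgrp[OF I] by (auto simp: sgrp_def single_diff)
 show "\<exists>B. finite B \<and> B \<subseteq> I \<and> I \<subseteq> lin_span (Rn 0) B"
 proof (cases "\<exists>a\<in>?A. a \<noteq> 0")
  case True
  then obtain c where c: "c > 0" "c \<in> ?A" "\<And>x. x \<in> ?A \<Longrightarrow> c dvd x" using int_subgroup_principal[OF sA] by metis
  have "x \<in> lin_span (Rn 0) {Poly_Mapping.single 0 c}" if x: "x \<in> I" for x
  proof -
   have xs: "x = Poly_Mapping.single 0 (lookup x 0)" using single rid_subset[OF I] x by blast
   then have "c dvd lookup x 0" using c(3) x by simp
   then obtain d where "lookup x 0 = c * d" by (auto simp: dvd_def)
   then have "x = Poly_Mapping.single 0 d * Poly_Mapping.single 0 c" using xs by (simp add: mult_single mult.commute)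
   then show ?thesis unfolding lin_span_def using single_Rn by (intro CollectI exI[of _ "\<lambda>_. Poly_Mapping.single 0 d"]) simp
  qed
  then show ?thesis using c(2) by (intro exI[of _ "{Poly_Mapping.single 0 c}"]) auto
 next
  case False
  have "x = 0" if x: "x \<in> I" for x
  proof -
   have xs: "x = Poly_Mapping.single 0 (lookup x 0)" using single rid_subset[OF I] x by blast
   then have "lookup x 0 = 0" using False x by auto
   then show ?thesis using xs by simp
  qed
  then show ?thesis by (intro exI[of _ "{}"]) (auto simp: lin_span_def)
 qed
qed

lemma frag_of_power: "frag_of (Poly_Mapping.single i 1 :: mon) ^ k = frag_of (Poly_Mapping.single i (int k))"
proof (induction k)
 case (Suc k)
 then show ?case by (simp add: mult_single single_add[symmetric])
qed simp

text \<open>One more variable is first adjoined and then inverted. A monomial is brought into the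
  intermediate ring by the power of the new variable that cancels its negative exponent.\<close>

theorem noeth_Rn: "noeth (Rn n)"
proof (induction n)
 case (Suc n)
 let ?t = "frag_of (Poly_Mapping.single n 1 :: mon)" and ?u = "frag_of (Poly_Mapping.single n (-1) :: mon)"
 let ?T = "adjoin (Rn n) ?t"
 have T: "subr ?T" by (rule subr_adjoin[OF subr_Rn])
 have RR: "Rn n \<subseteq> Rn (Suc n)" by (force simp: Rn_def)
 have tR: "?t \<in> Rn (Suc n)" "?u \<in> Rn (Suc n)" by (simp_all add: Rn_frag_of)
 have TS: "?T \<subseteq> Rn (Suc n)"
 proof
  fix x assume "x \<in> ?T"
  then obtain p where p: "x = poly p ?t" "\<forall>i. coeff p i \<in> Rn n" unfolding adjoin_def by blast
  show "x \<in> Rn (Suc n)" unfolding p(1) poly_altdef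
   by (intro sgrp_sum[OF sgrp_Rn] Rn_mult Rn_power tR) (use p(2) RR in blast)
 qed
 show ?case
 proof (rule noeth_invert[OF T hilbert_basis[OF subr_Rn Suc] TS subr_Rn _ tR(2)])
  show tT: "?t \<in> ?T" using adjoin_monom[OF subr_Rn Rn_1, of ?t 1] by simp
  show "?t * ?u = 1" by (simp add: mult_single flip: single_add)
  fix x assume "x \<in> Rn (Suc n)"
  then have "keys x \<subseteq> {k. keys k \<subseteq> {..<Suc n}}" by (auto simp: Rn_def)
  then show "\<exists>k. ?t ^ k * x \<in> ?T"
  proof (induction x rule: frag_induction)
   case zero
   show ?case using sgrp_0[OF subr_sgrp[OF T]] by (intro exI[of _ 0]) simp
  next
   case (one k)
   define c where "c = lookup k n"
   define k' where "k' = k - Poly_Mapping.single n c"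
   have "keys k' \<subseteq> {..<n}"
   proof
    fix i assume i: "i \<in> keys k'"
    then have "i \<noteq> n" by (auto simp: k'_def c_def in_keys_iff lookup_minus)
    moreover from this i have "i \<in> keys k" by (auto simp: k'_def in_keys_iff lookup_minus lookup_single)
    ultimately show "i \<in> {..<n}" using one by auto
   qed
   then have k'R: "frag_of k' \<in> Rn n" by (simp add: Rn_frag_of)
   have "?t ^ nat (- c) * frag_of k = frag_of k' * ?t ^ nat c"
    unfolding frag_of_power by (simp add: mult_single k'_def algebra_simps single_diff[symmetric] single_uminus flip: single_add)
   then show ?case using adjoin_monom[OF subr_Rn k'R, of ?t "nat c"] by metis
  next
   case (diff a b)
   then obtain i j where ij: "?t ^ i * a \<in> ?T" "?t ^ j * b \<in> ?T" by blast
   have "?t ^ j * (?t ^ i * a) - ?t ^ i * (?t ^ j * b) \<in> ?T"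
    by (intro sgrp_diff[OF subr_sgrp[OF T]] subr_mult[OF T] subr_power[OF T] tT ij)
   moreover have "?t ^ j * (?t ^ i * a) - ?t ^ i * (?t ^ j * b) = ?t ^ (i + j) * (a - b)"
    by (simp add: power_add algebra_simps)
   ultimately show ?case by metis
  qed
 qed
qed (rule noeth_Rn_0)

text \<open>In a chain of counterexamples the union is finitely generated, hence equal to a member,
  so Zorn gives a maximal counterexample \<open>M\<close>. It is not prime: \<open>a * b\<close>
  lies in \<open>M\<close> with \<open>a\<close> and \<open>b\<close> outside. The larger ideals
  \<open>ext a\<close> and \<open>ext b\<close> satisfy \<open>Q\<close>, and their products lie in
  \<open>M\<close>.\<close>

theorem noeth_prime_induct:
 assumes S: "subr S" "noeth S" and I0: "rid S I0"
  and prime: "\<And>P. rprime S P \<Longrightarrow> I0 \<subseteq> P \<Longrightarrow> Q P"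
  and prod: "\<And>I I1 I2. rid S I \<Longrightarrow> rid S I1 \<Longrightarrow> rid S I2 \<Longrightarrow> (\<And>a b. a \<in> I1 \<Longrightarrow> b \<in> I2 \<Longrightarrow> a * b \<in> I) \<Longrightarrow>
   I \<subseteq> I1 \<Longrightarrow> I \<subseteq> I2 \<Longrightarrow> Q I1 \<Longrightarrow> Q I2 \<Longrightarrow> Q I"
  and top: "Q S"
 shows "Q I0"
proof (rule ccontr)
 assume nQ: "\<not> Q I0"
 let ?F = "{I. rid S I \<and> I0 \<subseteq> I \<and> \<not> Q I}"
 have "\<exists>M\<in>?F. \<forall>X\<in>?F. M \<subseteq> X \<longrightarrow> X = M"
 proof (rule subset_Zorn_nonempty)
  show "?F \<noteq> {}" using I0 nQ by blast
  fix C assume C: "C \<noteq> {}" "subset.chain ?F C"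
  have CF: "\<And>I. I \<in> C \<Longrightarrow> rid S I \<and> I0 \<subseteq> I \<and> \<not> Q I" and lin: "\<And>I J. I \<in> C \<Longrightarrow> J \<in> C \<Longrightarrow> I \<subseteq> J \<or> J \<subseteq> I"
   using C(2) unfolding subset.chain_def by blast+
  have U: "rid S (\<Union>C)"
   unfolding rid_def
  proof (intro conjI ballI sgrpI)
   show "0 \<in> \<Union>C" using C(1) CF sgrp_0 rid_sgrp by blast
   show "\<Union>C \<subseteq> S" using CF rid_subset by blast
   fix x y assume "x \<in> \<Union>C" "y \<in> \<Union>C"
   then obtain I J where "I \<in> C" "J \<in> C" "x \<in> I" "y \<in> J" by blast
   then obtain K where "K \<in> C" "x \<in> K" "y \<in> K" using lin by blast
   then show "x - y \<in> \<Union>C" using CF sgrp_diff rid_sgrp by blast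
  next
   fix s x assume "s \<in> S" "x \<in> \<Union>C"
   then show "s * x \<in> \<Union>C" using CF rid_mult by blast
  qed
  then obtain B where B: "finite B" "B \<subseteq> \<Union>C" "\<Union>C \<subseteq> lin_span S B" using S(2) unfolding noeth_def by blast
  obtain K where K: "K \<in> C" "B \<subseteq> K" using finite_subset_Union_chain[OF B(1,2) C(1)] C(2) by metis
  have rK: "rid S K" using CF K(1) by blast
  have "lin_span S B \<subseteq> K"
   unfolding lin_span_def using K(2) rid_mult[OF rK] by (auto intro!: sgrp_sum[OF rid_sgrp[OF rK]])
  then have "\<Union>C = K" using B(3) K(1) by blast
  then show "\<Union>C \<in> ?F" using CF K(1) by blast
 qed
 then obtain M where M0: "M \<in> ?F" "\<forall>X\<in>?F. M \<subseteq> X \<longrightarrow> X = M" by (rule bexE)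
 have M: "rid S M" "I0 \<subseteq> M" "\<not> Q M" using M0(1) by simp_all
 have mx: "X = M" if "rid S X" "I0 \<subseteq> X" "\<not> Q X" "M \<subseteq> X" for X
  using M0(2) that by simp
 have "M \<noteq> S" using M(3) top by blast
 have "\<not> rprime S M" using prime[of M] M by auto
 then obtain a b where ab: "a \<in> S" "b \<in> S" "a * b \<in> M" "a \<notin> M" "b \<notin> M" using M(1) \<open>M \<noteq> S\<close> unfolding rprime_def by blast
 define ext where "ext = (\<lambda>a. {x + s * a | x s. x \<in> M \<and> s \<in> S})"
 have ext: "rid S (ext a)" "M \<subseteq> ext a" "a \<in> ext a" if a: "a \<in> S" for a
 proof -
  show "M \<subseteq> ext a"
  proof
   fix x assume "x \<in> M"
   then show "x \<in> ext a" unfolding ext_def using sgrp_0[OF subr_sgrp[OF S(1)]] by (intro CollectI exI[of _ x] exI[of _ 0]) simp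
  qed
  show "a \<in> ext a" unfolding ext_def using sgrp_0[OF rid_sgrp[OF M(1)]] subr_1[OF S(1)] by (intro CollectI exI[of _ 0] exI[of _ 1]) simp
  show "rid S (ext a)" unfolding rid_def
  proof (intro conjI ballI sgrpI)
   show "0 \<in> ext a" using \<open>M \<subseteq> ext a\<close> sgrp_0[OF rid_sgrp[OF M(1)]] by blast
   show "ext a \<subseteq> S" unfolding ext_def using rid_subset[OF M(1)] a by (auto intro!: sgrp_add[OF subr_sgrp[OF S(1)]] subr_mult[OF S(1)])
   fix x y assume "x \<in> ext a" "y \<in> ext a"
   then obtain x1 s1 x2 s2 where h: "x = x1 + s1 * a" "y = x2 + s2 * a" "x1 \<in> M" "x2 \<in> M" "s1 \<in> S" "s2 \<in> S" unfolding ext_def by blast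
   have "x - y = (x1 - x2) + (s1 - s2) * a" unfolding h by (simp add: algebra_simps)
   then show "x - y \<in> ext a" unfolding ext_def using h sgrp_diff[OF rid_sgrp[OF M(1)]] sgrp_diff[OF subr_sgrp[OF S(1)]] by blast
  next
   fix s x assume s: "s \<in> S" and "x \<in> ext a"
   then obtain x1 s1 where h: "x = x1 + s1 * a" "x1 \<in> M" "s1 \<in> S" unfolding ext_def by blast
   have "s * x = s * x1 + (s * s1) * a" unfolding h by (simp add: algebra_simps)
   then show "s * x \<in> ext a" unfolding ext_def using h s rid_mult[OF M(1) s] subr_mult[OF S(1) s] by blast
  qed
 qed
 have "Q (ext y)" if y: "y \<in> S" "y \<notin> M" for y
  using mx[OF ext(1)[OF y(1)] _ _ ext(2)[OF y(1)]] ext(2,3)[OF y(1)] M(2) y(2) by auto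
 then have "Q (ext a)" "Q (ext b)" using ab by simp_all
 moreover have "x * y \<in> M" if xy: "x \<in> ext a" "y \<in> ext b" for x y
 proof -
  obtain x1 s1 x2 s2 where h: "x = x1 + s1 * a" "y = x2 + s2 * b" "x1 \<in> M" "x2 \<in> M" "s1 \<in> S" "s2 \<in> S"
   using xy unfolding ext_def by blast
  have "y \<in> S" using ext(1)[OF ab(2)] rid_subset xy(2) by blast
  have "x * y = y * x1 + ((s1 * a) * x2 + (s1 * s2) * (a * b))" unfolding h by (simp add: algebra_simps)
  also have "\<dots> \<in> M"
   by (intro sgrp_add[OF rid_sgrp[OF M(1)]] rid_mult[OF M(1)] subr_mult[OF S(1)] h ab \<open>y \<in> S\<close>)
  finally show ?thesis .
 qed
 ultimately have "Q M" using prod[OF M(1) ext(1)[OF ab(1)] ext(1)[OF ab(2)] _ ext(2)[OF ab(1)] ext(2)[OF ab(2)]] by simp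
 then show False using M(3) by blast
qed

section \<open>Primes of height one\<close>

text \<open>Height one in a domain, expressed without chains; \<open>prime_height_ht1\<close>
  connects it with \<open>prime_height\<close>.\<close>

definition ht1 :: "'r::comm_ring_1 set \<Rightarrow> 'r set \<Rightarrow> bool" where
 "ht1 S P \<longleftrightarrow> rprime S P \<and> P \<noteq> {0} \<and> (\<forall>Q. rprime S Q \<longrightarrow> Q \<subset> P \<longrightarrow> Q = {0})"

definition gen2 :: "'r::comm_ring_1 set \<Rightarrow> 'r \<Rightarrow> 'r \<Rightarrow> 'r set" where
 "gen2 S f g = {f * a + g * b | a b. a \<in> S \<and> b \<in> S}"

lemma rprime_rid: "rprime S P \<Longrightarrow> rid S P"
 by (simp add: rprime_def)

lemma rprime_mult: "rprime S P \<Longrightarrow> a \<in> S \<Longrightarrow> b \<in> S \<Longrightarrow> a * b \<in> P \<Longrightarrow> a \<in> P \<or> b \<in> P"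
 by (simp add: rprime_def)

lemma rid_eq_top: assumes "rid S I" "1 \<in> I" shows "I = S"
proof
 show "S \<subseteq> I" using rid_mult[OF assms(1) _ assms(2)] by auto
qed (rule rid_subset[OF assms(1)])

lemma rprime_1: assumes "rprime S P" shows "1 \<notin> P"
 using rid_eq_top[OF rprime_rid[OF assms]] assms by (auto simp: rprime_def)

lemma rprime_prod:
 assumes S: "subr S" and P: "rprime S P" and "finite A" "\<And>a. a \<in> A \<Longrightarrow> h a \<in> S" "prod h A \<in> P"
 shows "\<exists>a\<in>A. h a \<in> P"
 using assms(3-5)
proof (induction A rule: finite_induct)
 case empty then show ?case using rprime_1[OF P] by simp
next
 case (insert x A)
 have "\<forall>a\<in>A. h a \<in> S" using insert.prems(1) by blast
 with insert.hyps(1) have "prod h A \<in> S"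
  by (induction A rule: finite_induct) (auto simp: subr_1[OF S] subr_mult[OF S])
 then have "h x \<in> P \<or> prod h A \<in> P" using rprime_mult[OF P, of "h x" "prod h A"] insert by simp
 then show ?case using insert by blast
qed

lemma rid_gen2: assumes S: "subr S" and "f \<in> S" "g \<in> S" shows "rid S (gen2 S f g)"
 unfolding rid_def
proof (intro conjI ballI sgrpI subsetI)
 show "0 \<in> gen2 S f g" unfolding gen2_def using sgrp_0[OF subr_sgrp[OF S]] by force
next
 fix x y assume "x \<in> gen2 S f g" "y \<in> gen2 S f g"
 then obtain a b c d where h: "x = f * a + g * b" "y = f * c + g * d" "a \<in> S" "b \<in> S" "c \<in> S" "d \<in> S" unfolding gen2_def by blast
 have "x - y = f * (a - c) + g * (b - d)" unfolding h by (simp add: algebra_simps)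
 then show "x - y \<in> gen2 S f g" unfolding gen2_def using h sgrp_diff[OF subr_sgrp[OF S]] by blast
next
 fix x assume "x \<in> gen2 S f g"
 then show "x \<in> S" unfolding gen2_def using assms by (auto intro!: sgrp_add[OF subr_sgrp[OF S]] subr_mult[OF S])
next
 fix s x assume s: "s \<in> S" and "x \<in> gen2 S f g"
 then obtain a b where h: "x = f * a + g * b" "a \<in> S" "b \<in> S" unfolding gen2_def by blast
 have "s * x = f * (s * a) + g * (s * b)" unfolding h by (simp add: algebra_simps)
 then show "s * x \<in> gen2 S f g" unfolding gen2_def using h subr_mult[OF S s] by blast
qed

lemma gen2_mem: assumes "subr S" shows "f \<in> gen2 S f g" "g \<in> gen2 S f g"
 unfolding gen2_def using subr_1[OF assms] sgrp_0[OF subr_sgrp[OF assms]]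
 by (intro CollectI exI[of _ 1] exI[of _ 0]; simp)+

text \<open>A prime of height one above a nonzero prime coincides with it, and a prime containing
  all products from two ideals contains one of the ideals. So Noetherian induction applies, starting
  from the principal ideal \<open>gen2 S f 0\<close>.\<close>

lemma finite_ht1_over:
 fixes S :: "'r::idom set"
 assumes S: "subr S" "noeth S" and f: "f \<in> S" "f \<noteq> 0"
 shows "finite {P. ht1 S P \<and> f \<in> P}"
proof -
 have S0: "0 \<in> S" by (rule sgrp_0[OF subr_sgrp[OF S(1)]])
 have "finite {P. ht1 S P \<and> gen2 S f 0 \<subseteq> P}"
 proof (rule noeth_prime_induct[OF S rid_gen2[OF S(1) f(1) S0]])
  fix P assume P: "rprime S P" "gen2 S f 0 \<subseteq> P"
  then have fP: "f \<in> P" using gen2_mem[OF S(1)] by blast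
  have "{P'. ht1 S P' \<and> P \<subseteq> P'} \<subseteq> {P}"
  proof
   fix P' assume "P' \<in> {P'. ht1 S P' \<and> P \<subseteq> P'}"
   then have "P \<subset> P' \<Longrightarrow> P = {0}" "P \<subseteq> P'" using P(1) unfolding ht1_def by blast+
   then show "P' \<in> {P}" using fP f(2) by auto
  qed
  then show "finite {P'. ht1 S P' \<and> P \<subseteq> P'}" by (rule finite_subset) simp
 next
  fix I I1 I2
  assume I12: "rid S I1" "rid S I2" and prod: "\<And>a b. a \<in> I1 \<Longrightarrow> b \<in> I2 \<Longrightarrow> a * b \<in> I"
   and fin: "finite {P. ht1 S P \<and> I1 \<subseteq> P}" "finite {P. ht1 S P \<and> I2 \<subseteq> P}"
  have "{P. ht1 S P \<and> I \<subseteq> P} \<subseteq> {P. ht1 S P \<and> I1 \<subseteq> P} \<union> {P. ht1 S P \<and> I2 \<subseteq> P}"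
  proof
   fix P assume "P \<in> {P. ht1 S P \<and> I \<subseteq> P}"
   then have P: "ht1 S P" "I \<subseteq> P" by auto
   have "I1 \<subseteq> P \<or> I2 \<subseteq> P"
   proof (rule ccontr)
    assume "\<not> (I1 \<subseteq> P \<or> I2 \<subseteq> P)"
    then obtain a b where ab: "a \<in> I1" "a \<notin> P" "b \<in> I2" "b \<notin> P" by blast
    have "a * b \<in> P" using prod ab P(2) by blast
    moreover have "a \<in> S" "b \<in> S" using ab I12 rid_subset by blast+
    ultimately show False using rprime_mult[of S P a b] P(1) ab by (simp add: ht1_def)
   qed
   then show "P \<in> {P. ht1 S P \<and> I1 \<subseteq> P} \<union> {P. ht1 S P \<and> I2 \<subseteq> P}" using P(1) by blast
  qed
  then show "finite {P. ht1 S P \<and> I \<subseteq> P}" by (rule finite_subset) (use fin in simp)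
 next
  have "{P. ht1 S P \<and> S \<subseteq> P} = {}" using rprime_1 subr_1[OF S(1)] unfolding ht1_def by blast
  then show "finite {P. ht1 S P \<and> S \<subseteq> P}" by (simp only: finite.emptyI)
 qed
 moreover have "{P. ht1 S P \<and> f \<in> P} \<subseteq> {P. ht1 S P \<and> gen2 S f 0 \<subseteq> P}"
 proof clarify
  fix P a assume P: "ht1 S P" "f \<in> P" and "a \<in> gen2 S f 0"
  then obtain b where "a = f * b" "b \<in> S" by (auto simp: gen2_def)
  then show "a \<in> P" using rid_mult[OF rprime_rid, of S P b f] P by (simp add: ht1_def mult.commute)
 qed
 ultimately show ?thesis by (rule finite_subset[rotated])
qed

lemma ht1_incomparable: "ht1 S P \<Longrightarrow> ht1 S P' \<Longrightarrow> P \<subseteq> P' \<Longrightarrow> P = P'"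
 unfolding ht1_def by blast

text \<open>Primes of height one are incomparable, so \<open>b P P'\<close> can be chosen in
  \<open>P'\<close> outside \<open>P\<close>. Modulo a given \<open>P\<close> all summands of
  \<open>g\<close> vanish except its own, whose factors all lie outside \<open>P\<close>.\<close>

lemma ht1_avoidance:
 assumes S: "subr S" and I: "rid S I" and F: "finite F" "\<And>P. P \<in> F \<Longrightarrow> ht1 S P" "\<And>P. P \<in> F \<Longrightarrow> \<not> I \<subseteq> P"
 shows "\<exists>g\<in>I. \<forall>P\<in>F. g \<notin> P"
proof -
 have "\<exists>a. a \<in> I \<and> a \<notin> P" if "P \<in> F" for P using F(3)[OF that] by blast
 then obtain a where a: "\<And>P. P \<in> F \<Longrightarrow> a P \<in> I \<and> a P \<notin> P" by metis
 have "\<exists>b. b \<in> P' \<and> b \<notin> P" if "P \<in> F" "P' \<in> F" "P' \<noteq> P" for P P'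
  using ht1_incomparable[OF F(2)[OF that(2)] F(2)[OF that(1)]] that(3) by blast
 then obtain b where b: "\<And>P P'. P \<in> F \<Longrightarrow> P' \<in> F \<Longrightarrow> P' \<noteq> P \<Longrightarrow> b P P' \<in> P' \<and> b P P' \<notin> P" by metis
 have pr: "rprime S P" if "P \<in> F" for P using F(2)[OF that] by (simp add: ht1_def)
 have bS: "b P P' \<in> S" if "P \<in> F" "P' \<in> F" "P' \<noteq> P" for P P'
  using b[OF that] rid_subset[OF rprime_rid[OF pr[OF that(2)]]] by blast
 have aS: "a P \<in> S" if "P \<in> F" for P using a[OF that] rid_subset[OF I] by blast
 define g where "g = (\<Sum>P\<in>F. (\<Prod>P'\<in>F - {P}. b P P') * a P)"
 have pS: "(\<Prod>P'\<in>A. b P P') \<in> S" if "P \<in> F" "A \<subseteq> F - {P}" for P A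
 proof -
  have "finite A" using that(2) F(1) finite_subset by blast
  then show ?thesis using that(2)
   by (induction A rule: finite_induct) (use subr_1[OF S] subr_mult[OF S] bS[OF that(1)] in auto)
 qed
 have "g \<in> I" unfolding g_def by (intro sgrp_sum[OF rid_sgrp[OF I]] rid_mult[OF I] pS) (use a in auto)
 moreover have "g \<notin> P" if P: "P \<in> F" for P
 proof
  assume gP: "g \<in> P"
  have rP: "rid S P" by (rule rprime_rid[OF pr[OF P]])
  have "(\<Prod>P'\<in>F - {Q}. b Q P') * a Q \<in> P" if Q: "Q \<in> F - {P}" for Q
  proof -
   have "(\<Prod>P'\<in>F - {Q}. b Q P') = b Q P * (\<Prod>P'\<in>F - {Q} - {P}. b Q P')"
    by (rule prod.remove) (use F(1) P Q in auto)
   then have "(\<Prod>P'\<in>F - {Q}. b Q P') * a Q = ((\<Prod>P'\<in>F - {Q} - {P}. b Q P') * a Q) * b Q P" by (simp add: mult_ac)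
   also have "\<dots> \<in> P"
    by (intro rid_mult[OF rP] subr_mult[OF S] pS aS) (use Q P b in auto)
   finally show ?thesis .
  qed
  then have 1: "(\<Sum>Q\<in>F - {P}. (\<Prod>P'\<in>F - {Q}. b Q P') * a Q) \<in> P" by (intro sgrp_sum[OF rid_sgrp[OF rP]])
  have 2: "g = (\<Prod>P'\<in>F - {P}. b P P') * a P + (\<Sum>Q\<in>F - {P}. (\<Prod>P'\<in>F - {Q}. b Q P') * a Q)"
   unfolding g_def by (rule sum.remove[OF F(1) P])
  have "(\<Prod>P'\<in>F - {P}. b P P') * a P \<in> P"
   using sgrp_diff[OF rid_sgrp[OF rP] gP 1] unfolding 2 by simp
  then have "(\<Prod>P'\<in>F - {P}. b P P') \<in> P" using rprime_mult[OF pr[OF P] pS[OF P subset_refl] aS[OF P]] a[OF P] by blast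
  then have "\<exists>P'\<in>F - {P}. b P P' \<in> P" by (intro rprime_prod[OF S pr[OF P]]) (use F(1) bS[OF P] in auto)
  then show False using b[OF P] by blast
 qed
 ultimately show ?thesis by blast
qed

section \<open>Reduction modulo 2 and the prime generated by 2\<close>

definition mod2 :: "lp \<Rightarrow> mon \<Rightarrow>\<^sub>0 bit" where
 "mod2 r = Poly_Mapping.map of_int r"

lemma lookup_mod2: "lookup (mod2 r) k = of_int (lookup r k)"
 by (simp add: mod2_def Poly_Mapping.map.rep_eq when_def)

lemma mod2_diff: "mod2 (r - s) = mod2 r - mod2 s"
 by (rule poly_mapping_eqI) (simp add: lookup_mod2 lookup_minus)

lemma mod2_frag: "mod2 (frag_of y) = Poly_Mapping.single y 1"
 by (rule poly_mapping_eqI) (simp add: lookup_mod2 lookup_single when_def)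

lemma mod2_mult: "mod2 (r * s) = mod2 r * mod2 s"
proof (induction r rule: lp_induct)
 case zero
 have "mod2 0 = 0" by (rule poly_mapping_eqI) (simp add: lookup_mod2)
 then show ?case by simp
next
 case (one y)
 show ?case
 proof (induction s rule: lp_induct)
  case zero
  have "mod2 0 = 0" by (rule poly_mapping_eqI) (simp add: lookup_mod2)
  then show ?case by simp
 next
  case (one z)
  show ?case by (simp add: mult_single mod2_frag)
 next
  case (diff a b)
  then show ?case by (simp add: mod2_diff right_diff_distrib)
 qed
next
 case (diff a b)
 then show ?case by (simp add: mod2_diff left_diff_distrib)
qed

lemma mod2_eq_0: "mod2 r = 0 \<longleftrightarrow> (\<forall>k. even (lookup r k))"
proof -
 have "(of_int c :: bit) = 0 \<longleftrightarrow> even c" for c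
  using even_of_int_iff[of c, where ?'a = bit] by (cases "of_int c :: bit") auto
 then show ?thesis by (simp add: poly_mapping_eq_iff fun_eq_iff lookup_mod2)
qed

lemma mod2_half:
 assumes "r \<in> Rn n" "mod2 r = 0" obtains s where "s \<in> Rn n" "r = s + s"
proof
 let ?s = "Poly_Mapping.map (\<lambda>c. c div 2) r"
 have l: "lookup ?s k = lookup r k div 2" for k
  by (simp add: Poly_Mapping.map.rep_eq when_def)
 show "?s \<in> Rn n" using assms(1) unfolding Rn_def by (auto simp: in_keys_iff l)
 show "r = ?s + ?s"
 proof (rule poly_mapping_eqI)
  fix k
  have "even (lookup r k)" using assms(2) by (simp add: mod2_eq_0)
  then show "lookup r k = lookup (?s + ?s) k" unfolding lookup_add l by (auto elim!: evenE)
 qed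
qed

lemma l1norm_double: "l1norm (s + s) = 2 * l1norm s"
proof -
 have l: "lookup (s + s) k = 2 * lookup s k" for k unfolding lookup_add by simp
 then have "keys (s + s) = keys s" unfolding set_eq_iff in_keys_iff by simp
 then show ?thesis unfolding l1norm_def l by (simp add: sum_distrib_left abs_mult)
qed

lemma l1norm_eq_0: "l1norm s = 0 \<longleftrightarrow> s = 0"
 by (simp add: l1norm_def sum_nonneg_eq_0_iff in_keys_iff) (auto simp: poly_mapping_eq_iff fun_eq_iff)

text \<open>A prime \<open>Q\<close> strictly inside does not contain 2, so from
  \<open>x = s + s\<close> in \<open>Q\<close> follows \<open>s\<close> in \<open>Q\<close>; halving
  \<open>l1norm\<close> forever forces \<open>x = 0\<close>. The point is that for every
  \<open>n\<close> a prime of height one exists, so an ideal contained in none of them is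
  nonzero.\<close>

theorem ht1_even: "ht1 (Rn n) {r\<in>Rn n. mod2 r = 0}"
 unfolding ht1_def
proof (intro conjI allI impI)
 let ?P = "{r\<in>Rn n. mod2 r = 0}"
 have m0: "mod2 0 = 0" using mod2_diff[of 0 0] by simp
 have "rid (Rn n) ?P"
  unfolding rid_def by (auto intro!: sgrpI simp: m0 sgrp_0[OF sgrp_Rn] sgrp_diff[OF sgrp_Rn] mod2_diff mod2_mult Rn_mult)
 moreover have "mod2 1 \<noteq> 0" using mod2_frag[of 0] by simp
 then have "?P \<noteq> Rn n" using Rn_1 by blast
 ultimately show "rprime (Rn n) ?P" unfolding rprime_def by (auto simp: mod2_mult)
 have "mod2 (1 + 1) = 0" unfolding mod2_eq_0 lookup_add by simp
 moreover have "1 + 1 \<in> Rn n" by (intro sgrp_add[OF sgrp_Rn] Rn_1)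
 moreover have "(1 + 1 :: lp) \<noteq> 0"
  using l1norm_double[of 1] l1norm_eq_0[of "1 + 1"] l1norm_eq_0[of 1] by auto
 ultimately show "?P \<noteq> {0}" by blast
 fix Q assume Q: "rprime (Rn n) Q" "Q \<subset> ?P"
 have rQ: "rid (Rn n) Q" by (rule rprime_rid[OF Q(1)])
 have two: "1 + 1 \<notin> Q"
 proof
  assume q: "1 + 1 \<in> Q"
  have "?P \<subseteq> Q"
  proof clarify
   fix r assume "r \<in> Rn n" "mod2 r = 0"
   then obtain s where s: "s \<in> Rn n" "r = s + s" by (rule mod2_half)
   have "s * (1 + 1) \<in> Q" by (rule rid_mult[OF rQ s(1) q])
   then show "r \<in> Q" using s(2) by (simp add: algebra_simps)
  qed
  then show False using Q(2) by blast
 qed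
 have "x = 0" if "x \<in> Q" for x
  using that
 proof (induction "nat (l1norm x)" arbitrary: x rule: less_induct)
  case less
  have "x \<in> Rn n" "mod2 x = 0" using less.prems Q(2) by auto
  then obtain s where s: "s \<in> Rn n" "x = s + s" by (rule mod2_half)
  have "(1 + 1) * s \<in> Q" using less.prems s(2) by (simp add: algebra_simps)
  then have sQ: "s \<in> Q" using rprime_mult[OF Q(1) \<open>1 + 1 \<in> Rn n\<close> s(1)] two by blast
  show "x = 0"
  proof (rule ccontr)
   assume "x \<noteq> 0"
   then have "l1norm s > 0" using s(2) l1norm_eq_0[of s] l1norm_nonneg[of s] by force
   then have "nat (l1norm s) < nat (l1norm x)" unfolding s(2) l1norm_double by simp
   then have "s = 0" using less.hyps sQ by blast
   then show False using s(2) \<open>x \<noteq> 0\<close> by simp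
  qed
 qed
 then show "Q = {0}" using sgrp_0[OF rid_sgrp[OF rQ]] by blast
qed

text \<open>A nonzero \<open>f\<close> lies in finitely many primes of height one, and
  \<open>g\<close> is chosen outside them. A prime over \<open>f * f\<close> and
  \<open>g * g\<close> contains both \<open>f\<close> and \<open>g\<close>, hence is not of height
  one and properly contains a nonzero prime \<open>Q\<close>. Any \<open>h\<close> in the difference
  is regular modulo \<open>Q\<close>, as \<open>zent_regular_quotient\<close> demands.\<close>

theorem coprime_pair:
 assumes I: "rid (Rn n) I" and nI: "\<And>P. ht1 (Rn n) P \<Longrightarrow> \<not> I \<subseteq> P"
 obtains f g where "f \<in> I" "g \<in> I" "zent n (gen2 (Rn n) (f * f) (g * g))"
proof -
 note S = subr_Rn[of n] and N = noeth_Rn[of n]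
 have "\<exists>f\<in>I. f \<noteq> 0"
 proof (rule ccontr)
  assume "\<not> (\<exists>f\<in>I. f \<noteq> 0)"
  then have "I \<subseteq> {r\<in>Rn n. mod2 r = 0}" using rid_subset[OF I] mod2_diff[of 0 0] by auto
  then show False using nI[OF ht1_even] by blast
 qed
 then obtain f where f: "f \<in> I" "f \<noteq> 0" by blast
 have fS: "f \<in> Rn n" using f rid_subset[OF I] by blast
 have "\<exists>g\<in>I. \<forall>P\<in>{P. ht1 (Rn n) P \<and> f \<in> P}. g \<notin> P"
  by (rule ht1_avoidance[OF S I finite_ht1_over[OF S N fS f(2)]]) (use nI in auto)
 then obtain g where g: "g \<in> I" "\<And>P. ht1 (Rn n) P \<Longrightarrow> f \<in> P \<Longrightarrow> g \<notin> P" by blast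
 have gS: "g \<in> Rn n" using g(1) rid_subset[OF I] by blast
 have "zent n (gen2 (Rn n) (f * f) (g * g))"
 proof (rule noeth_prime_induct[OF S N rid_gen2[OF S Rn_mult[OF fS fS] Rn_mult[OF gS gS]]])
  fix P assume P: "rprime (Rn n) P" "gen2 (Rn n) (f * f) (g * g) \<subseteq> P"
  then have "f * f \<in> P" "g * g \<in> P" using gen2_mem[OF S] by blast+
  then have fg: "f \<in> P" "g \<in> P" using rprime_mult[OF P(1)] fS gS by blast+
  then have "\<not> ht1 (Rn n) P" using g(2) by blast
  moreover have "P \<noteq> {0}" using fg f(2) by blast
  ultimately obtain Q where Q: "rprime (Rn n) Q" "Q \<subset> P" "Q \<noteq> {0}" using P(1) unfolding ht1_def by blast
  obtain h where h: "h \<in> P" "h \<notin> Q" using Q(2) by blast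
  obtain e where e: "e \<in> Q" "e \<noteq> 0" using Q(3) sgrp_0[OF rid_sgrp[OF rprime_rid[OF Q(1)]]] by blast
  have hS: "h \<in> Rn n" using h(1) rid_subset[OF rprime_rid[OF P(1)]] by blast
  show "zent n P"
  proof (rule zent_regular_quotient[OF rprime_rid[OF Q(1)] e hS _ rprime_rid[OF P(1)] _ h(1)])
   show "x \<in> Q" if "x \<in> Rn n" "h * x \<in> Q" for x using rprime_mult[OF Q(1) hS that] h(2) by blast
   show "Q \<subseteq> P" using Q(2) by blast
  qed
 next
  fix I I1 I2
  assume r: "rid (Rn n) I" "rid (Rn n) I1" "rid (Rn n) I2" and prod: "\<And>a b. a \<in> I1 \<Longrightarrow> b \<in> I2 \<Longrightarrow> a * b \<in> I"
   and z: "zent n I1" "zent n I2"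
  obtain A where A: "finite A" "A \<subseteq> I1" "I1 \<subseteq> lin_span (Rn n) A" using N r(2) unfolding noeth_def by blast
  show "zent n I"
  proof (rule zent_product[OF A(1) _ _ z(1) r(3) z(2) r(1)])
   show "A \<subseteq> Rn n" using A(2) rid_subset[OF r(2)] by blast
   show "a * p \<in> I" if "a \<in> A" "p \<in> I2" for a p using prod that A(2) by blast
   fix x assume "x \<in> I1"
   then have "x \<in> lin_span (Rn n) A" using A(3) by blast
   then show "\<exists>w. (\<forall>a\<in>A. w a \<in> Rn n) \<and> x = (\<Sum>a\<in>A. a * w a)"
    unfolding lin_span_def by (simp add: mult.commute)
  qed
 qed (rule zent_Rn)
 then show thesis by (rule that[OF f(1) g(1)])
qed

section \<open>Submodules of free modules\<close>

definition smod :: "'r::comm_ring_1 set \<Rightarrow> (nat \<Rightarrow> 'r) set \<Rightarrow> bool" where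
 "smod S N \<longleftrightarrow> sgrp N \<and> (\<forall>s\<in>S. \<forall>x\<in>N. (\<lambda>i. s * x i) \<in> N)"

definition tup :: "'r::comm_ring_1 set \<Rightarrow> nat \<Rightarrow> (nat \<Rightarrow> 'r) set" where
 "tup S q = {x. (\<forall>i<q. x i \<in> S) \<and> (\<forall>i\<ge>q. x i = 0)}"

lemma smod_sgrp: "smod S N \<Longrightarrow> sgrp N" and smod_scale: "smod S N \<Longrightarrow> s \<in> S \<Longrightarrow> x \<in> N \<Longrightarrow> (\<lambda>i. s * x i) \<in> N"
 by (auto simp: smod_def)

text \<open>Induction on the rank: the last coordinates form a finitely generated ideal, and the
  elements with last coordinate 0 fall under the hypothesis. Generation is phrased through
  submodules containing \<open>G\<close>, so later uses only check that a set is a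
  submodule.\<close>

lemma smod_fg:
 assumes S: "subr S" "noeth S" and N: "smod S N" "N \<subseteq> tup S q"
 shows "\<exists>G. finite G \<and> G \<subseteq> N \<and> (\<forall>H. smod S H \<longrightarrow> G \<subseteq> H \<longrightarrow> N \<subseteq> H)"
 using N
proof (induction q arbitrary: N)
 case 0
 have "N \<subseteq> {0}" using 0(2) by (auto simp: tup_def fun_eq_iff fun_apply)
 then show ?case by (intro exI[of _ "{}"]) (auto simp: sgrp_0[OF smod_sgrp])
next
 case (Suc q)
 define N0 where "N0 = {x\<in>N. x q = 0}"
 have sN: "sgrp N" by (rule smod_sgrp[OF Suc.prems(1)])
 have "smod S N0" using Suc.prems(1) unfolding smod_def N0_def sgrp_def by (auto simp: fun_apply)
 moreover have "N0 \<subseteq> tup S q"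
 proof
  fix x assume "x \<in> N0"
  then have "x \<in> tup S (Suc q)" "x q = 0" using Suc.prems(2) by (auto simp: N0_def)
  then show "x \<in> tup S q" by (auto simp: tup_def Suc_le_eq) (metis le_neq_implies_less)
 qed
 ultimately obtain G0 where G0: "finite G0" "G0 \<subseteq> N0" "\<And>H. smod S H \<Longrightarrow> G0 \<subseteq> H \<Longrightarrow> N0 \<subseteq> H" using Suc.IH by meson
 define I where "I = (\<lambda>x. x q) ` N"
 have "rid S I"
  unfolding rid_def
 proof (intro conjI ballI sgrpI)
  show "0 \<in> I" unfolding I_def using sgrp_0[OF sN] by (intro image_eqI[of _ _ 0]) (auto simp: fun_apply)
  show "I \<subseteq> S" using Suc.prems(2) by (auto simp: I_def tup_def)
  fix x y assume "x \<in> I" "y \<in> I"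
  then obtain u v where "x = u q" "y = v q" "u \<in> N" "v \<in> N" by (auto simp: I_def)
  then show "x - y \<in> I" unfolding I_def using sgrp_diff[OF sN] by (intro image_eqI[of _ _ "u - v"]) (auto simp: fun_apply)
 next
  fix s x assume s: "s \<in> S" and "x \<in> I"
  then obtain u where "x = u q" "u \<in> N" by (auto simp: I_def)
  then show "s * x \<in> I" unfolding I_def using smod_scale[OF Suc.prems(1) s] by (intro image_eqI[of _ _ "\<lambda>i. s * u i"]) auto
 qed
 from S(2)[unfolded noeth_def, rule_format, OF this] obtain B where B: "finite B" "B \<subseteq> I" "I \<subseteq> lin_span S B" by (elim exE conjE)
 have "\<exists>u. u \<in> N \<and> u q = b" if "b \<in> B" for b using B(2) that by (auto simp: I_def)
 then obtain h where h: "\<And>b. b \<in> B \<Longrightarrow> h b \<in> N \<and> h b q = b" by metis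
 show ?case
 proof (intro exI[of _ "G0 \<union> h ` B"] conjI allI impI)
  show "finite (G0 \<union> h ` B)" using G0(1) B(1) by simp
  show "G0 \<union> h ` B \<subseteq> N" using G0(2) h by (auto simp: N0_def)
  fix H assume H: "smod S H" "G0 \<union> h ` B \<subseteq> H"
  have N0H: "N0 \<subseteq> H" using G0(3)[OF H(1)] H(2) by simp
  show "N \<subseteq> H"
  proof
   fix x assume x: "x \<in> N"
   then have "x q \<in> lin_span S B" using B(3) by (auto simp: I_def)
   then obtain c where c: "\<forall>b\<in>B. c b \<in> S" "x q = (\<Sum>b\<in>B. c b * b)" unfolding lin_span_def by blast
   define y where "y = (\<Sum>b\<in>B. (\<lambda>i. c b * h b i))"
   have yq: "y q = (\<Sum>b\<in>B. c b * h b q)" unfolding y_def by (induction B rule: infinite_finite_induct) (auto simp: fun_apply)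
   have "y \<in> N" unfolding y_def by (intro sgrp_sum[OF sN] smod_scale[OF Suc.prems(1)]) (use c h in auto)
   then have "x - y \<in> N0" using sgrp_diff[OF sN x] h c(2) yq by (simp add: N0_def fun_apply)
   then have "x - y \<in> H" using N0H by blast
   moreover have "y \<in> H" unfolding y_def by (intro sgrp_sum[OF smod_sgrp[OF H(1)]] smod_scale[OF H(1)]) (use c H(2) in auto)
   ultimately have "(x - y) + y \<in> H" by (rule sgrp_add[OF smod_sgrp[OF H(1)]])
   then show "x \<in> H" by simp
  qed
 qed
qed

lemma smod_presentation:
 fixes S :: "'r::comm_ring_1 set"
 assumes S: "subr S" "noeth S" and N: "smod S N" "N \<subseteq> tup S q"
 obtains p :: nat and b :: "nat \<Rightarrow> nat \<Rightarrow> 'r" where "\<And>j. j < p \<Longrightarrow> (\<lambda>i. b i j) \<in> N"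
  "\<And>x. x \<in> N \<Longrightarrow> \<exists>c. (\<forall>j<p. c j \<in> S) \<and> x = (\<lambda>i. \<Sum>j<p. b i j * c j)"
proof -
 from smod_fg[OF assms] obtain G where G: "finite G" "G \<subseteq> N" "\<forall>H. smod S H \<longrightarrow> G \<subseteq> H \<longrightarrow> N \<subseteq> H" by (elim exE conjE)
 obtain e where e: "bij_betw e {..<card G} G" using ex_bij_betw_nat_finite[OF G(1)] by (auto simp: lessThan_atLeast0)
 define b where "b = (\<lambda>i j. e j i)"
 let ?H = "{x. \<exists>c. (\<forall>j<card G. c j \<in> S) \<and> x = (\<lambda>i. \<Sum>j<card G. b i j * c j)}"
 have "smod S ?H"
  unfolding smod_def
 proof (intro conjI ballI sgrpI)
  show "0 \<in> ?H" using sgrp_0[OF subr_sgrp[OF S(1)]] by (intro CollectI exI[of _ "\<lambda>_. 0"]) (auto simp: zero_fun_def)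
  fix x y assume "x \<in> ?H" "y \<in> ?H"
  then obtain c d where "\<forall>j<card G. c j \<in> S" "x = (\<lambda>i. \<Sum>j<card G. b i j * c j)"
   "\<forall>j<card G. d j \<in> S" "y = (\<lambda>i. \<Sum>j<card G. b i j * d j)" unfolding mem_Collect_eq by (elim exE conjE)
  moreover from this have "x - y = (\<lambda>i. \<Sum>j<card G. b i j * (c j - d j))"
   by (intro ext) (simp add: fun_apply right_diff_distrib sum_subtractf)
  ultimately show "x - y \<in> ?H" using sgrp_diff[OF subr_sgrp[OF S(1)]]
   by (intro CollectI exI[of _ "\<lambda>j. c j - d j"]) blast
 next
  fix s x assume s: "s \<in> S" and "x \<in> ?H"
  then obtain c where "\<forall>j<card G. c j \<in> S" "x = (\<lambda>i. \<Sum>j<card G. b i j * c j)" unfolding mem_Collect_eq by (elim exE conjE)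
  moreover from this have "(\<lambda>i. s * x i) = (\<lambda>i. \<Sum>j<card G. b i j * (s * c j))"
   by (intro ext) (simp add: sum_distrib_left mult_ac)
  ultimately show "(\<lambda>i. s * x i) \<in> ?H" using subr_mult[OF S(1) s]
   by (intro CollectI exI[of _ "\<lambda>j. s * c j"]) blast
 qed
 moreover have "G \<subseteq> ?H"
 proof
  fix x assume "x \<in> G"
  then obtain k where k: "k < card G" "x = e k" using e by (auto simp: bij_betw_def)
  have "x = (\<lambda>i. \<Sum>j<card G. b i j * (if j = k then 1 else 0))"
   using k by (simp add: fun_eq_iff b_def if_distrib cong: if_cong)
  then show "x \<in> ?H" using subr_1[OF S(1)] sgrp_0[OF subr_sgrp[OF S(1)]]
   by (intro CollectI exI[of _ "\<lambda>j. if j = k then 1 else 0"]) auto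
 qed
 ultimately have NH: "N \<subseteq> ?H" using G(3) by (elim allE[of _ ?H] impE)
 show thesis
 proof (rule that[of "card G" b])
  show "(\<lambda>i. b i j) \<in> N" if "j < card G" for j
   using e that G(2) unfolding b_def bij_betw_def by auto
  show "\<exists>c. (\<forall>j<card G. c j \<in> S) \<and> x = (\<lambda>i. \<Sum>j<card G. b i j * c j)" if "x \<in> N" for x
   using subsetD[OF NH that] by (rule CollectD)
 qed
qed

section \<open>Covering a finite quotient by boxes\<close>

text \<open>For the quotient of Z^n by \<Gamma> and \<open>pt\<close> the zero class, the stabilizer
  is \<Gamma>, and this says that \<Gamma> has no nonzero vector of maximum norm below
  \<open>L\<close>.\<close>

definition spread :: "nat \<Rightarrow> (mon \<Rightarrow> 'x \<Rightarrow> 'x) \<Rightarrow> 'x \<Rightarrow> int \<Rightarrow> bool" where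
 "spread n act pt L \<longleftrightarrow> (\<forall>y. keys y \<subseteq> {..<n} \<longrightarrow> act y pt = pt \<longrightarrow>
  (\<forall>i<n. \<bar>lookup y i\<bar> < L) \<longrightarrow> y = 0)"

text \<open>The locale \<open>transitive_action\<close> permits all variables; boxes of dimension
  \<open>n\<close> require that the first \<open>n\<close> already act transitively.\<close>

definition reach :: "nat \<Rightarrow> 'x set \<Rightarrow> (mon \<Rightarrow> 'x \<Rightarrow> 'x) \<Rightarrow> 'x \<Rightarrow> bool" where
 "reach n X act pt \<longleftrightarrow> (\<forall>c\<in>X. \<exists>y. keys y \<subseteq> {..<n} \<and> act y pt = c)"

lemma spread_inv_act: "spread n act pt L \<Longrightarrow> spread n (inv_act act) pt L"
 unfolding spread_def inv_act_def
proof (intro allI impI)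
 fix y :: mon
 assume a: "\<forall>y. keys y \<subseteq> {..<n} \<longrightarrow> act y pt = pt \<longrightarrow> (\<forall>i<n. \<bar>lookup y i\<bar> < L) \<longrightarrow> y = 0"
  and y: "keys y \<subseteq> {..<n}" "act (- y) pt = pt" "\<forall>i<n. \<bar>lookup y i\<bar> < L"
 have "- y = 0" using a[rule_format, of "- y"] y by simp
 then show "y = 0" by simp
qed

lemma reach_inv_act: assumes "reach n X act pt" shows "reach n X (inv_act act) pt"
 unfolding reach_def inv_act_def
proof
 fix c assume "c \<in> X"
 then obtain y where "keys y \<subseteq> {..<n}" "act y pt = c" using assms by (auto simp: reach_def)
 then show "\<exists>y. keys y \<subseteq> {..<n} \<and> act (- y) pt = c" by (intro exI[of _ "- y"]) simp
qed

context transitive_action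
begin

lemma act_commute: "c \<in> X \<Longrightarrow> act y (act z c) = act z (act y c)"
 using act_add[of c y z] act_add[of c z y] by (simp add: add.commute)

text \<open>The acting group is commutative, so every point of the orbit has the stabilizer of
  \<open>pt\<close>.\<close>

lemma spread_inj:
 assumes r: "reach n X act pt" and s: "spread n act pt L" and c: "c \<in> X"
  and v: "keys v \<subseteq> {..<n}" "keys v' \<subseteq> {..<n}"
  and b: "\<And>i. i < n \<Longrightarrow> \<bar>lookup v i - lookup v' i\<bar> < L" and e: "act v c = act v' c"
 shows "v = v'"
proof -
 obtain y where y: "act y pt = c" using r c by (auto simp: reach_def)
 have "act (v - v') c = act (- v') (act v c)" using act_add[OF c, of "- v'" v] by simp
 also have "\<dots> = c" unfolding e by (rule act_inverse(1)[OF c])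
 finally have f: "act (v - v') c = c" .
 have "act (v - v') pt = act (v - v') (act (- y) c)" using act_inverse(1)[OF pt, of y] y by simp
 also have "\<dots> = act (- y) (act (v - v') c)" by (rule act_commute[OF c])
 also have "\<dots> = pt" unfolding f using act_inverse(1)[OF pt, of y] y by simp
 finally have "act (v - v') pt = pt" .
 moreover have "keys (v - v') \<subseteq> {..<n}" using keys_diff[of v v'] v by blast
 ultimately have "v - v' = 0" using s[unfolded spread_def, rule_format, of "v - v'"] b by (simp add: lookup_minus)
 then show ?thesis by simp
qed

text \<open>Take a maximal family of centres with disjoint boxes; disjointness bounds their number.
  The box of any other point meets one of them, so the point differs from that centre by a
  difference of two vectors of the box.\<close>

lemma box_centers:
 assumes r: "reach n X act pt" and s: "spread n act pt (int L)" and L: "L > 0"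
 obtains C where "C \<subseteq> X" "card C * L ^ n \<le> card X" "\<And>x. x \<in> X \<Longrightarrow> \<exists>c\<in>C. \<exists>v\<in>ibox n (- int L) (int L). act v c = x"
proof -
 define B where "B = (\<lambda>c. (\<lambda>v. act v c) ` ibox n 0 (int L))"
 define good where "good = (\<lambda>C. C \<subseteq> X \<and> (\<forall>c\<in>C. \<forall>c'\<in>C. c \<noteq> c' \<longrightarrow> B c \<inter> B c' = {}))"
 have "finite {C. good C}" by (rule finite_subset[of _ "Pow X"]) (use fin in \<open>auto simp: good_def\<close>)
 moreover have "{} \<in> {C. good C}" by (simp add: good_def)
 ultimately obtain C where C: "good C" "\<And>C'. good C' \<Longrightarrow> C \<subseteq> C' \<Longrightarrow> C' = C"
  using finite_has_maximal2[of "{C. good C}" "{}"] by auto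
 have CX: "C \<subseteq> X" using C(1) by (simp add: good_def)
 have fC: "finite C" using CX fin finite_subset by blast
 have cB: "card (B c) = L ^ n" if "c \<in> X" for c
 proof -
  have "inj_on (\<lambda>v. act v c) (ibox n 0 (int L))"
  proof (rule inj_onI)
   fix v v' assume "v \<in> ibox n 0 (int L)" "v' \<in> ibox n 0 (int L)" "act v c = act v' c"
   moreover from this have "\<bar>lookup v i - lookup v' i\<bar> < int L" if "i < n" for i
   proof -
    have "lookup v i \<in> {0..<int L}" "lookup v' i \<in> {0..<int L}"
     using \<open>v \<in> _\<close> \<open>v' \<in> _\<close> \<open>i < n\<close> unfolding ibox_def by blast+
    then show ?thesis by (simp add: abs_less_iff)
   qed
   ultimately show "v = v'" by (intro spread_inj[OF r s \<open>c \<in> X\<close>, of v v']) (simp_all add: ibox_def)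
  qed
  then show ?thesis unfolding B_def by (simp add: card_image ibox_card)
 qed
 have "card C * L ^ n = (\<Sum>c\<in>C. card (B c))" using cB CX by (simp add: subset_iff)
 also have "\<dots> = card (\<Union>c\<in>C. B c)"
  by (rule card_UN_disjoint[symmetric]) (use C(1) fC in \<open>auto simp: good_def B_def ibox_card\<close>)
 also have "\<dots> \<le> card X" by (rule card_mono[OF fin]) (use CX act_closed in \<open>auto simp: B_def\<close>)
 finally have card: "card C * L ^ n \<le> card X" .
 have "\<exists>c\<in>C. \<exists>v\<in>ibox n (- int L) (int L). act v c = x" if x: "x \<in> X" for x
 proof (cases "x \<in> C")
  case True
  then show ?thesis using L act_0[OF x] by (intro bexI[of _ x] bexI[of _ 0]) (auto simp: ibox_def)
 next
  case False
  then have "\<not> good (insert x C)" using C(2)[of "insert x C"] by blast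
  then obtain c where c: "c \<in> C" "B x \<inter> B c \<noteq> {}"
   using C(1) x unfolding good_def by blast
  then obtain v v' where v: "v \<in> ibox n 0 (int L)" "v' \<in> ibox n 0 (int L)" "act v x = act v' c" unfolding B_def by blast
  have cX: "c \<in> X" using c CX by blast
  have "act (v' - v) c = act (- v) (act v' c)" using act_add[OF cX, of "- v" v'] by simp
  also have "\<dots> = x" unfolding v(3)[symmetric] by (rule act_inverse(1)[OF x])
  finally have "act (v' - v) c = x" .
  moreover have "v' - v \<in> ibox n (- int L) (int L)"
   unfolding ibox_def
  proof (intro CollectI conjI ballI)
   show "keys (v' - v) \<subseteq> {..<n}" using v keys_diff[of v' v] unfolding ibox_def by blast
   fix i assume "i \<in> {..<n}"
   then have "lookup v i \<in> {0..<int L}" "lookup v' i \<in> {0..<int L}" using v(1,2) unfolding ibox_def by blast+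
   then show "lookup (v' - v) i \<in> {- int L..<int L}" by (simp add: lookup_minus)
  qed
  ultimately show ?thesis using c(1) by blast
 qed
 then show thesis using that[OF CX card] by blast
qed

text \<open>A function is cut into pieces around the centres. Each piece lifts to a Laurent
  polynomial in a box of doubled side, which \<open>2 ^ n\<close> boxes of side \<open>L\<close>
  tile, and the ideal \<open>gen2 (Rn n) f g\<close> acts into
  \<open>Jset f g (Zf X)\<close>.\<close>

lemma covers_cubeZ:
 assumes r: "reach n X act pt" and s: "spread n act pt (int L)" and L: "L > 0" and m: "0 \<le> m"
  and fg: "f \<in> Rn n" "g \<in> Rn n" and cov: "covers c (cube n 0 (int L) m) (gen2 (Rn n) f g)"
 obtains k where "k * L ^ n \<le> card X" "covers ((c ^ (2 ^ n)) ^ k) (cubeZ X m) (Jset f g (Zf X))"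
proof -
 obtain C where C: "C \<subseteq> X" "card C * L ^ n \<le> card X" "\<And>x. x \<in> X \<Longrightarrow> \<exists>c\<in>C. \<exists>v\<in>ibox n (- int L) (int L). act v c = x"
  by (rule box_centers[OF r s L]) blast
 have fC: "finite C" using C(1) fin finite_subset by blast
 obtain ow where ow: "\<And>x. x \<in> X \<Longrightarrow> ow x \<in> C \<and> (\<exists>v\<in>ibox n (- int L) (int L). act v (ow x) = x)" using C(3) by metis
 then obtain vv where vv: "\<And>x. x \<in> X \<Longrightarrow> vv x \<in> ibox n (- int L) (int L) \<and> act (vv x) (ow x) = x" by metis
 have cov2: "covers (c ^ (2 ^ n)) (cube n (- int L) (int L) m) (gen2 (Rn n) f g)"
  by (rule covers_ibox[OF cov rid_gen2[OF subr_Rn fg] L _ m]) simp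
 have "covers ((c ^ (2 ^ n)) ^ card C) (cubeZ X m) (Jset f g (Zf X))"
 proof (rule covers_tile[OF fC _ cov2, where \<psi> = "\<lambda>c x. opr x (unit_fun c)"])
  show "opr (x - y) (unit_fun w) = opr x (unit_fun w) - opr y (unit_fun w)" for w x y by (rule opr_diff)
 next
  fix u assume u: "u \<in> cubeZ X m"
  \<comment> \<open>The lift of the piece owned by \<open>w\<close>. Two points with the same owner
    and the same exponent coincide, so every coefficient is one value of \<open>u\<close> or
    0.\<close>
  define x where "x = (\<lambda>w. \<Sum>z\<in>{z\<in>X. ow z = w}. Poly_Mapping.single (vv z) (u z))"
  have "x w \<in> cube n (- int L) (int L) m" if w: "w \<in> C" for w
   unfolding cube_iff[OF m]
  proof (intro conjI allI)
   have "keys (x w) \<subseteq> (\<Union>z\<in>{z\<in>X. ow z = w}. keys (Poly_Mapping.single (vv z) (u z)))"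
    unfolding x_def by (rule keys_sum)
   also have "\<dots> \<subseteq> ibox n (- int L) (int L)" using vv by (auto split: if_splits)
   finally show "keys (x w) \<subseteq> ibox n (- int L) (int L)" .
   fix k
   have l: "lookup (x w) k = (\<Sum>z\<in>{z\<in>X. ow z = w}. if vv z = k then u z else 0)"
    unfolding x_def lookup_sum lookup_single when_def by simp
   show "\<bar>lookup (x w) k\<bar> \<le> m"
   proof (cases "\<exists>z\<in>X. ow z = w \<and> vv z = k")
    case True
    then obtain z where z: "z \<in> X" "ow z = w" "vv z = k" by blast
    have uniq: "z' = z" if "z' \<in> X" "ow z' = w" "vv z' = k" for z' using vv[OF z(1)] vv[OF that(1)] z that by simp
    have "(if vv z' = k then u z' else 0) = (if z' = z then u z else 0)" if "z' \<in> {z\<in>X. ow z = w}" for z'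
     using uniq[of z'] that z(3) by (cases "z' = z") auto
    then have "(\<Sum>z\<in>{z\<in>X. ow z = w}. if vv z = k then u z else 0) = (\<Sum>z'\<in>{z\<in>X. ow z = w}. if z' = z then u z else 0)"
     by (rule sum.cong[OF refl])
    also have "\<dots> = u z" using z fin by simp
    finally show ?thesis unfolding l using u z(1) by (auto simp: cubeZ_def abs_le_iff)
   next
    case False
    then have "(\<Sum>z\<in>{z\<in>X. ow z = w}. if vv z = k then u z else 0) = 0" by (intro sum.neutral) auto
    then show ?thesis unfolding l using m by simp
   qed
  qed
  moreover have "u = (\<Sum>w\<in>C. opr (x w) (unit_fun w))"
  proof -
   have op_sum: "opr (sum F A) v = (\<Sum>a\<in>A. opr (F a) v)" for F :: "'a \<Rightarrow> lp" and A v
    by (induction A rule: infinite_finite_induct) (auto simp: opr_add)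
   have single: "opr (Poly_Mapping.single k a) (unit_fun w) = a \<star> unit_fun (act k w)" if "w \<in> X" for k a w
   proof -
    have "Poly_Mapping.single k a = of_int a * frag_of k"
     by (rule poly_mapping_eqI) (simp add: lookup_single when_def flip: single_of_int, simp add: lookup_single_mult lookup_single when_def)
    then show ?thesis by (simp add: opr_mult opr_of_int opr_Zf unit_fun_act[OF that])
   qed
   have uZ: "u \<in> Zf X" using u by (simp add: cubeZ_def)
   have "(\<Sum>w\<in>C. opr (x w) (unit_fun w)) = (\<Sum>w\<in>C. \<Sum>z\<in>{z\<in>X. ow z = w}. u z \<star> unit_fun z)"
    unfolding x_def op_sum using C(1) vv by (intro sum.cong) (auto simp: single subset_iff)
   also have "\<dots> = (\<Sum>z\<in>X. u z \<star> unit_fun z)" by (rule sum.group[OF fin fC]) (use ow in auto)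
   also have "\<dots> = u" by (rule Zf_expand[OF uZ, symmetric])
   finally show ?thesis by (rule sym)
  qed
  ultimately show "\<exists>x. (\<forall>w\<in>C. x w \<in> cube n (- int L) (int L) m) \<and> u = (\<Sum>w\<in>C. opr (x w) (unit_fun w))"
   by (intro exI[of _ x] conjI ballI)
 next
  fix z assume z: "\<And>w. w \<in> C \<Longrightarrow> z w \<in> gen2 (Rn n) f g"
  show "(\<Sum>w\<in>C. opr (z w) (unit_fun w)) \<in> Jset f g (Zf X)"
  proof (rule sgrp_sum[OF sgrp_Jset[OF sgrp_Zf]])
   fix w assume "w \<in> C"
   from z[OF this] obtain a b where "z w = f * a + g * b" unfolding gen2_def by blast
   then have "opr (z w) (unit_fun w) = opr f (opr a (unit_fun w)) + opr g (opr b (unit_fun w))" by (simp add: opr_add opr_mult)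
   also have "\<dots> \<in> Jset f g (Zf X)" by (rule JsetI[OF opr_Zf opr_Zf])
   finally show "opr (z w) (unit_fun w) \<in> Jset f g (Zf X)" .
  qed
 qed
 then show thesis using that C(2) by blast
qed

end

section \<open>Subexponential bounds\<close>

lemma power_le_fact_exp: assumes "0 \<le> x" shows "x ^ e \<le> fact e * exp (x::real)"
proof -
 have "(\<Sum>k\<in>{e}. x ^ k /\<^sub>R fact k) \<le> suminf (\<lambda>k. x ^ k /\<^sub>R fact k)"
  by (rule sum_le_suminf[OF sums_summable[OF exp_converges]]) (use assms in auto)
 then have "x ^ e / fact e \<le> exp x" using sums_unique[OF exp_converges[of x]] by (simp add: divide_inverse_commute)
 then show ?thesis by (simp add: field_simps)
qed

text \<open>The exponential series gives N^e / e! at most (1/s)^e exp(s N). Since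
  \<open>2 ^ e\<close> is at most \<open>c\<close>, the exponent \<open>e\<close> is at most
  \<delta> N / ln 2, so the power of 1/s contributes the rate \<delta> Q. Hence \<open>s\<close> is
  fixed first and then \<delta> with \<open>\<delta> * (2 + Q) = \<eta> / 2\<close>, the 2 coming
  from the square of \<open>c\<close>.\<close>

lemma entropy_bound:
 fixes \<eta> :: real assumes \<eta>: "0 < \<eta>"
 obtains \<delta> where "0 < \<delta>" "\<delta> \<le> \<eta>" "\<And>c \<iota> e N :: nat. 0 < c \<Longrightarrow> real c \<le> exp (\<delta> * real N) \<Longrightarrow>
  \<iota> * fact e \<le> c\<^sup>2 * N ^ e \<Longrightarrow> 2 ^ e \<le> c \<Longrightarrow> real \<iota> \<le> exp (\<eta> * real N)"
proof -
 define s where "s = min (\<eta> / 2) (1 / 2)"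
 have s: "0 < s" "s \<le> 1 / 2" "s \<le> \<eta> / 2" using \<eta> by (auto simp: s_def)
 define Q where "Q = ln (1 / s) / ln 2"
 have Q: "0 \<le> Q" using s by (simp add: Q_def)
 define \<delta> where "\<delta> = \<eta> / (2 * (2 + Q))"
 have \<delta>: "0 < \<delta>" "\<delta> * (2 + Q) = \<eta> / 2" using \<eta> Q by (auto simp: \<delta>_def divide_simps add_nonneg_eq_0_iff)
 have "\<eta> * 1 \<le> \<eta> * (2 * (2 + Q))" using \<eta> Q by (intro mult_left_mono) auto
 then have \<delta>\<eta>: "\<delta> \<le> \<eta>" using Q by (simp add: \<delta>_def divide_le_eq)
 show thesis
 proof (rule that[OF \<delta>(1) \<delta>\<eta>])
  fix c \<iota> e N :: nat
  assume c: "0 < c" "real c \<le> exp (\<delta> * real N)" and \<iota>: "\<iota> * fact e \<le> c\<^sup>2 * N ^ e" and e: "2 ^ e \<le> c"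
  have "real (2 ^ e) \<le> real c" using e by (simp only: of_nat_le_iff)
  moreover have "2 powr real e = real (2 ^ e)" by (simp add: powr_realpow)
  ultimately have "2 powr real e \<le> exp (\<delta> * real N)" using c(2) by linarith
  then have "real e * ln 2 \<le> \<delta> * real N" by (simp add: powr_def)
  then have eN: "real e \<le> \<delta> * real N / ln 2" by (simp add: field_simps)
  have "real (\<iota> * fact e) \<le> real (c\<^sup>2 * N ^ e)" using \<iota> by (simp only: of_nat_le_iff)
  then have "real \<iota> * fact e \<le> (real c)\<^sup>2 * real N ^ e" by simp
  also have "real N ^ e = (1 / s) ^ e * (s * real N) ^ e" using s(1) by (simp flip: power_mult_distrib)
  also have "(real c)\<^sup>2 * \<dots> \<le> (exp (\<delta> * real N))\<^sup>2 * ((1 / s) ^ e * (fact e * exp (s * real N)))"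
   using c s(1) by (intro mult_mono power_mono power_le_fact_exp) auto
  also have "\<dots> = (exp (\<delta> * real N))\<^sup>2 * ((1 / s) ^ e * exp (s * real N)) * fact e" by (simp only: mult_ac)
  finally have "real \<iota> \<le> (exp (\<delta> * real N))\<^sup>2 * ((1 / s) ^ e * exp (s * real N))" by (rule mult_right_le_imp_le) simp
  also have "(exp (\<delta> * real N))\<^sup>2 = exp (2 * (\<delta> * real N))" by (simp add: exp_double)
  also have "(1 / s) ^ e = exp (real e * ln (1 / s))" using s(1) by (simp add: exp_of_nat_mult)
  also have "exp (2 * (\<delta> * real N)) * (exp (real e * ln (1 / s)) * exp (s * real N)) = exp (2 * (\<delta> * real N) + real e * ln (1 / s) + s * real N)"
   by (simp add: exp_add)
  also have "\<dots> \<le> exp (\<eta> * real N)"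
  proof -
   have "real e * ln (1 / s) \<le> (\<delta> * real N / ln 2) * ln (1 / s)" using eN s by (intro mult_right_mono) auto
   then have "2 * (\<delta> * real N) + real e * ln (1 / s) + s * real N \<le> (\<delta> * (2 + Q) + s) * real N"
    by (simp add: Q_def algebra_simps)
   also have "\<dots> \<le> (\<eta> / 2 + \<eta> / 2) * real N" unfolding \<delta>(2) using s(3) by (intro mult_right_mono) auto
   finally show ?thesis by simp
  qed
  finally show "real \<iota> \<le> exp (\<eta> * real N)" .
 qed
qed

theorem torsion_quotient_small:
 fixes b :: "nat \<Rightarrow> nat \<Rightarrow> lp" and \<epsilon> :: real
 assumes z: "zent n (gen2 (Rn n) f g)" and fg: "f \<in> Rn n" "g \<in> Rn n" and \<epsilon>: "\<epsilon> > 0"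
 shows "\<exists>L0. \<forall>(X :: 'x set) act pt. transitive_action X act pt \<longrightarrow> reach n X act pt \<longrightarrow> spread n act pt L0 \<longrightarrow>
  (\<exists>k. covers k (sat ({..<q} \<times> X) (mat_image X act q p b)) (mat_image X act q p b [+]
    finite_action.Jset ({..<q} \<times> X) (pact act) f g (sat ({..<q} \<times> X) (mat_image X act q p b)))
   \<and> real k \<le> exp (\<epsilon> * real (card X)))"
proof -
 \<comment> \<open>The final bound has four factors raised to the power \<open>q\<close>, one
   \<open>C\<close> and three \<iota>; adding 1 covers \<open>q = 0\<close>.\<close>
 define \<eta> where "\<eta> = \<epsilon> / (4 * (real q + 1))"
 have \<eta>: "\<eta> > 0" "real q * (4 * \<eta>) \<le> \<epsilon>" using \<epsilon> by (auto simp: \<eta>_def field_simps)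
 obtain \<delta> where \<delta>: "0 < \<delta>" "\<delta> \<le> \<eta>" "\<And>c \<iota> e N :: nat. 0 < c \<Longrightarrow> real c \<le> exp (\<delta> * real N) \<Longrightarrow>
  \<iota> * fact e \<le> c\<^sup>2 * N ^ e \<Longrightarrow> 2 ^ e \<le> c \<Longrightarrow> real \<iota> \<le> exp (\<eta> * real N)" by (rule entropy_bound[OF \<eta>(1)]) blast
 define m where "m = max (l1norm f + l1norm g + 1) (\<Sum>i<q. \<Sum>j<p. l1norm (b i j))"
 have m: "l1norm f + l1norm g + 1 \<le> m" "(\<Sum>i<q. \<Sum>j<p. l1norm (b i j)) \<le> m" by (simp_all add: m_def)
 have m0: "0 \<le> m" using m(1) l1norm_nonneg[of f] l1norm_nonneg[of g] by linarith
 have "\<delta> / 2 ^ n > 0" using \<delta>(1) by simp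
 then obtain L c where Lc: "L > 0" "covers c (cube n 0 (int L) m) (gen2 (Rn n) f g)" "real c \<le> exp (\<delta> / 2 ^ n * real L ^ n)"
  using z m0 unfolding zent_def by meson
 have cp: "c > 0" by (rule covers_pos[OF Lc(2) cube_0[OF m0]])
 show ?thesis
 proof (intro exI[of _ "int L"] allI impI)
  fix X :: "'x set" and act pt
  assume act: "transitive_action X act pt" and r: "reach n X act pt" and s: "spread n act pt (int L)"
  interpret transitive_action X act pt by fact
  let ?N = "real (card X)"
  let ?\<Lambda> = "mat_image X act q p b"
  let ?S = "sat ({..<q} \<times> X) ?\<Lambda>"
  obtain k where k: "k * L ^ n \<le> card X" "covers ((c ^ (2 ^ n)) ^ k) (cubeZ X m) (Jset f g (Zf X))"
   by (rule covers_cubeZ[OF r s Lc(1) m0 fg Lc(2)]) blast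
  define C where "C = (c ^ (2 ^ n)) ^ k"
  have C0: "C > 0" using cp by (simp add: C_def)
  have "real C = real c ^ (2 ^ n * k)" by (simp add: C_def power_mult)
  also have "\<dots> \<le> exp (\<delta> / 2 ^ n * real L ^ n) ^ (2 ^ n * k)" by (rule power_mono[OF Lc(3)]) simp
  also have "\<dots> = exp (\<delta> * real (k * L ^ n))" by (simp flip: exp_of_nat_mult add: field_simps)
  also have "\<dots> \<le> exp (\<delta> * ?N)" using k(1) \<delta>(1) by (simp del: of_nat_mult)
  finally have CN: "real C \<le> exp (\<delta> * ?N)" .
  obtain \<iota> e where \<iota>: "covers (C ^ q * (\<iota> ^ q * (\<iota> ^ q * \<iota> ^ q))) ?S (?\<Lambda> [+] finite_action.Jset ({..<q} \<times> X) (pact act) f g ?S)"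
   "\<iota> * fact e \<le> C\<^sup>2 * card X ^ e" "2 ^ e \<le> C"
   by (rule torsion_mod_J_bound[OF act k(2)[folded C_def] m]) blast
  have \<iota>N: "real \<iota> \<le> exp (\<eta> * ?N)" by (rule \<delta>(3)[OF C0 CN \<iota>(2,3)])
  have CN': "real C \<le> exp (\<eta> * ?N)" using CN \<delta>(2) by (elim order_trans) (simp add: mult_right_mono)
  have "real (C ^ q * (\<iota> ^ q * (\<iota> ^ q * \<iota> ^ q))) = real C ^ q * (real \<iota> ^ q * (real \<iota> ^ q * real \<iota> ^ q))" by simp
  also have "\<dots> \<le> exp (\<eta> * ?N) ^ q * (exp (\<eta> * ?N) ^ q * (exp (\<eta> * ?N) ^ q * exp (\<eta> * ?N) ^ q))"
   using CN' \<iota>N by (intro mult_mono power_mono) auto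
  also have "\<dots> = exp (real q * (4 * \<eta>) * ?N)" by (simp flip: exp_of_nat_mult exp_add)
  also have "\<dots> \<le> exp (\<epsilon> * ?N)" using \<eta>(2) by (simp add: mult_right_mono)
  finally show "\<exists>k. covers k ?S (?\<Lambda> [+] finite_action.Jset ({..<q} \<times> X) (pact act) f g ?S) \<and> real k \<le> exp (\<epsilon> * ?N)"
   using \<iota>(1) by blast
 qed
qed

text \<open>Transitivity, \<open>reach\<close> and \<open>spread\<close> are invariant under
  inverting the action, so the threshold found for the transposed matrix serves here after
  \<open>torsion_duality\<close>.\<close>

theorem torsion_kernel_small:
 fixes b :: "nat \<Rightarrow> nat \<Rightarrow> lp" and \<epsilon> :: real
 assumes z: "zent n (gen2 (Rn n) f g)" and fg: "f \<in> Rn n" "g \<in> Rn n" and \<epsilon>: "\<epsilon> > 0"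
 shows "\<exists>L0. \<forall>(X :: 'x set) act pt. transitive_action X act pt \<longrightarrow> reach n X act pt \<longrightarrow> spread n act pt L0 \<longrightarrow>
  (\<exists>k. covers k {x\<in>sat ({..<q} \<times> X) (mat_image X act q p b). act_op ({..<q} \<times> X) (pact act) f x \<in> mat_image X act q p b \<and>
    act_op ({..<q} \<times> X) (pact act) g x \<in> mat_image X act q p b} (mat_image X act q p b)
   \<and> real k \<le> exp (\<epsilon> * real (card X)))"
proof -
 obtain L0 where L0: "\<forall>(X :: 'x set) act pt. transitive_action X act pt \<longrightarrow> reach n X act pt \<longrightarrow> spread n act pt L0 \<longrightarrow>
  (\<exists>k. covers k (sat ({..<p} \<times> X) (mat_image X act p q (\<lambda>j i. b i j))) (mat_image X act p q (\<lambda>j i. b i j) [+]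
    finite_action.Jset ({..<p} \<times> X) (pact act) f g (sat ({..<p} \<times> X) (mat_image X act p q (\<lambda>j i. b i j))))
   \<and> real k \<le> exp (\<epsilon> * real (card X)))"
  by (rule exE[OF torsion_quotient_small[OF z fg \<epsilon>, of p q "\<lambda>j i. b i j", where ?'x = 'x]])
 show ?thesis
 proof (intro exI[of _ L0] allI impI)
  fix X :: "'x set" and act pt
  assume act: "transitive_action X act pt" and r: "reach n X act pt" and s: "spread n act pt L0"
  interpret transitive_action X act pt by fact
  obtain k where k: "covers k (sat ({..<p} \<times> X) (mat_image X (inv_act act) p q (\<lambda>j i. b i j))) (mat_image X (inv_act act) p q (\<lambda>j i. b i j) [+]
    finite_action.Jset ({..<p} \<times> X) (pact (inv_act act)) f g (sat ({..<p} \<times> X) (mat_image X (inv_act act) p q (\<lambda>j i. b i j))))"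
   "real k \<le> exp (\<epsilon> * real (card X))"
   using L0[rule_format, OF transitive_action_inv_act[OF act] reach_inv_act[OF r] spread_inv_act[OF s]] by (elim exE conjE)
  from torsion_duality[OF finite_action_axioms k(1)] k(2)
  show "\<exists>k. covers k {x\<in>sat ({..<q} \<times> X) (mat_image X act q p b). act_op ({..<q} \<times> X) (pact act) f x \<in> mat_image X act q p b \<and>
    act_op ({..<q} \<times> X) (pact act) g x \<in> mat_image X act q p b} (mat_image X act q p b)
   \<and> real k \<le> exp (\<epsilon> * real (card X))" by (intro exI[of _ k] conjI)
 qed
qed

section \<open>Comparing torsion at a finite level\<close>

context finite_action
begin

lemma mat_op_cong:
 assumes "\<And>i j. i < q \<Longrightarrow> j < p \<Longrightarrow> b i j = b' i j" shows "mat_op X act q p b z = mat_op X act q p b' z"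
 unfolding mat_op_def using assms by (auto simp: fun_eq_iff)

lemma mat_op_mult: "mat_op X act q r (\<lambda>i k. \<Sum>j<p. a i j * b j k) z = mat_op X act q p a (mat_op X act p r b z)"
proof
 fix ic :: "nat \<times> 'x"
 obtain i c where ic: "ic = (i, c)" by fastforce
 have op_sum: "opr (sum F A) v = (\<Sum>a\<in>A. opr (F a) v)" for F :: "nat \<Rightarrow> lp" and A v
  by (induction A rule: infinite_finite_induct) (auto simp: opr_add)
 show "mat_op X act q r (\<lambda>i k. \<Sum>j<p. a i j * b j k) z ic = mat_op X act q p a (mat_op X act p r b z) ic"
 proof (cases "i < q")
  case True
  have "(\<Sum>k<r. opr (\<Sum>j<p. a i j * b j k) (\<lambda>c. z (k, c))) = (\<Sum>k<r. \<Sum>j<p. opr (a i j) (opr (b j k) (\<lambda>c. z (k, c))))"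
   by (simp add: op_sum opr_mult)
  also have "\<dots> = (\<Sum>j<p. \<Sum>k<r. opr (a i j) (opr (b j k) (\<lambda>c. z (k, c))))" by (rule sum.swap)
  also have "\<dots> = (\<Sum>j<p. opr (a i j) (\<lambda>c. mat_op X act p r b z (j, c)))" by (simp add: mat_op_slice opr_sum)
  finally have "(\<lambda>c. mat_op X act q r (\<lambda>i k. \<Sum>j<p. a i j * b j k) z (i, c)) = (\<lambda>c. mat_op X act q p a (mat_op X act p r b z) (i, c))"
   using True by (simp only: mat_op_slice)
  then show ?thesis by (simp add: ic fun_eq_iff)
 next
  case False then show ?thesis by (simp add: ic mat_op_def)
 qed
qed

lemma mat_op_diff_left: "mat_op X act q p (\<lambda>i j. a i j - b i j) z = mat_op X act q p a z - mat_op X act q p b z"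
 by (auto simp: mat_op_def opr_diff sum_subtractf fun_eq_iff fun_apply)

lemma mat_op_scalar: "mat_op X act q q (\<lambda>i j. if i = j then r else 0) z = act_op ({..<q} \<times> X) (pact act) r z"
proof
 fix ic :: "nat \<times> 'x"
 obtain i c where ic: "ic = (i, c)" by fastforce
 have "(\<Sum>j<q. opr (if i = j then r else 0) (\<lambda>c. z (j, c)) c) = (\<Sum>j<q. if i = j then opr r (\<lambda>c. z (j, c)) c else 0)"
  by (rule sum.cong) (auto simp: fun_apply)
 then show "mat_op X act q q (\<lambda>i j. if i = j then r else 0) z ic = act_op ({..<q} \<times> X) (pact act) r z ic"
  unfolding ic by (simp add: mat_op_def act_op_pact)
qed

end

definition mv :: "nat \<Rightarrow> nat \<Rightarrow> (nat \<Rightarrow> nat \<Rightarrow> 'r::comm_ring_1) \<Rightarrow> (nat \<Rightarrow> 'r) \<Rightarrow> nat \<Rightarrow> 'r" where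
 "mv q p a x = (\<lambda>i. if i < q then \<Sum>k<p. a i k * x k else 0)"

definition presents :: "'r::comm_ring_1 set \<Rightarrow> nat \<Rightarrow> (nat \<Rightarrow> 'r) set \<Rightarrow> nat \<Rightarrow> (nat \<Rightarrow> nat \<Rightarrow> 'r) \<Rightarrow> bool" where
 "presents S q N p b \<longleftrightarrow> smod S N \<and> N \<subseteq> tup S q \<and> (\<forall>j<p. (\<lambda>i. b i j) \<in> N)
   \<and> (\<forall>x\<in>N. \<exists>c. (\<forall>j<p. c j \<in> S) \<and> x = (\<lambda>i. \<Sum>j<p. b i j * c j))"

text \<open>\<psi> induces a homomorphism from the second quotient module to the first whose
  composites with that of \<open>a\<close>, in both orders, are multiplication by
  \<open>r\<close>.\<close>

definition near_inverse :: "'r::comm_ring_1 set \<Rightarrow> nat \<Rightarrow> (nat \<Rightarrow> 'r) set \<Rightarrow> nat \<Rightarrow> (nat \<Rightarrow> 'r) set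
  \<Rightarrow> (nat \<Rightarrow> nat \<Rightarrow> 'r) \<Rightarrow> (nat \<Rightarrow> nat \<Rightarrow> 'r) \<Rightarrow> 'r \<Rightarrow> bool" where
 "near_inverse S q1 N1 q2 N2 a \<psi> r \<longleftrightarrow>
   (\<forall>y\<in>N2. mv q1 q2 \<psi> y \<in> N1)
   \<and> (\<forall>y\<in>tup S q2. mv q2 q1 a (mv q1 q2 \<psi> y) - (\<lambda>i. r * y i) \<in> N2)
   \<and> (\<forall>x\<in>tup S q1. mv q1 q2 \<psi> (mv q2 q1 a x) - (\<lambda>i. r * x i) \<in> N1)"

definition unit_tup :: "nat \<Rightarrow> nat \<Rightarrow> 'r::comm_ring_1" where
 "unit_tup k = (\<lambda>i. if i = k then 1 else 0)"

lemma unit_tup_in: "subr S \<Longrightarrow> k < q \<Longrightarrow> unit_tup k \<in> tup S q"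
 by (auto simp: tup_def unit_tup_def subr_1 sgrp_0[OF subr_sgrp])

lemma mv_unit_tup: "k < p \<Longrightarrow> mv q p a (unit_tup k) = (\<lambda>i. if i < q then a i k else 0)"
 by (auto simp: mv_def unit_tup_def if_distrib cong: if_cong)

context finite_action
begin

text \<open>Columns that are relations factor through the presentation matrix, and products of
  matrices act as composites. This transports statements about \<open>N\<close> to every finite
  level \<open>X\<close>.\<close>

lemma columns_mat_image:
 assumes N: "presents (Rn n) q N p b" and a: "\<And>k. k < r \<Longrightarrow> \<exists>x\<in>N. \<forall>i<q. a i k = x i"
 shows "mat_op X act q r a z \<in> mat_image X act q p b"
proof -
 have "\<exists>c. \<forall>i<q. a i k = (\<Sum>j<p. b i j * c j)" if k: "k < r" for k
 proof -
  obtain x where x: "x \<in> N" "\<forall>i<q. a i k = x i" using a[OF k] by (elim bexE)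
  have "\<exists>c. (\<forall>j<p. c j \<in> Rn n) \<and> x = (\<lambda>i. \<Sum>j<p. b i j * c j)" using N x(1) by (simp add: presents_def)
  then obtain c where "x = (\<lambda>i. \<Sum>j<p. b i j * c j)" by (elim exE conjE)
  then show ?thesis using x(2) by (intro exI[of _ c]) simp
 qed
 then obtain c where c: "\<And>k i. k < r \<Longrightarrow> i < q \<Longrightarrow> a i k = (\<Sum>j<p. b i j * c k j)" by metis
 have "mat_op X act q r a z = mat_op X act q r (\<lambda>i k. \<Sum>j<p. b i j * (\<lambda>j k. c k j) j k) z"
  by (rule mat_op_cong) (simp add: c)
 also have "\<dots> = mat_op X act q p b (mat_op X act p r (\<lambda>j k. c k j) z)" by (rule mat_op_mult)
 finally show ?thesis unfolding mat_image_def using mat_op_Zf by (intro image_eqI)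
qed

lemma hom_mat_image:
 assumes N1: "presents (Rn n) q1 N1 p1 b1" and N2: "presents (Rn n) q2 N2 p2 b2"
  and a: "\<And>x. x \<in> N1 \<Longrightarrow> mv q2 q1 a x \<in> N2" and w: "w \<in> mat_image X act q1 p1 b1"
 shows "mat_op X act q2 q1 a w \<in> mat_image X act q2 p2 b2"
proof -
 obtain z where z: "w = mat_op X act q1 p1 b1 z" using w by (auto simp: mat_image_def)
 have "mat_op X act q2 p1 (\<lambda>i k. \<Sum>j<q1. a i j * b1 j k) z \<in> mat_image X act q2 p2 b2"
 proof (rule columns_mat_image[OF N2])
  fix k assume "k < p1"
  then have "mv q2 q1 a (\<lambda>i. b1 i k) \<in> N2" using a N1 by (simp add: presents_def)
  then show "\<exists>x\<in>N2. \<forall>i<q2. (\<Sum>j<q1. a i j * b1 j k) = x i"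
   by (intro bexI[of _ "mv q2 q1 a (\<lambda>i. b1 i k)"]) (simp_all add: mv_def)
 qed
 then show ?thesis unfolding z mat_op_mult .
qed

lemma hom_sat:
 assumes N1: "presents (Rn n) q1 N1 p1 b1" and N2: "presents (Rn n) q2 N2 p2 b2"
  and a: "\<And>x. x \<in> N1 \<Longrightarrow> mv q2 q1 a x \<in> N2" and w: "w \<in> sat ({..<q1} \<times> X) (mat_image X act q1 p1 b1)"
 shows "mat_op X act q2 q1 a w \<in> sat ({..<q2} \<times> X) (mat_image X act q2 p2 b2)"
proof -
 obtain k where k: "k > 0" "k \<star> w \<in> mat_image X act q1 p1 b1" using w by (auto simp: sat_def)
 have "k \<star> mat_op X act q2 q1 a w \<in> mat_image X act q2 p2 b2"
  using hom_mat_image[OF N1 N2 a k(2)] by (simp add: mat_op_linear)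
 then show ?thesis using k(1) mat_op_Zf by (auto simp: sat_def)
qed

lemma near_inverse_mat:
 assumes N: "presents (Rn n) q N p b"
  and id: "\<And>y. y \<in> tup (Rn n) q \<Longrightarrow> mv q q' a (mv q' q \<psi> y) - (\<lambda>i. r * y i) \<in> N"
 shows "mat_op X act q q' a (mat_op X act q' q \<psi> w) - act_op ({..<q} \<times> X) (pact act) r w \<in> mat_image X act q p b"
proof -
 have "mat_op X act q q (\<lambda>i k. (\<Sum>j<q'. a i j * \<psi> j k) - (if i = k then r else 0)) w \<in> mat_image X act q p b"
 proof (rule columns_mat_image[OF N])
  fix k assume k: "k < q"
  let ?x = "mv q q' a (mv q' q \<psi> (unit_tup k)) - (\<lambda>i. r * unit_tup k i)"
  have "?x \<in> N" by (rule id[OF unit_tup_in[OF subr_Rn k]])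
  moreover have "(\<Sum>j<q'. a i j * \<psi> j k) - (if i = k then r else 0) = ?x i" if "i < q" for i
   using that unfolding mv_unit_tup[OF k] by (simp add: mv_def fun_apply unit_tup_def)
  ultimately show "\<exists>x\<in>N. \<forall>i<q. (\<Sum>j<q'. a i j * \<psi> j k) - (if i = k then r else 0) = x i" by (intro bexI[of _ ?x]) simp_all
 qed
 then show ?thesis unfolding mat_op_diff_left mat_op_mult mat_op_scalar .
qed

text \<open>Cokernel: for \<open>w\<close> in \<open>S2\<close> the element f w is congruent to A
  (\<psi> w) modulo \<Lambda>2, so \<open>?H\<close> contains
  \<open>\<Lambda>2 [+] Jset f g S2\<close>, while \<open>?H\<close> modulo \<Lambda>2 is an image
  of S1/\<Lambda>1. Kernel: if A w lies in \<Lambda>2, then \<psi> (A w) lies in \<Lambda>1, and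
  hence so do f w and g w.\<close>

theorem torsion_comparison:
 assumes N1: "presents (Rn n) q1 N1 p1 b1" and N2: "presents (Rn n) q2 N2 p2 b2"
  and a: "\<And>x. x \<in> N1 \<Longrightarrow> mv q2 q1 a x \<in> N2"
  and \<psi>: "near_inverse (Rn n) q1 N1 q2 N2 a \<psi>f f" "near_inverse (Rn n) q1 N1 q2 N2 a \<psi>g g"
 defines "\<Lambda>1 \<equiv> mat_image X act q1 p1 b1" and "\<Lambda>2 \<equiv> mat_image X act q2 p2 b2"
 defines "S1 \<equiv> sat ({..<q1} \<times> X) \<Lambda>1" and "S2 \<equiv> sat ({..<q2} \<times> X) \<Lambda>2"
 assumes t1: "has_idx S1 \<Lambda>1 t1" and t2: "has_idx S2 \<Lambda>2 t2"
  and k2: "covers k2 S2 (\<Lambda>2 [+] finite_action.Jset ({..<q2} \<times> X) (pact act) f g S2)"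
  and k1: "covers k1 {x\<in>S1. act_op ({..<q1} \<times> X) (pact act) f x \<in> \<Lambda>1 \<and> act_op ({..<q1} \<times> X) (pact act) g x \<in> \<Lambda>1} \<Lambda>1"
 shows "t2 \<le> t1 * k2" "t1 \<le> t2 * k1"
proof -
 interpret P2: finite_action "{..<q2} \<times> X" "pact act" by (rule finite_action_pact) unfold_locales
 let ?A = "mat_op X act q2 q1 a" and ?\<psi> = "\<lambda>\<psi>. mat_op X act q1 q2 \<psi>"
 have \<Lambda>: "sgrp \<Lambda>1" "sgrp \<Lambda>2" unfolding \<Lambda>1_def \<Lambda>2_def by (rule sgrp_mat_image)+
 have S: "sgrp S1" "sgrp S2" unfolding S1_def S2_def by (rule sgrp_sat, rule \<Lambda>)+
 have A1: "?A x \<in> \<Lambda>2" if "x \<in> \<Lambda>1" for x unfolding \<Lambda>2_def by (rule hom_mat_image[OF N1 N2]) (use a that in \<open>simp_all add: \<Lambda>1_def\<close>)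
 have A2: "?A x \<in> S2" if "x \<in> S1" for x unfolding S2_def \<Lambda>2_def by (rule hom_sat[OF N1 N2]) (use a that in \<open>simp_all add: S1_def \<Lambda>1_def\<close>)
 have \<psi>1: "?\<psi> \<psi> x \<in> \<Lambda>1" if "x \<in> \<Lambda>2" "near_inverse (Rn n) q1 N1 q2 N2 a \<psi> r" for x \<psi> r
  unfolding \<Lambda>1_def by (rule hom_mat_image[OF N2 N1]) (use that in \<open>simp_all add: \<Lambda>2_def near_inverse_def\<close>)
 have \<psi>2: "?\<psi> \<psi> x \<in> S1" if "x \<in> S2" "near_inverse (Rn n) q1 N1 q2 N2 a \<psi> r" for x \<psi> r
  unfolding S1_def \<Lambda>1_def by (rule hom_sat[OF N2 N1]) (use that in \<open>simp_all add: S2_def \<Lambda>2_def near_inverse_def\<close>)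
 have i2: "?A (?\<psi> \<psi> w) - act_op ({..<q2} \<times> X) (pact act) r w \<in> \<Lambda>2" if "near_inverse (Rn n) q1 N1 q2 N2 a \<psi> r" for w \<psi> r
  unfolding \<Lambda>2_def using that by (intro near_inverse_mat[OF N2]) (simp add: near_inverse_def)
 have i1: "?\<psi> \<psi> (?A w) - act_op ({..<q1} \<times> X) (pact act) r w \<in> \<Lambda>1" if "near_inverse (Rn n) q1 N1 q2 N2 a \<psi> r" for w \<psi> r
  unfolding \<Lambda>1_def using that by (intro near_inverse_mat[OF N1]) (simp add: near_inverse_def)
 let ?H = "?A ` S1 [+] \<Lambda>2"
 have sA: "sgrp (?A ` S1)"
 proof (rule sgrpI)
  show "0 \<in> ?A ` S1" using sgrp_0[OF S(1)] by (intro image_eqI[of _ _ 0]) (simp_all add: mat_op_linear)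
  fix x y assume "x \<in> ?A ` S1" "y \<in> ?A ` S1"
  then obtain u v where "x = ?A u" "y = ?A v" "u \<in> S1" "v \<in> S1" by blast
  then show "x - y \<in> ?A ` S1" using sgrp_diff[OF S(1)] by (intro image_eqI[of _ _ "u - v"]) (simp_all add: mat_op_linear)
 qed
 have sH: "sgrp ?H" by (rule sgrp_setsum2[OF sA \<Lambda>(2)])
 have mem: "act_op ({..<q2} \<times> X) (pact act) r w \<in> ?H" if "w \<in> S2" "near_inverse (Rn n) q1 N1 q2 N2 a \<psi> r" for w \<psi> r
 proof -
  have 1: "?A (?\<psi> \<psi> w) \<in> ?H" using setsum2_left[OF \<Lambda>(2), of "?A ` S1"] \<psi>2[OF that] by blast
  have 2: "?A (?\<psi> \<psi> w) - act_op ({..<q2} \<times> X) (pact act) r w \<in> ?H" using setsum2_right[OF sA, of \<Lambda>2] i2[OF that(2)] by blast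
  show ?thesis using sgrp_diff[OF sH 1 2] by simp
 qed
 have sub: "\<Lambda>2 [+] P2.Jset f g S2 \<subseteq> ?H"
 proof (rule setsum2_subset[OF sH setsum2_right[OF sA]])
  show "P2.Jset f g S2 \<subseteq> ?H"
  proof
   fix x assume "x \<in> P2.Jset f g S2"
   then show "x \<in> ?H" by (elim P2.JsetE) (auto intro!: sgrp_add[OF sH] mem[OF _ \<psi>(1)] mem[OF _ \<psi>(2)])
  qed
 qed
 have c2: "covers k2 S2 ?H" using covers_mono[OF k2 _ subset_refl sub] by simp
 have c1: "covers t1 ?H \<Lambda>2"
 proof (rule covers_via[OF has_idx_covers[OF t1] \<Lambda>(1), where P = "\<lambda>y v. y - ?A v \<in> \<Lambda>2"])
  fix y assume "y \<in> ?H"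
  then obtain v l where "v \<in> S1" "l \<in> \<Lambda>2" "y = ?A v + l" by (auto elim: setsum2_E)
  then show "\<exists>v\<in>S1. y - ?A v \<in> \<Lambda>2" by (intro bexI[of _ v]) simp_all
 next
  fix y y' v v' assume h: "y - ?A v \<in> \<Lambda>2" "y' - ?A v' \<in> \<Lambda>2" "v - v' \<in> \<Lambda>1"
  have "(y - ?A v) - (y' - ?A v') + ?A (v - v') \<in> \<Lambda>2"
   by (rule sgrp_add[OF \<Lambda>(2) sgrp_diff[OF \<Lambda>(2) h(1,2)] A1[OF h(3)]])
  then show "y - y' \<in> \<Lambda>2" by (simp add: mat_op_linear algebra_simps)
 qed
 have "covers (k2 * t1) S2 \<Lambda>2" by (rule covers_trans[OF c2 c1])
 then have "t2 \<le> k2 * t1" by (rule has_idx_le_covers[OF \<Lambda>(2) t2])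
 then show "t2 \<le> t1 * k2" by (simp only: mult.commute)
 let ?K = "{x\<in>S1. ?A x \<in> \<Lambda>2}"
 have mem1: "act_op ({..<q1} \<times> X) (pact act) r w \<in> \<Lambda>1" if "?A w \<in> \<Lambda>2" "near_inverse (Rn n) q1 N1 q2 N2 a \<psi> r" for w \<psi> r
  using sgrp_diff[OF \<Lambda>(1) \<psi>1[OF that] i1[OF that(2), of w]] by simp
 have "?K \<subseteq> {x\<in>S1. act_op ({..<q1} \<times> X) (pact act) f x \<in> \<Lambda>1 \<and> act_op ({..<q1} \<times> X) (pact act) g x \<in> \<Lambda>1}"
  using mem1[OF _ \<psi>(1)] mem1[OF _ \<psi>(2)] by blast
 then have d1: "covers k1 ?K \<Lambda>1" using covers_mono[OF k1 _ _ subset_refl] by simp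
 have d2: "covers t2 S1 ?K"
 proof (rule covers_via[OF has_idx_covers[OF t2] \<Lambda>(2), where P = "\<lambda>y v. y \<in> S1 \<and> v = ?A y"])
  show "\<exists>v\<in>S2. y \<in> S1 \<and> v = ?A y" if "y \<in> S1" for y using that A2 by (intro bexI[of _ "?A y"]) simp_all
  show "y - y' \<in> ?K" if "y \<in> S1 \<and> v = ?A y" "y' \<in> S1 \<and> v' = ?A y'" "v - v' \<in> \<Lambda>2" for y y' v v'
   using that sgrp_diff[OF S(1)] by (simp add: mat_op_linear)
 qed
 have "covers (t2 * k1) S1 \<Lambda>1" by (rule covers_trans[OF d2 d1])
 then show "t1 \<le> t2 * k1" by (rule has_idx_le_covers[OF \<Lambda>(1) t1])
qed

end

lemma mv_diff: "mv q p a (x - y) = mv q p a x - mv q p a y"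
 by (auto simp: mv_def fun_eq_iff fun_apply right_diff_distrib sum_subtractf)

lemma mv_scale: "mv q p a (\<lambda>i. s * x i) = (\<lambda>i. s * mv q p a x i)"
 by (auto simp: mv_def fun_eq_iff sum_distrib_left mult_ac)

lemma mv_scale_left: "mv q p (\<lambda>i j. s * a i j) x = (\<lambda>i. s * mv q p a x i)"
 by (auto simp: mv_def fun_eq_iff sum_distrib_left mult_ac)

lemma mv_tup:
 assumes S: "subr S" and "\<And>i j. i < q \<Longrightarrow> j < p \<Longrightarrow> a i j \<in> S" "x \<in> tup S p" shows "mv q p a x \<in> tup S q"
 using assms(2,3) by (auto simp: mv_def tup_def intro!: sgrp_sum[OF subr_sgrp[OF S]] subr_mult[OF S])

lemma smod_tup: assumes S: "subr S" shows "smod S (tup S q)"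
 unfolding smod_def tup_def
 by (auto intro!: sgrpI sgrp_diff[OF subr_sgrp[OF S]] subr_mult[OF S] simp: fun_apply sgrp_0[OF subr_sgrp[OF S]])

lemma tup_span:
 assumes H: "smod S H" and e: "\<And>k. k < q \<Longrightarrow> unit_tup k \<in> H" shows "tup S q \<subseteq> H"
proof
 fix y assume y: "y \<in> tup S q"
 have "y = (\<Sum>k<q. (\<lambda>i. y k * unit_tup k i))"
 proof
  fix i
  have "(\<Sum>k<q. (\<lambda>i. y k * unit_tup k i)) i = (\<Sum>k<q. if i = k then y k else 0)"
   unfolding sum_fun_apply by (rule sum.cong) (auto simp: unit_tup_def)
  also have "\<dots> = y i" using y by (simp add: tup_def)
  finally show "y i = (\<Sum>k<q. (\<lambda>i. y k * unit_tup k i)) i" by (rule sym)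
 qed
 also have "\<dots> \<in> H" by (intro sgrp_sum[OF smod_sgrp[OF H]] smod_scale[OF H] e) (use y in \<open>auto simp: tup_def\<close>)
 finally show "y \<in> H" .
qed

lemma sub_scale_simps:
 fixes s t :: "'r::comm_ring_1" and x y :: "nat \<Rightarrow> 'r"
 shows "(\<lambda>i. s * (x - y) i) = (\<lambda>i. s * x i) - (\<lambda>i. s * y i)"
  "(\<lambda>i. (s - t) * x i) = (\<lambda>i. s * x i) - (\<lambda>i. t * x i)"
  "(\<lambda>i. s * (0 :: nat \<Rightarrow> 'r) i) = 0"
 by (auto simp: fun_eq_iff fun_apply algebra_simps)

lemma mv_0: "mv q p a 0 = 0"
 by (auto simp: mv_def fun_eq_iff fun_apply)

lemma smod_colon: assumes N: "smod S N" shows "smod S {x. (\<lambda>i. s * x i) \<in> N}"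
 unfolding smod_def
proof (intro conjI ballI sgrpI)
 show "0 \<in> {x. (\<lambda>i. s * x i) \<in> N}" using sgrp_0[OF smod_sgrp[OF N]] by (simp add: sub_scale_simps)
 show "x - y \<in> {x. (\<lambda>i. s * x i) \<in> N}" if "x \<in> {x. (\<lambda>i. s * x i) \<in> N}" "y \<in> {x. (\<lambda>i. s * x i) \<in> N}" for x y
  using that sgrp_diff[OF smod_sgrp[OF N]] by (simp add: sub_scale_simps)
 show "(\<lambda>i. r * x i) \<in> {x. (\<lambda>i. s * x i) \<in> N}" if "r \<in> S" "x \<in> {x. (\<lambda>i. s * x i) \<in> N}" for r x
  using smod_scale[OF N that(1), of "\<lambda>i. s * x i"] that(2) by (simp add: mult.left_commute)
qed

text \<open>The map induced by \<open>a\<close> between the quotients of free modules by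
  \<open>N1\<close> and \<open>N2\<close> is a pseudo-isomorphism. The vanishing of localized kernel
  and cokernel is spelled out on tuples, with \<open>u\<close> outside \<open>P\<close> as
  denominator.\<close>

locale near_iso =
 fixes S :: "'r::idom set" and q1 q2 :: nat and N1 N2 :: "(nat \<Rightarrow> 'r) set" and a :: "nat \<Rightarrow> nat \<Rightarrow> 'r"
 assumes S: "subr S" "noeth S" and N1: "smod S N1" "N1 \<subseteq> tup S q1" and N2: "smod S N2" "N2 \<subseteq> tup S q2"
  and a: "\<And>i j. i < q2 \<Longrightarrow> j < q1 \<Longrightarrow> a i j \<in> S"
  and hom: "\<And>x. x \<in> N1 \<Longrightarrow> mv q2 q1 a x \<in> N2"
  and ker: "\<And>P x. ht1 S P \<Longrightarrow> x \<in> tup S q1 \<Longrightarrow> mv q2 q1 a x \<in> N2 \<Longrightarrow> \<exists>u\<in>S - P. (\<lambda>i. u * x i) \<in> N1"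
  and coker: "\<And>P y. ht1 S P \<Longrightarrow> y \<in> tup S q2 \<Longrightarrow> \<exists>u\<in>S - P. \<exists>x\<in>tup S q1. (\<lambda>i. u * y i) - mv q2 q1 a x \<in> N2"
begin

definition Ker :: "(nat \<Rightarrow> 'r) set" where "Ker = {x\<in>tup S q1. mv q2 q1 a x \<in> N2}"

definition Coim :: "'r \<Rightarrow> (nat \<Rightarrow> 'r) set" where "Coim r = {y. \<exists>x\<in>tup S q1. (\<lambda>i. r * y i) - mv q2 q1 a x \<in> N2}"

text \<open>The common annihilator of the kernel and the cokernel of the induced map.\<close>

definition Ann :: "'r set" where
 "Ann = {r\<in>S. (\<forall>x\<in>Ker. (\<lambda>i. r * x i) \<in> N1) \<and> tup S q2 \<subseteq> Coim r}"

lemma sN: "sgrp N1" "sgrp N2" by (rule smod_sgrp[OF N1(1)], rule smod_sgrp[OF N2(1)])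

lemma smod_Ker: "smod S Ker"
 unfolding smod_def Ker_def
 using sgrp_0[OF sN(2)] sgrp_diff[OF sN(2)] smod_scale[OF N2(1)] sgrp_0[OF smod_sgrp[OF smod_tup[OF S(1)]]]
  sgrp_diff[OF smod_sgrp[OF smod_tup[OF S(1)]]] smod_scale[OF smod_tup[OF S(1)]]
 by (auto intro!: sgrpI simp: mv_diff mv_scale mv_0)

lemma smod_Coim: "smod S (Coim r)"
 unfolding smod_def
proof (intro conjI ballI sgrpI)
 note T = smod_tup[OF S(1), of q1]
 show "0 \<in> Coim r" unfolding Coim_def using sgrp_0[OF sN(2)] sgrp_0[OF smod_sgrp[OF T]]
  by (intro CollectI bexI[of _ 0]) (simp_all add: mv_0 sub_scale_simps)
 fix y y' assume "y \<in> Coim r" "y' \<in> Coim r"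
 then obtain x x' where h: "x \<in> tup S q1" "x' \<in> tup S q1" "(\<lambda>i. r * y i) - mv q2 q1 a x \<in> N2" "(\<lambda>i. r * y' i) - mv q2 q1 a x' \<in> N2"
  unfolding Coim_def by blast
 have "((\<lambda>i. r * y i) - mv q2 q1 a x) - ((\<lambda>i. r * y' i) - mv q2 q1 a x') \<in> N2" by (rule sgrp_diff[OF sN(2) h(3,4)])
 then have "(\<lambda>i. r * (y - y') i) - mv q2 q1 a (x - x') \<in> N2" by (simp add: sub_scale_simps mv_diff algebra_simps)
 then show "y - y' \<in> Coim r" unfolding Coim_def using sgrp_diff[OF smod_sgrp[OF T] h(1,2)] by (intro CollectI bexI)
next
 fix s y assume s: "s \<in> S" and "y \<in> Coim r"
 then obtain x where h: "x \<in> tup S q1" "(\<lambda>i. r * y i) - mv q2 q1 a x \<in> N2" unfolding Coim_def by blast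
 from smod_scale[OF N2(1) s h(2)]
 have "(\<lambda>i. r * (s * y i)) - mv q2 q1 a (\<lambda>i. s * x i) \<in> N2" by (simp add: sub_scale_simps mv_scale mult.left_commute)
 then show "(\<lambda>i. s * y i) \<in> Coim r" unfolding Coim_def using smod_scale[OF smod_tup[OF S(1)] s h(1)] by (intro CollectI bexI)
qed

lemma Coim_diff: assumes "y \<in> Coim r" "y \<in> Coim s" shows "y \<in> Coim (r - s)"
proof -
 obtain x x' where h: "x \<in> tup S q1" "x' \<in> tup S q1" "(\<lambda>i. r * y i) - mv q2 q1 a x \<in> N2" "(\<lambda>i. s * y i) - mv q2 q1 a x' \<in> N2"
  using assms unfolding Coim_def by blast
 have "((\<lambda>i. r * y i) - mv q2 q1 a x) - ((\<lambda>i. s * y i) - mv q2 q1 a x') \<in> N2" by (rule sgrp_diff[OF sN(2) h(3,4)])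
 then have "(\<lambda>i. (r - s) * y i) - mv q2 q1 a (x - x') \<in> N2"
  unfolding sub_scale_simps mv_diff by (simp add: algebra_simps)
 then show ?thesis unfolding Coim_def using sgrp_diff[OF smod_sgrp[OF smod_tup[OF S(1)]] h(1,2)] by (intro CollectI bexI)
qed

lemma Coim_mult: assumes "s \<in> S" "y \<in> Coim r" shows "y \<in> Coim (s * r)"
proof -
 have "(\<lambda>i. s * y i) \<in> Coim r" by (rule smod_scale[OF smod_Coim assms])
 then show ?thesis unfolding Coim_def by (simp add: mult_ac)
qed

lemma Coim_0: "tup S q2 \<subseteq> Coim 0"
proof
 fix y
 show "y \<in> Coim 0" unfolding Coim_def using sgrp_0[OF sN(2)] sgrp_0[OF smod_sgrp[OF smod_tup[OF S(1)]]]
  by (intro CollectI bexI[of _ 0]) (simp_all add: mv_0 zero_fun_def[symmetric])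
qed

lemma rid_Ann: "rid S Ann"
 unfolding rid_def
proof (intro conjI ballI sgrpI)
 show "Ann \<subseteq> S" by (auto simp: Ann_def)
 show "0 \<in> Ann" using sgrp_0[OF sN(1)] sgrp_0[OF subr_sgrp[OF S(1)]] Coim_0 by (simp add: Ann_def zero_fun_def[symmetric])
 show "r - s \<in> Ann" if "r \<in> Ann" "s \<in> Ann" for r s
  unfolding Ann_def
 proof (intro CollectI conjI ballI subsetI)
  show "r - s \<in> S" using that sgrp_diff[OF subr_sgrp[OF S(1)]] by (simp add: Ann_def)
  show "(\<lambda>i. (r - s) * x i) \<in> N1" if "x \<in> Ker" for x
   unfolding sub_scale_simps using that \<open>r \<in> Ann\<close> \<open>s \<in> Ann\<close> by (intro sgrp_diff[OF sN(1)]) (simp_all add: Ann_def)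
  show "y \<in> Coim (r - s)" if "y \<in> tup S q2" for y
   using that \<open>r \<in> Ann\<close> \<open>s \<in> Ann\<close> by (intro Coim_diff) (auto simp: Ann_def)
 qed
 show "s * r \<in> Ann" if "s \<in> S" "r \<in> Ann" for s r
  unfolding Ann_def
 proof (intro CollectI conjI ballI subsetI)
  show "s * r \<in> S" using that subr_mult[OF S(1)] by (simp add: Ann_def)
  show "(\<lambda>i. s * r * x i) \<in> N1" if "x \<in> Ker" for x
   using smod_scale[OF N1(1) \<open>s \<in> S\<close>, of "\<lambda>i. r * x i"] that \<open>r \<in> Ann\<close> by (simp add: Ann_def mult.assoc)
  show "y \<in> Coim (s * r)" if "y \<in> tup S q2" for y
   using that \<open>r \<in> Ann\<close> \<open>s \<in> S\<close> by (intro Coim_mult) (auto simp: Ann_def)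
 qed
qed

text \<open>\<open>Ker\<close> and the free module over the cokernel have finitely many generators,
  each killed in its quotient by an element outside \<open>P\<close>. The product of these elements
  lies in \<open>Ann\<close> and, \<open>P\<close> being prime, outside \<open>P\<close>.\<close>

lemma Ann_not_ht1: assumes P: "ht1 S P" shows "\<not> Ann \<subseteq> P"
proof -
 have pr: "rprime S P" using P by (simp add: ht1_def)
 have "Ker \<subseteq> tup S q1" by (auto simp: Ker_def)
 from smod_fg[OF S smod_Ker this] obtain G where G: "finite G" "G \<subseteq> Ker" "\<forall>H. smod S H \<longrightarrow> G \<subseteq> H \<longrightarrow> Ker \<subseteq> H"
  by (elim exE conjE)
 have "\<exists>u. u \<in> S - P \<and> (\<lambda>i. u * x i) \<in> N1" if "x \<in> G" for x using ker[OF P, of x] that G(2) by (auto simp: Ker_def)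
 then obtain u where u: "\<And>x. x \<in> G \<Longrightarrow> u x \<in> S - P \<and> (\<lambda>i. u x * x i) \<in> N1" by metis
 have "\<exists>v. v \<in> S - P \<and> unit_tup k \<in> Coim v" if "k < q2" for k
  using coker[OF P unit_tup_in[OF S(1) that]] unfolding Coim_def by blast
 then obtain v where v: "\<And>k. k < q2 \<Longrightarrow> v k \<in> S - P \<and> unit_tup k \<in> Coim (v k)" by metis
 have prodS: "prod h A \<in> S" if "finite A" "\<And>x. x \<in> A \<Longrightarrow> h x \<in> S" for h :: "'i \<Rightarrow> 'r" and A
  using that by (induction A rule: finite_induct) (simp_all add: subr_1[OF S(1)] subr_mult[OF S(1)])
 let ?U = "prod u G" and ?V = "prod v {..<q2}"
 have US: "?U \<in> S" "?V \<in> S" using u v by (auto intro!: prodS G(1))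
 have "?U \<notin> P" "?V \<notin> P" using rprime_prod[OF S(1) pr G(1), of u] rprime_prod[OF S(1) pr, of "{..<q2}" v] u v by auto
 then have nP: "?U * ?V \<notin> P" using rprime_mult[OF pr US] by blast
 have "?U * ?V \<in> Ann"
  unfolding Ann_def
 proof (intro CollectI conjI ballI)
  show "?U * ?V \<in> S" by (rule subr_mult[OF S(1) US])
  have "Ker \<subseteq> {x. (\<lambda>i. ?U * ?V * x i) \<in> N1}"
  proof (rule G(3)[rule_format, OF smod_colon[OF N1(1)]], rule subsetI)
   fix x assume x: "x \<in> G"
   have E: "?U * ?V = (prod u (G - {x}) * ?V) * u x" by (simp only: prod.remove[OF G(1) x, of u] mult_ac)
   have "prod u (G - {x}) * ?V \<in> S" using u G(1) by (intro subr_mult[OF S(1)] prodS US) auto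
   from smod_scale[OF N1(1) this, of "\<lambda>i. u x * x i"]
   have "(\<lambda>i. (prod u (G - {x}) * ?V) * (u x * x i)) \<in> N1" using u[OF x] by blast
   then show "x \<in> {x. (\<lambda>i. ?U * ?V * x i) \<in> N1}" unfolding E mem_Collect_eq by (simp only: mult.assoc)
  qed
  then show "(\<lambda>i. ?U * ?V * x i) \<in> N1" if "x \<in> Ker" for x using that by blast
  show "tup S q2 \<subseteq> Coim (?U * ?V)"
  proof (rule tup_span[OF smod_Coim])
   fix k assume k: "k < q2"
   have E: "?U * ?V = (?U * prod v ({..<q2} - {k})) * v k" 
   proof -
    have "prod v {..<q2} = v k * prod v ({..<q2} - {k})" by (rule prod.remove) (use k in auto)
    then show ?thesis by (simp only: mult_ac)
   qed
   have "?U * prod v ({..<q2} - {k}) \<in> S" using v by (intro subr_mult[OF S(1)] prodS US) auto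
   then show "unit_tup k \<in> Coim (?U * ?V)" unfolding E by (rule Coim_mult) (use v[OF k] in blast)
  qed
 qed
 then show ?thesis using nP by blast
qed

text \<open>The columns of \<open>C\<close> lift \<open>r\<close> times the unit tuples through
  \<open>a\<close>, so \<open>C\<close> inverts \<open>a\<close> up to \<open>r\<close> modulo
  \<open>N2\<close>. It sends \<open>N2\<close> only into \<open>Ker\<close>; as \<open>r\<close>
  maps \<open>Ker\<close> into \<open>N1\<close>, the matrix \<open>r * C\<close> respects
  relations, and both composites become \<open>r * r\<close>.\<close>

lemma Ann_near_inverse: assumes r: "r \<in> Ann" shows "\<exists>\<psi>. near_inverse S q1 N1 q2 N2 a \<psi> (r * r)"
proof -
 have rS: "r \<in> S" using r by (simp add: Ann_def)
 have rK: "(\<lambda>i. r * x i) \<in> N1" if "x \<in> Ker" for x using r that by (simp add: Ann_def)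
 have "\<exists>x. x \<in> tup S q1 \<and> (\<lambda>i. r * unit_tup k i) - mv q2 q1 a x \<in> N2" if "k < q2" for k
  using r unit_tup_in[OF S(1) that] unfolding Ann_def Coim_def by blast
 then obtain c where c: "\<And>k. k < q2 \<Longrightarrow> c k \<in> tup S q1 \<and> (\<lambda>i. r * unit_tup k i) - mv q2 q1 a (c k) \<in> N2" by metis
 define C where "C = (\<lambda>j k. c k j)"
 have Ct: "mv q1 q2 C y \<in> tup S q1" if "y \<in> tup S q2" for y
  by (rule mv_tup[OF S(1) _ that]) (use c in \<open>auto simp: C_def tup_def\<close>)
 let ?H = "{y. (\<lambda>i. r * y i) - mv q2 q1 a (mv q1 q2 C y) \<in> N2}"
 have H: "smod S ?H"
  unfolding smod_def
 proof (intro conjI ballI sgrpI)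
  show "0 \<in> ?H" using sgrp_0[OF sN(2)] by (simp add: mv_0 sub_scale_simps)
  show "x - y \<in> ?H" if "x \<in> ?H" "y \<in> ?H" for x y
  proof -
   have "((\<lambda>i. r * x i) - mv q2 q1 a (mv q1 q2 C x)) - ((\<lambda>i. r * y i) - mv q2 q1 a (mv q1 q2 C y)) \<in> N2"
    using that by (intro sgrp_diff[OF sN(2), of "(\<lambda>i. r * x i) - mv q2 q1 a (mv q1 q2 C x)"]) simp_all
   then show ?thesis by (simp add: sub_scale_simps mv_diff algebra_simps)
  qed
  show "(\<lambda>i. s * y i) \<in> ?H" if "s \<in> S" "y \<in> ?H" for s y
   using smod_scale[OF N2(1) that(1), of "(\<lambda>i. r * y i) - mv q2 q1 a (mv q1 q2 C y)"] that(2)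
   by (simp add: sub_scale_simps mv_scale mult.left_commute)
 qed
 have key: "(\<lambda>i. r * y i) - mv q2 q1 a (mv q1 q2 C y) \<in> N2" if "y \<in> tup S q2" for y
 proof -
  have "tup S q2 \<subseteq> ?H"
  proof (rule tup_span[OF H])
   fix k assume k: "k < q2"
   have "mv q1 q2 C (unit_tup k) = c k" unfolding mv_unit_tup[OF k] C_def using c[OF k] by (auto simp: tup_def fun_eq_iff)
   then show "unit_tup k \<in> ?H" using c[OF k] by simp
  qed
  then show ?thesis using that by blast
 qed
 have "near_inverse S q1 N1 q2 N2 a (\<lambda>i j. r * C i j) (r * r)"
  unfolding near_inverse_def mv_scale_left mv_scale
 proof (intro conjI ballI)
  fix y assume y: "y \<in> N2"
  have yt: "y \<in> tup S q2" using y N2(2) by blast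
  have "mv q2 q1 a (mv q1 q2 C y) \<in> N2" using sgrp_diff[OF sN(2) smod_scale[OF N2(1) rS y] key[OF yt]] by simp
  then have "mv q1 q2 C y \<in> Ker" using Ct[OF yt] by (simp add: Ker_def)
  then show "(\<lambda>i. r * mv q1 q2 C y i) \<in> N1" by (rule rK)
 next
  fix y assume y: "y \<in> tup S q2"
  have "- (\<lambda>i. r * ((\<lambda>i. r * y i) - mv q2 q1 a (mv q1 q2 C y)) i) \<in> N2"
   by (rule sgrp_minus[OF sN(2) smod_scale[OF N2(1) rS key[OF y]]])
  moreover have "- (\<lambda>i. r * ((\<lambda>i. r * y i) - mv q2 q1 a (mv q1 q2 C y)) i) = (\<lambda>i. r * mv q2 q1 a (mv q1 q2 C y) i) - (\<lambda>i. r * r * y i)"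
   by (auto simp: fun_eq_iff fun_apply algebra_simps)
  ultimately show "(\<lambda>i. r * mv q2 q1 a (mv q1 q2 C y) i) - (\<lambda>i. r * r * y i) \<in> N2" by simp
 next
  fix x assume x: "x \<in> tup S q1"
  let ?y = "mv q2 q1 a x"
  have y: "?y \<in> tup S q2" by (rule mv_tup[OF S(1) a x])
  have "mv q2 q1 a ((\<lambda>i. r * x i) - mv q1 q2 C ?y) \<in> N2" using key[OF y] by (simp add: mv_diff mv_scale)
  moreover have "(\<lambda>i. r * x i) - mv q1 q2 C ?y \<in> tup S q1"
   by (intro sgrp_diff[OF smod_sgrp[OF smod_tup[OF S(1)]]] smod_scale[OF smod_tup[OF S(1)] rS x] Ct y)
  ultimately have "(\<lambda>i. r * x i) - mv q1 q2 C ?y \<in> Ker" by (simp add: Ker_def)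
  from sgrp_minus[OF sN(1) rK[OF this]]
  have "- (\<lambda>i. r * ((\<lambda>i. r * x i) - mv q1 q2 C ?y) i) \<in> N1" .
  moreover have "- (\<lambda>i. r * ((\<lambda>i. r * x i) - mv q1 q2 C ?y) i) = (\<lambda>i. r * mv q1 q2 C ?y i) - (\<lambda>i. r * r * x i)"
   by (auto simp: fun_eq_iff fun_apply algebra_simps)
  ultimately show "(\<lambda>i. r * mv q1 q2 C ?y i) - (\<lambda>i. r * r * x i) \<in> N1" by simp
 qed
 then show ?thesis by blast
qed

end

theorem near_iso_growth:
 fixes N1 N2 :: "(nat \<Rightarrow> lp) set"
 assumes ni: "near_iso (Rn n) q1 q2 N1 N2 a" and pN1: "presents (Rn n) q1 N1 p1 b1" and pN2: "presents (Rn n) q2 N2 p2 b2"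
  and \<epsilon>: "\<epsilon> > 0"
 shows "\<exists>L0. \<forall>(X :: 'x set) act pt t1 t2. transitive_action X act pt \<longrightarrow> reach n X act pt \<longrightarrow> spread n act pt L0 \<longrightarrow>
  has_idx (sat ({..<q1} \<times> X) (mat_image X act q1 p1 b1)) (mat_image X act q1 p1 b1) t1 \<longrightarrow>
  has_idx (sat ({..<q2} \<times> X) (mat_image X act q2 p2 b2)) (mat_image X act q2 p2 b2) t2 \<longrightarrow>
  real t2 \<le> real t1 * exp (\<epsilon> * real (card X)) \<and> real t1 \<le> real t2 * exp (\<epsilon> * real (card X))"
proof -
 interpret near_iso "Rn n" q1 q2 N1 N2 a by (rule ni)
 obtain f g where fg: "f \<in> Ann" "g \<in> Ann" "zent n (gen2 (Rn n) (f * f) (g * g))"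
  by (rule coprime_pair[OF rid_Ann Ann_not_ht1])
 have fgR: "f * f \<in> Rn n" "g * g \<in> Rn n" using fg by (auto simp: Ann_def Rn_mult)
 obtain \<psi>f where \<psi>f: "near_inverse (Rn n) q1 N1 q2 N2 a \<psi>f (f * f)" by (rule exE[OF Ann_near_inverse[OF fg(1)]])
 obtain \<psi>g where \<psi>g: "near_inverse (Rn n) q1 N1 q2 N2 a \<psi>g (g * g)" by (rule exE[OF Ann_near_inverse[OF fg(2)]])
 obtain L2 where L2: "\<forall>(X :: 'x set) act pt. transitive_action X act pt \<longrightarrow> reach n X act pt \<longrightarrow> spread n act pt L2 \<longrightarrow>
  (\<exists>k. covers k (sat ({..<q2} \<times> X) (mat_image X act q2 p2 b2)) (mat_image X act q2 p2 b2 [+]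
    finite_action.Jset ({..<q2} \<times> X) (pact act) (f * f) (g * g) (sat ({..<q2} \<times> X) (mat_image X act q2 p2 b2)))
   \<and> real k \<le> exp (\<epsilon> * real (card X)))"
  by (rule exE[OF torsion_quotient_small[OF fg(3) fgR \<epsilon>, of q2 p2 b2, where ?'x = 'x]])
 obtain L1 where L1: "\<forall>(X :: 'x set) act pt. transitive_action X act pt \<longrightarrow> reach n X act pt \<longrightarrow> spread n act pt L1 \<longrightarrow>
  (\<exists>k. covers k {x\<in>sat ({..<q1} \<times> X) (mat_image X act q1 p1 b1). act_op ({..<q1} \<times> X) (pact act) (f * f) x \<in> mat_image X act q1 p1 b1 \<and>
    act_op ({..<q1} \<times> X) (pact act) (g * g) x \<in> mat_image X act q1 p1 b1} (mat_image X act q1 p1 b1)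
   \<and> real k \<le> exp (\<epsilon> * real (card X)))"
  by (rule exE[OF torsion_kernel_small[OF fg(3) fgR \<epsilon>, of q1 p1 b1, where ?'x = 'x]])
 have sp: "spread n act pt L'" if "spread n act pt L" "L' \<le> L" for act and pt :: 'x and L L' :: int
  unfolding spread_def
 proof (intro allI impI)
  fix y :: mon assume y: "keys y \<subseteq> {..<n}" "act y pt = pt" "\<forall>i<n. \<bar>lookup y i\<bar> < L'"
  have "\<forall>i<n. \<bar>lookup y i\<bar> < L" using y(3) that(2) less_le_trans by blast
  then show "y = 0" using that(1)[unfolded spread_def, rule_format, OF y(1,2)] by blast
 qed
 show ?thesis
 proof (intro exI[of _ "max L1 L2"] allI impI)
  fix X :: "'x set" and act pt t1 t2
  assume act: "transitive_action X act pt" and r: "reach n X act pt" and s: "spread n act pt (max L1 L2)"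
   and t1: "has_idx (sat ({..<q1} \<times> X) (mat_image X act q1 p1 b1)) (mat_image X act q1 p1 b1) t1"
   and t2: "has_idx (sat ({..<q2} \<times> X) (mat_image X act q2 p2 b2)) (mat_image X act q2 p2 b2) t2"
  interpret act: transitive_action X act pt by (rule act)
  from L1[rule_format, OF act r sp[OF s max.cobounded1]] obtain k1 where
   k1: "covers k1 {x\<in>sat ({..<q1} \<times> X) (mat_image X act q1 p1 b1). act_op ({..<q1} \<times> X) (pact act) (f * f) x \<in> mat_image X act q1 p1 b1 \<and>
    act_op ({..<q1} \<times> X) (pact act) (g * g) x \<in> mat_image X act q1 p1 b1} (mat_image X act q1 p1 b1)"
    "real k1 \<le> exp (\<epsilon> * real (card X))" by (elim exE conjE)
  from L2[rule_format, OF act r sp[OF s max.cobounded2]] obtain k2 where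
   k2: "covers k2 (sat ({..<q2} \<times> X) (mat_image X act q2 p2 b2)) (mat_image X act q2 p2 b2 [+]
    finite_action.Jset ({..<q2} \<times> X) (pact act) (f * f) (g * g) (sat ({..<q2} \<times> X) (mat_image X act q2 p2 b2)))"
    "real k2 \<le> exp (\<epsilon> * real (card X))" by (elim exE conjE)
  note c = act.torsion_comparison[OF pN1 pN2 hom \<psi>f \<psi>g t1 t2 k2(1) k1(1)]
  have "real t2 \<le> real t1 * real k2" "real t1 \<le> real t2 * real k1" using c by (simp_all only: of_nat_le_iff flip: of_nat_mult)
  moreover have "real t1 * real k2 \<le> real t1 * exp (\<epsilon> * real (card X))" "real t2 * real k1 \<le> real t2 * exp (\<epsilon> * real (card X))"
   using k1(2) k2(2) by (simp_all add: mult_left_mono)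
  ultimately show "real t2 \<le> real t1 * exp (\<epsilon> * real (card X)) \<and> real t1 \<le> real t2 * exp (\<epsilon> * real (card X))" by linarith
 qed
qed

section \<open>The Laurent polynomial ring\<close>

definition res :: "nat \<Rightarrow> mon \<Rightarrow> nat \<Rightarrow> int" where
 "res n k = restrict (lookup k) {..<n}"

text \<open>Transfer from \<open>lp\<close> to the ring record of the statement. Variables from
  \<open>n\<close> on are specialized to 1, so this is a homomorphism on all of \<open>lp\<close>
  but injective only on \<open>Rn n\<close>.\<close>

definition emb :: "nat \<Rightarrow> lp \<Rightarrow> (nat \<Rightarrow> int) \<Rightarrow>\<^sub>0 int" where
 "emb n = frag_extend (\<lambda>k. frag_of (res n k))"

lemma carrier_int_lattice: "carrier (int_lattice n) = {..<n} \<rightarrow>\<^sub>E UNIV"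
 by (simp add: int_lattice_def)

lemma mult_int_lattice: "x \<otimes>\<^bsub>int_lattice n\<^esub> y = (\<lambda>i\<in>{..<n}. x i + y i)"
 by (simp add: int_lattice_def)

lemma one_int_lattice: "\<one>\<^bsub>int_lattice n\<^esub> = (\<lambda>i\<in>{..<n}. 0)"
 by (simp add: int_lattice_def)

lemma group_int_lattice: "group (int_lattice n)"
 by (simp add: int_lattice_def)

lemma comm_int_lattice: "comm_group (int_lattice n)"
 by (rule group.group_comm_groupI[OF group_int_lattice]) (simp add: mult_int_lattice add.commute)

lemma res_carrier: "res n k \<in> carrier (int_lattice n)"
 by (simp add: res_def carrier_int_lattice)

lemma res_add: "res n (k + l) = res n k \<otimes>\<^bsub>int_lattice n\<^esub> res n l"
 by (auto simp: res_def mult_int_lattice lookup_add fun_eq_iff)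

lemma res_0: "res n 0 = \<one>\<^bsub>int_lattice n\<^esub>"
 by (auto simp: res_def one_int_lattice fun_eq_iff)

lemma res_mkmon: "x \<in> carrier (int_lattice n) \<Longrightarrow> res n (mkmon n x) = x"
 by (auto simp: res_def carrier_int_lattice lookup_mkmon fun_eq_iff PiE_def extensional_def)

lemma mkmon_res: "keys k \<subseteq> {..<n} \<Longrightarrow> mkmon n (res n k) = k"
 by (rule poly_mapping_eqI) (auto simp: res_def lookup_mkmon in_keys_iff)

lemma laurent_ring_simps:
 "carrier (laurent_ring n) = {r. keys r \<subseteq> carrier (int_lattice n)}"
 "a \<oplus>\<^bsub>laurent_ring n\<^esub> b = a + b" "\<zero>\<^bsub>laurent_ring n\<^esub> = 0" "\<one>\<^bsub>laurent_ring n\<^esub> = frag_of \<one>\<^bsub>int_lattice n\<^esub>"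
 "a \<otimes>\<^bsub>laurent_ring n\<^esub> b = frag_extend (\<lambda>x. frag_extend (\<lambda>y. frag_of (x \<otimes>\<^bsub>int_lattice n\<^esub> y)) b) a"
 by (auto simp: laurent_ring_def group_ring_def)

lemma emb_carrier: "emb n r \<in> carrier (laurent_ring n)"
 unfolding laurent_ring_simps emb_def using keys_frag_extend[of "\<lambda>k. frag_of (res n k)" r] res_carrier by fastforce

lemma emb_frag: "emb n (frag_of k) = frag_of (res n k)"
 by (simp add: emb_def)

lemma emb_diff: "emb n (r - s) = emb n r - emb n s"
 by (simp add: emb_def frag_extend_diff)

lemma emb_0: "emb n 0 = 0"
 by (simp add: emb_def)

lemma emb_add: "emb n (r + s) = emb n r \<oplus>\<^bsub>laurent_ring n\<^esub> emb n s"
 by (simp add: emb_def frag_extend_add laurent_ring_simps)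

lemma emb_1: "emb n 1 = \<one>\<^bsub>laurent_ring n\<^esub>"
 using emb_frag[of n 0] by (simp add: laurent_ring_simps res_0)

lemma emb_mult: "emb n (r * s) = emb n r \<otimes>\<^bsub>laurent_ring n\<^esub> emb n s"
proof (induction r rule: lp_induct)
 case (one k)
 show ?case
  by (induction s rule: lp_induct)
   (simp_all add: emb_0 laurent_ring_simps emb_frag emb_diff right_diff_distrib frag_extend_diff mult_single res_add)
qed (simp_all add: emb_0 laurent_ring_simps emb_diff left_diff_distrib frag_extend_diff)

lemma emb_surj:
 assumes "r \<in> carrier (laurent_ring n)" shows "\<exists>s\<in>Rn n. emb n s = r"
proof -
 have "keys r \<subseteq> carrier (int_lattice n)" using assms by (simp add: laurent_ring_simps)
 then show ?thesis
 proof (induction r rule: frag_induction)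
  case zero
  show ?case by (intro bexI[of _ 0]) (simp_all add: emb_0 sgrp_0[OF sgrp_Rn])
 next
  case (one x)
  then show ?case by (intro bexI[of _ "frag_of (mkmon n x)"]) (simp_all add: emb_frag res_mkmon Rn_frag_of keys_mkmon)
 next
  case (diff a b)
  then obtain s t where "s \<in> Rn n" "emb n s = a" "t \<in> Rn n" "emb n t = b" by blast
  then show ?case by (intro bexI[of _ "s - t"]) (simp_all add: emb_diff sgrp_diff[OF sgrp_Rn])
 qed
qed

lemma emb_inj: assumes "r \<in> Rn n" "s \<in> Rn n" "emb n r = emb n s" shows "r = s"
proof -
 define unemb where "unemb = frag_extend (\<lambda>x. frag_of (mkmon n x) :: lp)"
 have "unemb (emb n r) = r" if "r \<in> Rn n" for r
 proof -
  have "keys r \<subseteq> {k. keys k \<subseteq> {..<n}}" using that by (auto simp: Rn_def)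
  then show ?thesis
   by (induction r rule: frag_induction) (simp_all add: unemb_def emb_0 emb_frag mkmon_res emb_diff frag_extend_diff)
 qed
 then show ?thesis using assms by metis
qed

lemma prime_pullback:
 assumes Q: "primeideal Q (laurent_ring n)" shows "rprime (Rn n) {r\<in>Rn n. emb n r \<in> Q}"
proof -
 interpret primeideal Q "laurent_ring n" by (rule Q)
 have m: "emb n (r - s) \<in> Q" if "emb n r \<in> Q" "emb n s \<in> Q" for r s
 proof -
  have "emb n (- 1 * s) \<in> Q" unfolding emb_mult by (rule I_l_closed[OF that(2) emb_carrier])
  then have "emb n r \<oplus>\<^bsub>laurent_ring n\<^esub> emb n (- 1 * s) \<in> Q" by (rule additive_subgroup.a_closed[OF additive_subgroup_axioms that(1)])
  then show ?thesis by (simp flip: emb_add)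
 qed
 have "rid (Rn n) {r\<in>Rn n. emb n r \<in> Q}"
  unfolding rid_def
 proof (intro conjI ballI sgrpI)
  show "0 \<in> {r\<in>Rn n. emb n r \<in> Q}" using additive_subgroup.zero_closed[OF additive_subgroup_axioms] sgrp_0[OF sgrp_Rn] by (simp add: emb_0 laurent_ring_simps)
  show "s * x \<in> {r\<in>Rn n. emb n r \<in> Q}" if "s \<in> Rn n" "x \<in> {r\<in>Rn n. emb n r \<in> Q}" for s x
   using that I_l_closed[OF _ emb_carrier, of "emb n x"] by (simp add: emb_mult Rn_mult)
  show "x - y \<in> {r\<in>Rn n. emb n r \<in> Q}" if "x \<in> {r\<in>Rn n. emb n r \<in> Q}" "y \<in> {r\<in>Rn n. emb n r \<in> Q}" for x y
   using that m sgrp_diff[OF sgrp_Rn] by simp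
 qed simp
 moreover have "1 \<notin> {r\<in>Rn n. emb n r \<in> Q}" using one_imp_carrier I_notcarr by (auto simp: emb_1)
 moreover have "a \<in> {r\<in>Rn n. emb n r \<in> Q} \<or> b \<in> {r\<in>Rn n. emb n r \<in> Q}"
  if "a \<in> Rn n" "b \<in> Rn n" "a * b \<in> {r\<in>Rn n. emb n r \<in> Q}" for a b
  using that I_prime[OF emb_carrier emb_carrier, of a b] by (simp add: emb_mult)
 ultimately show ?thesis unfolding rprime_def using Rn_1 by blast
qed

lemma emb_image_iff: "P \<subseteq> Rn n \<Longrightarrow> r \<in> Rn n \<Longrightarrow> emb n r \<in> emb n ` P \<longleftrightarrow> r \<in> P"
 by (auto dest: emb_inj[rotated 2])

lemma prime_push:
 assumes R: "cring (laurent_ring n)" and P: "rprime (Rn n) P" shows "primeideal (emb n ` P) (laurent_ring n)"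
proof -
 let ?R = "laurent_ring n"
 interpret cring ?R by (rule R)
 have rP: "rid (Rn n) P" by (rule rprime_rid[OF P])
 have PR: "P \<subseteq> Rn n" by (rule rid_subset[OF rP])
 show ?thesis
 proof (rule primeidealI[OF idealI[OF ring_axioms] R])
  show "subgroup (emb n ` P) (add_monoid ?R)"
  proof (rule group.subgroupI[OF a_group])
   show "emb n ` P \<subseteq> carrier (add_monoid ?R)" using emb_carrier by auto
   show "emb n ` P \<noteq> {}" using sgrp_0[OF rid_sgrp[OF rP]] by blast
   fix x assume "x \<in> emb n ` P"
   then obtain r where r: "r \<in> P" "x = emb n r" by blast
   have "emb n (- r) \<oplus>\<^bsub>?R\<^esub> emb n r = \<zero>\<^bsub>?R\<^esub>" using emb_diff[of n 0 r] by (simp add: laurent_ring_simps emb_0)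
   then have e: "\<ominus>\<^bsub>?R\<^esub> emb n r = emb n (- r)" by (intro minus_equality emb_carrier)
   show "inv\<^bsub>add_monoid ?R\<^esub> x \<in> emb n ` P"
    unfolding r(2) a_inv_def[symmetric] e using sgrp_minus[OF rid_sgrp[OF rP] r(1)] by (rule imageI)
   fix y assume "y \<in> emb n ` P"
   then obtain s where "s \<in> P" "y = emb n s" by blast
   then show "x \<otimes>\<^bsub>add_monoid ?R\<^esub> y \<in> emb n ` P" using r sgrp_add[OF rid_sgrp[OF rP]]
    by (intro image_eqI[of _ _ "r + s"]) (simp_all add: emb_add)
  qed
  have l: "x \<otimes>\<^bsub>?R\<^esub> a \<in> emb n ` P" if ax: "a \<in> emb n ` P" "x \<in> carrier ?R" for a x
  proof -
   obtain r where r: "r \<in> P" "a = emb n r" using ax(1) by blast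
   obtain s where s: "s \<in> Rn n" "emb n s = x" using emb_surj[OF ax(2)] by blast
   show ?thesis using rid_mult[OF rP s(1) r(1)] s r by (intro image_eqI[of _ _ "s * r"]) (simp_all add: emb_mult)
  qed
  then show "x \<otimes>\<^bsub>?R\<^esub> a \<in> emb n ` P" if "a \<in> emb n ` P" "x \<in> carrier ?R" for a x using that by blast
  show "a \<otimes>\<^bsub>?R\<^esub> x \<in> emb n ` P" if "a \<in> emb n ` P" "x \<in> carrier ?R" for a x
  proof -
   have "a \<in> carrier ?R" using that(1) emb_carrier by blast
   then show ?thesis using l[OF that] m_comm[of a x] that(2) by simp
  qed
  show "carrier ?R \<noteq> emb n ` P"
  proof
   assume "carrier ?R = emb n ` P"
   then have "emb n 1 \<in> emb n ` P" using emb_carrier by blast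
   then show False using emb_image_iff[OF PR Rn_1] rprime_1[OF P] by simp
  qed
  fix a b assume "a \<in> carrier ?R" "b \<in> carrier ?R" and ab: "a \<otimes>\<^bsub>?R\<^esub> b \<in> emb n ` P"
  then obtain r s where r: "r \<in> Rn n" "emb n r = a" "s \<in> Rn n" "emb n s = b" using emb_surj by meson
  then have "r * s \<in> P" using emb_image_iff[OF PR Rn_mult[of r n s]] ab by (simp add: emb_mult)
  then show "a \<in> emb n ` P \<or> b \<in> emb n ` P" using rprime_mult[OF P r(1,3)] r by blast
 qed
qed

text \<open>The zero ideal and \<open>P\<close> give a chain of length 1. In a longer chain, the
  prime below the top pulls back to a prime strictly inside \<open>P\<close>, hence to {0}, and the
  one below that would be properly contained in {0}.\<close>

lemma prime_height_ht1:
 assumes R: "cring (laurent_ring n)" and P: "ht1 (Rn n) P" shows "prime_height (laurent_ring n) (emb n ` P) = 1"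
proof -
 let ?R = "laurent_ring n"
 have pP: "rprime (Rn n) P" using P by (simp add: ht1_def)
 have PR: "P \<subseteq> Rn n" by (rule rid_subset[OF rprime_rid[OF pP]])
 let ?H = "{enat k |k. \<exists>Q. (\<forall>i\<le>k. primeideal (Q i) ?R) \<and> (\<forall>i<k. Q i \<subset> Q (Suc i)) \<and> Q k = emb n ` P}"
 have le: "k \<le> 1" if Q: "\<forall>i\<le>k. primeideal (Q i) ?R" "\<forall>i<k. Q i \<subset> Q (Suc i)" "Q k = emb n ` P" for k :: nat and Q
 proof (rule ccontr)
  assume "\<not> k \<le> 1"
  then have "k = Suc (Suc (k - 2))" by simp
  then obtain j where j: "k = Suc (Suc j)" by blast
  define Q0 where "Q0 = (\<lambda>i. {r\<in>Rn n. emb n r \<in> Q i})"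
  have pr: "rprime (Rn n) (Q0 i)" if "i \<le> k" for i unfolding Q0_def using Q(1) that by (intro prime_pullback) blast
  have st: "Q0 i \<subset> Q0 (Suc i)" if "i < k" for i
  proof -
   have s: "Q i \<subset> Q (Suc i)" using Q(2) that by blast
   then obtain x where x: "x \<in> Q (Suc i)" "x \<notin> Q i" by blast
   have pq: "primeideal (Q (Suc i)) ?R" using Q(1) that by simp
   then interpret I: primeideal "Q (Suc i)" ?R .
   obtain r where "r \<in> Rn n" "emb n r = x" using emb_surj[OF I.Icarr[OF x(1)]] by blast
   then have "r \<in> Q0 (Suc i)" "r \<notin> Q0 i" using x by (simp_all add: Q0_def)
   moreover have "Q0 i \<subseteq> Q0 (Suc i)" using s by (auto simp: Q0_def)
   ultimately show ?thesis by blast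
  qed
  have "Q0 k = P" unfolding Q0_def Q(3) using emb_image_iff[OF PR] PR by blast
  then have "Q0 (Suc j) \<subset> P" using st[of "Suc j"] j by simp
  then have "Q0 (Suc j) = {0}" using P pr[of "Suc j"] j unfolding ht1_def by simp
  then have "Q0 j \<subset> {0}" using st[of j] j by simp
  moreover have "0 \<in> Q0 j" using sgrp_0[OF rid_sgrp[OF rprime_rid[OF pr[of j]]]] j by simp
  ultimately show False by blast
 qed
 have "{0} \<noteq> Rn n" using Rn_1[of n] by (metis singletonD zero_neq_one)
 then have "rprime (Rn n) {0}"
  unfolding rprime_def rid_def by (auto intro!: sgrpI simp: sgrp_0[OF sgrp_Rn])
 then have p0: "primeideal (emb n ` {0}) ?R" by (rule prime_push[OF R])
 have p1: "primeideal (emb n ` P) ?R" by (rule prime_push[OF R pP])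
 have "{0} \<subset> P" using P sgrp_0[OF rid_sgrp[OF rprime_rid[OF pP]]] by (auto simp: ht1_def)
 then have "emb n ` {0} \<subseteq> emb n ` P" and "\<exists>x\<in>P. x \<noteq> 0" by blast+
 moreover from this obtain x where x: "x \<in> P" "x \<noteq> 0" by blast
 have "emb n x \<notin> emb n ` {0}" using emb_inj[of x n 0] x PR sgrp_0[OF sgrp_Rn] by auto
 ultimately have s: "emb n ` {0} \<subset> emb n ` P" using x by blast
 have "enat 1 \<in> ?H"
  by (intro CollectI exI[of _ 1] exI[of _ "\<lambda>i. if i = 0 then emb n ` {0} else emb n ` P"] conjI) (use p0 p1 s in auto)
 then have "1 \<le> prime_height ?R (emb n ` P)" unfolding prime_height_def by (intro Sup_upper) (simp add: one_enat_def)
 moreover have "prime_height ?R (emb n ` P) \<le> 1" unfolding prime_height_def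
  by (rule Sup_least) (use le in \<open>auto simp: one_enat_def\<close>)
 ultimately show ?thesis by (rule antisym[rotated])
qed

text \<open>In the localization x/1 equals 0/1. The scalars 1 and the zero stay unsimplified because
  \<open>N\<close> is also applied to the cokernel record, for which only the raw operations are at
  hand.\<close>

lemma pseudo_zero_kill:
 assumes N: "pseudo_zero R N" and P: "primeideal P R" "prime_height R P = 1" and R: "cring R"
  and x: "x \<in> carrier N" "\<zero>\<^bsub>N\<^esub> \<in> carrier N"
 shows "\<exists>u\<in>carrier R - P. u \<odot>\<^bsub>N\<^esub> (\<one>\<^bsub>R\<^esub> \<odot>\<^bsub>N\<^esub> \<zero>\<^bsub>N\<^esub>) = u \<odot>\<^bsub>N\<^esub> (\<one>\<^bsub>R\<^esub> \<odot>\<^bsub>N\<^esub> x)"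
proof -
 interpret primeideal P R by (rule P(1))
 let ?S = "carrier R - P"
 let ?r = "fraction_rel R ?S N"
 have 1: "\<one>\<^bsub>R\<^esub> \<in> ?S" using one_imp_carrier I_notcarr by auto
 have "carrier (localization_at R P N) = {\<zero>\<^bsub>localization_at R P N\<^esub>}" using N P unfolding pseudo_zero_def by blast
 then have c: "(carrier N \<times> ?S) // ?r = {?r `` {(\<zero>\<^bsub>N\<^esub>, \<one>\<^bsub>R\<^esub>)}}"
  by (simp add: localization_at_def localization_def fraction_def)
 have "?r `` {(x, \<one>\<^bsub>R\<^esub>)} \<in> (carrier N \<times> ?S) // ?r" by (rule quotientI) (use x 1 in simp)
 then have e: "?r `` {(x, \<one>\<^bsub>R\<^esub>)} = ?r `` {(\<zero>\<^bsub>N\<^esub>, \<one>\<^bsub>R\<^esub>)}" unfolding c by simp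
 have "(x, \<one>\<^bsub>R\<^esub>) \<in> ?r `` {(x, \<one>\<^bsub>R\<^esub>)}" using x 1 by (auto simp: fraction_rel_def)
 then have "((\<zero>\<^bsub>N\<^esub>, \<one>\<^bsub>R\<^esub>), (x, \<one>\<^bsub>R\<^esub>)) \<in> ?r" unfolding e by simp
 then show ?thesis by (auto simp: fraction_rel_def)
qed

section \<open>Presentations of finitely generated modules\<close>

text \<open>The linear combination of the generators \<open>m 0\<close>, ...,
  \<open>m (q - 1)\<close> with coefficients \<open>x\<close>; its kernel is the module of
  relations.\<close>

primrec ev :: "nat \<Rightarrow> ((nat \<Rightarrow> int) \<Rightarrow>\<^sub>0 int, 'a, 'm) module_scheme \<Rightarrow> (nat \<Rightarrow> 'a) \<Rightarrow> nat \<Rightarrow> (nat \<Rightarrow> lp) \<Rightarrow> 'a" where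
 "ev n M m 0 x = \<zero>\<^bsub>M\<^esub>"
| "ev n M m (Suc k) x = ev n M m k x \<oplus>\<^bsub>M\<^esub> emb n (x k) \<odot>\<^bsub>M\<^esub> m k"

definition rels :: "nat \<Rightarrow> ((nat \<Rightarrow> int) \<Rightarrow>\<^sub>0 int, 'a, 'm) module_scheme \<Rightarrow> (nat \<Rightarrow> 'a) \<Rightarrow> nat \<Rightarrow> (nat \<Rightarrow> lp) set" where
 "rels n M m q = {x\<in>tup (Rn n) q. ev n M m q x = \<zero>\<^bsub>M\<^esub>}"

lemma ev_cong: "(\<And>i. i < q \<Longrightarrow> x i = y i) \<Longrightarrow> ev n M m q x = ev n M m q y"
 by (induction q) auto

locale laurent_module = module "laurent_ring n" M for n and M :: "((nat \<Rightarrow> int) \<Rightarrow>\<^sub>0 int, 'a, 'm) module_scheme" (structure)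
begin

lemma zero_smult: "x \<in> carrier M \<Longrightarrow> 0 \<odot>\<^bsub>M\<^esub> x = \<zero>\<^bsub>M\<^esub>"
 using smult_l_null[of x] by (simp add: laurent_ring_simps)

lemma ev_closed: "\<forall>i<q. m i \<in> carrier M \<Longrightarrow> ev n M m q x \<in> carrier M"
 by (induction q) (simp_all add: emb_carrier)

lemma ev_add: "\<forall>i<q. m i \<in> carrier M \<Longrightarrow> ev n M m q (x + y) = ev n M m q x \<oplus>\<^bsub>M\<^esub> ev n M m q y"
proof (induction q)
 case (Suc q)
 then show ?case by (simp add: fun_apply emb_add smult_l_distr emb_carrier ev_closed M.a_ac)
qed simp

lemma ev_scale: "\<forall>i<q. m i \<in> carrier M \<Longrightarrow> ev n M m q (\<lambda>i. s * x i) = emb n s \<odot>\<^bsub>M\<^esub> ev n M m q x"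
proof (induction q)
 case (Suc q)
 then show ?case by (simp add: emb_mult smult_assoc1 smult_r_distr emb_carrier ev_closed)
qed (simp add: emb_carrier)

lemma ev_zero: "\<forall>i<q. m i \<in> carrier M \<Longrightarrow> ev n M m q 0 = \<zero>\<^bsub>M\<^esub>"
 by (induction q) (simp_all add: fun_apply emb_0 zero_smult)

lemma ev_diff_iff:
 assumes m: "\<forall>i<q. m i \<in> carrier M" shows "ev n M m q (x - y) = \<zero>\<^bsub>M\<^esub> \<longleftrightarrow> ev n M m q x = ev n M m q y"
proof -
 have "ev n M m q x = ev n M m q (x - y) \<oplus>\<^bsub>M\<^esub> ev n M m q y" using ev_add[OF m, of "x - y" y] by simp
 then show ?thesis using ev_closed[OF m, of "x - y"] ev_closed[OF m, of y] by (auto simp: M.add.r_cancel_one)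
qed

lemma ev_unit: "\<forall>i<q. m i \<in> carrier M \<Longrightarrow> ev n M m q (unit_tup k) = (if k < q then m k else \<zero>\<^bsub>M\<^esub>)"
proof (induction q)
 case (Suc q)
 have "emb n (unit_tup k q) \<odot>\<^bsub>M\<^esub> m q = (if k = q then m q else \<zero>\<^bsub>M\<^esub>)" using Suc.prems
  by (simp add: unit_tup_def emb_1 emb_0 zero_smult)
 then show ?case using Suc by (auto simp: less_Suc_eq)
qed simp

lemma smod_rels: assumes m: "\<forall>i<q. m i \<in> carrier M" shows "smod (Rn n) (rels n M m q)"
 unfolding smod_def
proof (intro conjI ballI sgrpI)
 note T = smod_tup[OF subr_Rn, of n q]
 show "0 \<in> rels n M m q" using ev_zero[OF m] sgrp_0[OF smod_sgrp[OF T]] by (simp add: rels_def)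
 show "x - y \<in> rels n M m q" if "x \<in> rels n M m q" "y \<in> rels n M m q" for x y
  using that sgrp_diff[OF smod_sgrp[OF T]] ev_diff_iff[OF m] by (simp add: rels_def)
 show "(\<lambda>i. s * x i) \<in> rels n M m q" if "s \<in> Rn n" "x \<in> rels n M m q" for s x
  using that smod_scale[OF T] ev_scale[OF m] emb_carrier by (simp add: rels_def)
qed

lemma rels_presents:
 assumes m: "\<forall>i<q. m i \<in> carrier M" shows "\<exists>p b. presents (Rn n) q (rels n M m q) p b"
proof -
 have t: "rels n M m q \<subseteq> tup (Rn n) q" by (auto simp: rels_def)
 obtain p :: nat and b where "\<And>j. j < p \<Longrightarrow> (\<lambda>i. b i j) \<in> rels n M m q"
  "\<And>x. x \<in> rels n M m q \<Longrightarrow> \<exists>c. (\<forall>j<p. c j \<in> Rn n) \<and> x = (\<lambda>i. \<Sum>j<p. b i j * c j)"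
  by (rule smod_presentation[OF subr_Rn noeth_Rn smod_rels[OF m] t]) blast+
 then have "presents (Rn n) q (rels n M m q) p b" unfolding presents_def using smod_rels[OF m] t by simp
 then show ?thesis by blast
qed

lemma generators:
 assumes "finitely_generated (laurent_ring n) M"
 obtains q :: nat and m where "\<forall>i<q. m i \<in> carrier M" "carrier M = ev n M m q ` tup (Rn n) q"
proof -
 obtain A where A: "finite A" "A \<subseteq> carrier M" "\<Inter>{H. submodule H (laurent_ring n) M \<and> A \<subseteq> H} = carrier M"
  using assms unfolding finitely_generated_def by blast
 obtain m where mb: "bij_betw m {..<card A} A" using ex_bij_betw_nat_finite[OF A(1)] by (auto simp: lessThan_atLeast0)
 have m: "\<forall>i<card A. m i \<in> carrier M" using mb A(2) by (auto simp: bij_betw_def)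
 let ?q = "card A"
 let ?H = "ev n M m ?q ` tup (Rn n) ?q"
 note T = smod_tup[OF subr_Rn, of n ?q]
 have "submodule ?H (laurent_ring n) M"
 proof (rule submoduleI)
  show "?H \<subseteq> carrier M" using ev_closed[OF m] by blast
  show "\<zero>\<^bsub>M\<^esub> \<in> ?H" using ev_zero[OF m] sgrp_0[OF smod_sgrp[OF T]] by (intro image_eqI[of _ _ 0]) simp_all
  show "x \<oplus>\<^bsub>M\<^esub> y \<in> ?H" if xy: "x \<in> ?H" "y \<in> ?H" for x y
  proof -
   obtain u v where "u \<in> tup (Rn n) ?q" "x = ev n M m ?q u" "v \<in> tup (Rn n) ?q" "y = ev n M m ?q v" using xy by blast
   then show ?thesis using ev_add[OF m] sgrp_add[OF smod_sgrp[OF T]] by (intro image_eqI[of _ _ "u + v"]) simp_all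
  qed
  show s: "r \<odot>\<^bsub>M\<^esub> x \<in> ?H" if r: "r \<in> carrier (laurent_ring n)" "x \<in> ?H" for r x
  proof -
   obtain u where u: "u \<in> tup (Rn n) ?q" "x = ev n M m ?q u" using r by blast
   obtain s where s: "s \<in> Rn n" "emb n s = r" using emb_surj[OF r(1)] by blast
   show ?thesis using ev_scale[OF m] smod_scale[OF T s(1) u(1)] s u by (intro image_eqI[of _ _ "\<lambda>i. s * u i"]) simp_all
  qed
  show "\<ominus>\<^bsub>M\<^esub> x \<in> ?H" if x: "x \<in> ?H" for x
  proof -
   have "x \<in> carrier M" using x ev_closed[OF m] by blast
   then have "\<ominus>\<^bsub>M\<^esub> x = (\<ominus>\<^bsub>laurent_ring n\<^esub> \<one>\<^bsub>laurent_ring n\<^esub>) \<odot>\<^bsub>M\<^esub> x" by (simp add: smult_l_minus)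
   then show ?thesis using s[OF _ x] by simp
  qed
 qed
 moreover have "A \<subseteq> ?H"
 proof
  fix x assume "x \<in> A"
  then obtain k where k: "k < ?q" "x = m k" using mb by (auto simp: bij_betw_def)
  then show "x \<in> ?H" using ev_unit[of ?q m k, OF m] unit_tup_in[OF subr_Rn k(1)] by (intro image_eqI[of _ _ "unit_tup k"]) simp_all
 qed
 ultimately have "carrier M \<subseteq> ?H" using A(3) by blast
 moreover have "?H \<subseteq> carrier M" using ev_closed[OF m] by blast
 ultimately have "carrier M = ?H" by (rule antisym)
 with m show thesis by (rule that)
qed

end

lemma hom_ev:
 assumes h: "h \<in> module_homs (laurent_ring n) M1 M2" and M: "laurent_module n M1" "laurent_module n M2"
  and m: "\<forall>i<q. m i \<in> carrier M1"
 shows "h (ev n M1 m q x) = ev n M2 (h \<circ> m) q x"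
 using m
proof (induction q)
 interpret M1: laurent_module n M1 by (rule M)
 interpret M2: laurent_module n M2 by (rule M)
 have hc: "h z \<in> carrier M2" if "z \<in> carrier M1" for z using h that by (auto simp: module_homs_def)
 case 0
 have "h (\<zero>\<^bsub>laurent_ring n\<^esub> \<odot>\<^bsub>M1\<^esub> \<zero>\<^bsub>M1\<^esub>) = \<zero>\<^bsub>laurent_ring n\<^esub> \<odot>\<^bsub>M2\<^esub> h \<zero>\<^bsub>M1\<^esub>"
  using h M1.zero_closed M1.R.zero_closed unfolding module_homs_def by blast
 then show ?case using hc[of "\<zero>\<^bsub>M1\<^esub>"] by simp
next
 interpret M1: laurent_module n M1 by (rule M)
 case (Suc q)
 then show ?case using h M1.ev_closed[of q m x] emb_carrier[of n "x q"] by (simp add: module_homs_def)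
qed

lemma ev_matrix:
 assumes M: "laurent_module n M" and m: "\<forall>i<q2. m i \<in> carrier M"
 shows "ev n M (\<lambda>j. ev n M m q2 (\<lambda>i. a i j)) q1 x = ev n M m q2 (mv q2 q1 a x)"
proof (induction q1)
 interpret laurent_module n M by (rule M)
 case 0
 have "mv q2 0 a x = 0" by (auto simp: mv_def fun_apply)
 then show ?case using ev_zero[OF m] by simp
next
 interpret laurent_module n M by (rule M)
 case (Suc k)
 have "ev n M m q2 (mv q2 (Suc k) a x) = ev n M m q2 (mv q2 k a x + (\<lambda>i. x k * a i k))"
  by (rule ev_cong) (simp add: mv_def fun_apply mult.commute)
 also have "\<dots> = ev n M m q2 (mv q2 k a x) \<oplus>\<^bsub>M\<^esub> emb n (x k) \<odot>\<^bsub>M\<^esub> ev n M m q2 (\<lambda>i. a i k)"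
  by (simp add: ev_add[OF m] ev_scale[OF m])
 finally show ?case using Suc by simp
qed

lemma cokernel_kill:
 assumes M: "laurent_module n M1" "laurent_module n M2" and h: "h \<in> module_homs (laurent_ring n) M1 M2"
  and pz: "pseudo_zero (laurent_ring n) (cokernel_module M1 M2 h)"
  and P: "primeideal P (laurent_ring n)" "prime_height (laurent_ring n) P = 1" and y: "y \<in> carrier M2"
 shows "\<exists>u\<in>carrier (laurent_ring n) - P. u \<odot>\<^bsub>M2\<^esub> y \<in> h ` carrier M1"
proof -
 let ?R = "laurent_ring n"
 interpret M1: laurent_module n M1 by (rule M)
 interpret M2: laurent_module n M2 by (rule M)
 let ?H = "h ` carrier M1"
 let ?N = "cokernel_module M1 M2 h"
 have hc: "h z \<in> carrier M2" if "z \<in> carrier M1" for z using h that by (auto simp: module_homs_def)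
 have h0: "h \<zero>\<^bsub>M1\<^esub> = \<zero>\<^bsub>M2\<^esub>" using hom_ev[OF h M, of 0] by simp
 have H0: "\<zero>\<^bsub>M2\<^esub> \<in> ?H" by (rule image_eqI[of _ _ "\<zero>\<^bsub>M1\<^esub>"]) (simp_all add: h0)
 have Ha: "a \<oplus>\<^bsub>M2\<^esub> b \<in> ?H" if ab: "a \<in> ?H" "b \<in> ?H" for a b
 proof -
  obtain u v where "u \<in> carrier M1" "v \<in> carrier M1" "a = h u" "b = h v" using ab by blast
  then show ?thesis using h by (intro image_eqI[of _ _ "u \<oplus>\<^bsub>M1\<^esub> v"]) (simp_all add: module_homs_def)
 qed
 have Hs: "r \<odot>\<^bsub>M2\<^esub> a \<in> ?H" if ra: "r \<in> carrier ?R" "a \<in> ?H" for r a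
 proof -
  obtain u where "u \<in> carrier M1" "a = h u" using ra by blast
  then show ?thesis using h ra(1) by (intro image_eqI[of _ _ "r \<odot>\<^bsub>M1\<^esub> u"]) (simp_all add: module_homs_def)
 qed
 have cos: "?H +>\<^bsub>M2\<^esub> z = {k \<oplus>\<^bsub>M2\<^esub> z | k. k \<in> ?H}" for z by (auto simp: a_r_coset_def')
 have carr: "carrier ?N = {?H +>\<^bsub>M2\<^esub> z | z. z \<in> carrier M2}"
  by (auto simp: cokernel_module_def quotient_module_def A_RCOSETS_def')
 have zN: "\<zero>\<^bsub>?N\<^esub> = ?H" by (simp add: cokernel_module_def quotient_module_def)
 have sm: "r \<odot>\<^bsub>?N\<^esub> C = (\<Union>x\<in>C. ?H +>\<^bsub>M2\<^esub> (r \<odot>\<^bsub>M2\<^esub> x))" for r C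
  by (simp add: cokernel_module_def quotient_module_def)
 have self: "z \<in> ?H +>\<^bsub>M2\<^esub> z" if "z \<in> carrier M2" for z
  unfolding cos using H0 that by (intro CollectI exI[of _ "\<zero>\<^bsub>M2\<^esub>"]) simp
 have "?H +>\<^bsub>M2\<^esub> \<zero>\<^bsub>M2\<^esub> = ?H"
 proof -
  have "k \<oplus>\<^bsub>M2\<^esub> \<zero>\<^bsub>M2\<^esub> = k" if "k \<in> ?H" for k using that hc by auto
  then show ?thesis unfolding cos by force
 qed
 then have "?H \<in> carrier ?N" unfolding carr using M2.zero_closed by blast
 then have "\<exists>u\<in>carrier ?R - P. u \<odot>\<^bsub>?N\<^esub> (\<one>\<^bsub>?R\<^esub> \<odot>\<^bsub>?N\<^esub> \<zero>\<^bsub>?N\<^esub>) = u \<odot>\<^bsub>?N\<^esub> (\<one>\<^bsub>?R\<^esub> \<odot>\<^bsub>?N\<^esub> (?H +>\<^bsub>M2\<^esub> y))"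
  by (intro pseudo_zero_kill[OF pz P M1.R.is_cring]) (use y in \<open>auto simp: carr zN\<close>)
 then obtain u where u: "u \<in> carrier ?R - P"
  "u \<odot>\<^bsub>?N\<^esub> (\<one>\<^bsub>?R\<^esub> \<odot>\<^bsub>?N\<^esub> ?H) = u \<odot>\<^bsub>?N\<^esub> (\<one>\<^bsub>?R\<^esub> \<odot>\<^bsub>?N\<^esub> (?H +>\<^bsub>M2\<^esub> y))" unfolding zN by (elim bexE)
 have uR: "u \<in> carrier ?R" using u by simp
 have "y \<in> \<one>\<^bsub>?R\<^esub> \<odot>\<^bsub>?N\<^esub> (?H +>\<^bsub>M2\<^esub> y)" unfolding sm
  by (rule UN_I[of y]) (use self[OF y] y in simp_all)
 then have "u \<odot>\<^bsub>M2\<^esub> y \<in> u \<odot>\<^bsub>?N\<^esub> (\<one>\<^bsub>?R\<^esub> \<odot>\<^bsub>?N\<^esub> (?H +>\<^bsub>M2\<^esub> y))" unfolding sm[of u]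
  by (rule UN_I) (rule self[OF M2.smult_closed[OF uR y]])
 then have mem: "u \<odot>\<^bsub>M2\<^esub> y \<in> u \<odot>\<^bsub>?N\<^esub> (\<one>\<^bsub>?R\<^esub> \<odot>\<^bsub>?N\<^esub> ?H)" unfolding u(2) .
 \<comment> \<open>Two containments stand in for the module axioms of the quotient: scalars keep
   subsets of \<open>?H\<close> inside \<open>?H\<close>, and the scaled coset of \<open>y\<close>
   contains the scaled \<open>y\<close>.\<close>
 have sub: "r \<odot>\<^bsub>?N\<^esub> C \<subseteq> ?H" if "r \<in> carrier ?R" "C \<subseteq> ?H" for r C
 proof
  fix w assume "w \<in> r \<odot>\<^bsub>?N\<^esub> C"
  then obtain z where z: "z \<in> C" "w \<in> ?H +>\<^bsub>M2\<^esub> (r \<odot>\<^bsub>M2\<^esub> z)" unfolding sm by (rule UN_E)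
  then obtain k where k: "w = k \<oplus>\<^bsub>M2\<^esub> (r \<odot>\<^bsub>M2\<^esub> z)" "k \<in> ?H" unfolding cos mem_Collect_eq by (elim exE conjE)
  show "w \<in> ?H" unfolding k(1) by (rule Ha[OF k(2) Hs[OF that(1)]]) (use z(1) that(2) in \<open>rule subsetD[rotated]\<close>)
 qed
 have "u \<odot>\<^bsub>?N\<^esub> (\<one>\<^bsub>?R\<^esub> \<odot>\<^bsub>?N\<^esub> ?H) \<subseteq> ?H" by (intro sub uR M1.R.one_closed subset_refl)
 then have "u \<odot>\<^bsub>M2\<^esub> y \<in> ?H" using mem by blast
 then show ?thesis using u(1) by blast
qed

lemma kernel_kill:
 assumes M: "laurent_module n M1" "laurent_module n M2" and h: "h \<in> module_homs (laurent_ring n) M1 M2"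
  and pz: "pseudo_zero (laurent_ring n) (kernel_module M1 M2 h)"
  and P: "primeideal P (laurent_ring n)" "prime_height (laurent_ring n) P = 1" and x: "x \<in> carrier M1" "h x = \<zero>\<^bsub>M2\<^esub>"
 shows "\<exists>u\<in>carrier (laurent_ring n) - P. u \<odot>\<^bsub>M1\<^esub> x = \<zero>\<^bsub>M1\<^esub>"
proof -
 let ?R = "laurent_ring n"
 interpret M1: laurent_module n M1 by (rule M)
 have h0: "h \<zero>\<^bsub>M1\<^esub> = \<zero>\<^bsub>M2\<^esub>" using hom_ev[OF h M, of 0] by simp
 have "\<exists>u\<in>carrier ?R - P. u \<odot>\<^bsub>kernel_module M1 M2 h\<^esub> (\<one>\<^bsub>?R\<^esub> \<odot>\<^bsub>kernel_module M1 M2 h\<^esub> \<zero>\<^bsub>kernel_module M1 M2 h\<^esub>)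
   = u \<odot>\<^bsub>kernel_module M1 M2 h\<^esub> (\<one>\<^bsub>?R\<^esub> \<odot>\<^bsub>kernel_module M1 M2 h\<^esub> x)"
  by (intro pseudo_zero_kill[OF pz P M1.R.is_cring]) (use x h0 in \<open>simp_all add: kernel_module_def a_kernel_def kernel_def\<close>)
 then show ?thesis using x(1) by (auto simp: kernel_module_def)
qed

text \<open>The columns of \<open>a\<close> express the images of the generators of
  \<open>M1\<close> by those of \<open>M2\<close>, so \<open>h\<close> acts on coefficient tuples as
  \<open>mv q2 q1 a\<close>. Denominators found in the ring record outside the image of
  \<open>P\<close> are pulled back along \<open>emb n\<close>.\<close>

theorem pseudo_iso_near_iso:
 assumes M: "laurent_module n M1" "laurent_module n M2" and h: "pseudo_isomorphism (laurent_ring n) M1 M2 h"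
  and m1: "\<forall>i<q1. m1 i \<in> carrier M1" and g1: "carrier M1 = ev n M1 m1 q1 ` tup (Rn n) q1"
  and m2: "\<forall>i<q2. m2 i \<in> carrier M2" and g2: "carrier M2 = ev n M2 m2 q2 ` tup (Rn n) q2"
 shows "\<exists>a. near_iso (Rn n) q1 q2 (rels n M1 m1 q1) (rels n M2 m2 q2) a"
proof -
 let ?R = "laurent_ring n"
 interpret M1: laurent_module n M1 by (rule M)
 interpret M2: laurent_module n M2 by (rule M)
 have hh: "h \<in> module_homs ?R M1 M2" "pseudo_zero ?R (kernel_module M1 M2 h)" "pseudo_zero ?R (cokernel_module M1 M2 h)"
  using h by (auto simp: pseudo_isomorphism_def)
 have hc: "h z \<in> carrier M2" if "z \<in> carrier M1" for z using hh(1) that by (auto simp: module_homs_def)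
 have "\<exists>c. c \<in> tup (Rn n) q2 \<and> ev n M2 m2 q2 c = h (m1 j)" if "j < q1" for j
  using hc[OF m1[rule_format, OF that]] unfolding g2 by force
 then obtain c where c: "\<And>j. j < q1 \<Longrightarrow> c j \<in> tup (Rn n) q2 \<and> ev n M2 m2 q2 (c j) = h (m1 j)" by metis
 define a where "a = (\<lambda>i j. c j i)"
 have hev: "h (ev n M1 m1 q1 x) = ev n M2 m2 q2 (mv q2 q1 a x)" for x :: "nat \<Rightarrow> lp"
 proof -
  have "ev n M2 (h \<circ> m1) k x = ev n M2 (\<lambda>j. ev n M2 m2 q2 (\<lambda>i. a i j)) k x" if "k \<le> q1" for k
   using that by (induction k) (simp_all add: a_def c)
  then show ?thesis using hom_ev[OF hh(1) M m1, of x] ev_matrix[OF M(2) m2, of a q1 x] by simp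
 qed
 have aR: "a i j \<in> Rn n" if "i < q2" "j < q1" for i j using c[OF that(2)] that(1) by (simp add: a_def tup_def)
 have mvt: "mv q2 q1 a x \<in> tup (Rn n) q2" if "x \<in> tup (Rn n) q1" for x by (rule mv_tup[OF subr_Rn aR that])
 have prime: "primeideal (emb n ` P) ?R" "prime_height ?R (emb n ` P) = 1" if "ht1 (Rn n) P" for P
  using prime_push[OF M1.R.is_cring] prime_height_ht1[OF M1.R.is_cring that] that by (simp_all add: ht1_def)
 have pull: "\<exists>r\<in>Rn n - P. u = emb n r" if u: "u \<in> carrier ?R - emb n ` P" for u P
 proof -
  obtain r where "r \<in> Rn n" "emb n r = u" using emb_surj[of u n] u by blast
  then show ?thesis using u by blast
 qed
 have "near_iso (Rn n) q1 q2 (rels n M1 m1 q1) (rels n M2 m2 q2) a"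
 proof (rule near_iso.intro)
  show "subr (Rn n)" "noeth (Rn n)" by (rule subr_Rn, rule noeth_Rn)
  show "smod (Rn n) (rels n M1 m1 q1)" "smod (Rn n) (rels n M2 m2 q2)" using M1.smod_rels[OF m1] M2.smod_rels[OF m2] by blast+
  show "rels n M1 m1 q1 \<subseteq> tup (Rn n) q1" "rels n M2 m2 q2 \<subseteq> tup (Rn n) q2" by (auto simp: rels_def)
  show "a i j \<in> Rn n" if "i < q2" "j < q1" for i j by (rule aR[OF that])
  show "mv q2 q1 a x \<in> rels n M2 m2 q2" if "x \<in> rels n M1 m1 q1" for x
   using that mvt hev[of x] hom_ev[OF hh(1) M, of 0] by (simp add: rels_def)
 next
  fix P x assume P: "ht1 (Rn n) P" and x: "x \<in> tup (Rn n) q1" "mv q2 q1 a x \<in> rels n M2 m2 q2"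
  have "h (ev n M1 m1 q1 x) = \<zero>\<^bsub>M2\<^esub>" using x(2) hev by (simp add: rels_def)
  from kernel_kill[OF M hh(1,2) prime[OF P] M1.ev_closed[OF m1] this]
  obtain u where u: "u \<in> carrier ?R - emb n ` P" "u \<odot>\<^bsub>M1\<^esub> ev n M1 m1 q1 x = \<zero>\<^bsub>M1\<^esub>" by blast
  obtain r where r: "r \<in> Rn n - P" "u = emb n r" using pull[OF u(1)] by blast
  have "(\<lambda>i. r * x i) \<in> rels n M1 m1 q1"
   using u(2) r smod_scale[OF smod_tup[OF subr_Rn] _ x(1)] M1.ev_scale[OF m1] by (simp add: rels_def)
  then show "\<exists>u\<in>Rn n - P. (\<lambda>i. u * x i) \<in> rels n M1 m1 q1" using r(1) by (rule bexI)
 next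
  fix P y assume P: "ht1 (Rn n) P" and y: "y \<in> tup (Rn n) q2"
  from cokernel_kill[OF M hh(1,3) prime[OF P] M2.ev_closed[OF m2, of y]]
  obtain u where u: "u \<in> carrier ?R - emb n ` P" "u \<odot>\<^bsub>M2\<^esub> ev n M2 m2 q2 y \<in> h ` carrier M1" by blast
  obtain r where r: "r \<in> Rn n - P" "u = emb n r" using pull[OF u(1)] by blast
  obtain x where x: "x \<in> tup (Rn n) q1" "u \<odot>\<^bsub>M2\<^esub> ev n M2 m2 q2 y = h (ev n M1 m1 q1 x)" using u(2) unfolding g1 by blast
  have "ev n M2 m2 q2 (\<lambda>i. r * y i) = ev n M2 m2 q2 (mv q2 q1 a x)" using x(2) r M2.ev_scale[OF m2] by (simp add: hev)
  moreover have "(\<lambda>i. r * y i) - mv q2 q1 a x \<in> tup (Rn n) q2"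
   using r by (intro sgrp_diff[OF smod_sgrp[OF smod_tup[OF subr_Rn]]] smod_scale[OF smod_tup[OF subr_Rn]] mvt x y) simp
  ultimately have "(\<lambda>i. r * y i) - mv q2 q1 a x \<in> rels n M2 m2 q2" using M2.ev_diff_iff[OF m2] by (simp add: rels_def)
  then show "\<exists>u\<in>Rn n - P. \<exists>x\<in>tup (Rn n) q1. (\<lambda>i. u * y i) - mv q2 q1 a x \<in> rels n M2 m2 q2"
   using r(1) x(1) by blast
 qed
 then show ?thesis by blast
qed

section \<open>Finite quotients of the lattice\<close>

locale finite_quotient =
 fixes n :: nat and \<Gamma> :: "(nat \<Rightarrow> int) set"
 assumes \<Gamma>: "\<Gamma> \<in> finite_index_subgroups n"
begin

definition X :: "(nat \<Rightarrow> int) set set" where "X = carrier (int_lattice n Mod \<Gamma>)"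

definition pr :: "mon \<Rightarrow> (nat \<Rightarrow> int) set" where "pr k = \<Gamma> #>\<^bsub>int_lattice n\<^esub> res n k"

definition act :: "mon \<Rightarrow> (nat \<Rightarrow> int) set \<Rightarrow> (nat \<Rightarrow> int) set" where
 "act k C = pr k \<otimes>\<^bsub>int_lattice n Mod \<Gamma>\<^esub> C"

abbreviation "N \<equiv> quotient_group_ring_module (int_lattice n) \<Gamma>"

lemma sub: "subgroup \<Gamma> (int_lattice n)" and fin: "finite X"
 using \<Gamma> by (auto simp: finite_index_subgroups_def X_def)

lemma nor: "\<Gamma> \<lhd> int_lattice n"
 by (rule comm_group.subgroup_imp_normal[OF comm_int_lattice sub])

lemma grp: "group (int_lattice n Mod \<Gamma>)"
 by (rule normal.factorgroup_is_group[OF nor])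

lemma pr_X: "pr k \<in> X"
 unfolding pr_def X_def carrier_FactGroup using res_carrier by blast

lemma pr_add: "pr (k + l) = pr k \<otimes>\<^bsub>int_lattice n Mod \<Gamma>\<^esub> pr l"
 unfolding pr_def mult_FactGroup res_add by (rule normal.rcos_sum[OF nor res_carrier res_carrier, symmetric])

lemma pr_0: "pr 0 = \<one>\<^bsub>int_lattice n Mod \<Gamma>\<^esub>"
 unfolding pr_def res_0 one_FactGroup using group.coset_join2[OF group_int_lattice _ sub]
  group.is_monoid[OF group_int_lattice, THEN monoid.one_closed] subgroup.one_closed[OF sub] by blast

lemma pr_surj: assumes "C \<in> X" shows "\<exists>y. keys y \<subseteq> {..<n} \<and> pr y = C"
proof -
 obtain x where "x \<in> carrier (int_lattice n)" "C = \<Gamma> #>\<^bsub>int_lattice n\<^esub> x" using assms unfolding X_def carrier_FactGroup by blast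
 then show ?thesis by (intro exI[of _ "mkmon n x"]) (simp add: keys_mkmon pr_def res_mkmon)
qed

lemma finite_action_quotient: "finite_action X act"
proof
 show "finite X" by (rule fin)
 fix c y z assume c: "c \<in> X"
 show "act y c \<in> X" using monoid.m_closed[OF group.is_monoid[OF grp]] pr_X[of y] c unfolding act_def X_def by blast
 show "act 0 c = c" using monoid.l_one[OF group.is_monoid[OF grp]] c unfolding act_def pr_0 X_def by blast
 show "act (y + z) c = act y (act z c)"
  using monoid.m_assoc[OF group.is_monoid[OF grp]] pr_X[of y] pr_X[of z] c unfolding act_def pr_add X_def by blast
qed

sublocale A: finite_action X act by (rule finite_action_quotient)

lemma act_one: "act y \<one>\<^bsub>int_lattice n Mod \<Gamma>\<^esub> = pr y"
 using monoid.r_one[OF group.is_monoid[OF grp]] pr_X[of y] unfolding act_def X_def by blast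

lemma one_X: "\<one>\<^bsub>int_lattice n Mod \<Gamma>\<^esub> \<in> X"
 using monoid.one_closed[OF group.is_monoid[OF grp]] unfolding X_def .

lemma transitive: "transitive_action X act \<one>\<^bsub>int_lattice n Mod \<Gamma>\<^esub>"
proof
 show "\<one>\<^bsub>int_lattice n Mod \<Gamma>\<^esub> \<in> X" by (rule one_X)
 show "\<exists>y. act y \<one>\<^bsub>int_lattice n Mod \<Gamma>\<^esub> = c" if "c \<in> X" for c using pr_surj[OF that] act_one by auto
qed

sublocale T: transitive_action X act "\<one>\<^bsub>int_lattice n Mod \<Gamma>\<^esub>" by (rule transitive)

lemma reach_quotient: "reach n X act \<one>\<^bsub>int_lattice n Mod \<Gamma>\<^esub>"
 unfolding reach_def act_one using pr_surj by blast

text \<open>\<open>LEAST\<close> over the reals is meaningful only if the minimum is attained.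
  Finitely many lattice vectors are no longer than \<open>x\<close>, and the shortest of those in
  \<Gamma> is shortest overall.\<close>

lemma min_norm_le:
 assumes x: "x \<in> \<Gamma>" "x \<noteq> \<one>\<^bsub>int_lattice n\<^esub>" shows "min_norm n \<Gamma> \<le> lattice_norm n x"
proof -
 let ?D = "\<Gamma> - {\<one>\<^bsub>int_lattice n\<^esub>}"
 define B where "B = {z\<in>?D. lattice_norm n z \<le> lattice_norm n x}"
 have "B \<subseteq> {..<n} \<rightarrow>\<^sub>E {- \<lceil>lattice_norm n x\<rceil>..\<lceil>lattice_norm n x\<rceil>}"
 proof
  fix z assume "z \<in> B"
  then have z: "z \<in> \<Gamma>" "lattice_norm n z \<le> lattice_norm n x" by (auto simp: B_def)
  have "z \<in> {..<n} \<rightarrow>\<^sub>E UNIV" using subgroup.subset[OF sub] z(1) by (auto simp: carrier_int_lattice)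
  moreover have "z i \<in> {- \<lceil>lattice_norm n x\<rceil>..\<lceil>lattice_norm n x\<rceil>}" if "i < n" for i
  proof -
   have "\<bar>real_of_int (z i)\<bar> \<le> lattice_norm n z"
    unfolding lattice_norm_def L2_set_def
    by (rule real_le_rsqrt) (use member_le_sum[of i "{..<n}" "\<lambda>i. (real_of_int (z i))\<^sup>2"] that in simp)
   then have "\<bar>real_of_int (z i)\<bar> \<le> lattice_norm n x" using z(2) by linarith
   then have "real_of_int \<bar>z i\<bar> \<le> real_of_int \<lceil>lattice_norm n x\<rceil>" unfolding of_int_abs using le_of_int_ceiling[of "lattice_norm n x"] by linarith
   then show ?thesis by (simp add: abs_le_iff)
  qed
  ultimately show "z \<in> {..<n} \<rightarrow>\<^sub>E {- \<lceil>lattice_norm n x\<rceil>..\<lceil>lattice_norm n x\<rceil>}" by (simp add: PiE_iff)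
 qed
 then have fB: "finite B" by (rule finite_subset) (intro finite_PiE; simp)
 have xB: "x \<in> B" using x by (simp add: B_def)
 let ?m = "Min (lattice_norm n ` B)"
 have mB: "?m \<in> lattice_norm n ` B" using fB xB by (intro Min_in) auto
 have mx: "?m \<le> lattice_norm n x" using fB xB by (intro Min_le) auto
 have "min_norm n \<Gamma> = ?m"
  unfolding min_norm_def
 proof (rule Least_equality)
  show "?m \<in> lattice_norm n ` ?D" using mB by (auto simp: B_def)
  fix r assume "r \<in> lattice_norm n ` ?D"
  then obtain z where z: "z \<in> ?D" "r = lattice_norm n z" by blast
  show "?m \<le> r"
  proof (cases "z \<in> B")
   case True then show ?thesis using fB z(2) by (intro Min_le) auto
  next
   case False then show ?thesis using mx z by (auto simp: B_def)
  qed
 qed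
 then show ?thesis using mx by simp
qed

text \<open>The factor \<open>n\<close> compares norms: a vector with entries below \<open>L\<close>
  has Euclidean norm below \<open>n * L\<close>, since the norm is at most the sum of absolute
  values. If it fixes the zero class it lies in \<Gamma>, so it is 0.\<close>

lemma spread_quotient: assumes "real n * real_of_int L \<le> min_norm n \<Gamma>" and n: "n \<ge> 1"
 shows "spread n act \<one>\<^bsub>int_lattice n Mod \<Gamma>\<^esub> L"
 unfolding spread_def
proof (intro allI impI)
 fix y :: mon assume y: "keys y \<subseteq> {..<n}" "act y \<one>\<^bsub>int_lattice n Mod \<Gamma>\<^esub> = \<one>\<^bsub>int_lattice n Mod \<Gamma>\<^esub>"
  "\<forall>i<n. \<bar>lookup y i\<bar> < L"
 have "\<Gamma> #>\<^bsub>int_lattice n\<^esub> res n y = \<Gamma>" using y(2) unfolding act_one pr_def by simp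
 then have mem: "res n y \<in> \<Gamma>" by (rule group.coset_join1[OF group_int_lattice _ res_carrier sub])
 have "lattice_norm n (res n y) \<le> (\<Sum>i<n. \<bar>real_of_int (res n y i)\<bar>)"
  unfolding lattice_norm_def by (rule L2_set_le_sum_abs)
 also have "\<dots> < (\<Sum>i<n. real_of_int L)"
 proof (rule sum_strict_mono)
  show "{..<n} \<noteq> {}" using n by (simp add: lessThan_empty_iff)
  fix i assume "i \<in> {..<n}"
  then have "real_of_int \<bar>lookup y i\<bar> < real_of_int L" using y(3) by (simp only: of_int_less_iff) simp
  then show "\<bar>real_of_int (res n y i)\<bar> < real_of_int L" using \<open>i \<in> {..<n}\<close> by (simp add: res_def)
 qed simp
 finally have "lattice_norm n (res n y) < min_norm n \<Gamma>" using assms(1) by simp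
 then have e: "res n y = \<one>\<^bsub>int_lattice n\<^esub>" using min_norm_le[OF mem] by (cases "res n y = \<one>\<^bsub>int_lattice n\<^esub>") simp_all
 show "y = 0"
  using mkmon_res[OF y(1)] unfolding e res_0[symmetric] by (simp add: mkmon_res)
qed

lemma carrier_N: "carrier N = {w. keys w \<subseteq> X}"
 by (auto simp: quotient_group_ring_module_def ring.defs module.defs group_ring_def X_def)

lemma add_N: "v \<oplus>\<^bsub>N\<^esub> w = v + w"
 by (simp add: quotient_group_ring_module_def ring.defs module.defs group_ring_def)

lemma smult_N: "r \<odot>\<^bsub>N\<^esub> w = frag_extend (\<lambda>x. frag_extend (\<lambda>y. frag_of (x \<otimes>\<^bsub>int_lattice n Mod \<Gamma>\<^esub> y)) w) (group_ring_projection (int_lattice n) \<Gamma> r)"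
 by (simp add: quotient_group_ring_module_def ring.defs module.defs group_ring_def)

lemma smult_emb_frag: "emb n (frag_of k) \<odot>\<^bsub>N\<^esub> w = frag_extend (\<lambda>y. frag_of (act k y)) w"
 by (simp add: smult_N emb_frag group_ring_projection_def act_def pr_def)

lemma smult_emb_diff: "emb n (r - s) \<odot>\<^bsub>N\<^esub> w = emb n r \<odot>\<^bsub>N\<^esub> w - emb n s \<odot>\<^bsub>N\<^esub> w"
 by (simp add: smult_N emb_diff group_ring_projection_def frag_extend_diff)

lemma smult_emb_0: "emb n 0 \<odot>\<^bsub>N\<^esub> w = 0"
 by (simp add: smult_N emb_0 group_ring_projection_def)

lemma lookup_frag_unit: "lookup (frag_of c) = unit_fun c"
 by (auto simp: fun_eq_iff unit_fun_def lookup_single when_def)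

lemma lookup_diff_fun: "lookup (v - w) = lookup v - lookup w" for v w :: "'z \<Rightarrow>\<^sub>0 int"
 by (simp add: fun_eq_iff lookup_minus fun_apply)

lemma lookup_0_fun: "lookup (0 :: 'z \<Rightarrow>\<^sub>0 int) = 0"
 by (simp add: fun_eq_iff fun_apply)

text \<open>Links the module structure of the group ring of the quotient with the translation action
  for which all counting was done.\<close>

lemma lookup_smult:
 assumes "w \<in> carrier N" shows "lookup (emb n r \<odot>\<^bsub>N\<^esub> w) = A.opr r (lookup w)"
proof (induction r rule: lp_induct)
 case zero
 show ?case by (simp add: smult_emb_0 lookup_0_fun)
next
 case (one k)
 have "keys w \<subseteq> X" using assms by (simp add: carrier_N)
 then show ?case
 proof (induction w rule: frag_induction)
  case zero
  show ?case by (simp add: smult_emb_frag lookup_0_fun A.opr_linear)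
 next
  case (one c)
  then show ?case by (simp add: smult_emb_frag lookup_frag_unit T.unit_fun_act del: lookup_frag_of)
 next
  case (diff a b)
  then show ?case by (simp add: smult_emb_frag frag_extend_diff lookup_diff_fun A.opr_linear)
 qed
next
 case (diff a b)
 then show ?case by (simp add: smult_emb_diff lookup_diff_fun A.opr_diff)
qed

lemma smult_closed_N: assumes "w \<in> carrier N" shows "emb n r \<odot>\<^bsub>N\<^esub> w \<in> carrier N"
proof -
 have "lookup (emb n r \<odot>\<^bsub>N\<^esub> w) \<in> Zf X" unfolding lookup_smult[OF assms] by (rule A.opr_Zf)
 then show ?thesis by (auto simp: carrier_N Zf_def in_keys_iff)
qed

lemma frag_closed_N: "c \<in> X \<Longrightarrow> frag_of c \<in> carrier N" and zero_closed_N: "0 \<in> carrier N"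
 and diff_closed_N: "v \<in> carrier N \<Longrightarrow> w \<in> carrier N \<Longrightarrow> v - w \<in> carrier N"
 using keys_diff[of v w] by (auto simp: carrier_N)

end

section \<open>Torsion in a quotient of a free abelian group\<close>

text \<open>\<Psi> and \<Theta> induce mutually inverse isomorphisms between the free group modulo
  \<open>H\<close> and \<open>Zf U\<close> modulo \<Lambda>. The torsion subgroup corresponds to
  \<open>sat U \<Lambda>\<close> modulo \<Lambda>.\<close>

lemma card_torsion_quotient:
 fixes H :: "('b \<Rightarrow>\<^sub>0 int) set" and S \<Lambda> :: "('u \<Rightarrow> int) set"
 assumes H: "sgrp H" "H \<subseteq> {c. keys c \<subseteq> B}" and \<Lambda>: "sgrp \<Lambda>" "\<Lambda> \<subseteq> Zf U"
  and t: "has_idx (sat U \<Lambda>) \<Lambda> t"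
  and \<Psi>: "\<And>x y. \<Psi> (x - y) = \<Psi> x - \<Psi> y" "\<And>x. \<Psi> x \<in> Zf U" "\<And>x. x \<in> H \<Longrightarrow> \<Psi> x \<in> \<Lambda>"
  and \<Theta>: "\<And>u v. u \<in> Zf U \<Longrightarrow> v \<in> Zf U \<Longrightarrow> \<Theta> (u - v) = \<Theta> u - \<Theta> v" "\<And>u. u \<in> Zf U \<Longrightarrow> keys (\<Theta> u) \<subseteq> B"
   "\<And>u. u \<in> \<Lambda> \<Longrightarrow> \<Theta> u \<in> H"
  and \<Psi>\<Theta>: "\<And>u. u \<in> Zf U \<Longrightarrow> \<Psi> (\<Theta> u) - u \<in> \<Lambda>" and \<Theta>\<Psi>: "\<And>x. keys x \<subseteq> B \<Longrightarrow> \<Theta> (\<Psi> x) - x \<in> H"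
 shows "card (torsion_subgroup (free_Abelian_group B Mod H)) = t"
proof -
 let ?F = "free_Abelian_group B"
 interpret F: comm_group ?F by (rule abelian_free_Abelian_group)
 have sub: "subgroup H ?F"
 proof (rule F.subgroupI)
  show "H \<subseteq> carrier ?F" using H(2) by auto
  show "H \<noteq> {}" using sgrp_0[OF H(1)] by blast
  show "inv\<^bsub>?F\<^esub> x \<in> H" if "x \<in> H" for x using that H(2) sgrp_minus[OF H(1)] by auto
  show "x \<otimes>\<^bsub>?F\<^esub> y \<in> H" if "x \<in> H" "y \<in> H" for x y using that sgrp_add[OF H(1)] by simp
 qed
 interpret N: normal H ?F by (rule F.subgroup_imp_normal[OF sub])
 have coset_iff: "H #>\<^bsub>?F\<^esub> x = H #>\<^bsub>?F\<^esub> y \<longleftrightarrow> x - y \<in> H" if "x \<in> carrier ?F" "y \<in> carrier ?F" for x y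
 proof
  assume "H #>\<^bsub>?F\<^esub> x = H #>\<^bsub>?F\<^esub> y"
  then have "x \<in> H #>\<^bsub>?F\<^esub> y" using F.rcos_self[OF that(1) sub] by simp
  then obtain h where "h \<in> H" "x = h + y" by (auto simp: r_coset_def)
  then show "x - y \<in> H" by simp
 next
  assume "x - y \<in> H"
  then have "x \<in> H #>\<^bsub>?F\<^esub> y" unfolding r_coset_def by (intro UN_I[of "x - y"]) simp_all
  then show "H #>\<^bsub>?F\<^esub> x = H #>\<^bsub>?F\<^esub> y" using F.repr_independence[OF _ that(2) sub] by simp
 qed
 have pow: "(H #>\<^bsub>?F\<^esub> x) [^]\<^bsub>?F Mod H\<^esub> (k::nat) = H #>\<^bsub>?F\<^esub> frag_cmul (int k) x" if "x \<in> carrier ?F" for x k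
 proof (induction k)
  case 0
  show ?case using F.coset_join2[OF _ sub, of 0] sgrp_0[OF H(1)] by simp
 next
  case (Suc k)
  have "frag_cmul (int k) x \<in> carrier ?F" using that keys_cmul[of "int k" x] by auto
  then have "(H #>\<^bsub>?F\<^esub> frag_cmul (int k) x) <#>\<^bsub>?F\<^esub> (H #>\<^bsub>?F\<^esub> x) = H #>\<^bsub>?F\<^esub> (frag_cmul (int k) x + x)"
   using N.rcos_sum[OF _ that] by simp
  then show ?case using Suc by (simp add: frag_cmul_distrib add.commute)
 qed
 have one: "H #>\<^bsub>?F\<^esub> x = H \<longleftrightarrow> x \<in> H" if "x \<in> carrier ?F" for x
  using F.coset_join1[OF _ that sub] F.coset_join2[OF that sub] by blast
 have tors: "torsion_subgroup (?F Mod H) = (\<lambda>x. H #>\<^bsub>?F\<^esub> x) ` {x. keys x \<subseteq> B \<and> (\<exists>k>0. frag_cmul (int k) x \<in> H)}"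
 proof -
  have "frag_cmul (int k) x \<in> carrier ?F" if "keys x \<subseteq> B" for k x using that keys_cmul[of "int k" x] by auto
  then show ?thesis unfolding torsion_subgroup_def carrier_FactGroup using pow one by (auto intro!: imageI)
 qed
 have scale\<Psi>: "\<Psi> (frag_cmul (int k) x) = int k \<star> \<Psi> x" for k x
 proof (induction k)
  case 0
  show ?case using \<Psi>(1)[of 0 0] by (simp add: fun_eq_iff fun_apply)
 next
  case (Suc k)
  have "\<Psi> (frag_cmul (int k) x) = \<Psi> (frag_cmul (int (Suc k)) x) - \<Psi> x"
   using \<Psi>(1)[of "frag_cmul (int (Suc k)) x" x] by (simp add: frag_cmul_distrib)
  then show ?case using Suc by (simp add: fun_eq_iff fun_apply algebra_simps)
 qed
 have zz: "int k \<star> u \<in> Zf U" if "u \<in> Zf U" for k u using that by (simp add: Zf_def fun_apply)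
 have scale\<Theta>: "\<Theta> (int k \<star> u) = frag_cmul (int k) (\<Theta> u)" if u: "u \<in> Zf U" for k u
 proof (induction k)
  case 0
  have "int 0 \<star> u = u - u" by (simp add: fun_eq_iff fun_apply)
  then show ?case using \<Theta>(1)[OF u u] by simp
 next
  case (Suc k)
  have "int k \<star> u = int (Suc k) \<star> u - u" by (simp add: fun_eq_iff fun_apply algebra_simps)
  then have "\<Theta> (int k \<star> u) = \<Theta> (int (Suc k) \<star> u) - \<Theta> u" using \<Theta>(1)[OF zz[OF u, of "Suc k"] u] by simp
  then show ?case using Suc by (simp add: frag_cmul_distrib algebra_simps)
 qed
 obtain R where R: "R \<subseteq> sat U \<Lambda>" "finite R" "card R = t" "\<forall>h\<in>sat U \<Lambda>. \<exists>r\<in>R. h - r \<in> \<Lambda>" "\<forall>r\<in>R. \<forall>r'\<in>R. r - r' \<in> \<Lambda> \<longrightarrow> r = r'"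
  using t unfolding has_idx_def by (elim exE conjE)
 have RZ: "r \<in> Zf U" if "r \<in> R" for r using R(1) that by (auto simp: sat_def)
 have "bij_betw (\<lambda>r. H #>\<^bsub>?F\<^esub> \<Theta> r) R (torsion_subgroup (?F Mod H))"
  unfolding bij_betw_def tors
 proof (intro conjI inj_onI subset_antisym subsetI)
  fix r r' assume r: "r \<in> R" "r' \<in> R" "H #>\<^bsub>?F\<^esub> \<Theta> r = H #>\<^bsub>?F\<^esub> \<Theta> r'"
  then have "\<Theta> r - \<Theta> r' \<in> H" using coset_iff[of "\<Theta> r" "\<Theta> r'"] \<Theta>(2) RZ by simp
  then have "\<Psi> (\<Theta> r) - \<Psi> (\<Theta> r') \<in> \<Lambda>" using \<Psi>(3) \<Psi>(1) by metis
  then have "(\<Psi> (\<Theta> r) - \<Psi> (\<Theta> r')) - ((\<Psi> (\<Theta> r) - r) - (\<Psi> (\<Theta> r') - r')) \<in> \<Lambda>"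
   by (rule sgrp_diff[OF \<Lambda>(1) _ sgrp_diff[OF \<Lambda>(1) \<Psi>\<Theta>[OF RZ[OF r(1)]] \<Psi>\<Theta>[OF RZ[OF r(2)]]]])
  then have "r - r' \<in> \<Lambda>" by simp
  then show "r = r'" using R(5) r(1,2) by blast
 next
  fix C assume "C \<in> (\<lambda>r. H #>\<^bsub>?F\<^esub> \<Theta> r) ` R"
  then obtain r where r: "r \<in> R" "C = H #>\<^bsub>?F\<^esub> \<Theta> r" by blast
  obtain k where k: "k > 0" "k \<star> r \<in> \<Lambda>" using R(1) r(1) by (auto simp: sat_def)
  have "int (nat k) \<star> r \<in> \<Lambda>" using k by simp
  then have "frag_cmul (int (nat k)) (\<Theta> r) \<in> H" using \<Theta>(3) scale\<Theta>[OF RZ[OF r(1)], of "nat k"] by metis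
  then show "C \<in> (\<lambda>x. H #>\<^bsub>?F\<^esub> x) ` {x. keys x \<subseteq> B \<and> (\<exists>k>0. frag_cmul (int k) x \<in> H)}"
   unfolding r(2) using k(1) \<Theta>(2)[OF RZ[OF r(1)]] by (intro imageI CollectI conjI exI[of _ "nat k"]) simp_all
 next
  fix C assume "C \<in> (\<lambda>x. H #>\<^bsub>?F\<^esub> x) ` {x. keys x \<subseteq> B \<and> (\<exists>k>0. frag_cmul (int k) x \<in> H)}"
  then obtain x k where x: "C = H #>\<^bsub>?F\<^esub> x" "keys x \<subseteq> B" "k > (0::nat)" "frag_cmul (int k) x \<in> H" by blast
  have "int k \<star> \<Psi> x \<in> \<Lambda>" using \<Psi>(3)[OF x(4)] scale\<Psi>[of k x] by simp
  then have "\<Psi> x \<in> sat U \<Lambda>" using \<Psi>(2) x(3) unfolding sat_def by (intro CollectI conjI exI[of _ "int k"]) simp_all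
  then obtain r where r: "r \<in> R" "\<Psi> x - r \<in> \<Lambda>" using R(4) by blast
  have "\<Theta> (\<Psi> x) - \<Theta> r \<in> H" using \<Theta>(3)[OF r(2)] \<Theta>(1)[OF \<Psi>(2) RZ[OF r(1)]] by simp
  from sgrp_diff[OF H(1) this \<Theta>\<Psi>[OF x(2)]] have "x - \<Theta> r \<in> H" by (simp add: algebra_simps)
  then have "C = H #>\<^bsub>?F\<^esub> \<Theta> r" using coset_iff[of x "\<Theta> r"] x(1,2) \<Theta>(2)[OF RZ[OF r(1)]] by simp
  then show "C \<in> (\<lambda>r. H #>\<^bsub>?F\<^esub> \<Theta> r) ` R" using r(1) by blast
 qed
 from bij_betw_same_card[OF this] R(3) show ?thesis by simp
qed

section \<open>The torsion of the tensor product\<close>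

locale tensor_setup = finite_quotient n \<Gamma> + laurent_module n M
 for n \<Gamma> and M :: "((nat \<Rightarrow> int) \<Rightarrow>\<^sub>0 int, 'a) module" +
 fixes m :: "nat \<Rightarrow> 'a" and q p :: nat and b :: "nat \<Rightarrow> nat \<Rightarrow> lp"
 assumes m: "\<forall>i<q. m i \<in> carrier M" and gen: "carrier M = ev n M m q ` tup (Rn n) q"
  and pres: "presents (Rn n) q (rels n M m q) p b"
begin

abbreviation "U \<equiv> {..<q} \<times> X"
abbreviation "Lam \<equiv> mat_image X act q p b"
abbreviation "B \<equiv> carrier M \<times> carrier N"

text \<open>Coordinates of the tensor of \<open>ev n M m q x\<close> with \<open>u\<close>: each
  coefficient \<open>x i\<close> is moved across the tensor sign and acts on \<open>u\<close> in
  copy \<open>i\<close>.\<close>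

definition tens :: "(nat \<Rightarrow> lp) \<Rightarrow> ((nat \<Rightarrow> int) set \<Rightarrow> int) \<Rightarrow> nat \<times> (nat \<Rightarrow> int) set \<Rightarrow> int" where
 "tens x u = (\<lambda>(i, c). if i < q then A.opr (x i) u c else 0)"

text \<open>An arbitrary expression of \<open>z\<close> by the generators. It is neither unique nor
  additive; \<open>tens_cong\<close> absorbs the choice into \<open>Lam\<close>.\<close>

definition sel :: "'a \<Rightarrow> nat \<Rightarrow> lp" where
 "sel z = (SOME x. x \<in> tup (Rn n) q \<and> ev n M m q x = z)"

definition toV :: "(nat \<times> (nat \<Rightarrow> int) set \<Rightarrow> int) \<Rightarrow> (nat \<times> (nat \<Rightarrow> int) set) \<Rightarrow>\<^sub>0 int" where
 "toV u = Abs_poly_mapping u"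

definition psi :: "'a \<times> ((nat \<Rightarrow> int) set \<Rightarrow>\<^sub>0 int) \<Rightarrow> (nat \<times> (nat \<Rightarrow> int) set) \<Rightarrow>\<^sub>0 int" where
 "psi = (\<lambda>(z, w). toV (tens (sel z) (lookup w)))"

definition theta :: "nat \<times> (nat \<Rightarrow> int) set \<Rightarrow> ('a \<times> ((nat \<Rightarrow> int) set \<Rightarrow>\<^sub>0 int)) \<Rightarrow>\<^sub>0 int" where
 "theta = (\<lambda>(i, c). frag_of (m i, frag_of c))"

definition H :: "(('a \<times> ((nat \<Rightarrow> int) set \<Rightarrow>\<^sub>0 int)) \<Rightarrow>\<^sub>0 int) set" where
 "H = generate (free_Abelian_group B) (tensor_relations (laurent_ring n) M N)"

lemma fU: "finite U" using fin by simp

lemma sel: assumes "z \<in> carrier M" shows "sel z \<in> tup (Rn n) q \<and> ev n M m q (sel z) = z"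
proof -
 have "z \<in> ev n M m q ` tup (Rn n) q" using assms unfolding gen .
 then obtain x where x: "z = ev n M m q x" "x \<in> tup (Rn n) q" by (rule imageE)
 show ?thesis unfolding sel_def by (rule someI[of "\<lambda>x. x \<in> tup (Rn n) q \<and> ev n M m q x = z", OF conjI[OF x(2) x(1)[symmetric]]])
qed

lemma tens_mat_op: "tens x u = mat_op X act q 1 (\<lambda>i j. x i) (\<lambda>(j, c). u c)"
 by (auto simp: tens_def mat_op_def fun_eq_iff)

lemma tens_Zf: "tens x u \<in> Zf U"
 unfolding tens_mat_op by (rule A.mat_op_Zf)

lemma tens_linear: "tens (x - y) u = tens x u - tens y u" "tens x (u - v) = tens x u - tens x v"
 by (auto simp: tens_def fun_eq_iff fun_apply A.opr_diff A.opr_linear)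

lemma tens_scale: "tens (\<lambda>i. s * x i) u = tens x (A.opr s u)"
 by (auto simp: tens_def fun_eq_iff A.opr_mult A.opr_commute[of s])

lemma tens_rel: assumes "x \<in> rels n M m q" shows "tens x u \<in> Lam"
 unfolding tens_mat_op by (rule A.columns_mat_image[OF pres]) (use assms in \<open>intro bexI[of _ x]; simp\<close>)

lemma sLam: "sgrp Lam" "Lam \<subseteq> Zf U" by (rule A.sgrp_mat_image, rule A.mat_image_Zf)

lemma tens_cong:
 assumes "x \<in> tup (Rn n) q" "y \<in> tup (Rn n) q" "ev n M m q x = ev n M m q y" shows "tens x u - tens y u \<in> Lam"
proof -
 have "x - y \<in> rels n M m q" using assms ev_diff_iff[OF m, of x y] sgrp_diff[OF smod_sgrp[OF smod_tup[OF subr_Rn]]] by (simp add: rels_def)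
 from tens_rel[OF this] show ?thesis by (simp only: tens_linear)
qed

lemma lookup_toV: assumes "u \<in> Zf U" shows "lookup (toV u) = u"
proof -
 have "{x. u x \<noteq> 0} \<subseteq> U" using assms by (auto simp: Zf_def)
 then have "finite {x. u x \<noteq> 0}" using fU finite_subset by blast
 then show ?thesis unfolding toV_def by (rule Abs_poly_mapping_inverse[OF CollectI])
qed

lemma toV_lookup: "toV (lookup v) = v"
 by (simp add: toV_def)

lemma toV_diff: assumes "u \<in> Zf U" "v \<in> Zf U" shows "toV (u - v) = toV u - toV v"
proof -
 have "u - v = lookup (toV u - toV v)" unfolding lookup_diff_fun using assms by (simp add: lookup_toV)
 then show ?thesis by (simp only: toV_lookup)
qed

lemma keys_toV: "u \<in> Zf U \<Longrightarrow> keys (toV u) \<subseteq> U"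
 by (auto simp: in_keys_iff lookup_toV) (auto simp: Zf_def)

lemma Psi_Zf: "lookup (frag_extend psi y) \<in> Zf U"
proof -
 have "keys (psi zw) \<subseteq> U" for zw unfolding psi_def using keys_toV[OF tens_Zf] by (simp split: prod.split)
 then have "keys (frag_extend psi y) \<subseteq> U" using keys_frag_extend[of psi y] by blast
 then show ?thesis unfolding Zf_def in_keys_iff by (auto simp: in_keys_iff)
qed

lemma lookup_psi: "lookup (psi (z, w)) = tens (sel z) (lookup w)"
 by (simp add: psi_def lookup_toV[OF tens_Zf])

lemma add_closed_N: "v \<in> carrier N \<Longrightarrow> w \<in> carrier N \<Longrightarrow> v + w \<in> carrier N"
 using keys_add[of v w] by (auto simp: carrier_N)

lemma smult_closed_N': assumes "r \<in> carrier (laurent_ring n)" "w \<in> carrier N" shows "r \<odot>\<^bsub>N\<^esub> w \<in> carrier N"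
 using emb_surj[OF assms(1)] smult_closed_N[OF assms(2)] by blast

lemma relations_keys: "tensor_relations (laurent_ring n) M N \<subseteq> carrier (free_Abelian_group B)"
proof -
 have two: "keys (frag_of x - frag_of y) \<subseteq> B" if "x \<in> B" "y \<in> B" for x y
  using keys_diff[of "frag_of x" "frag_of y"] that by auto
 have three: "keys (frag_of x - frag_of y - frag_of z) \<subseteq> B" if "x \<in> B" "y \<in> B" "z \<in> B" for x y z
  using keys_diff[of "frag_of x - frag_of y" "frag_of z"] two[OF that(1,2)] that(3) by auto
 show ?thesis unfolding tensor_relations_def add_N
  by (intro Un_least subsetI; clarify; unfold carrier_free_Abelian_group_iff; intro two three)
   (auto intro: add_closed_N smult_closed_N')
qed

lemma subgroup_H: "subgroup H (free_Abelian_group B)"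
 unfolding H_def by (rule group.generate_is_subgroup[OF group_free_Abelian_group relations_keys])

lemma H_keys: "H \<subseteq> {c. keys c \<subseteq> B}"
proof
 fix x assume "x \<in> H"
 then have "x \<in> carrier (free_Abelian_group B)" using subgroup.subset[OF subgroup_H] by blast
 then show "x \<in> {c. keys c \<subseteq> B}" by (simp only: carrier_free_Abelian_group_iff mem_Collect_eq)
qed

lemma sH: "sgrp H"
proof (rule sgrpI)
 show "0 \<in> H" using subgroup.one_closed[OF subgroup_H] by simp
 fix x y assume "x \<in> H" "y \<in> H"
 moreover from this have "- y \<in> H" using subgroup.m_inv_closed[OF subgroup_H, of y] H_keys by auto
 ultimately show "x - y \<in> H" using subgroup.m_closed[OF subgroup_H, of x "- y"] by simp
qed

lemma H_minimal: assumes K: "sgrp K" "tensor_relations (laurent_ring n) M N \<subseteq> K" shows "H \<subseteq> K"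
proof
 fix x assume "x \<in> H"
 then show "x \<in> K" unfolding H_def
 proof (induction rule: generate.induct)
  case one then show ?case using sgrp_0[OF K(1)] by simp
 next
  case (incl h) then show ?case using K(2) by blast
 next
  case (inv h)
  then have "h \<in> carrier (free_Abelian_group B)" using relations_keys by blast
  then have "keys h \<subseteq> B" by (simp only: carrier_free_Abelian_group_iff)
  then show ?case using inv K(2) sgrp_minus[OF K(1), of h] by (simp add: subset_iff)
 next
  case (eng a c) then show ?case using sgrp_add[OF K(1)] by simp
 qed
qed

lemma H_relation_left:
 assumes "x \<in> carrier M" "x' \<in> carrier M" "y \<in> carrier N"
 shows "frag_of (x \<oplus>\<^bsub>M\<^esub> x', y) - frag_of (x, y) - frag_of (x', y) \<in> H"
proof -
 have "frag_of (x \<oplus>\<^bsub>M\<^esub> x', y) - frag_of (x, y) - frag_of (x', y) \<in> tensor_relations (laurent_ring n) M N"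
  unfolding tensor_relations_def by (rule UnI1, rule UnI1) (use assms in blast)
 then show ?thesis unfolding H_def by (rule generate.incl)
qed

lemma H_relation_right:
 assumes "x \<in> carrier M" "y \<in> carrier N" "y' \<in> carrier N"
 shows "frag_of (x, y + y') - frag_of (x, y) - frag_of (x, y') \<in> H"
proof -
 have "frag_of (x, y \<oplus>\<^bsub>N\<^esub> y') - frag_of (x, y) - frag_of (x, y') \<in> tensor_relations (laurent_ring n) M N"
  unfolding tensor_relations_def by (rule UnI1, rule UnI2) (use assms in blast)
 then show ?thesis unfolding H_def add_N by (rule generate.incl)
qed

lemma H_relation_scalar:
 assumes "x \<in> carrier M" "y \<in> carrier N"
 shows "frag_of (emb n s \<odot>\<^bsub>M\<^esub> x, y) - frag_of (x, emb n s \<odot>\<^bsub>N\<^esub> y) \<in> H"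
proof -
 have "frag_of (emb n s \<odot>\<^bsub>M\<^esub> x, y) - frag_of (x, emb n s \<odot>\<^bsub>N\<^esub> y) \<in> tensor_relations (laurent_ring n) M N"
  unfolding tensor_relations_def by (rule UnI2) (use assms emb_carrier[of n s] in blast)
 then show ?thesis unfolding H_def by (rule generate.incl)
qed

lemma H_zero_left: assumes "w \<in> carrier N" shows "frag_of (\<zero>\<^bsub>M\<^esub>, w) \<in> H"
 using H_relation_left[OF M.zero_closed M.zero_closed assms] sgrp_minus_iff[OF sH, of "frag_of (\<zero>\<^bsub>M\<^esub>, w)"] by simp

lemma H_zero_right: assumes "z \<in> carrier M" shows "frag_of (z, 0) \<in> H"
 using H_relation_right[OF assms zero_closed_N zero_closed_N] sgrp_minus_iff[OF sH, of "frag_of (z, 0)"] by simp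

lemma H_diff_right:
 assumes "z \<in> carrier M" "v \<in> carrier N" "w \<in> carrier N" shows "frag_of (z, v) - frag_of (z, w) - frag_of (z, v - w) \<in> H"
 using H_relation_right[OF assms(1) diff_closed_N[OF assms(2,3)] assms(3)] by (simp add: algebra_simps)

lemma theta_slice:
 assumes i: "i < q" and w: "w \<in> carrier N" shows "frag_extend (\<lambda>c. theta (i, c)) w - frag_of (m i, w) \<in> H"
proof -
 have "keys w \<subseteq> X" using w by (simp add: carrier_N)
 then have "w \<in> carrier N \<and> frag_extend (\<lambda>c. theta (i, c)) w - frag_of (m i, w) \<in> H"
 proof (induction w rule: frag_induction)
  case zero
  show ?case using H_zero_right[of "m i"] m i sgrp_minus[OF sH] zero_closed_N by simp
 next
  case (one c)
  then show ?case using sgrp_0[OF sH] frag_closed_N by (simp add: theta_def)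
 next
  case (diff v w)
  let ?f = "frag_extend (\<lambda>c. theta (i, c))"
  have "(?f v - frag_of (m i, v)) - (?f w - frag_of (m i, w)) + (frag_of (m i, v) - frag_of (m i, w) - frag_of (m i, v - w)) \<in> H"
   using diff m i by (intro sgrp_add[OF sH] sgrp_diff[OF sH, of "?f v - frag_of (m i, v)"] H_diff_right) simp_all
  then show ?case using diff diff_closed_N by (simp add: frag_extend_diff algebra_simps)
 qed
 then show ?thesis by blast
qed

lemma toV_tens:
 assumes w: "w \<in> carrier N"
 shows "toV (tens x (lookup w)) = (\<Sum>i<q. frag_extend (\<lambda>c. frag_of (i, c)) (emb n (x i) \<odot>\<^bsub>N\<^esub> w))"
proof -
 have l: "lookup (frag_extend (\<lambda>c. frag_of (i, c)) v) (i', c) = (if i' = i then lookup v c else 0)"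
  for i i' :: nat and v and c :: "(nat \<Rightarrow> int) set"
  by (induction v rule: lp_induct) (simp_all add: frag_extend_diff lookup_minus)
 have "tens x (lookup w) = lookup (\<Sum>i<q. frag_extend (\<lambda>c. frag_of (i, c)) (emb n (x i) \<odot>\<^bsub>N\<^esub> w))"
  by (auto simp: fun_eq_iff tens_def lookup_sum l lookup_smult[OF w])
 then show ?thesis by (simp only: toV_lookup)
qed

text \<open>Moving coefficients across the tensor sign turns the sum of the tensors of
  \<open>m i\<close> with \<open>x i\<close> times \<open>w\<close> into the tensor of
  \<open>ev n M m q x\<close> with \<open>w\<close>. The induction adds one generator at a time, by
  one scalar and one additive relation.\<close>

lemma theta_tens:
 assumes w: "w \<in> carrier N"
 shows "frag_extend theta (toV (tens x (lookup w))) - frag_of (ev n M m q x, w) \<in> H"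
proof -
 have c: "frag_extend theta (frag_extend (\<lambda>c. frag_of (i, c)) v) = frag_extend (\<lambda>c. theta (i, c)) v" for i v
  by (induction v rule: lp_induct) (simp_all add: frag_extend_diff)
 have "(\<Sum>i<k. frag_extend (\<lambda>c. theta (i, c)) (emb n (x i) \<odot>\<^bsub>N\<^esub> w)) - frag_of (ev n M m k x, w) \<in> H" if "k \<le> q" for k
  using that
 proof (induction k)
  case 0
  show ?case using H_zero_left[OF w] sgrp_minus[OF sH] by simp
 next
  case (Suc k)
  let ?A = "\<Sum>i<k. frag_extend (\<lambda>c. theta (i, c)) (emb n (x i) \<odot>\<^bsub>N\<^esub> w)" and ?s = "emb n (x k)"
  have mk: "m k \<in> carrier M" "\<forall>i<k. m i \<in> carrier M" using m Suc.prems by simp_all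
  have 1: "?A - frag_of (ev n M m k x, w) \<in> H" using Suc by simp
  have 2: "frag_extend (\<lambda>c. theta (k, c)) (?s \<odot>\<^bsub>N\<^esub> w) - frag_of (m k, ?s \<odot>\<^bsub>N\<^esub> w) \<in> H"
   using Suc.prems by (intro theta_slice smult_closed_N w) simp
  have 3: "frag_of (?s \<odot>\<^bsub>M\<^esub> m k, w) - frag_of (m k, ?s \<odot>\<^bsub>N\<^esub> w) \<in> H" by (rule H_relation_scalar[OF mk(1) w])
  have 4: "frag_of (ev n M m k x \<oplus>\<^bsub>M\<^esub> ?s \<odot>\<^bsub>M\<^esub> m k, w) - frag_of (ev n M m k x, w) - frag_of (?s \<odot>\<^bsub>M\<^esub> m k, w) \<in> H"
   by (intro H_relation_left ev_closed mk(2) smult_closed emb_carrier mk(1) w)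
  show ?case using sgrp_diff[OF sH sgrp_diff[OF sH sgrp_add[OF sH 1 2] 3] 4] by (simp add: algebra_simps)
 qed
 from this[of q] show ?thesis unfolding toV_tens[OF w] by (simp add: frag_extend_sum c)
qed

lemma theta_Lam: assumes "u \<in> Lam" shows "frag_extend theta (toV u) \<in> H"
proof -
 obtain z where z: "u = mat_op X act q p b z" "z \<in> Zf ({..<p} \<times> X)" using assms by (auto simp: mat_image_def)
 let ?K = "{u\<in>Zf U. frag_extend theta (toV u) \<in> H}"
 have K: "sgrp ?K"
 proof (rule sgrpI)
  have "toV 0 = 0" using toV_lookup[of 0] by (simp add: lookup_0_fun)
  then show "0 \<in> ?K" using sgrp_0[OF sgrp_Zf[of U]] sgrp_0[OF sH] by simp
  show "x - y \<in> ?K" if "x \<in> ?K" "y \<in> ?K" for x y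
   using that sgrp_diff[OF sgrp_Zf[of U]] sgrp_diff[OF sH] by (simp add: toV_diff frag_extend_diff)
 qed
 have "u = (\<Sum>j<p. tens (\<lambda>i. b i j) (\<lambda>c. z (j, c)))"
  by (auto simp: z(1) mat_op_def tens_def fun_eq_iff sum_fun_apply)
 also have "\<dots> \<in> ?K"
 proof (rule sgrp_sum[OF K])
  fix j assume j: "j \<in> {..<p}"
  have sl: "(\<lambda>c. z (j, c)) \<in> Zf X" by (rule Zf_slice[OF z(2)])
  define w where "w = Abs_poly_mapping (\<lambda>c. z (j, c))"
  have "{c. z (j, c) \<noteq> 0} \<subseteq> X" using sl by (auto simp: Zf_def)
  then have "finite {c. z (j, c) \<noteq> 0}" using fin finite_subset by blast
  then have lw: "lookup w = (\<lambda>c. z (j, c))" unfolding w_def by (rule Abs_poly_mapping_inverse[OF CollectI])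
  have w: "w \<in> carrier N" using sl by (auto simp: carrier_N in_keys_iff lw) (auto simp: Zf_def)
  have "(\<lambda>i. b i j) \<in> rels n M m q" using pres j by (simp add: presents_def)
  then have "ev n M m q (\<lambda>i. b i j) = \<zero>\<^bsub>M\<^esub>" by (simp add: rels_def)
  with theta_tens[OF w, of "\<lambda>i. b i j"] sgrp_add[OF sH _ H_zero_left[OF w]]
  have "frag_extend theta (toV (tens (\<lambda>i. b i j) (\<lambda>c. z (j, c)))) \<in> H" unfolding lw by fastforce
  then show "tens (\<lambda>i. b i j) (\<lambda>c. z (j, c)) \<in> ?K" using tens_Zf by simp
 qed
 finally show ?thesis by simp
qed

text \<open>By \<open>H_minimal\<close> the three kinds of bilinearity relations suffice. Additivity
  in \<open>y\<close> holds exactly; the relations that change the element of \<open>M\<close> hold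
  only modulo \<open>Lam\<close>, since \<open>sel\<close> involves a choice.\<close>

lemma psi_H: "x \<in> H \<Longrightarrow> lookup (frag_extend psi x) \<in> Lam"
proof -
 let ?K = "{x. lookup (frag_extend psi x) \<in> Lam}"
 have K: "sgrp ?K"
  by (rule sgrpI) (simp_all add: frag_extend_diff lookup_diff_fun lookup_0_fun sgrp_0[OF sLam(1)] sgrp_diff[OF sLam(1)])
 note T = smod_sgrp[OF smod_tup[OF subr_Rn, of n q]]
 have "tensor_relations (laurent_ring n) M N \<subseteq> ?K"
  unfolding tensor_relations_def add_N
 proof (intro Un_least subsetI; clarify)
  fix x x' y assume h: "x \<in> carrier M" "x' \<in> carrier M" "y \<in> carrier N"
  have "tens (sel (x \<oplus>\<^bsub>M\<^esub> x')) (lookup y) - tens (sel x + sel x') (lookup y) \<in> Lam"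
   using h sel[of x] sel[of x'] sel[of "x \<oplus>\<^bsub>M\<^esub> x'"] sgrp_add[OF T] ev_add[OF m, of "sel x" "sel x'"] by (intro tens_cong) simp_all
  moreover have "tens (sel x + sel x') u = tens (sel x) u + tens (sel x') u" for u
   using tens_linear(1)[of "sel x + sel x'" "sel x'" u] by simp
  ultimately show "lookup (frag_extend psi (frag_of (x \<oplus>\<^bsub>M\<^esub> x', y) - frag_of (x, y) - frag_of (x', y))) \<in> Lam"
   unfolding frag_extend_diff lookup_diff_fun frag_extend_of lookup_psi by (simp add: algebra_simps)
 next
  fix x y y' assume h: "x \<in> carrier M" "y \<in> carrier N" "y' \<in> carrier N"
  have "lookup (y + y') - lookup y = lookup y'" by (simp add: fun_eq_iff fun_apply lookup_add)
  then have "tens (sel x) (lookup (y + y')) - tens (sel x) (lookup y) = tens (sel x) (lookup y')"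
   by (simp only: tens_linear(2)[symmetric])
  then show "lookup (frag_extend psi (frag_of (x, y + y') - frag_of (x, y) - frag_of (x, y'))) \<in> Lam"
   using sgrp_0[OF sLam(1)] by (simp add: frag_extend_diff lookup_diff_fun lookup_psi)
 next
  fix r x y assume h: "r \<in> carrier (laurent_ring n)" "x \<in> carrier M" "y \<in> carrier N"
  obtain s where s: "s \<in> Rn n" "emb n s = r" using emb_surj[OF h(1)] by blast
  have "tens (sel (r \<odot>\<^bsub>M\<^esub> x)) (lookup y) - tens (\<lambda>i. s * sel x i) (lookup y) \<in> Lam"
   using h s sel[of x] sel[of "r \<odot>\<^bsub>M\<^esub> x"] smod_scale[OF smod_tup[OF subr_Rn] s(1)] ev_scale[OF m, of s "sel x"]
   by (intro tens_cong) simp_all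
  then show "lookup (frag_extend psi (frag_of (r \<odot>\<^bsub>M\<^esub> x, y) - frag_of (x, r \<odot>\<^bsub>N\<^esub> y))) \<in> Lam"
   using lookup_smult[OF h(3), of s] s(2) by (simp add: frag_extend_diff lookup_diff_fun lookup_psi tens_scale)
 qed
 from H_minimal[OF K this] show "x \<in> H \<Longrightarrow> lookup (frag_extend psi x) \<in> Lam" by blast
qed

lemma psi_theta: assumes "u \<in> Zf U" shows "lookup (frag_extend psi (frag_extend theta (toV u))) - u \<in> Lam"
proof -
 have "lookup (frag_extend psi (frag_extend theta v)) - lookup v \<in> Lam" if "keys v \<subseteq> U" for v
  using that
 proof (induction v rule: frag_induction)
  case zero
  show ?case using sgrp_0[OF sLam(1)] by (simp add: lookup_0_fun)
 next
  case (one ic)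
  then obtain i c where ic: "ic = (i, c)" "i < q" "c \<in> X" by auto
  have "unit_fun (i, c) = tens (unit_tup i) (unit_fun c)"
  proof
   fix jd :: "nat \<times> (nat \<Rightarrow> int) set"
   obtain j d where jd: "jd = (j, d)" by fastforce
   have "unit_fun c \<in> Zf X" using ic(3) by (auto simp: Zf_def unit_fun_def)
   then show "unit_fun (i, c) jd = tens (unit_tup i) (unit_fun c) jd"
    using ic(2) by (auto simp: jd tens_def unit_tup_def A.opr_1 fun_apply) (auto simp: unit_fun_def)
  qed
  moreover have "tens (sel (m i)) (unit_fun c) - tens (unit_tup i) (unit_fun c) \<in> Lam"
   using sel[of "m i"] m ic(2) ev_unit[OF m, of i] unit_tup_in[OF subr_Rn ic(2)] by (intro tens_cong) simp_all
  ultimately show ?case unfolding ic(1) frag_extend_of theta_def prod.case lookup_psi lookup_frag_unit by simp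
 next
  case (diff v w)
  have "(lookup (frag_extend psi (frag_extend theta v)) - lookup v)
   - (lookup (frag_extend psi (frag_extend theta w)) - lookup w) \<in> Lam" by (rule sgrp_diff[OF sLam(1) diff(1,2)])
  then show ?case by (simp add: frag_extend_diff lookup_diff_fun algebra_simps)
 qed
 from this[OF keys_toV[OF assms]] show ?thesis by (simp add: lookup_toV[OF assms])
qed

lemma theta_psi: assumes "keys x \<subseteq> B" shows "frag_extend theta (frag_extend psi x) - x \<in> H"
 using assms
proof (induction x rule: frag_induction)
 case zero
 show ?case using sgrp_0[OF sH] by simp
next
 case (one zw)
 obtain z w where zw: "zw = (z, w)" by (cases zw)
 have zw': "z \<in> carrier M" "w \<in> carrier N" using one unfolding zw by blast+
 have "frag_extend theta (toV (tens (sel z) (lookup w))) - frag_of (ev n M m q (sel z), w) \<in> H"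
  by (rule theta_tens[OF zw'(2)])
 then show ?case unfolding zw frag_extend_of psi_def prod.case using sel[OF zw'(1)] by simp
next
 case (diff v w)
 have "(frag_extend theta (frag_extend psi v) - v) - (frag_extend theta (frag_extend psi w) - w) \<in> H" by (rule sgrp_diff[OF sH diff(1,2)])
 then show ?case by (simp add: frag_extend_diff algebra_simps)
qed

lemma theta_keys: assumes "u \<in> Zf U" shows "keys (frag_extend theta (toV u)) \<subseteq> B"
proof -
 have "keys (theta ic) \<subseteq> B" if "ic \<in> U" for ic using that m frag_closed_N by (auto simp: theta_def)
 then show ?thesis using keys_frag_extend[of theta "toV u"] keys_toV[OF assms] by blast
qed

theorem card_torsion_tensor:
 assumes "has_idx (sat U Lam) Lam t"
 shows "card (torsion_subgroup (tensor_product (laurent_ring n) M N)) = t"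
proof -
 have "card (torsion_subgroup (free_Abelian_group B Mod H)) = t"
  by (rule card_torsion_quotient[OF sH H_keys sLam assms,
    where \<Psi> = "\<lambda>x. lookup (frag_extend psi x)" and \<Theta> = "\<lambda>u. frag_extend theta (toV u)"])
   (simp_all add: frag_extend_diff lookup_diff_fun Psi_Zf psi_H toV_diff theta_keys theta_Lam psi_theta theta_psi toV_lookup)
 then show ?thesis by (simp add: tensor_product_def Let_def H_def)
qed

lemma index_exists: "\<exists>t. has_idx (sat U Lam) Lam t"
 by (rule sat_finite_index[OF fU sLam])

end

section \<open>Passage to the limit over subgroups without short vectors\<close>

theorem theorem6:
 fixes n :: nat
  and M\<^sub>1 :: "((nat \<Rightarrow> int) \<Rightarrow>\<^sub>0 int, 'a) module"
  and M\<^sub>2 :: "((nat \<Rightarrow> int) \<Rightarrow>\<^sub>0 int, 'b) module"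
 assumes "n \<ge> 1"
  and "module (laurent_ring n) M\<^sub>1" and "finitely_generated (laurent_ring n) M\<^sub>1"
  and "module (laurent_ring n) M\<^sub>2" and "finitely_generated (laurent_ring n) M\<^sub>2"
  and "pseudo_isomorphic (laurent_ring n) M\<^sub>1 M\<^sub>2"
 shows "((\<lambda>\<Gamma>. torsion_growth n M\<^sub>1 \<Gamma> - torsion_growth n M\<^sub>2 \<Gamma>) \<longlongrightarrow> 0)
      ((min_norm n) going_to at_top within finite_index_subgroups n)"
proof -
 have L1: "laurent_module n M\<^sub>1" and L2: "laurent_module n M\<^sub>2" using assms(2,4) by (simp_all add: laurent_module_def)
 obtain q1 :: nat and m1 where m1: "\<forall>i<q1. m1 i \<in> carrier M\<^sub>1" "carrier M\<^sub>1 = ev n M\<^sub>1 m1 q1 ` tup (Rn n) q1"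
  by (rule laurent_module.generators[OF L1 assms(3)])
 obtain q2 :: nat and m2 where m2: "\<forall>i<q2. m2 i \<in> carrier M\<^sub>2" "carrier M\<^sub>2 = ev n M\<^sub>2 m2 q2 ` tup (Rn n) q2"
  by (rule laurent_module.generators[OF L2 assms(5)])
 obtain p1 b1 where pb1: "presents (Rn n) q1 (rels n M\<^sub>1 m1 q1) p1 b1" using laurent_module.rels_presents[OF L1 m1(1)] by (elim exE)
 obtain p2 b2 where pb2: "presents (Rn n) q2 (rels n M\<^sub>2 m2 q2) p2 b2" using laurent_module.rels_presents[OF L2 m2(1)] by (elim exE)
 obtain h where h: "pseudo_isomorphism (laurent_ring n) M\<^sub>1 M\<^sub>2 h" using assms(6) unfolding pseudo_isomorphic_def by (elim exE)
 obtain a where a: "near_iso (Rn n) q1 q2 (rels n M\<^sub>1 m1 q1) (rels n M\<^sub>2 m2 q2) a"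
  using pseudo_iso_near_iso[OF L1 L2 h m1 m2] by (elim exE)
 have bound: "\<exists>L. \<forall>\<Gamma>\<in>finite_index_subgroups n. real n * real_of_int L \<le> min_norm n \<Gamma> \<longrightarrow>
   \<bar>torsion_growth n M\<^sub>1 \<Gamma> - torsion_growth n M\<^sub>2 \<Gamma>\<bar> \<le> \<epsilon>" if \<epsilon>: "\<epsilon> > 0" for \<epsilon> :: real
 proof -
  obtain L0 where L0: "\<forall>(X :: (nat \<Rightarrow> int) set set) act pt t1 t2. transitive_action X act pt \<longrightarrow> reach n X act pt \<longrightarrow> spread n act pt L0 \<longrightarrow>
   has_idx (sat ({..<q1} \<times> X) (mat_image X act q1 p1 b1)) (mat_image X act q1 p1 b1) t1 \<longrightarrow>
   has_idx (sat ({..<q2} \<times> X) (mat_image X act q2 p2 b2)) (mat_image X act q2 p2 b2) t2 \<longrightarrow>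
   real t2 \<le> real t1 * exp (\<epsilon> * real (card X)) \<and> real t1 \<le> real t2 * exp (\<epsilon> * real (card X))"
   by (rule exE[OF near_iso_growth[OF a pb1 pb2 \<epsilon>, where ?'x = "(nat \<Rightarrow> int) set"]])
  show ?thesis
  proof (intro exI[of _ L0] ballI impI)
   fix \<Gamma> assume \<Gamma>: "\<Gamma> \<in> finite_index_subgroups n" and mn: "real n * real_of_int L0 \<le> min_norm n \<Gamma>"
   interpret Q: finite_quotient n \<Gamma> by standard (rule \<Gamma>)
   interpret T1: tensor_setup n \<Gamma> M\<^sub>1 m1 q1 p1 b1
    by (intro tensor_setup.intro tensor_setup_axioms.intro L1 m1 pb1 Q.finite_quotient_axioms)
   interpret T2: tensor_setup n \<Gamma> M\<^sub>2 m2 q2 p2 b2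
    by (intro tensor_setup.intro tensor_setup_axioms.intro L2 m2 pb2 Q.finite_quotient_axioms)
   obtain t1 where t1: "has_idx (sat ({..<q1} \<times> Q.X) (mat_image Q.X Q.act q1 p1 b1)) (mat_image Q.X Q.act q1 p1 b1) t1"
    using T1.index_exists by (elim exE)
   obtain t2 where t2: "has_idx (sat ({..<q2} \<times> Q.X) (mat_image Q.X Q.act q2 p2 b2)) (mat_image Q.X Q.act q2 p2 b2) t2"
    using T2.index_exists by (elim exE)
   let ?N = "real (card Q.X)"
   note L0[rule_format, OF Q.transitive Q.reach_quotient Q.spread_quotient[OF mn assms(1)] t1 t2]
   then have cmp: "real t2 \<le> real t1 * exp (\<epsilon> * ?N)" "real t1 \<le> real t2 * exp (\<epsilon> * ?N)" by (rule conjunct1, rule conjunct2)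
   have pos: "t1 > 0" "t2 > 0" using has_idx_pos[OF t1] has_idx_pos[OF t2]
     sgrp_0[OF sgrp_sat[OF T1.sLam(1)]] sgrp_0[OF sgrp_sat[OF T2.sLam(1)]] by blast+
   have Np: "?N > 0" using Q.fin Q.one_X by (auto simp: card_gt_0_iff)
   have "ln (real t2) \<le> ln (real t1) + \<epsilon> * ?N" "ln (real t1) \<le> ln (real t2) + \<epsilon> * ?N"
    using cmp pos by (simp_all add: ln_le_cancel_iff[symmetric] ln_mult del: ln_le_cancel_iff)
   then have "\<bar>ln (real t1) - ln (real t2)\<bar> \<le> \<epsilon> * ?N" by linarith
   then have "\<bar>(ln (real t1) - ln (real t2)) / ?N\<bar> \<le> \<epsilon>" using Np by (simp add: divide_le_eq)
   moreover have "Coset.order (int_lattice n Mod \<Gamma>) = card Q.X" by (simp add: Coset.order_def Q.X_def)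
   ultimately show "\<bar>torsion_growth n M\<^sub>1 \<Gamma> - torsion_growth n M\<^sub>2 \<Gamma>\<bar> \<le> \<epsilon>"
    unfolding torsion_growth_def T1.card_torsion_tensor[OF t1] T2.card_torsion_tensor[OF t2] by (simp add: diff_divide_distrib)
  qed
 qed
 show ?thesis
 proof (rule tendstoI)
  fix e :: real assume "e > 0"
  then obtain L where L: "\<forall>\<Gamma>\<in>finite_index_subgroups n. real n * real_of_int L \<le> min_norm n \<Gamma> \<longrightarrow>
   \<bar>torsion_growth n M\<^sub>1 \<Gamma> - torsion_growth n M\<^sub>2 \<Gamma>\<bar> \<le> e / 2" using bound[of "e / 2"] by auto
  have "dist (torsion_growth n M\<^sub>1 \<Gamma> - torsion_growth n M\<^sub>2 \<Gamma>) 0 < e"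
   if "\<Gamma> \<in> finite_index_subgroups n" "real n * real_of_int L \<le> min_norm n \<Gamma>" for \<Gamma>
   using L[rule_format, OF that] \<open>e > 0\<close> by (simp add: dist_real_def)
  then show "\<forall>\<^sub>F \<Gamma> in (min_norm n) going_to at_top within finite_index_subgroups n. dist (torsion_growth n M\<^sub>1 \<Gamma> - torsion_growth n M\<^sub>2 \<Gamma>) 0 < e"
   unfolding going_to_within_def eventually_inf_principal eventually_filtercomap
   by (intro exI[of _ "\<lambda>r. real n * real_of_int L \<le> r"] conjI eventually_ge_at_top) auto
 qed
qed

end
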